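(* Assume that $R$ is discretely valued. Then the functor $\check T_\varepsilon\colon \underline{\hat M}\mapsto\check T_\varepsilon\underline{\hat M}$ from the category of local shtukas over $R$ (with morphisms) to the category of continuous representations of $\mathrm{Gal}(K^{\rm sep}/K)$ on finite free $A_\varepsilon$-modules is fully faithful, and the functor $\check V_\varepsilon\colon\underline{\hat M}\mapsto\check V_\varepsilon\underline{\hat M}$ from the category of local shtukas over $R$ with quasi-morphisms to the category of continuous representations of $\mathrm{Gal}(K^{\rm sep}/K)$ on finite dimensional $Q_\varepsilon$-vector spaces is fully faithful.
   Context: Setting. $C$ is a smooth projective geometrically irreducible curve over a finite field $\mathbb F_q$ with function field $Q$, $\infty\in C$ is a closed point, $A=\Gamma(C\setminus\{\infty\},\mathcal O_C)$. $K$ is a field complete with respect to a non-trivial non-archimedean absolute value, $R$ is its valuation ring with maximal ideal $\mathfrak m_R$ and residue field $k$, $K^{\rm sep}$ is a separable closure. $\gamma\colon A\hookrightarrow R$ is an injective ring homomorphism such that $\varepsilon:=\gamma^{-1}(\mathfrak m_R)$ is a maximal ideal of $A$. Put $\mathbb F_\varepsilon=A/\varepsilon$, $\hat q=\#\mathbb F_\varepsilon$; $z\in Q$ is a uniformizing parameter at $\varepsilon$; $A_\varepsilon\cong\mathbb F_\varepsilon[[z]]$ is the completion of $\mathcal O_{C,\varepsilon}$ and $Q_\varepsilon=\mathrm{Frac}(A_\varepsilon)=\mathbb F_\varepsilon((z))$. By continuity $\gamma$ extends to $A_\varepsilon\hookrightarrow R$; put $\zeta=\gamma(z)$, so $0<|\zeta|<1$,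 and $R,K$ are $\mathbb F_\varepsilon$-algebras. On $R[[z]]$, $K^{\rm sep}[[z]]$, $K^{\rm sep}((z))$ let $\hat\sigma$ be the endomorphism $\sum b_iz^i\mapsto\sum b_i^{\hat q}z^i$; $A_\varepsilon=\mathbb F_\varepsilon[[z]]$ is a subring of $K^{\rm sep}[[z]]$ in the evident way. Local shtukas. For an $R[[z]]$-module $\hat M$ put $\hat\sigma^*\hat M=\hat M\otimes_{R[[z]],\hat\sigma}R[[z]]$ and $\hat\sigma^*_{\hat M}m=m\otimes1$. A local shtuka of rank $r$ over $R$ is a pair $\underline{\hat M}=(\hat M,\tau_{\hat M})$ of a free $R[[z]]$-module $\hat M$ of rank $r$ and an isomorphism $\tau_{\hat M}\colon\hat\sigma^*\hat M[\frac1{z-\zeta}]\to\hat M[\frac1{z-\zeta}]$. A morphism $f\colon\underline{\hat M}\to\underline{\hat M}'$ is an $R[[z]]$-linear map $\hat M\to\hat M'$ with $\tau_{\hat M'}\circ\hat\sigma^*f=f\circ\tau_{\hat M}$; a quasi-morphism is an $R[[z]][\frac1z]$-linear map $\hat M[\frac1z]\to\hat M'[\frac1z]$ with the same compatibility. Tate modules. Since $z-\zeta$ is a unit in $K^{\rm sep}[[z]]$, $\tau_{\hat M}$ extends to $K^{\rm sep}[[z]]$, and one sets $\check T_\varepsilon\underline{\hat M}=\{m\in\hat M\otimes_{R[[z]]}K^{\rm sep}[[z]]:\tau_{\hat M}(\hat\sigma^*_{\hat M}m)=m\}$ and $\check V_\varepsilon\underline{\hat M}=\check T_\varepsilon\underline{\hat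 M}\otimes_{A_\varepsilon}Q_\varepsilon=\{m\in\hat M\otimes_{R[[z]]}K^{\rm sep}((z)):\tau_{\hat M}(\hat\sigma^*_{\hat M}m)=m\}$, with $\mathrm{Gal}(K^{\rm sep}/K)$ acting through the coefficients in $K^{\rm sep}$. These are a free $A_\varepsilon$-module, respectively a $Q_\varepsilon$-vector space, of rank $\mathrm{rk}\,\hat M$ with continuous Galois action. *)

theory Defs
  imports
    "HOL-Analysis.Function_Topology"
    "HOL-Algebra.Algebra"
    "HOL-Algebra.Algebraic_Closure_Type"
begin

text \<open>
  All the coefficient rings of the theory live inside one of two ambient fields, given as types:
  the function field \<open>Q\<close> of the curve (type \<open>'q\<close>) and the separable closure
  of the valued field \<open>K\<close> (type \<open>'l\<close>, with \<open>K\<close> a subset).  Rings of power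
  series over subrings of the separable closure are subsets of \<open>'l fls\<close>.
\<close>

abbreviation sub_ring :: "'a::comm_ring_1 set \<Rightarrow> 'a ring"
  where "sub_ring S \<equiv> ring_of_type_algebra\<lparr>carrier := S\<rparr>"


section \<open>Curves over finite fields, in terms of their function field\<close>

text \<open>
  Smooth projective geometrically irreducible curves over \<open>F\<^sub>q\<close> correspond to
  algebraic function fields in one variable whose field of constants is exactly
  \<open>F\<^sub>q\<close> (which is perfect).
\<close>

definition curve_function_field :: "'q::field set \<Rightarrow> bool"
  where "curve_function_field Fq \<longleftrightarrow>
    subfield Fq (ring_of_type_algebra :: 'q ring) \<and> finite Fq \<and>
    (\<forall>x. ring.algebraic (ring_of_type_algebra :: 'q ring) Fq x \<longrightarrow> x \<in> Fq) \<and>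
    (\<exists>x. ring.transcendental (ring_of_type_algebra :: 'q ring) Fq x \<and>
         ring.finite_dimension (ring_of_type_algebra :: 'q ring)
           (generate_field ring_of_type_algebra (insert x Fq)) UNIV)"

text \<open>A closed point of the curve is represented by its local ring, a nontrivial valuation
  ring of the function field containing the constants.\<close>

definition closed_points :: "'q::field set \<Rightarrow> 'q set set"
  where "closed_points Fq =
    {V. subring V (ring_of_type_algebra :: 'q ring) \<and> Fq \<subseteq> V \<and> V \<noteq> UNIV \<and>
        (\<forall>x. x \<in> V \<or> inverse x \<in> V)}"

text \<open>\<open>A = \<Gamma>(C - {\<infinity>}, O\<^sub>C)\<close>: a section over an open subset
  is a rational function lying in all the local rings of closed points of that subset.\<close>

definition coord_ring :: "'q::field set \<Rightarrow> 'q set \<Rightarrow> 'q set"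
  where "coord_ring Fq infty = \<Inter> (closed_points Fq - {infty})"

definition local_ring_at :: "'q::field set \<Rightarrow> 'q set \<Rightarrow> 'q set"
  where "local_ring_at A p = {a / b | a b. a \<in> A \<and> b \<in> A \<and> b \<notin> p}"

definition uniformizer_at :: "'q::field set \<Rightarrow> 'q set \<Rightarrow> 'q \<Rightarrow> bool"
  where "uniformizer_at A p z \<longleftrightarrow>
    z \<noteq> 0 \<and> {a / b | a b. a \<in> p \<and> b \<in> A \<and> b \<notin> p} = {z * x | x. x \<in> local_ring_at A p}"

definition extend_to_local_ring ::
    "'q::field set \<Rightarrow> 'q set \<Rightarrow> ('q \<Rightarrow> 'l::field) \<Rightarrow> 'q \<Rightarrow> 'l"
  where "extend_to_local_ring A p \<gamma> x =
    (THE y. \<exists>a\<in>A. \<exists>b\<in>A - p. x = a / b \<and> y = \<gamma> a / \<gamma> b)"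


section \<open>Valued fields, separable closures and Galois groups\<close>

definition nonarch_absolute_value :: "'l::field set \<Rightarrow> ('l \<Rightarrow> real) \<Rightarrow> bool"
  where "nonarch_absolute_value K v \<longleftrightarrow>
    v 0 = 0 \<and> (\<forall>x\<in>K - {0}. v x > 0) \<and> (\<forall>x\<in>K. \<forall>y\<in>K. v (x * y) = v x * v y) \<and>
    (\<forall>x\<in>K. \<forall>y\<in>K. v (x + y) \<le> max (v x) (v y)) \<and> (\<exists>x\<in>K - {0}. v x \<noteq> 1)"

definition complete_valued :: "'l::field set \<Rightarrow> ('l \<Rightarrow> real) \<Rightarrow> bool"
  where "complete_valued K v \<longleftrightarrow>
    (\<forall>s :: nat \<Rightarrow> 'l. range s \<subseteq> K \<and>
       (\<forall>e>0. \<exists>N. \<forall>m\<ge>N. \<forall>n\<ge>N. v (s m - s n) < e) \<longrightarrow>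
       (\<exists>l\<in>K. (\<lambda>n. v (s n - l)) \<longlonglongrightarrow> 0))"

text \<open>The value group is infinite cyclic (the absolute value being nontrivial).\<close>

definition discretely_valued :: "'l::field set \<Rightarrow> ('l \<Rightarrow> real) \<Rightarrow> bool"
  where "discretely_valued K v \<longleftrightarrow>
    (\<exists>\<pi>\<in>K. 0 < v \<pi> \<and> v \<pi> < 1 \<and> (\<forall>x\<in>K - {0}. \<exists>n::int. v x = v \<pi> powi n))"

definition valuation_ring :: "'l::field set \<Rightarrow> ('l \<Rightarrow> real) \<Rightarrow> 'l set"
  where "valuation_ring K v = {x \<in> K. v x \<le> 1}"

definition valuation_ideal :: "'l::field set \<Rightarrow> ('l \<Rightarrow> real) \<Rightarrow> 'l set"
  where "valuation_ideal K v = {x \<in> K. v x < 1}"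

definition separable_poly :: "'l::field poly \<Rightarrow> bool"
  where "separable_poly p \<longleftrightarrow> coprime p (pderiv p)"

definition is_separable_closure_of :: "'l::field itself \<Rightarrow> 'l set \<Rightarrow> bool"
  where "is_separable_closure_of T K \<longleftrightarrow>
    (\<forall>x :: 'l. \<exists>p. range (Polynomial.coeff p) \<subseteq> K \<and> separable_poly p \<and> poly p x = 0) \<and>
    (\<forall>p :: 'l poly. Polynomial.degree p > 0 \<and> separable_poly p \<longrightarrow> (\<exists>x. poly p x = 0))"

definition galois_group :: "'l::field set \<Rightarrow> ('l \<Rightarrow> 'l) set"
  where "galois_group K =
    {g. bij g \<and> g \<in> ring_hom (ring_of_type_algebra :: 'l ring) ring_of_type_algebra \<and>
        (\<forall>x\<in>K. g x = x)}"

text \<open>The Krull topology is the topology of pointwise convergence for the discrete topology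
  on the separable closure.\<close>

definition krull_topology :: "'l::field set \<Rightarrow> ('l \<Rightarrow> 'l) topology"
  where "krull_topology K =
    subtopology (product_topology (\<lambda>_. discrete_topology UNIV) UNIV) (galois_group K)"


section \<open>The setting\<close>

definition kernel_point :: "'q::field set \<Rightarrow> ('q \<Rightarrow> 'l::field) \<Rightarrow> 'l set \<Rightarrow> ('l \<Rightarrow> real) \<Rightarrow> 'q set"
  where "kernel_point A \<gamma> K v = {a \<in> A. \<gamma> a \<in> valuation_ideal K v}"

text \<open>
  The map \<open>\<iota>\<close> is the restriction to \<open>F\<^sub>\<epsilon> \<subseteq> A\<^sub>\<epsilon>\<close> of the continuous
  extension \<open>A\<^sub>\<epsilon> \<rightarrow> R\<close> of \<open>\<gamma>\<close>; it makes \<open>R\<close> and \<open>K\<close>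
  into \<open>F\<^sub>\<epsilon>\<close>-algebras.  By Hensel's lemma it exists and is unique as a ring
  homomorphism \<open>A/\<epsilon> \<rightarrow> R\<close> that reduces to the map
  \<open>A/\<epsilon> \<rightarrow> R/m\<^sub>R\<close> induced by \<open>\<gamma>\<close>.
  Finiteness of \<open>F\<^sub>\<epsilon>\<close> is automatic for a maximal ideal of the coordinate
  ring; it is recorded because its cardinality enters all further definitions.
\<close>

locale shtuka_setting =
  fixes Fq :: "'q::field set" and infty :: "'q set"
    and K :: "'l::field set" and v :: "'l \<Rightarrow> real"
    and \<gamma> :: "'q \<Rightarrow> 'l" and \<iota> :: "'q set \<Rightarrow> 'l" and z :: 'q
  assumes curve: "curve_function_field Fq"
    and infty: "infty \<in> closed_points Fq"
    and K_field: "subfield K (ring_of_type_algebra :: 'l ring)"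
    and K_value: "nonarch_absolute_value K v"
    and K_complete: "complete_valued K v"
    and sep_closure: "is_separable_closure_of TYPE('l) K"
    and \<gamma>_hom: "\<gamma> \<in> ring_hom (sub_ring (coord_ring Fq infty)) (sub_ring (valuation_ring K v))"
    and \<gamma>_inj: "inj_on \<gamma> (coord_ring Fq infty)"
    and \<epsilon>_maximal:
      "maximalideal (kernel_point (coord_ring Fq infty) \<gamma> K v) (sub_ring (coord_ring Fq infty))"
    and \<epsilon>_finite:
      "finite (carrier (sub_ring (coord_ring Fq infty) Quot kernel_point (coord_ring Fq infty) \<gamma> K v))"
    and uniformizer:
      "uniformizer_at (coord_ring Fq infty) (kernel_point (coord_ring Fq infty) \<gamma> K v) z"
    and \<iota>_hom:
      "\<iota> \<in> ring_hom (sub_ring (coord_ring Fq infty) Quot kernel_point (coord_ring Fq infty) \<gamma> K v)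
                 (sub_ring (valuation_ring K v))"
    and \<iota>_lifts_\<gamma>:
      "\<forall>a\<in>coord_ring Fq infty.
         \<iota> (kernel_point (coord_ring Fq infty) \<gamma> K v +>\<^bsub>sub_ring (coord_ring Fq infty)\<^esub> a) - \<gamma> a
           \<in> valuation_ideal K v"
begin

abbreviation "A \<equiv> coord_ring Fq infty"

abbreviation "\<epsilon> \<equiv> kernel_point A \<gamma> K v"

abbreviation "R \<equiv> valuation_ring K v"

definition qhat :: nat
  where "qhat = card (carrier (sub_ring A Quot \<epsilon>))"

definition \<zeta> :: 'l
  where "\<zeta> = extend_to_local_ring A \<epsilon> \<gamma> z"

text \<open>\<open>F\<^sub>\<epsilon>\<close> as a subfield of \<open>K\<close>.\<close>

definition F_eps :: "'l set"
  where "F_eps = \<iota> ` carrier (sub_ring A Quot \<epsilon>)"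

end


section \<open>Rings of power series and Laurent series\<close>

definition power_series_over :: "'l::field set \<Rightarrow> 'l fls set"
  where "power_series_over S = fps_to_fls ` {f. range (fps_nth f) \<subseteq> S}"

definition laurent_series_over :: "'l::field set \<Rightarrow> 'l fls set"
  where "laurent_series_over S = {f. range (fls_nth f) \<subseteq> S}"

text \<open>\<open>B[1/s]\<close> for a subring \<open>B\<close> of a field and nonzero \<open>s \<in> B\<close>.\<close>

definition localize :: "'b::field set \<Rightarrow> 'b \<Rightarrow> 'b set"
  where "localize B s = {x. \<exists>n. x * s ^ n \<in> B}"

definition z_minus :: "'l::field \<Rightarrow> 'l fls"
  where "z_minus \<zeta> = fls_X - fls_const \<zeta>"

text \<open>Applies \<open>h\<close> (with \<open>h 0 = 0\<close>) to all coefficients.\<close>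

definition map_coeffs :: "('l::field \<Rightarrow> 'l) \<Rightarrow> 'l fls \<Rightarrow> 'l fls"
  where "map_coeffs h f = Abs_fls (\<lambda>i. h (fls_nth f i))"

definition frob :: "nat \<Rightarrow> 'l::field fls \<Rightarrow> 'l fls"
  where "frob q = map_coeffs (\<lambda>b. b ^ q)"


section \<open>Free modules and base change\<close>

definition module_basis :: "'b::field set \<Rightarrow> ('b, 'm) module \<Rightarrow> nat \<Rightarrow> (nat \<Rightarrow> 'm) \<Rightarrow> bool"
  where "module_basis B M r e \<longleftrightarrow>
    (\<forall>i<r. e i \<in> carrier M) \<and>
    (\<forall>x\<in>carrier M. \<exists>!c. c \<in> {..<r} \<rightarrow>\<^sub>E B \<and> x = (\<Oplus>\<^bsub>M\<^esub>i\<in>{..<r}. c i \<odot>\<^bsub>M\<^esub> e i))"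

definition free_of_rank :: "'b::field set \<Rightarrow> nat \<Rightarrow> ('b, 'm) module \<Rightarrow> bool"
  where "free_of_rank B r M \<longleftrightarrow> Module.module (sub_ring B) M \<and> (\<exists>e. module_basis B M r e)"

definition linear_maps :: "'b set \<Rightarrow> ('b, 'm) module \<Rightarrow> ('b, 'n) module \<Rightarrow> ('m \<Rightarrow> 'n) set"
  where "linear_maps B M N =
    {f \<in> carrier M \<rightarrow>\<^sub>E carrier N.
       (\<forall>x\<in>carrier M. \<forall>y\<in>carrier M. f (x \<oplus>\<^bsub>M\<^esub> y) = f x \<oplus>\<^bsub>N\<^esub> f y) \<and>
       (\<forall>b\<in>B. \<forall>x\<in>carrier M. f (b \<odot>\<^bsub>M\<^esub> x) = b \<odot>\<^bsub>N\<^esub> f x)}"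

text \<open>
  The base change \<open>M \<otimes>\<^sub>B\<^sub>,\<^sub>\<phi> S\<close> along a ring homomorphism
  \<open>\<phi>: B \<rightarrow> S\<close>, built as usual: the formal sums of symbols \<open>m \<otimes> s\<close>,
  encoded as finitely supported functions \<open>carrier M \<rightarrow> S\<close> (so that additivity in
  \<open>s\<close> is built in), modulo additivity in \<open>m\<close> and
  \<open>bm \<otimes> s = m \<otimes> s \<phi>(b)\<close>.
\<close>

definition formal_sums :: "'b::field set \<Rightarrow> ('b, 'm) module \<Rightarrow> ('m \<Rightarrow> 'b) set"
  where "formal_sums S M =
    {c. range c \<subseteq> S \<and> (\<forall>m. m \<notin> carrier M \<longrightarrow> c m = 0) \<and> finite {m. c m \<noteq> 0}}"

definition symb :: "'m \<Rightarrow> 'b::field \<Rightarrow> 'm \<Rightarrow> 'b"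
  where "symb m s = (\<lambda>x. if x = m then s else 0)"

inductive_set tensor_relations ::
    "('b::field \<Rightarrow> 'b) \<Rightarrow> 'b set \<Rightarrow> 'b set \<Rightarrow> ('b, 'm) module \<Rightarrow> ('m \<Rightarrow> 'b) set"
  for \<phi> B S M where
  zero: "(\<lambda>_. 0) \<in> tensor_relations \<phi> B S M"
| add: "c \<in> tensor_relations \<phi> B S M \<Longrightarrow> d \<in> tensor_relations \<phi> B S M \<Longrightarrow>
    (\<lambda>x. c x + d x) \<in> tensor_relations \<phi> B S M"
| additive: "m \<in> carrier M \<Longrightarrow> n \<in> carrier M \<Longrightarrow> s \<in> S \<Longrightarrow>
    (\<lambda>x. symb (m \<oplus>\<^bsub>M\<^esub> n) s x - symb m s x - symb n s x) \<in> tensor_relations \<phi> B S M"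
| balanced: "m \<in> carrier M \<Longrightarrow> b \<in> B \<Longrightarrow> s \<in> S \<Longrightarrow>
    (\<lambda>x. symb (b \<odot>\<^bsub>M\<^esub> m) s x - symb m (s * \<phi> b) x) \<in> tensor_relations \<phi> B S M"

definition tensor_class ::
    "('b::field \<Rightarrow> 'b) \<Rightarrow> 'b set \<Rightarrow> 'b set \<Rightarrow> ('b, 'm) module \<Rightarrow> ('m \<Rightarrow> 'b) \<Rightarrow> ('m \<Rightarrow> 'b) set"
  where "tensor_class \<phi> B S M c =
    {d \<in> formal_sums S M. (\<lambda>x. d x - c x) \<in> tensor_relations \<phi> B S M}"

text \<open>The fields \<open>mult\<close> and \<open>one\<close> of a module record carry no meaning.\<close>

definition base_change ::
    "('b::field \<Rightarrow> 'b) \<Rightarrow> 'b set \<Rightarrow> 'b set \<Rightarrow> ('b, 'm) module \<Rightarrow> ('b, ('m \<Rightarrow> 'b) set) module"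
  where "base_change \<phi> B S M =
    \<lparr>carrier = tensor_class \<phi> B S M ` formal_sums S M,
     monoid.mult = undefined, one = undefined,
     ring.zero = tensor_class \<phi> B S M (\<lambda>_. 0),
     add = (\<lambda>U W. {(\<lambda>m. c m + d m) | c d. c \<in> U \<and> d \<in> W}),
     module.smult = (\<lambda>s U. \<Union>c\<in>U. tensor_class \<phi> B S M (\<lambda>m. s * c m))\<rparr>"

definition pure_tensor ::
    "('b::field \<Rightarrow> 'b) \<Rightarrow> 'b set \<Rightarrow> 'b set \<Rightarrow> ('b, 'm) module \<Rightarrow> 'm \<Rightarrow> 'b \<Rightarrow> ('m \<Rightarrow> 'b) set"
  where "pure_tensor \<phi> B S M m s = tensor_class \<phi> B S M (symb m s)"

text \<open>
  The additive map \<open>m \<otimes> s \<mapsto> \<psi>(s) \<cdot> g(m)\<close> from a base change to \<open>P\<close>.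
  The result does not depend on the chosen representative whenever this assignment is compatible
  with the defining relations, which is the case in all uses below.
\<close>

definition tensor_lift ::
    "('b, 'n) module \<Rightarrow> ('b::field \<Rightarrow> 'b) \<Rightarrow> ('m \<Rightarrow> 'n) \<Rightarrow> ('m \<Rightarrow> 'b) set \<Rightarrow> 'n"
  where "tensor_lift P \<psi> g U =
    (let c = (SOME c. c \<in> U) in \<Oplus>\<^bsub>P\<^esub>m\<in>{m. c m \<noteq> 0}. \<psi> (c m) \<odot>\<^bsub>P\<^esub> g m)"


section \<open>Local shtukas\<close>

text \<open>\<open>M \<otimes>\<^bsub>R[[z]]\<^esub> S\<close> for an overring \<open>S\<close> of \<open>R[[z]]\<close>.\<close>

abbreviation ext :: "'l::field set \<Rightarrow> 'l fls set \<Rightarrow> ('l fls, 'm) module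
    \<Rightarrow> ('l fls, ('m \<Rightarrow> 'l fls) set) module"
  where "ext R S M \<equiv> base_change (\<lambda>x. x) (power_series_over R) S M"

text \<open>\<open>\<sigma>\<^sup>*M \<otimes>\<^bsub>R[[z]]\<^esub> S\<close>, formed in one step as
  \<open>M \<otimes>\<^bsub>R[[z]],\<sigma>\<^esub> S\<close>.\<close>

abbreviation frob_ext :: "nat \<Rightarrow> 'l::field set \<Rightarrow> 'l fls set \<Rightarrow> ('l fls, 'm) module
    \<Rightarrow> ('l fls, ('m \<Rightarrow> 'l fls) set) module"
  where "frob_ext q R S M \<equiv> base_change (frob q) (power_series_over R) S M"

abbreviation pure_ext :: "'l::field set \<Rightarrow> 'l fls set \<Rightarrow> ('l fls, 'm) module \<Rightarrow> 'm \<Rightarrow> ('m \<Rightarrow> 'l fls) set"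
  where "pure_ext R S M m \<equiv> pure_tensor (\<lambda>x. x) (power_series_over R) S M m 1"

abbreviation pure_frob_ext ::
    "nat \<Rightarrow> 'l::field set \<Rightarrow> 'l fls set \<Rightarrow> ('l fls, 'm) module \<Rightarrow> 'm \<Rightarrow> ('m \<Rightarrow> 'l fls) set"
  where "pure_frob_ext q R S M m \<equiv> pure_tensor (frob q) (power_series_over R) S M m 1"

text \<open>The canonical maps \<open>M \<otimes> S' \<rightarrow> M \<otimes> S\<close> and
  \<open>\<sigma>\<^sup>*M \<otimes> S' \<rightarrow> \<sigma>\<^sup>*M \<otimes> S\<close> for \<open>S' \<subseteq> S\<close>.\<close>

definition enlarge ::
    "'l::field set \<Rightarrow> 'l fls set \<Rightarrow> ('l fls, 'm) module \<Rightarrow> ('m \<Rightarrow> 'l fls) set \<Rightarrow> ('m \<Rightarrow> 'l fls) set"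
  where "enlarge R S M = tensor_lift (ext R S M) (\<lambda>s. s) (pure_ext R S M)"

definition frob_enlarge ::
    "nat \<Rightarrow> 'l::field set \<Rightarrow> 'l fls set \<Rightarrow> ('l fls, 'm) module
      \<Rightarrow> ('m \<Rightarrow> 'l fls) set \<Rightarrow> ('m \<Rightarrow> 'l fls) set"
  where "frob_enlarge q R S M = tensor_lift (frob_ext q R S M) (\<lambda>s. s) (pure_frob_ext q R S M)"

text \<open>\<open>x \<mapsto> \<sigma>\<^sup>*x\<close>, that is, the map \<open>m \<otimes> s \<mapsto> \<sigma>\<^sup>*m \<otimes> \<sigma>(s)\<close> from
  \<open>M \<otimes> S\<close> to \<open>\<sigma>\<^sup>*M \<otimes> S\<close>.\<close>

definition frob_pull ::
    "nat \<Rightarrow> 'l::field set \<Rightarrow> 'l fls set \<Rightarrow> ('l fls, 'm) module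
      \<Rightarrow> ('m \<Rightarrow> 'l fls) set \<Rightarrow> ('m \<Rightarrow> 'l fls) set"
  where "frob_pull q R S M = tensor_lift (frob_ext q R S M) (frob q) (pure_frob_ext q R S M)"

type_synonym ('l, 'm) shtuka =
  "('l fls, 'm) module \<times> (('m \<Rightarrow> 'l fls) set \<Rightarrow> ('m \<Rightarrow> 'l fls) set)"

text \<open>The ring \<open>R[[z]][1/(z - \<zeta>)]\<close>; note that it is contained in
  \<open>K[[z]]\<close> when \<open>\<zeta> \<noteq> 0\<close>.\<close>

definition shtuka_ring :: "'l::field set \<Rightarrow> 'l \<Rightarrow> 'l fls set"
  where "shtuka_ring R \<zeta> = localize (power_series_over R) (z_minus \<zeta>)"

definition local_shtuka :: "'l::field set \<Rightarrow> nat \<Rightarrow> 'l \<Rightarrow> nat \<Rightarrow> ('l, 'm) shtuka \<Rightarrow> bool"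
  where "local_shtuka R q \<zeta> r = (\<lambda>(M, \<tau>).
    free_of_rank (power_series_over R) r M \<and>
    \<tau> \<in> linear_maps (shtuka_ring R \<zeta>) (frob_ext q R (shtuka_ring R \<zeta>) M) (ext R (shtuka_ring R \<zeta>) M) \<and>
    bij_betw \<tau> (carrier (frob_ext q R (shtuka_ring R \<zeta>) M)) (carrier (ext R (shtuka_ring R \<zeta>) M)))"

text \<open>The extension \<open>\<tau> \<otimes> id: \<sigma>\<^sup>*M \<otimes> S \<rightarrow> M \<otimes> S\<close> of
  \<open>\<tau>\<close> to an overring \<open>S\<close> of \<open>R[[z]][1/(z - \<zeta>)]\<close>.\<close>

definition tau_ext ::
    "'l::field set \<Rightarrow> nat \<Rightarrow> 'l \<Rightarrow> 'l fls set \<Rightarrow> ('l, 'm) shtuka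
      \<Rightarrow> ('m \<Rightarrow> 'l fls) set \<Rightarrow> ('m \<Rightarrow> 'l fls) set"
  where "tau_ext R q \<zeta> S = (\<lambda>(M, \<tau>).
    tensor_lift (ext R S M) (\<lambda>s. s)
      (\<lambda>m. enlarge R S M (\<tau> (pure_frob_ext q R (shtuka_ring R \<zeta>) M m))))"

text \<open>\<open>f \<otimes> id: M \<otimes> S \<rightarrow> N \<otimes> S\<close> and
  \<open>\<sigma>\<^sup>*f \<otimes> id: \<sigma>\<^sup>*M \<otimes> S \<rightarrow> \<sigma>\<^sup>*N \<otimes> S\<close> for \<open>f: M \<rightarrow> N\<close>.\<close>

definition map_ext ::
    "'l::field set \<Rightarrow> 'l fls set \<Rightarrow> ('l fls, 'n) module \<Rightarrow> ('m \<Rightarrow> 'n)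
      \<Rightarrow> ('m \<Rightarrow> 'l fls) set \<Rightarrow> ('n \<Rightarrow> 'l fls) set"
  where "map_ext R S N f = tensor_lift (ext R S N) (\<lambda>s. s) (\<lambda>m. pure_ext R S N (f m))"

definition map_frob_ext ::
    "nat \<Rightarrow> 'l::field set \<Rightarrow> 'l fls set \<Rightarrow> ('l fls, 'n) module \<Rightarrow> ('m \<Rightarrow> 'n)
      \<Rightarrow> ('m \<Rightarrow> 'l fls) set \<Rightarrow> ('n \<Rightarrow> 'l fls) set"
  where "map_frob_ext q R S N f =
    tensor_lift (frob_ext q R S N) (\<lambda>s. s) (\<lambda>m. pure_frob_ext q R S N (f m))"

definition shtuka_morphisms ::
    "'l::field set \<Rightarrow> nat \<Rightarrow> 'l \<Rightarrow> ('l, 'm) shtuka \<Rightarrow> ('l, 'n) shtuka \<Rightarrow> ('m \<Rightarrow> 'n) set"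
  where "shtuka_morphisms R q \<zeta> = (\<lambda>(M, \<tau>) (N, \<tau>').
    {f \<in> linear_maps (power_series_over R) M N.
       \<forall>x\<in>carrier (frob_ext q R (shtuka_ring R \<zeta>) M).
         \<tau>' (map_frob_ext q R (shtuka_ring R \<zeta>) N f x) = map_ext R (shtuka_ring R \<zeta>) N f (\<tau> x)})"

text \<open>The same for \<open>f: M[1/z] \<rightarrow> N[1/z]\<close> and overrings \<open>S\<close> of
  \<open>E = R[[z]][1/z]\<close>.  Here \<open>\<sigma>\<^sup>*f\<close> sends \<open>\<sigma>\<^sup>*m\<close> to
  \<open>\<sigma>\<^sup>*(f(m))\<close>.\<close>

definition inv_z_ring :: "'l::field set \<Rightarrow> 'l fls set"
  where "inv_z_ring R = localize (power_series_over R) fls_X"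

definition qmap_ext ::
    "'l::field set \<Rightarrow> 'l fls set \<Rightarrow> ('l fls, 'm) module \<Rightarrow> ('l fls, 'n) module
      \<Rightarrow> (('m \<Rightarrow> 'l fls) set \<Rightarrow> ('n \<Rightarrow> 'l fls) set) \<Rightarrow> ('m \<Rightarrow> 'l fls) set \<Rightarrow> ('n \<Rightarrow> 'l fls) set"
  where "qmap_ext R S M N f =
    tensor_lift (ext R S N) (\<lambda>s. s) (\<lambda>m. enlarge R S N (f (pure_ext R (inv_z_ring R) M m)))"

definition qmap_frob_ext ::
    "nat \<Rightarrow> 'l::field set \<Rightarrow> 'l fls set \<Rightarrow> ('l fls, 'm) module \<Rightarrow> ('l fls, 'n) module
      \<Rightarrow> (('m \<Rightarrow> 'l fls) set \<Rightarrow> ('n \<Rightarrow> 'l fls) set) \<Rightarrow> ('m \<Rightarrow> 'l fls) set \<Rightarrow> ('n \<Rightarrow> 'l fls) set"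
  where "qmap_frob_ext q R S M N f =
    tensor_lift (frob_ext q R S N) (\<lambda>s. s)
      (\<lambda>m. frob_enlarge q R S N
             (frob_pull q R (inv_z_ring R) N (f (pure_ext R (inv_z_ring R) M m))))"

text \<open>The compatibility of a quasi-morphism with the \<open>\<tau>\<close>s takes place over
  \<open>R[[z]][1/z][1/(z - \<zeta>)]\<close>.\<close>

definition shtuka_quasi_morphisms ::
    "'l::field set \<Rightarrow> nat \<Rightarrow> 'l \<Rightarrow> ('l, 'm) shtuka \<Rightarrow> ('l, 'n) shtuka
      \<Rightarrow> (('m \<Rightarrow> 'l fls) set \<Rightarrow> ('n \<Rightarrow> 'l fls) set) set"
  where "shtuka_quasi_morphisms R q \<zeta> = (\<lambda>(M, \<tau>) (N, \<tau>').
    let S = localize (inv_z_ring R) (z_minus \<zeta>) in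
    {f \<in> linear_maps (inv_z_ring R) (ext R (inv_z_ring R) M) (ext R (inv_z_ring R) N).
       \<forall>x\<in>carrier (frob_ext q R S M).
         tau_ext R q \<zeta> S (N, \<tau>') (qmap_frob_ext q R S M N f x) =
         qmap_ext R S M N f (tau_ext R q \<zeta> S (M, \<tau>) x)})"


section \<open>Categories and fully faithful functors\<close>

text \<open>Composition also receives the source object, because composites of set-theoretic maps are
  made extensional on its carrier.\<close>

record ('o, 'f) category =
  Ob :: "'o set"
  Hom :: "'o \<Rightarrow> 'o \<Rightarrow> 'f set"
  Idt :: "'o \<Rightarrow> 'f"
  Comp :: "'o \<Rightarrow> 'f \<Rightarrow> 'f \<Rightarrow> 'f"

definition is_functor ::
    "('o, 'f) category \<Rightarrow> ('p, 'g) category \<Rightarrow> ('o \<Rightarrow> 'p) \<Rightarrow> ('o \<Rightarrow> 'o \<Rightarrow> 'f \<Rightarrow> 'g) \<Rightarrow> bool"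
  where "is_functor C D F0 F1 \<longleftrightarrow>
    (\<forall>U\<in>Ob C. F0 U \<in> Ob D) \<and>
    (\<forall>U\<in>Ob C. \<forall>W\<in>Ob C. \<forall>f\<in>Hom C U W. F1 U W f \<in> Hom D (F0 U) (F0 W)) \<and>
    (\<forall>U\<in>Ob C. F1 U U (Idt C U) = Idt D (F0 U)) \<and>
    (\<forall>U\<in>Ob C. \<forall>W\<in>Ob C. \<forall>P\<in>Ob C. \<forall>f\<in>Hom C U W. \<forall>g\<in>Hom C W P.
       F1 U P (Comp C U g f) = Comp D (F0 U) (F1 W P g) (F1 U W f))"

definition fully_faithful_functor ::
    "('o, 'f) category \<Rightarrow> ('p, 'g) category \<Rightarrow> ('o \<Rightarrow> 'p) \<Rightarrow> ('o \<Rightarrow> 'o \<Rightarrow> 'f \<Rightarrow> 'g) \<Rightarrow> bool"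
  where "fully_faithful_functor C D F0 F1 \<longleftrightarrow>
    is_functor C D F0 F1 \<and>
    (\<forall>U\<in>Ob C. \<forall>W\<in>Ob C. bij_betw (F1 U W) (Hom C U W) (Hom D (F0 U) (F0 W)))"

definition shtuka_category ::
    "'l::field set \<Rightarrow> nat \<Rightarrow> 'l \<Rightarrow> (('l, 'm) shtuka, 'm \<Rightarrow> 'm) category"
  where "shtuka_category R q \<zeta> =
    \<lparr>Ob = {U. \<exists>r. local_shtuka R q \<zeta> r U},
     Hom = shtuka_morphisms R q \<zeta>,
     Idt = (\<lambda>U. \<lambda>m\<in>carrier (fst U). m),
     Comp = (\<lambda>U. compose (carrier (fst U)))\<rparr>"

definition shtuka_quasi_category ::
    "'l::field set \<Rightarrow> nat \<Rightarrow> 'l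
      \<Rightarrow> (('l, 'm) shtuka, ('m \<Rightarrow> 'l fls) set \<Rightarrow> ('m \<Rightarrow> 'l fls) set) category"
  where "shtuka_quasi_category R q \<zeta> =
    \<lparr>Ob = {U. \<exists>r. local_shtuka R q \<zeta> r U},
     Hom = shtuka_quasi_morphisms R q \<zeta>,
     Idt = (\<lambda>U. \<lambda>m\<in>carrier (ext R (inv_z_ring R) (fst U)). m),
     Comp = (\<lambda>U. compose (carrier (ext R (inv_z_ring R) (fst U))))\<rparr>"


section \<open>Continuous Galois representations\<close>

type_synonym ('l, 't) galois_rep = "('l fls, 't) module \<times> (('l \<Rightarrow> 'l) \<Rightarrow> 't \<Rightarrow> 't)"

text \<open>
  Finite free modules over \<open>D = A\<^sub>\<epsilon>\<close> or \<open>D = Q\<^sub>\<epsilon>\<close> with a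
  \<open>D\<close>-linear action of the Galois group that is continuous, i.e. whose matrix
  coefficients in a basis are continuous functions to \<open>D\<close>.  The metric of
  \<open>'l fls\<close> in the library induces the \<open>z\<close>-adic topology on \<open>D\<close>.
\<close>

definition galois_representation ::
    "'l::field set \<Rightarrow> 'l fls set \<Rightarrow> nat \<Rightarrow> ('l, 't) galois_rep \<Rightarrow> bool"
  where "galois_representation K D r = (\<lambda>(T, \<rho>).
    free_of_rank D r T \<and>
    (\<forall>g\<in>galois_group K. restrict (\<rho> g) (carrier T) \<in> linear_maps D T T) \<and>
    (\<forall>x\<in>carrier T. \<rho> id x = x) \<and>
    (\<forall>g\<in>galois_group K. \<forall>h\<in>galois_group K. \<forall>x\<in>carrier T. \<rho> (g \<circ> h) x = \<rho> g (\<rho> h x)) \<and>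
    (\<exists>e a. module_basis D T r e \<and>
       (\<forall>i<r. \<forall>j<r. continuous_map (krull_topology K) (top_of_set D) (a i j)) \<and>
       (\<forall>g\<in>galois_group K. \<forall>j<r. \<rho> g (e j) = (\<Oplus>\<^bsub>T\<^esub>i\<in>{..<r}. a i j g \<odot>\<^bsub>T\<^esub> e i))))"

definition rep_morphisms ::
    "'l::field set \<Rightarrow> 'l fls set \<Rightarrow> ('l, 't) galois_rep \<Rightarrow> ('l, 't) galois_rep \<Rightarrow> ('t \<Rightarrow> 't) set"
  where "rep_morphisms K D = (\<lambda>(T, \<rho>) (T', \<rho>').
    {f \<in> linear_maps D T T'. \<forall>g\<in>galois_group K. \<forall>x\<in>carrier T. f (\<rho> g x) = \<rho>' g (f x)})"

definition rep_category ::
    "'l::field set \<Rightarrow> 'l fls set \<Rightarrow> (('l, 't) galois_rep, 't \<Rightarrow> 't) category"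
  where "rep_category K D =
    \<lparr>Ob = {U. \<exists>r. galois_representation K D r U},
     Hom = rep_morphisms K D,
     Idt = (\<lambda>U. \<lambda>x\<in>carrier (fst U). x),
     Comp = (\<lambda>U. compose (carrier (fst U)))\<rparr>"


section \<open>Tate modules\<close>

text \<open>The \<open>\<tau>\<close>-invariants of \<open>M \<otimes> S\<close> with Galois action through the coefficients;
  \<open>S\<close> is the ring of power series over the separable closure for the integral and the
  field of Laurent series for the rational Tate module.\<close>

definition tate_object ::
    "'l::field set \<Rightarrow> nat \<Rightarrow> 'l \<Rightarrow> 'l fls set \<Rightarrow> ('l, 'm) shtuka \<Rightarrow> ('l, ('m \<Rightarrow> 'l fls) set) galois_rep"
  where "tate_object R q \<zeta> S = (\<lambda>(M, \<tau>).
    ((ext R S M)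
       \<lparr>carrier := {x \<in> carrier (ext R S M). tau_ext R q \<zeta> S (M, \<tau>) (frob_pull q R S M x) = x}\<rparr>,
     \<lambda>g. tensor_lift (ext R S M) (map_coeffs g) (pure_ext R S M)))"

abbreviation T_object ::
    "'l::field set \<Rightarrow> nat \<Rightarrow> 'l \<Rightarrow> ('l, 'm) shtuka \<Rightarrow> ('l, ('m \<Rightarrow> 'l fls) set) galois_rep"
  where "T_object R q \<zeta> \<equiv> tate_object R q \<zeta> (power_series_over UNIV)"

abbreviation V_object ::
    "'l::field set \<Rightarrow> nat \<Rightarrow> 'l \<Rightarrow> ('l, 'm) shtuka \<Rightarrow> ('l, ('m \<Rightarrow> 'l fls) set) galois_rep"
  where "V_object R q \<zeta> \<equiv> tate_object R q \<zeta> (laurent_series_over UNIV)"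

definition T_map ::
    "'l::field set \<Rightarrow> nat \<Rightarrow> 'l \<Rightarrow> ('l, 'm) shtuka \<Rightarrow> ('l, 'n) shtuka
      \<Rightarrow> ('m \<Rightarrow> 'n) \<Rightarrow> ('m \<Rightarrow> 'l fls) set \<Rightarrow> ('n \<Rightarrow> 'l fls) set"
  where "T_map R q \<zeta> U W f =
    restrict (map_ext R (power_series_over UNIV) (fst W) f) (carrier (fst (T_object R q \<zeta> U)))"

definition V_map ::
    "'l::field set \<Rightarrow> nat \<Rightarrow> 'l \<Rightarrow> ('l, 'm) shtuka \<Rightarrow> ('l, 'n) shtuka
      \<Rightarrow> (('m \<Rightarrow> 'l fls) set \<Rightarrow> ('n \<Rightarrow> 'l fls) set) \<Rightarrow> ('m \<Rightarrow> 'l fls) set \<Rightarrow> ('n \<Rightarrow> 'l fls) set"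
  where "V_map R q \<zeta> U W f =
    restrict (qmap_ext R (laurent_series_over UNIV) (fst U) (fst W) f)
      (carrier (fst (V_object R q \<zeta> U)))"

end

theory Submission
  imports Defs "Jordan_Normal_Form.Determinant" "HOL-Number_Theory.Cong"
begin

text \<open>
  In coordinates a local shtuka is an invertible matrix \<open>T\<close> over \<open>R[[z]][1/(z - \<zeta>)]\<close>, and a morphism
  from \<open>T\<close> to \<open>T'\<close> is a matrix \<open>H\<close> over \<open>R[[z]]\<close> (over \<open>R[[z]][1/z]\<close> for quasi-morphisms) with
  \<open>T' \<sigma>(H) = H T\<close>.  Lang's theorem, applied coefficient by coefficient, gives an invertible \<open>U\<close> over
  \<open>K\<^sup>s\<^sup>e\<^sup>p[[z]]\<close> with \<open>T \<sigma>(U) = U\<close>, whose columns are a basis of the Tate module.  So an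
  equivariant map with matrix \<open>c\<close> of Tate modules comes from exactly one solution \<open>H = U' c U\<^sup>-\<^sup>1\<close>
  over \<open>K\<^sup>s\<^sup>e\<^sup>p[[z]]\<close>, and by equivariance the coefficients of \<open>H\<close> are fixed by the Galois group,
  hence lie in \<open>K\<close>.

  What remains is that a solution \<open>H\<close> over \<open>K[[z]]\<close> is integral.  The equation bounds the growth of
  the coefficients of \<open>H\<close> by a geometric sequence.  If they grow slower than \<open>|\<zeta>|\<^sup>-\<^sup>n\<^sup>/\<^sup>q\<close>, then
  reading the equation as \<open>\<sigma>(H) = T'\<^sup>-\<^sup>1 H T\<close> improves the bound by a \<open>q\<close>-th root, and
  iterating makes \<open>H\<close> integral.  To get below that threshold one clears the poles of
  \<open>\<sigma>\<^sup>k(H)\<close>, whose coefficients are \<open>q\<^sup>k\<close>-th powers; as \<open>R\<close> is discretely valued, their valuations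
  are multiples of \<open>q\<^sup>k\<close>, which for large \<open>k\<close> excludes a pole at \<open>\<zeta>\<close>.
\<close>


section \<open>Growth of coefficients and integrality\<close>

text \<open>The equation alone bounds the i-th coefficient of H by a constant times
  |\<zeta>|^(-i/q). This is exactly the threshold, not below it: \<sigma>(H) then converges for |z|
  < |\<zeta>| but may still have a pole at \<zeta>, and a factor z - \<zeta> can be divided out
  without loss only where convergence at \<zeta> is known. At the other poles \<zeta>^(q^j), j >= 1,
  it is known, since they lie strictly inside that disc. So only \<zeta> itself needs arithmetic.
  The exponent of z - \<zeta> is padded to a power n of q, so that (z - \<zeta>)^n = z^n -
  \<zeta>^n, and a coefficient above the bound has the same absolute value as \<zeta>^n times the
  coefficient n places further. If both are q^k-th powers, q^k divides n times the valuation of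
  \<zeta>; taking this number as k excludes it because q^k > k. The integral and the rational
  functor differ only in their coefficient rings and are treated together.\<close>

definition subr :: "'a::comm_ring_1 set \<Rightarrow> bool"
  where "subr S \<longleftrightarrow> 0 \<in> S \<and> 1 \<in> S \<and> (\<forall>x\<in>S. - x \<in> S) \<and>
    (\<forall>x\<in>S. \<forall>y\<in>S. x + y \<in> S) \<and> (\<forall>x\<in>S. \<forall>y\<in>S. x * y \<in> S)"

lemma subrD:
  assumes "subr S"
  shows "0 \<in> S" "1 \<in> S" "x \<in> S \<Longrightarrow> - x \<in> S" "x \<in> S \<Longrightarrow> y \<in> S \<Longrightarrow> x + y \<in> S"
    "x \<in> S \<Longrightarrow> y \<in> S \<Longrightarrow> x * y \<in> S" "x \<in> S \<Longrightarrow> y \<in> S \<Longrightarrow> x - y \<in> S"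
  using assms unfolding subr_def by (auto simp: diff_conv_add_uminus simp del: add_uminus_conv_diff)

lemma subr_power: "subr S \<Longrightarrow> x \<in> S \<Longrightarrow> x ^ n \<in> S"
  by (induction n) (auto intro: subrD)

lemma subr_sum: "subr S \<Longrightarrow> (\<And>i. i \<in> I \<Longrightarrow> f i \<in> S) \<Longrightarrow> sum f I \<in> S"
  by (induction I rule: infinite_finite_induct) (auto intro: subrD)

lemma subr_prod: "subr S \<Longrightarrow> (\<And>i. i \<in> I \<Longrightarrow> f i \<in> S) \<Longrightarrow> prod f I \<in> S"
  by (induction I rule: infinite_finite_induct) (auto intro: subrD)

text \<open>The estimates take place in \<open>fps\<close>, with coefficients indexed by natural
  numbers; Laurent series enter only with the modules.\<close>

definition fps_over :: "'a::comm_ring_1 set \<Rightarrow> 'a fps set"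
  where "fps_over S = {f. range (fps_nth f) \<subseteq> S}"

lemma fps_overI: "(\<And>i. fps_nth f i \<in> S) \<Longrightarrow> f \<in> fps_over S"
  by (auto simp: fps_over_def)

lemma fps_overD: "f \<in> fps_over S \<Longrightarrow> fps_nth f i \<in> S"
  by (auto simp: fps_over_def)

lemma subr_fps_over: "subr S \<Longrightarrow> subr (fps_over S)"
  unfolding subr_def [of "fps_over S"]
  by (auto simp: fps_over_def image_subset_iff fps_mult_nth fps_one_nth intro!: subr_sum intro: subrD)

lemma fps_X_over: "subr S \<Longrightarrow> fps_X \<in> fps_over S"
  by (auto intro!: fps_overI intro: subrD simp: fps_X_nth)

lemma fps_const_over: "subr S \<Longrightarrow> c \<in> S \<Longrightarrow> fps_const c \<in> fps_over S"
  by (auto intro!: fps_overI intro: subrD)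

section \<open>The coefficientwise Frobenius\<close>

definition fps_frob :: "nat \<Rightarrow> 'a::comm_ring_1 fps \<Rightarrow> 'a fps"
  where "fps_frob Q f = Abs_fps (\<lambda>i. fps_nth f i ^ Q)"

lemma fps_frob_nth [simp]: "fps_nth (fps_frob Q f) i = fps_nth f i ^ Q"
  by (simp add: fps_frob_def)

text \<open>Positivity of the exponent gives \<open>of_nat Q = 0\<close> and Q > 1; the separability
  of Artin-Schreier polynomials rests on the former, the gain in the growth estimates on the
  latter.\<close>

definition frobexp :: "'a::field itself \<Rightarrow> nat \<Rightarrow> bool"
  where "frobexp _ Q \<longleftrightarrow> normalization_semidom_class.prime CHAR('a) \<and> (\<exists>e>0. Q = CHAR('a) ^ e)"

lemma frobexp_gt1: "frobexp TYPE('a::field) Q \<Longrightarrow> Q > 1"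
  unfolding frobexp_def by (metis one_less_power prime_gt_1_nat)

lemma frobexp_power: "frobexp TYPE('a::field) Q \<Longrightarrow> k > 0 \<Longrightarrow> frobexp TYPE('a) (Q ^ k)"
  unfolding frobexp_def by (metis nat_0_less_mult_iff power_mult)

lemma frobexp_add:
  "frobexp TYPE('a::field) Q \<Longrightarrow> (x + y :: 'a) ^ Q = x ^ Q + y ^ Q"
  by (auto simp: frobexp_def intro: freshmans_dream')

lemma frobexp_sum:
  "frobexp TYPE('a::field) Q \<Longrightarrow> (\<Sum>i\<in>I. f i :: 'a) ^ Q = (\<Sum>i\<in>I. f i ^ Q)"
  by (auto simp: frobexp_def intro!: freshmans_dream_sum')

lemma frobexp_minus:
  "frobexp TYPE('a::field) Q \<Longrightarrow> (- x :: 'a) ^ Q = - (x ^ Q)"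
  using frobexp_add[of Q "-x" x] frobexp_gt1[where 'a='a, of Q] by (simp add: power_0_left eq_neg_iff_add_eq_0)

lemma frobexp_diff:
  "frobexp TYPE('a::field) Q \<Longrightarrow> (x - y :: 'a) ^ Q = x ^ Q - y ^ Q"
  using frobexp_add[of Q x "-y"] frobexp_minus[of Q y] by simp

lemma frobexp_of_nat: "frobexp TYPE('a::field) Q \<Longrightarrow> of_nat Q = (0 :: 'a)"
  by (auto simp: frobexp_def of_nat_eq_0_iff_char_dvd)

text \<open>This concerns the Q-th power of the series itself, which also replaces z by z^Q, whereas
  \<open>fps_frob\<close> acts on coefficients only. Applied to z - \<alpha> it gives z^Q -
  \<alpha>^Q.\<close>

lemma frobexp_fps_diff:
  "frobexp TYPE('a::field) Q \<Longrightarrow> (f - g :: 'a fps) ^ Q = f ^ Q - g ^ Q"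
proof -
  assume *: "frobexp TYPE('a) Q"
  then have add: "(x + y) ^ Q = x ^ Q + y ^ Q" for x y :: "'a fps"
    by (auto simp: frobexp_def intro!: freshmans_dream')
  show ?thesis
    using add[of "f - g" g] by simp
qed

lemma fps_frob_mult:
  assumes "frobexp TYPE('a::field) Q"
  shows "fps_frob Q (f * g :: 'a fps) = fps_frob Q f * fps_frob Q g"
  by (rule fps_ext) (simp add: fps_mult_nth frobexp_sum[OF assms] power_mult_distrib)

lemma fps_frob_diff:
  assumes "frobexp TYPE('a::field) Q"
  shows "fps_frob Q (f - g :: 'a fps) = fps_frob Q f - fps_frob Q g"
  by (rule fps_ext) (simp add: frobexp_diff[OF assms])

lemma fps_frob_sum:
  assumes "frobexp TYPE('a::field) Q"
  shows "fps_frob Q (\<Sum>i\<in>I. f i :: 'a fps) = (\<Sum>i\<in>I. fps_frob Q (f i))"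
  by (rule fps_ext) (simp add: fps_sum_nth frobexp_sum[OF assms])

lemma fps_frob_1 [simp]: "Q > 0 \<Longrightarrow> fps_frob Q 1 = (1 :: 'a::field fps)"
  by (rule fps_ext) (simp add: fps_one_nth)

lemma fps_frob_power:
  assumes "frobexp TYPE('a::field) Q"
  shows "fps_frob Q (f ^ n :: 'a fps) = fps_frob Q f ^ n"
  using frobexp_gt1[OF assms] by (induction n) (simp_all add: fps_frob_mult[OF assms])

lemma fps_frob_X [simp]: "Q > 0 \<Longrightarrow> fps_frob Q fps_X = (fps_X :: 'a::field fps)"
  by (rule fps_ext) (simp add: fps_X_nth)

lemma fps_frob_const [simp]: "Q > 0 \<Longrightarrow> fps_frob Q (fps_const c) = fps_const (c ^ Q :: 'a::field)"
  by (rule fps_ext) simp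

lemma fps_frob_fps_frob: "fps_frob P (fps_frob Q f) = fps_frob (Q * P) f"
  by (rule fps_ext) (simp add: power_mult)

lemma fps_frob_over: "subr S \<Longrightarrow> f \<in> fps_over S \<Longrightarrow> fps_frob Q f \<in> fps_over S"
  by (auto intro!: fps_overI subr_power intro: fps_overD)

section \<open>Absolute values on a subfield of the ambient field\<close>

locale valued_field =
  fixes K :: "'l::field set" and v :: "'l \<Rightarrow> real"
  assumes subr_K: "subr K" and inverse_K: "x \<in> K \<Longrightarrow> inverse x \<in> K"
    and absolute_value: "nonarch_absolute_value K v"
begin

lemma v_0 [simp]: "v 0 = 0"
  and v_pos: "x \<in> K \<Longrightarrow> x \<noteq> 0 \<Longrightarrow> v x > 0"
  and v_mult: "x \<in> K \<Longrightarrow> y \<in> K \<Longrightarrow> v (x * y) = v x * v y"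
  and v_add: "x \<in> K \<Longrightarrow> y \<in> K \<Longrightarrow> v (x + y) \<le> max (v x) (v y)"
  using absolute_value by (auto simp: nonarch_absolute_value_def)

lemmas K_closed [simp, intro] = subrD [OF subr_K] subr_power [OF subr_K] subr_sum [OF subr_K]

lemma v_nonneg: "x \<in> K \<Longrightarrow> v x \<ge> 0"
  using v_pos[of x] by (cases "x = 0") auto

lemma v_1 [simp]: "v 1 = 1"
  using v_mult[of 1 1] v_pos[of 1] by simp

lemma v_power: "x \<in> K \<Longrightarrow> v (x ^ n) = v x ^ n"
  by (induction n) (simp_all add: v_mult)

lemma v_minus [simp]: "x \<in> K \<Longrightarrow> v (- x) = v x"
proof -
  assume x: "x \<in> K"
  have "v (- 1) ^ 2 = 1"
    using v_power[of "-1" 2] by simp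
  then have "v (- 1) = 1"
    using v_nonneg[of "-1"] by (simp add: power2_eq_1_iff)
  then show ?thesis
    using v_mult[of "-1" x] x by simp
qed

lemma v_diff: "x \<in> K \<Longrightarrow> y \<in> K \<Longrightarrow> v (x - y) \<le> max (v x) (v y)"
  using v_add[of x "-y"] by simp

lemma v_sum:
  assumes "\<And>i. i \<in> I \<Longrightarrow> f i \<in> K" "\<And>i. i \<in> I \<Longrightarrow> v (f i) \<le> C" "C \<ge> 0"
  shows "v (sum f I) \<le> C"
  using assms
proof (induction I rule: infinite_finite_induct)
  case (insert i I)
  then show ?case
    using v_add[of "f i" "sum f I"] by force
qed simp_all

lemma v_add_eq:
  assumes "x \<in> K" "y \<in> K" "v x < v y"
  shows "v (x + y) = v y"
  using v_add[of x y] v_diff[of "x + y" x] assms by auto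

lemma v_inverse: "x \<in> K \<Longrightarrow> v (inverse x) = inverse (v x)"
  by (cases "x = 0") (use v_mult[of x "inverse x"] inverse_K v_pos[of x] in \<open>auto simp: field_simps\<close>)

abbreviation valR where "valR \<equiv> valuation_ring K v"

lemma R_K: "x \<in> valR \<Longrightarrow> x \<in> K" and R_v: "x \<in> valR \<Longrightarrow> v x \<le> 1"
  by (auto simp: valuation_ring_def)

lemma subr_R: "subr valR"
  unfolding subr_def
  using v_add v_nonneg by (auto simp: valuation_ring_def v_mult mult_le_one intro: order_trans [OF v_add])

end

abbreviation lin :: "'a::comm_ring_1 \<Rightarrow> 'a fps"
  where "lin \<alpha> \<equiv> fps_X - fps_const \<alpha>"

lemma lin_mult_nth_Suc: "fps_nth (lin \<alpha> * f) (Suc i) = fps_nth f i - \<alpha> * fps_nth f (Suc i)"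
  by (simp add: left_diff_distrib)

section \<open>Gauss norms and division by linear factors\<close>

context valued_field
begin

text \<open>For \<rho> > 0 this says that the Gauss norm of \<open>f\<close> on the disc |z| \<le>
  1/\<rho> is at most \<open>C\<close>. A smaller rate \<rho> means a larger disc, and
  \<open>growth 1 1\<close> is integrality.\<close>

definition growth :: "real \<Rightarrow> real \<Rightarrow> 'l fps \<Rightarrow> bool"
  where "growth \<rho> C f \<longleftrightarrow> f \<in> fps_over K \<and> (\<forall>i. v (fps_nth f i) \<le> C * \<rho> ^ i)"

text \<open>On a disc of radius 1/\<rho> \<le> 1 an integral series has Gauss norm at most 1, so
  multiplying by it costs nothing.\<close>

lemma growth_mult:
  assumes "growth \<rho> C f" "a \<in> fps_over valR" "\<rho> \<ge> 1" "C \<ge> 0"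
  shows "growth \<rho> C (a * f)"
  unfolding growth_def
proof (intro conjI allI)
  have aK: "a \<in> fps_over K"
    using assms(2) by (auto simp: fps_over_def valuation_ring_def)
  have fK: "f \<in> fps_over K"
    using assms(1) by (simp add: growth_def)
  then show "a * f \<in> fps_over K"
    using aK subrD(5)[OF subr_fps_over[OF subr_K]] by blast
  fix i
  show "v (fps_nth (a * f) i) \<le> C * \<rho> ^ i"
    unfolding fps_mult_nth
  proof (rule v_sum)
    fix j assume "j \<in> {0..i}"
    have *: "fps_nth a j \<in> K" "fps_nth f (i - j) \<in> K"
      using aK fK by (auto intro: fps_overD)
    then show "fps_nth a j * fps_nth f (i - j) \<in> K"
      by simp
    have "v (fps_nth a j * fps_nth f (i - j)) \<le> 1 * v (fps_nth f (i - j))"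
      unfolding v_mult[OF *] using R_v[OF fps_overD[OF assms(2)]] v_nonneg[OF *(2)]
      by (intro mult_right_mono) auto
    also have "\<dots> \<le> C * \<rho> ^ (i - j)"
      using assms(1) by (simp add: growth_def)
    also have "\<dots> \<le> C * \<rho> ^ i"
      using assms by (intro mult_left_mono power_increasing) auto
    finally show "v (fps_nth a j * fps_nth f (i - j)) \<le> C * \<rho> ^ i" .
  qed (use assms in auto)
qed

lemma growth_sum:
  assumes "\<And>a. a \<in> I \<Longrightarrow> growth \<rho> C (f a)" "\<rho> \<ge> 0" "C \<ge> 0"
  shows "growth \<rho> C (\<Sum>a\<in>I. f a)"
  using assms subr_sum[OF subr_fps_over[OF subr_K], of I f]
  unfolding growth_def by (auto simp: fps_sum_nth fps_overD intro!: v_sum)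

lemma growth_frob:
  assumes "growth \<rho> C f" "\<rho> \<ge> 0" "C \<ge> 0"
  shows "growth (\<rho> ^ Q) (C ^ Q) (fps_frob Q f)"
  unfolding growth_def
proof (intro conjI allI)
  show "fps_frob Q f \<in> fps_over K"
    using assms(1) fps_frob_over[OF subr_K] by (simp add: growth_def)
  fix i
  have fi: "fps_nth f i \<in> K" "v (fps_nth f i) \<le> C * \<rho> ^ i"
    using assms(1) by (auto simp: growth_def intro: fps_overD)
  have "v (fps_nth f i) ^ Q \<le> (C * \<rho> ^ i) ^ Q"
    using fi v_nonneg[OF fi(1)] by (intro power_mono) auto
  then show "v (fps_nth (fps_frob Q f) i) \<le> C ^ Q * (\<rho> ^ Q) ^ i"
    using fi by (simp add: v_power power_mult_distrib mult.commute flip: power_mult)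
qed

text \<open>Every improvement of the rate comes from here: a bound for the twist passes to
  \<open>f\<close> with \<rho> and \<open>C\<close> replaced by their Q-th roots.\<close>

lemma growth_unfrob:
  assumes "growth (\<rho> ^ Q) (C ^ Q) (fps_frob Q f)" "f \<in> fps_over K" "\<rho> \<ge> 0" "C \<ge> 0" "Q > 0"
  shows "growth \<rho> C f"
  unfolding growth_def
proof (intro conjI allI)
  fix i
  have fi: "fps_nth f i \<in> K"
    using assms(2) by (auto intro: fps_overD)
  have "v (fps_nth f i ^ Q) \<le> C ^ Q * (\<rho> ^ Q) ^ i"
    using assms(1) unfolding growth_def by simp
  also have "(\<rho> ^ Q) ^ i = (\<rho> ^ i) ^ Q"
    by (simp add: mult.commute flip: power_mult)
  finally have "v (fps_nth f i) ^ Q \<le> (C * \<rho> ^ i) ^ Q"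
    using fi by (simp add: v_power power_mult_distrib)
  then show "v (fps_nth f i) \<le> C * \<rho> ^ i"
    using assms by (simp add: power_mono_iff v_nonneg[OF fi])
qed fact

lemma lin_over: "\<alpha> \<in> valR \<Longrightarrow> lin \<alpha> \<in> fps_over valR"
  by (intro subrD(6)[OF subr_fps_over] fps_X_over fps_const_over subr_R)

text \<open>The a priori rate with |\<alpha>| \<rho>' < 1 says that \<open>f\<close> converges at
  \<alpha>; it excludes 1/(z - \<alpha>), whose rate is 1/|\<alpha>|. Then f_i is the sum over m of
  \<alpha>^m g_(i+m+1), where g = (z - \<alpha>) f, and the bound for g is inherited with one extra
  factor \<rho>.\<close>

lemma growth_divide_lin:
  assumes f: "growth \<rho>' C' f" and g: "growth \<rho> G (lin \<alpha> * f)"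
    and \<alpha>: "\<alpha> \<in> K" "v \<alpha> * \<rho> \<le> 1" "v \<alpha> * \<rho>' < 1" and nonneg: "\<rho> \<ge> 0" "\<rho>' \<ge> 0" "G \<ge> 0"
  shows "growth \<rho> (G * \<rho>) f"
  unfolding growth_def
proof (intro conjI allI)
  show "f \<in> fps_over K"
    using f by (simp add: growth_def)
  then have fK: "fps_nth f i \<in> K" for i
    by (rule fps_overD)
  have gK: "fps_nth (lin \<alpha> * f) i \<in> K" and gv: "v (fps_nth (lin \<alpha> * f) i) \<le> G * \<rho> ^ i" for i
    using g by (auto simp: growth_def intro: fps_overD)
  have v\<alpha>: "v \<alpha> \<ge> 0"
    using v_nonneg \<alpha> by blast
  fix i
  \<comment> \<open>The relation f_i = g_(i+1) + \<alpha> f_(i+1) is unrolled \<open>m\<close>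
    times; the terms in g stay bounded because |\<alpha>| \<rho> \<le> 1.\<close>
  have step: "v (fps_nth f i) \<le> max (G * \<rho> * \<rho> ^ i) (v \<alpha> ^ m * v (fps_nth f (i + m)))" for m
  proof (induction m)
    case (Suc m)
    have "fps_nth f (i + m) = fps_nth (lin \<alpha> * f) (Suc (i + m)) + \<alpha> * fps_nth f (Suc (i + m))"
      unfolding lin_mult_nth_Suc by simp
    then have "v (fps_nth f (i + m)) \<le> max (G * \<rho> ^ Suc (i + m)) (v \<alpha> * v (fps_nth f (Suc (i + m))))"
      using v_add[of "fps_nth (lin \<alpha> * f) (Suc (i + m))" "\<alpha> * fps_nth f (Suc (i + m))"]
        gK gv[of "Suc (i + m)"] fK \<alpha>(1) v_mult[of \<alpha> "fps_nth f (Suc (i + m))"]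
      by fastforce
    then have "v \<alpha> ^ m * v (fps_nth f (i + m)) \<le>
        v \<alpha> ^ m * max (G * \<rho> ^ Suc (i + m)) (v \<alpha> * v (fps_nth f (Suc (i + m))))"
      using v\<alpha> by (intro mult_left_mono) auto
    also have "\<dots> = max (v \<alpha> ^ m * (G * \<rho> ^ Suc (i + m))) (v \<alpha> ^ m * (v \<alpha> * v (fps_nth f (Suc (i + m)))))"
      using v\<alpha> by (auto simp: max_mult_distrib_left)
    also have "v \<alpha> ^ m * (G * \<rho> ^ Suc (i + m)) = (v \<alpha> * \<rho>) ^ m * (G * \<rho> * \<rho> ^ i)"
      by (simp add: power_add power_mult_distrib)
    finally have "v \<alpha> ^ m * v (fps_nth f (i + m)) \<le>
        max ((v \<alpha> * \<rho>) ^ m * (G * \<rho> * \<rho> ^ i)) (v \<alpha> ^ Suc m * v (fps_nth f (i + Suc m)))"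
      by (simp add: mult_ac)
    moreover have "(v \<alpha> * \<rho>) ^ m * (G * \<rho> * \<rho> ^ i) \<le> 1 * (G * \<rho> * \<rho> ^ i)"
      using \<alpha> v\<alpha> nonneg by (intro mult_right_mono power_le_one) auto
    ultimately show ?case
      using Suc.IH by linarith
  qed simp
  have "(\<lambda>m. (v \<alpha> * \<rho>') ^ m * (C' * \<rho>' ^ i)) \<longlonglongrightarrow> 0 * (C' * \<rho>' ^ i)"
    using \<alpha> v\<alpha> nonneg by (intro tendsto_mult LIMSEQ_realpow_zero tendsto_const) auto
  then have lim: "(\<lambda>m. (v \<alpha> * \<rho>') ^ m * (C' * \<rho>' ^ i)) \<longlonglongrightarrow> 0"
    by simp
  have le: "v \<alpha> ^ m * v (fps_nth f (i + m)) \<le> (v \<alpha> * \<rho>') ^ m * (C' * \<rho>' ^ i)" for m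
  proof -
    have "v \<alpha> ^ m * v (fps_nth f (i + m)) \<le> v \<alpha> ^ m * (C' * \<rho>' ^ (i + m))"
      using v\<alpha> f by (intro mult_left_mono) (auto simp: growth_def)
    then show ?thesis
      by (simp add: power_add power_mult_distrib mult_ac)
  qed
  \<comment> \<open>If the bound failed, the remainder would have to dominate for every
    \<open>m\<close>, although it tends to 0.\<close>
  show "v (fps_nth f i) \<le> G * \<rho> * \<rho> ^ i"
  proof (rule ccontr)
    assume *: "\<not> ?thesis"
    then have "v (fps_nth f i) \<le> (v \<alpha> * \<rho>') ^ m * (C' * \<rho>' ^ i)" for m
      using step[of m] le[of m] by linarith
    then have "v (fps_nth f i) \<le> 0"
      using lim by (intro LIMSEQ_le_const) auto
    moreover have "G * \<rho> * \<rho> ^ i \<ge> 0"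
      using nonneg by simp
    ultimately show False
      using * by linarith
  qed
qed

lemma growth_divide_lin_power:
  assumes "growth \<rho>' C' f" "growth \<rho> G (lin \<alpha> ^ n * f)"
    and "\<alpha> \<in> valR" "v \<alpha> * \<rho> \<le> 1" "v \<alpha> * \<rho>' < 1" and "\<rho> \<ge> 0" "\<rho>' \<ge> 1" "G \<ge> 0" "C' \<ge> 0"
  shows "growth \<rho> (G * \<rho> ^ n) f"
  using assms(2,8)
proof (induction n arbitrary: G)
  case (Suc n)
  have "growth \<rho>' C' (lin \<alpha> ^ n * f)"
    using assms by (intro growth_mult subr_power[OF subr_fps_over[OF subr_R]] lin_over) auto
  moreover have "growth \<rho> G (lin \<alpha> * (lin \<alpha> ^ n * f))"
    using Suc.prems by (simp add: mult.assoc)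
  ultimately have "growth \<rho> (G * \<rho>) (lin \<alpha> ^ n * f)"
    using assms Suc.prems by (intro growth_divide_lin[of \<rho>' C']) (auto intro: R_K)
  then have "growth \<rho> (G * \<rho> * \<rho> ^ n) f"
    using Suc.prems assms by (intro Suc.IH) auto
  then show ?case
    by (simp add: mult_ac)
qed simp

text \<open>Multiplication by the remaining factors keeps the a priori rate of \<open>f\<close>, so
  the roots can be divided out one after the other.\<close>

lemma growth_divide_prod:
  assumes "growth \<rho>' C' f" "growth \<rho> G ((\<Prod>j\<in>J. lin (\<alpha> j) ^ n) * f)" "finite J"
    and "\<And>j. j \<in> J \<Longrightarrow> \<alpha> j \<in> valR" "\<And>j. j \<in> J \<Longrightarrow> v (\<alpha> j) * \<rho> \<le> 1" "\<And>j. j \<in> J \<Longrightarrow> v (\<alpha> j) * \<rho>' < 1"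
    and "\<rho> \<ge> 0" "\<rho>' \<ge> 1" "G \<ge> 0" "C' \<ge> 0"
  shows "\<exists>G'\<ge>0. growth \<rho> G' f"
  using assms(3,2,4,5,6,9)
proof (induction J arbitrary: G rule: finite_induct)
  case (insert j J)
  have "growth \<rho>' C' ((\<Prod>j\<in>J. lin (\<alpha> j) ^ n) * f)"
    using assms insert.prems
    by (intro growth_mult subr_prod[OF subr_fps_over[OF subr_R]]
        subr_power[OF subr_fps_over[OF subr_R]] lin_over) auto
  moreover have "growth \<rho> G (lin (\<alpha> j) ^ n * ((\<Prod>j\<in>J. lin (\<alpha> j) ^ n) * f))"
    using insert by (simp add: mult.assoc)
  ultimately have "growth \<rho> (G * \<rho> ^ n) ((\<Prod>j\<in>J. lin (\<alpha> j) ^ n) * f)"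
    using assms insert.prems by (intro growth_divide_lin_power[of \<rho>' C']) auto
  then show ?case
    using insert.prems assms by (intro insert.IH[of "G * \<rho> ^ n"]) auto
qed auto

text \<open>The recurrence is used in the other direction, \<zeta> f_(j+1) = f_j - g_(j+1). This
  requires no convergence at \<zeta>, but is tied to the rate 1/|\<zeta>| and costs a factor
  1/|\<zeta>| for each division. Only coefficients up to \<open>i\<close> are involved, as an
  induction on \<open>i\<close> demands.\<close>

lemma bound_divide_lin:
  assumes f: "f \<in> fps_over K" and \<zeta>: "\<zeta> \<in> K" "\<zeta> \<noteq> 0" "v \<zeta> \<le> 1"
    and g: "\<forall>j\<le>i. v (fps_nth (lin \<zeta> ^ n * f) j) \<le> G * (1 / v \<zeta>) ^ j" and "G \<ge> 0"
  shows "\<forall>j\<le>i. v (fps_nth f j) \<le> (1 / v \<zeta>) ^ n * G * (1 / v \<zeta>) ^ j"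
  using g \<open>G \<ge> 0\<close>
proof (induction n arbitrary: G)
  case (Suc n)
  define h where "h = lin \<zeta> ^ n * f"
  have "\<zeta> \<in> valR"
    using \<zeta> by (auto simp: valuation_ring_def)
  have "lin \<zeta> \<in> fps_over K"
    by (intro subrD(6)[OF subr_fps_over] fps_X_over fps_const_over subr_K \<zeta>)
  then have "h \<in> fps_over K"
    unfolding h_def using f subr_fps_over[OF subr_K] by (intro subrD(5) subr_power)
  then have hK: "fps_nth h j \<in> K" for j
    by (rule fps_overD)
  have v\<zeta>: "v \<zeta> > 0"
    using v_pos \<zeta> by blast
  have g: "v (fps_nth (lin \<zeta> * h) j) \<le> G * (1 / v \<zeta>) ^ j" if "j \<le> i" for j
    using Suc.prems(1) that by (simp add: h_def mult.assoc)
  have "v (fps_nth h j) \<le> (1 / v \<zeta> * G) * (1 / v \<zeta>) ^ j" if "j \<le> i" for j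
    using that
  proof (induction j)
    case 0
    have "v \<zeta> * v (fps_nth h 0) \<le> G"
      using g[OF 0] hK \<zeta> by (simp add: v_mult)
    then show ?case
      using v\<zeta> by (simp add: field_simps)
  next
    case (Suc j)
    have "\<zeta> * fps_nth h (Suc j) = fps_nth h j - fps_nth (lin \<zeta> * h) (Suc j)"
      unfolding lin_mult_nth_Suc by simp
    then have "v \<zeta> * v (fps_nth h (Suc j)) = v (fps_nth h j - fps_nth (lin \<zeta> * h) (Suc j))"
      using hK \<zeta> by (simp flip: v_mult)
    also have "\<dots> \<le> max (v (fps_nth h j)) (v (fps_nth (lin \<zeta> * h) (Suc j)))"
      using hK \<zeta> by (intro v_diff) (auto simp: lin_mult_nth_Suc)
    also have "\<dots> \<le> G * (1 / v \<zeta>) ^ Suc j"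
      using g[OF Suc.prems] Suc.IH Suc.prems by (simp add: mult_ac)
    finally show ?case
      using v\<zeta> by (simp add: field_simps)
  qed
  then have "\<forall>j\<le>i. v (fps_nth f j) \<le> (1 / v \<zeta>) ^ n * (1 / v \<zeta> * G) * (1 / v \<zeta>) ^ j"
    using Suc.prems v\<zeta> by (intro Suc.IH) (auto simp: h_def)
  then show ?case
    by (simp add: mult_ac)
qed simp

end

text \<open>Vector form of the equation: \<open>I\<close> indexes the entries of the matrix H, the
  exponent \<open>n\<close> clears the denominators in z - \<zeta>, and \<open>A\<close> and
  \<open>A'\<close> come from solving the equation for \<sigma>(H) and for H.\<close>

locale frob_system = valued_field K v
  for K :: "'l::field set" and v +
  fixes q n :: nat and \<zeta> :: 'l and I :: "'i set" and h :: "'i \<Rightarrow> 'l fps" and A A' :: "'i \<Rightarrow> 'i \<Rightarrow> 'l fps"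
  assumes frobexp: "frobexp TYPE('l) q"
    and \<zeta>: "\<zeta> \<in> K" "\<zeta> \<noteq> 0" "v \<zeta> < 1"
    and finite_I: "finite I"
    and h_K: "a \<in> I \<Longrightarrow> h a \<in> fps_over K"
    and A_R: "a \<in> I \<Longrightarrow> b \<in> I \<Longrightarrow> A a b \<in> fps_over valR" "a \<in> I \<Longrightarrow> b \<in> I \<Longrightarrow> A' a b \<in> fps_over valR"
    and frob_h: "a \<in> I \<Longrightarrow> lin \<zeta> ^ n * fps_frob q (h a) = (\<Sum>b\<in>I. A a b * h b)"
    and h_frob: "a \<in> I \<Longrightarrow> lin \<zeta> ^ n * h a = (\<Sum>b\<in>I. A' a b * fps_frob q (h b))"
begin

definition "\<Lambda> = 1 / v \<zeta>"

lemma q1: "q > 1"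
  using frobexp frobexp_gt1 by blast

lemma v\<zeta>: "v \<zeta> > 0"
  using v_pos \<zeta> by blast

lemma \<Lambda>1: "\<Lambda> > 1"
  using \<zeta> v\<zeta> by (simp add: \<Lambda>_def)

lemma \<zeta>_R: "\<zeta> \<in> valR"
  using \<zeta> by (simp add: valuation_ring_def)

text \<open>The threshold rate: a series of rate \<rho>0 has a twist of rate \<Lambda>, which is
  guaranteed to converge only for |z| < |\<zeta>|.\<close>

definition "\<rho>0 = root q \<Lambda>"

lemma \<rho>0_q: "\<rho>0 ^ q = \<Lambda>"
  using q1 \<Lambda>1 by (simp add: \<rho>0_def real_root_pow_pos2)

lemma \<rho>0_1: "\<rho>0 > 1"
  using q1 \<Lambda>1 by (simp add: \<rho>0_def)

lemma \<rho>0_less: "\<rho>0 < \<Lambda>"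
  using power_strict_increasing[of 1 q \<rho>0] \<rho>0_1 \<rho>0_q q1 by simp

lemma growth_comb:
  assumes "\<And>b. b \<in> I \<Longrightarrow> growth \<rho> C (f b)" "\<And>b. b \<in> I \<Longrightarrow> B b \<in> fps_over valR" "\<rho> \<ge> 1" "C \<ge> 0"
  shows "growth \<rho> C (\<Sum>b\<in>I. B b * f b)"
  using assms by (intro growth_sum growth_mult) auto

text \<open>One side of the equation has degree q in \<open>h\<close>, the other is linear. If the
  largest i-th coefficient x exceeds the claim, the linear side is bounded at rate \<Lambda> with
  constant max(\<Lambda>^n, x/\<Lambda>^i), and removing (z - \<zeta>)^n from the other side costs
  \<Lambda>^n. Hence x^q \<le> \<Lambda>^n max(\<Lambda>^(n+i), x), which contradicts x >
  \<Lambda>^n \<rho>0^i in both cases, as q \<ge> 2.\<close>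

lemma initial_growth:
  assumes "a \<in> I"
  shows "growth \<rho>0 (\<Lambda> ^ n) (h a)"
proof -
  have "v (fps_nth (h a) i) \<le> \<Lambda> ^ n * \<rho>0 ^ i" if "a \<in> I" for i a
    using that
  proof (induction i arbitrary: a rule: less_induct)
    case (less i)
    define x where "x = Max ((\<lambda>b. v (fps_nth (h b) i)) ` I)"
    have "x \<in> (\<lambda>b. v (fps_nth (h b) i)) ` I"
      unfolding x_def using finite_I less.prems by (intro Max_in) auto
    then obtain b where b: "b \<in> I" "x = v (fps_nth (h b) i)"
      by blast
    have x_ge: "v (fps_nth (h c) i) \<le> x" if "c \<in> I" for c
      unfolding x_def using finite_I that by (intro Max_ge) auto
    have hK: "fps_nth (h c) j \<in> K" if "c \<in> I" for c j
      using h_K[OF that] by (rule fps_overD)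
    have C1: "\<Lambda> ^ n \<ge> 1"
      using \<Lambda>1 by simp
    have "x \<le> \<Lambda> ^ n * \<rho>0 ^ i"
    proof (rule ccontr)
      assume "\<not> ?thesis"
      then have x: "x > \<Lambda> ^ n * \<rho>0 ^ i"
        by simp
      \<comment> \<open>Chosen so that the rate \<Lambda> covers both the inductive bound below
        \<open>i\<close> and the value \<open>x\<close> at \<open>i\<close>.\<close>
      define G where "G = max (\<Lambda> ^ n) (x / \<Lambda> ^ i)"
      have GC: "G \<ge> \<Lambda> ^ n"
        by (simp add: G_def)
      then have G0: "G \<ge> 0"
        using C1 by linarith
      have hb: "v (fps_nth (h c) j) \<le> G * \<Lambda> ^ j" if "c \<in> I" "j < i" for c j
      proof -
        have "v (fps_nth (h c) j) \<le> \<Lambda> ^ n * \<rho>0 ^ j"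
          using less.IH that by blast
        also have "\<dots> \<le> G * \<Lambda> ^ j"
          using \<rho>0_1 \<rho>0_less GC G0 by (intro mult_mono power_mono) auto
        finally show ?thesis .
      qed
      have hb': "v (fps_nth (h c) j) \<le> (if j < i then G * \<Lambda> ^ j else x)" if "c \<in> I" "j \<le> i" for c j
        using hb[OF that(1), of j] x_ge[OF that(1)] that by auto
      have Gx: "x \<le> G * \<Lambda> ^ i"
      proof -
        have "x / \<Lambda> ^ i * \<Lambda> ^ i \<le> G * \<Lambda> ^ i"
          using \<Lambda>1 by (intro mult_right_mono) (auto simp: G_def)
        then show ?thesis
          using \<Lambda>1 by simp
      qed
      have hG: "v (fps_nth (h c) j) \<le> G * \<Lambda> ^ j" if "c \<in> I" "j \<le> i" for c j
        using hb[OF that(1), of j] x_ge[OF that(1)] that Gx by (cases "j = i") auto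
      have "\<forall>j\<le>i. v (fps_nth (lin \<zeta> ^ n * fps_frob q (h b)) j) \<le> G * \<Lambda> ^ j"
      proof (intro allI impI)
        fix j assume j: "j \<le> i"
        have AhK: "fps_nth (A b c) k * fps_nth (h c) m \<in> K" if "c \<in> I" for c k m
          using fps_overD[OF A_R(1)[OF b(1) that], of k] hK[OF that] by (auto intro: R_K)
        show "v (fps_nth (lin \<zeta> ^ n * fps_frob q (h b)) j) \<le> G * \<Lambda> ^ j"
          unfolding frob_h[OF b(1)] fps_sum_nth fps_mult_nth
        proof (intro v_sum subr_sum[OF subr_K])
          fix c k assume c: "c \<in> I" and k: "k \<in> {0..j}"
          have AK: "fps_nth (A b c) k \<in> K" "v (fps_nth (A b c) k) \<le> 1"
            using A_R(1)[OF b(1) c] by (auto dest!: fps_overD[of _ _ k] intro: R_K R_v)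
          have "v (fps_nth (A b c) k * fps_nth (h c) (j - k)) \<le> 1 * v (fps_nth (h c) (j - k))"
            unfolding v_mult[OF AK(1) hK[OF c]]
            using AK v_nonneg[OF hK[OF c]] by (intro mult_right_mono) auto
          also have "\<dots> \<le> G * \<Lambda> ^ (j - k)"
            using hG[OF c, of "j - k"] j by simp
          also have "\<dots> \<le> G * \<Lambda> ^ j"
            using \<Lambda>1 G0 by (intro mult_left_mono power_increasing) auto
          finally show "v (fps_nth (A b c) k * fps_nth (h c) (j - k)) \<le> G * \<Lambda> ^ j" .
        qed (use G0 \<Lambda>1 AhK in auto)
      qed
      then have "v (fps_nth (fps_frob q (h b)) i) \<le> \<Lambda> ^ n * G * \<Lambda> ^ i"
        using bound_divide_lin[of "fps_frob q (h b)" \<zeta> i n G] fps_frob_over[OF subr_K h_K[OF b(1)]] \<zeta> G0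
        by (auto simp: \<Lambda>_def)
      then have "x ^ q \<le> \<Lambda> ^ n * (G * \<Lambda> ^ i)"
        using hK[OF b(1)] b(2) by (simp add: v_power mult.assoc)
      also have "G * \<Lambda> ^ i = max (\<Lambda> ^ n * \<Lambda> ^ i) x"
        using \<Lambda>1 by (simp add: G_def max_mult_distrib_right)
      finally have xq: "x ^ q \<le> \<Lambda> ^ n * max (\<Lambda> ^ n * \<Lambda> ^ i) x" .
      have \<rho>i: "\<rho>0 ^ i \<ge> 1"
        using \<rho>0_1 by simp
      have xC: "x > \<Lambda> ^ n"
        using x mult_left_mono[OF \<rho>i, of "\<Lambda> ^ n"] C1 by linarith
      show False
      proof (cases "\<Lambda> ^ n * \<Lambda> ^ i \<le> x")
        case True
        have "x * x \<le> x ^ q"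
          using power_increasing[of 2 q x] q1 xC C1 by (simp add: power2_eq_square)
        also have "\<dots> \<le> \<Lambda> ^ n * x"
          using xq True by (simp add: max_def split: if_splits)
        finally show False
          using xC C1 by simp
      next
        case False
        have "(\<Lambda> ^ n * \<rho>0 ^ i) ^ q < x ^ q"
          using x q1 \<Lambda>1 \<rho>0_1 by (intro power_strict_mono) auto
        also have "\<dots> \<le> \<Lambda> ^ n * (\<Lambda> ^ n * \<Lambda> ^ i)"
          using xq False by (simp add: max_def)
        also have "\<dots> = (\<Lambda> ^ n) ^ 2 * \<Lambda> ^ i"
          by (simp add: power2_eq_square)
        also have "\<dots> \<le> (\<Lambda> ^ n) ^ q * \<Lambda> ^ i"
          using q1 C1 \<Lambda>1 by (intro mult_right_mono power_increasing) auto
        also have "\<Lambda> ^ i = (\<rho>0 ^ i) ^ q"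
          by (simp add: mult.commute flip: \<rho>0_q power_mult)
        finally show False
          by (simp add: power_mult_distrib)
      qed
    qed
    then show ?case
      using x_ge[OF less.prems] by linarith
  qed
  then show ?thesis
    using assms h_K by (auto simp: growth_def)
qed

text \<open>The condition \<rho>^q < \<Lambda> makes \<sigma>(h) converge at \<zeta>, so z - \<zeta>
  can be divided out of (z - \<zeta>)^n \<sigma>(h) = A h. The twist then has the rate \<rho> of
  \<open>h\<close> itself instead of \<rho>^q, and \<open>h\<close> has the q-th root of \<rho> as
  its rate.\<close>

lemma growth_step:
  assumes "\<And>b. b \<in> I \<Longrightarrow> growth \<rho> C (h b)" "\<rho> > 1" "\<rho> ^ q < \<Lambda>" "C > 0" "a \<in> I"
  shows "growth (root q \<rho>) (root q (C * \<rho> ^ n)) (h a)"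
proof -
  have v\<rho>: "v \<zeta> * \<rho> ^ q < 1"
    using assms(3) v\<zeta> by (simp add: \<Lambda>_def pos_less_divide_eq mult.commute)
  have "\<rho> \<le> \<rho> ^ q"
    using assms(2) q1 power_increasing[of 1 q \<rho>] by simp
  then have v\<rho>': "v \<zeta> * \<rho> \<le> 1"
    using v\<rho> v\<zeta> mult_left_mono[of \<rho> "\<rho> ^ q" "v \<zeta>"] by linarith
  have "growth \<rho> C (lin \<zeta> ^ n * fps_frob q (h a))"
    unfolding frob_h[OF assms(5)] using assms A_R by (intro growth_comb) auto
  moreover have "growth (\<rho> ^ q) (C ^ q) (fps_frob q (h a))"
    using assms by (intro growth_frob) auto
  ultimately have "growth \<rho> (C * \<rho> ^ n) (fps_frob q (h a))"
    using assms \<zeta>_R v\<rho> v\<rho>' by (intro growth_divide_lin_power[where \<rho>' = "\<rho> ^ q" and C' = "C ^ q" and \<alpha> = \<zeta>]) auto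
  moreover have "root q \<rho> ^ q = \<rho>" "root q (C * \<rho> ^ n) ^ q = C * \<rho> ^ n"
    using assms(2,4) q1 by (auto intro!: real_root_pow_pos2)
  ultimately have "growth (root q \<rho> ^ q) (root q (C * \<rho> ^ n) ^ q) (fps_frob q (h a))"
    by (simp only:)
  then show ?thesis
    using assms(2,4,5) q1 by - (rule growth_unfrob[of _ q], auto simp: h_K)
qed

text \<open>With \<rho> = exp s and C = exp c, the rate after \<open>k\<close> steps is exp(s/q^k)
  and the constant is exp((c + n k s)/q^k). Both tend to 1, so every coefficient has absolute value
  at most 1.\<close>

lemma growth_iterate:
  assumes "\<And>b. b \<in> I \<Longrightarrow> growth \<rho> C (h b)" "\<rho> > 1" "\<rho> ^ q < \<Lambda>" "C > 0" "a \<in> I"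
  shows "h a \<in> fps_over valR"
proof -
  define s where "s = ln \<rho>"
  define c where "c = ln C"
  have s0: "s > 0" and \<rho>: "\<rho> = exp s" and C: "C = exp c"
    using assms by (auto simp: s_def c_def)
  have root_exp: "root q (exp x) = exp (x / q)" for x :: real
    using q1 by (intro real_root_pos_unique) (auto simp flip: exp_of_nat_mult)
  have it: "growth (exp (s / q ^ k)) (exp ((c + n * k * s) / q ^ k)) (h b)" if "b \<in> I" for b k
    using that
  proof (induction k arbitrary: b)
    case 0
    then show ?case
      using assms by (simp add: \<rho> C)
  next
    case (Suc k)
    have "s / q ^ k \<le> s / 1"
      using s0 q1 by (intro divide_left_mono) auto
    then have "exp (s / q ^ k) ^ q \<le> exp s ^ q"
      by (intro power_mono) auto
    then have "exp (s / q ^ k) ^ q < \<Lambda>"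
      using assms(3) unfolding \<rho> by linarith
    then have "growth (root q (exp (s / q ^ k)))
        (root q (exp ((c + n * k * s) / q ^ k) * exp (s / q ^ k) ^ n)) (h b)"
      using Suc s0 q1 by (intro growth_step) auto
    moreover have "exp ((c + n * k * s) / q ^ k) * exp (s / q ^ k) ^ n = exp ((c + n * Suc k * s) / q ^ k)"
      by (simp add: exp_add [symmetric] exp_of_nat_mult [symmetric] add_divide_distrib [symmetric] algebra_simps)
    ultimately show ?case
      by (simp add: root_exp mult.commute)
  qed
  have "v (fps_nth (h a) i) \<le> 1" for i
  proof -
    have le: "v (fps_nth (h a) i) \<le> exp ((c + n * k * s + i * s) / q ^ k)" for k
    proof -
      have "v (fps_nth (h a) i) \<le> exp ((c + n * k * s) / q ^ k) * exp (s / q ^ k) ^ i"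
        using it[OF assms(5), of k] by (auto simp: growth_def)
      also have "\<dots> = exp ((c + n * k * s) / q ^ k + i * (s / q ^ k))"
        by (simp only: exp_add exp_of_nat_mult)
      finally show ?thesis
        by (simp add: add_divide_distrib)
    qed
    have "norm (1 / real q) < 1"
      using q1 by simp
    then have "(\<lambda>k. (c + i * s) * (1 / real q) ^ k + n * s * (real k * (1 / real q) ^ k)) \<longlonglongrightarrow>
        (c + i * s) * 0 + n * s * 0"
      by (intro tendsto_add tendsto_mult tendsto_const LIMSEQ_power_zero powser_times_n_limit_0)
    moreover have "(c + i * s) * (1 / real q) ^ k + n * s * (real k * (1 / real q) ^ k) =
        (c + n * k * s + i * s) / q ^ k" for k
      using q1 by (simp add: field_simps)
    ultimately have "(\<lambda>k. (c + n * k * s + i * s) / q ^ k) \<longlonglongrightarrow> 0"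
      by simp
    then have "(\<lambda>k. exp ((c + n * k * s + i * s) / q ^ k)) \<longlonglongrightarrow> exp 0"
      by (intro tendsto_exp)
    then show ?thesis
      using le by (intro LIMSEQ_le_const[of _ 1]) auto
  qed
  then show ?thesis
    using h_K[OF assms(5)] by (auto simp: fps_over_def valuation_ring_def)
qed

end

lemma fps_frob_exp_1 [simp]: "fps_frob (Suc 0) f = f"
  by (rule fps_ext) simp

lemma fps_frob_power_mult:
  assumes "frobexp TYPE('a::field) q"
  shows "fps_frob (q ^ j) (f * g :: 'a fps) = fps_frob (q ^ j) f * fps_frob (q ^ j) g"
proof (cases "j = 0")
  case True
  then show ?thesis
    by simp
next
  case False
  then show ?thesis
    by (intro fps_frob_mult frobexp_power assms) simp
qed

lemma fps_frob_power_sum: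
  assumes "frobexp TYPE('a::field) q"
  shows "fps_frob (q ^ j) (\<Sum>i\<in>I. f i :: 'a fps) = (\<Sum>i\<in>I. fps_frob (q ^ j) (f i))"
proof (cases "j = 0")
  case True
  then show ?thesis
    by simp
next
  case False
  then show ?thesis
    by (intro fps_frob_sum frobexp_power assms) simp
qed

lemma fps_frob_power_lin:
  assumes "frobexp TYPE('a::field) q"
  shows "fps_frob (q ^ j) (lin \<alpha> ^ n :: 'a fps) = lin (\<alpha> ^ (q ^ j)) ^ n"
proof (cases "j = 0")
  case True
  then show ?thesis
    by simp
next
  case False
  then have *: "frobexp TYPE('a) (q ^ j)"
    by (intro frobexp_power assms) simp
  show ?thesis
    using frobexp_gt1[OF assms] by (simp add: fps_frob_power[OF *] fps_frob_diff[OF *])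
qed

section \<open>Iterated twists and the exclusion of the pole at \<zeta>\<close>

context frob_system
begin

text \<open>The j-th twist of z - \<zeta>; its root moves towards 0 as \<open>j\<close>
  grows.\<close>

abbreviation "Et j \<equiv> lin (\<zeta> ^ (q ^ j))"

abbreviation "Fr j a \<equiv> fps_frob (q ^ j) (h a)"

lemma Et_R: "Et j \<in> fps_over valR"
  by (intro lin_over subr_power subr_R \<zeta>_R)

lemma frob_Fr:
  assumes "a \<in> I"
  shows "Et j ^ n * Fr (Suc j) a = (\<Sum>b\<in>I. fps_frob (q ^ j) (A a b) * Fr j b)"
  using arg_cong[OF frob_h[OF assms], of "fps_frob (q ^ j)"]
  by (simp add: fps_frob_power_mult[OF frobexp] fps_frob_power_lin[OF frobexp]
      fps_frob_power_sum[OF frobexp] fps_frob_fps_frob)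

lemma Fr_frob:
  assumes "a \<in> I"
  shows "Et j ^ n * Fr j a = (\<Sum>b\<in>I. fps_frob (q ^ j) (A' a b) * Fr (Suc j) b)"
  using arg_cong[OF h_frob[OF assms], of "fps_frob (q ^ j)"]
  by (simp add: fps_frob_power_mult[OF frobexp] fps_frob_power_lin[OF frobexp]
      fps_frob_power_sum[OF frobexp] fps_frob_fps_frob)

text \<open>The twisted equations of index below \<open>k\<close> express the product through the
  untwisted \<open>h\<close> with integral coefficients. So the rate stays \<rho>, whereas the k-th
  twist alone is only known to have rate \<rho>^(q^k).\<close>

lemma growth_up:
  assumes "\<And>b. b \<in> I \<Longrightarrow> growth \<rho> C (h b)" "\<rho> \<ge> 1" "C \<ge> 0" "a \<in> I"
  shows "growth \<rho> C ((\<Prod>j<k. Et j ^ n) * Fr k a)"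
  using assms(4)
proof (induction k arbitrary: a)
  case 0
  then show ?case
    using assms by simp
next
  case (Suc k)
  have "(\<Prod>j<Suc k. Et j ^ n) * Fr (Suc k) a = (\<Prod>j<k. Et j ^ n) * (Et k ^ n * Fr (Suc k) a)"
    by (simp add: mult.assoc)
  also have "\<dots> = (\<Sum>b\<in>I. fps_frob (q ^ k) (A a b) * ((\<Prod>j<k. Et j ^ n) * Fr k b))"
    unfolding frob_Fr[OF Suc.prems] by (simp add: sum_distrib_left mult_ac)
  finally show ?case
    using Suc assms by (auto intro!: growth_comb fps_frob_over subr_R A_R)
qed

text \<open>Each twisted equation, solved for its lower twist, contributes the factor of its own
  index. A descent to i = 1 therefore does not bring in z - \<zeta>, which has index 0.\<close>

lemma growth_down:
  assumes "\<And>b. b \<in> I \<Longrightarrow> growth \<rho> C (P * Fr k b)" "\<rho> \<ge> 1" "C \<ge> 0" "a \<in> I" "i \<le> k"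
  shows "growth \<rho> C (P * (\<Prod>j\<in>{i..<k}. Et j ^ n) * Fr i a)"
  using assms(5,4)
proof (induction i arbitrary: a rule: inc_induct)
  case base
  then show ?case
    using assms by simp
next
  case (step i)
  have "P * (\<Prod>j\<in>{i..<k}. Et j ^ n) * Fr i a = P * (\<Prod>j\<in>{Suc i..<k}. Et j ^ n) * (Et i ^ n * Fr i a)"
    using step.hyps by (simp add: prod.atLeast_Suc_lessThan mult_ac)
  also have "\<dots> = (\<Sum>b\<in>I. fps_frob (q ^ i) (A' a b) * (P * (\<Prod>j\<in>{Suc i..<k}. Et j ^ n) * Fr (Suc i) b))"
    unfolding Fr_frob[OF step.prems] by (simp add: sum_distrib_left mult_ac)
  finally show ?case
    using step assms by (auto intro!: growth_comb fps_frob_over subr_R A_R)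
qed

text \<open>A pole of \<open>h\<close> at a \<open>q\<^sup>k\<close>-th root of \<open>\<zeta>\<close> would give a pole of its \<open>k\<close>-th Frobenius twist
  at \<open>\<zeta>\<close>; after clearing the other poles the coefficients of that twist are still \<open>q\<^sup>k\<close>-th powers,
  which contradicts the growth by \<open>v \<zeta> ^ n\<close> of the coefficients over \<open>n\<close> steps.\<close>

lemma growth_twist:
  assumes disc: "discretely_valued K v" and n: "n = q ^ m" "m > 0"
  obtains k where "k > 0"
    "\<And>a. a \<in> I \<Longrightarrow> growth \<rho>0 (\<Lambda> ^ n * \<rho>0 ^ n) ((\<Prod>j\<in>{1..<k}. Et j) ^ (q ^ k) * Fr k a)"
proof -
  obtain \<pi> where \<pi>: "\<pi> \<in> K" "0 < v \<pi>" "v \<pi> < 1" and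
    val: "\<And>x. x \<in> K \<Longrightarrow> x \<noteq> 0 \<Longrightarrow> \<exists>n::int. v x = v \<pi> powi n"
    using disc by (auto simp: discretely_valued_def)
  have powi_inj: "i = j" if "v \<pi> powi i = v \<pi> powi j" for i j :: int
    using that \<pi> power_int_strict_decreasing[of i j "v \<pi>"] power_int_strict_decreasing[of j i "v \<pi>"]
    by (cases i j rule: linorder_cases) auto
  obtain c :: int where c: "v \<zeta> = v \<pi> powi c"
    using val \<zeta> by blast
  have c0: "c > 0"
  proof (rule ccontr)
    assume "\<not> c > 0"
    then have "v \<pi> powi c \<ge> v \<pi> powi 0"
      using \<pi> by (intro power_int_decreasing) auto
    then show False
      using \<zeta> c by simp
  qed
  have n0: "n > 0"
    using n q1 by simp
  \<comment> \<open>With |\<zeta>| = |\<pi>|^c this is the valuation of \<zeta>^n. Since Q = q^k > k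
    > 0, it is not divisible by Q.\<close>
  define k where "k = nat c * n"
  have k0: "k > 0"
    using c0 n0 by (simp add: k_def)
  define Q where "Q = q ^ k"
  have Qk: "Q > k"
    unfolding Q_def using q1 by (intro power_gt_expt) simp
  have nk: "n \<le> k"
    using c0 mult_le_mono1[of 1 "nat c" n] by (simp add: k_def Suc_le_eq)
  have Qf: "frobexp TYPE('l) Q"
    unfolding Q_def by (intro frobexp_power frobexp k0)
  \<comment> \<open>All factors except z - \<zeta>.\<close>
  define D where "D = (\<Prod>j\<in>{1..<k}. Et j)"
  have D_R: "D \<in> fps_over valR"
    unfolding D_def by (intro subr_prod[OF subr_fps_over] subr_R Et_R)
  \<comment> \<open>The Q-th powers form a subring because Q is a power of the characteristic.
    \<open>D\<close> is used with exponent Q so that multiplying by it keeps all coefficients in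
    this subring.\<close>
  define KQ where "KQ = (\<lambda>x. x ^ Q) ` K"
  have subr_KQ: "subr KQ"
    unfolding subr_def KQ_def
    using frobexp_gt1[OF Qf]
    by (auto simp: image_iff power_0_left
        intro: bexI[of _ 0] bexI[of _ 1] K_closed
        simp flip: frobexp_minus[OF Qf] frobexp_add[OF Qf] power_mult_distrib)
  have "growth \<rho>0 (\<Lambda> ^ n * \<rho>0 ^ n) (D ^ Q * Fr k a)" if a: "a \<in> I" for a
  proof -
    define F where "F = D ^ Q * Fr k a"
    have "Et j ^ Q \<in> fps_over KQ" for j
    proof -
      have "Et j ^ Q = fps_X ^ Q - fps_const ((\<zeta> ^ q ^ j) ^ Q)"
        by (simp add: frobexp_fps_diff[OF Qf] fps_const_power)
      moreover have "(\<zeta> ^ q ^ j) ^ Q \<in> KQ"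
        unfolding KQ_def using \<zeta> by (intro imageI) simp
      ultimately show ?thesis
        by (simp only:) (intro subrD(6)[OF subr_fps_over] subr_power[OF subr_fps_over]
            fps_X_over fps_const_over subr_KQ)
    qed
    then have "D ^ Q \<in> fps_over KQ"
      unfolding D_def prod_power_distrib by (intro subr_prod[OF subr_fps_over] subr_KQ)
    moreover have "Fr k a \<in> fps_over KQ"
      using fps_overD[OF h_K[OF a]] by (intro fps_overI) (auto simp: KQ_def Q_def)
    ultimately have "F \<in> fps_over KQ"
      unfolding F_def by (intro subrD(5)[OF subr_fps_over] subr_KQ)
    then have F_KQ: "\<exists>x\<in>K. fps_nth F i = x ^ Q" for i
      using fps_overD[of F KQ i] by (auto simp: KQ_def)
    then have F_K: "fps_nth F i \<in> K" for i
      using K_closed by metis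
    \<comment> \<open>Since n \<le> Q, the power of \<open>D\<close> contains the \<open>n\<close>
      copies that \<open>growth_up\<close> asks for; the surplus is integral.\<close>
    have "lin \<zeta> ^ n * F = D ^ (Q - n) * ((\<Prod>j<k. Et j ^ n) * Fr k a)"
    proof -
      have "{..<k} = insert 0 {1..<k}"
        using k0 by auto
      then have "(\<Prod>j<k. Et j ^ n) = lin \<zeta> ^ n * D ^ n"
        by (simp add: D_def prod_power_distrib)
      moreover have "D ^ Q = D ^ (Q - n) * D ^ n"
        using nk Qk by (simp flip: power_add)
      ultimately show ?thesis
        by (simp add: F_def mult_ac)
    qed
    moreover have "growth \<rho>0 (\<Lambda> ^ n) \<dots>"
      using \<rho>0_1 \<Lambda>1 a by (intro growth_mult growth_up initial_growth subr_power[OF subr_fps_over] D_R subr_R) auto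
    ultimately have G: "growth \<rho>0 (\<Lambda> ^ n) (lin \<zeta> ^ n * F)"
      by simp
    \<comment> \<open>As \<open>n\<close> is a power of q, (z - \<zeta>)^n = z^n - \<zeta>^n, and
      each coefficient of the product involves only two coefficients of \<open>F\<close>.\<close>
    have nf: "frobexp TYPE('l) n"
      unfolding n(1) using frobexp n(2) by (rule frobexp_power)
    have Gn: "fps_nth (lin \<zeta> ^ n * F) (i + n) = fps_nth F i - \<zeta> ^ n * fps_nth F (i + n)" for i
      by (simp add: frobexp_fps_diff[OF nf] fps_const_power left_diff_distrib fps_X_power_mult_nth)
    have "v (fps_nth F i) \<le> \<Lambda> ^ n * \<rho>0 ^ n * \<rho>0 ^ i" for i
    proof (rule ccontr)
      assume "\<not> ?thesis"
      then have gt: "v (fps_nth F i) > \<Lambda> ^ n * \<rho>0 ^ (i + n)"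
        by (simp add: power_add mult_ac)
      define g where "g = fps_nth (lin \<zeta> ^ n * F) (i + n)"
      have g: "g \<in> K" "v g \<le> \<Lambda> ^ n * \<rho>0 ^ (i + n)"
        using G by (auto simp: g_def growth_def intro: fps_overD)
      \<comment> \<open>F_i strictly exceeds \<open>g\<close> in absolute value, so the ultrametric
        equality leaves |\<zeta>^n F_(i+n)| = |F_i|.\<close>
      have "\<zeta> ^ n * fps_nth F (i + n) = - g + fps_nth F i"
        using Gn[of i] by (simp add: g_def)
      also have "v (- g + fps_nth F i) = v (fps_nth F i)"
        using g gt F_K by (intro v_add_eq) auto
      finally have veq: "v (\<zeta> ^ n * fps_nth F (i + n)) = v (fps_nth F i)" .
      obtain x y where x: "x \<in> K" "fps_nth F i = x ^ Q" and y: "y \<in> K" "fps_nth F (i + n) = y ^ Q"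
        using F_KQ by metis
      have veq': "v \<zeta> ^ n * v y ^ Q = v x ^ Q"
        using veq x y \<zeta> by (simp add: v_mult v_power)
      have "v x ^ Q > 0"
      proof -
        have "0 < \<Lambda> ^ n * \<rho>0 ^ (i + n)"
          using \<Lambda>1 \<rho>0_1 by simp
        also note gt
        finally show ?thesis
          using x by (simp add: v_power)
      qed
      then have "x \<noteq> 0" "y \<noteq> 0"
        using veq' frobexp_gt1[OF Qf] by (auto simp: power_0_left)
      then obtain s t :: int where st: "v x = v \<pi> powi s" "v y = v \<pi> powi t"
        using val x y by metis
      \<comment> \<open>Both coefficients are Q-th powers, so their valuations are multiples of Q,
        which would force Q to divide c n = k.\<close>
      have "v \<pi> powi (c * int n + t * int Q) = v \<pi> powi (s * int Q)"
        using veq' \<pi> by (simp add: st c power_int_add power_int_mult)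
      then have "c * int n + t * int Q = s * int Q"
        by (rule powi_inj)
      then have "c * int n = (s - t) * int Q"
        by (simp add: algebra_simps)
      then have "int Q dvd c * int n"
        by simp
      moreover have "c * int n = int k"
        using c0 by (simp add: k_def)
      ultimately show False
        using Qk k0 by (auto dest: nat_dvd_not_less)
    qed
    then show ?thesis
      using F_K by (auto simp: growth_def F_def intro: fps_overI)
  qed
  then show thesis
    using that[OF k0] by (simp add: D_def Q_def)
qed

text \<open>After the descent from the k-th twist to \<sigma>(h) only factors with roots
  \<zeta>^(q^j), j \<ge> 1, are left. These roots lie where \<sigma>(h), of a priori rate \<Lambda>,
  converges, so the factors can be divided out. Then \<sigma>(h) has rate \<rho>0 and
  \<open>h\<close> has rate \<open>root q \<rho>0\<close>, whose q-th power \<rho>0 is below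
  \<Lambda>.\<close>

lemma integral_power:
  assumes disc: "discretely_valued K v" and n: "n = q ^ m" "m > 0" and a: "a \<in> I"
  shows "h a \<in> fps_over valR"
proof -
  obtain k where k: "k > 0" and
    tw: "\<And>a. a \<in> I \<Longrightarrow> growth \<rho>0 (\<Lambda> ^ n * \<rho>0 ^ n) ((\<Prod>j\<in>{1..<k}. Et j) ^ (q ^ k) * Fr k a)"
    using growth_twist[OF disc n] by metis
  have "\<exists>G\<ge>0. growth \<rho>0 G (fps_frob q (h a))" if a: "a \<in> I" for a
  proof -
    have "growth \<rho>0 (\<Lambda> ^ n * \<rho>0 ^ n)
        ((\<Prod>j\<in>{1..<k}. Et j) ^ (q ^ k) * (\<Prod>j\<in>{1..<k}. Et j ^ n) * Fr 1 a)"
      using tw a k \<rho>0_1 \<Lambda>1 by (intro growth_down) auto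
    then have *: "growth \<rho>0 (\<Lambda> ^ n * \<rho>0 ^ n) ((\<Prod>j\<in>{1..<k}. Et j ^ (q ^ k + n)) * fps_frob q (h a))"
      by (simp add: prod_power_distrib power_add prod.distrib)
    have "growth (\<rho>0 ^ q) ((\<Lambda> ^ n) ^ q) (fps_frob q (h a))"
      using \<rho>0_1 \<Lambda>1 a by (intro growth_frob initial_growth) auto
    \<comment> \<open>For j \<ge> 1 the root has absolute value at most |\<zeta>|^2, strictly less
      than 1/\<Lambda>; j = 0 would give equality.\<close>
    moreover have lt: "v (\<zeta> ^ q ^ j) * \<Lambda> < 1" if "j \<in> {1..<k}" for j
    proof -
      have "q ^ j > 1"
        using that q1 by (intro one_less_power) auto
      then obtain i where i: "q ^ j = Suc (Suc i)"
        by (metis One_nat_def less_imp_Suc_add add_Suc plus_1_eq_Suc)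
      have "v (\<zeta> ^ q ^ j) * \<Lambda> = v \<zeta> ^ Suc i"
        using \<zeta> v\<zeta> by (simp add: i v_mult v_power \<Lambda>_def)
      also have "\<dots> < 1"
        using \<zeta> v\<zeta> by (intro power_Suc_less_one) auto
      finally show ?thesis .
    qed
    moreover have "v (\<zeta> ^ q ^ j) * \<rho>0 \<le> 1" if "j \<in> {1..<k}" for j
      using lt[OF that] \<rho>0_less v_nonneg[of "\<zeta> ^ q ^ j"] \<zeta>
        mult_left_mono[of \<rho>0 \<Lambda> "v (\<zeta> ^ q ^ j)"] by auto
    ultimately show ?thesis
      using * \<rho>0_1 \<Lambda>1 \<rho>0_q
      by (intro growth_divide_prod[where J = "{1..<k}" and \<rho>' = \<Lambda> and n = "q ^ k + n"
            and \<alpha> = "\<lambda>j. \<zeta> ^ q ^ j"]) (auto intro: subr_power subr_R \<zeta>_R)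
  qed
  then obtain G where G: "\<And>a. a \<in> I \<Longrightarrow> G a \<ge> 0 \<and> growth \<rho>0 (G a) (fps_frob q (h a))"
    by metis
  \<comment> \<open>A common constant for all entries; the summand 1 keeps it positive.\<close>
  define C where "C = 1 + (\<Sum>a\<in>I. G a)"
  have C0: "C > 0"
    using G sum_nonneg[of I G] by (auto simp: C_def)
  have hb: "growth (root q \<rho>0) (root q C) (h b)" if "b \<in> I" for b
  proof (rule growth_unfrob)
    have "G b \<le> C"
      using member_le_sum[of b I G] G finite_I that by (simp add: C_def)
    then have "G b * \<rho>0 ^ i \<le> C * \<rho>0 ^ i" for i
      using \<rho>0_1 by (intro mult_right_mono) auto
    then have "growth \<rho>0 C (fps_frob q (h b))"
      using G[OF that] unfolding growth_def by (meson order_trans)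
    then show "growth (root q \<rho>0 ^ q) (root q C ^ q) (fps_frob q (h b))"
      using C0 \<rho>0_1 q1 by simp
  qed (use that h_K C0 \<rho>0_1 q1 in auto)
  show ?thesis
    using hb a C0 \<rho>0_1 q1 \<rho>0_less by (intro growth_iterate[of "root q \<rho>0" "root q C"]) auto
qed

text \<open>Multiplying both equations by a power of z - \<zeta> changes the exponent
  \<open>n\<close> into a power of q without touching \<open>h\<close>. The exponent
  \<open>Suc n\<close> makes that power large enough and is positive even for n = 0.\<close>

lemma integral:
  assumes disc: "discretely_valued K v" and a: "a \<in> I"
  shows "h a \<in> fps_over valR"
proof -
  define d where "d = q ^ Suc n - n"
  have "n < q ^ Suc n"
    using q1 power_gt_expt[of q "Suc n"] by linarith
  then have nd: "lin \<zeta> ^ (q ^ Suc n) = lin \<zeta> ^ d * lin \<zeta> ^ n"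
    by (simp add: d_def flip: power_add del: power_Suc)
  have dR: "lin \<zeta> ^ d \<in> fps_over valR"
    by (intro subr_power[OF subr_fps_over] subr_R lin_over \<zeta>_R)
  interpret S: frob_system K v q "q ^ Suc n" \<zeta> I h "\<lambda>a b. lin \<zeta> ^ d * A a b" "\<lambda>a b. lin \<zeta> ^ d * A' a b"
    using frobexp \<zeta> finite_I h_K A_R dR
    by unfold_locales
      (auto simp: nd mult.assoc frob_h h_frob sum_distrib_left simp del: power_Suc
        intro: subrD(5)[OF subr_fps_over] subr_R)
  show ?thesis
    using S.integral_power[OF disc _ _ a] by blast
qed

end


section \<open>Frobenius-fixed vectors over a separably closed field\<close>

definition sep_closed :: "'l::field itself \<Rightarrow> bool"
  where "sep_closed T \<longleftrightarrow> (\<forall>p :: 'l poly. Polynomial.degree p > 0 \<and> separable_poly p \<longrightarrow> (\<exists>x. poly p x = 0))"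

text \<open>The polynomial y^q - y + c has derivative -1 and is therefore separable.\<close>

lemma artin_schreier_root:
  fixes c :: "'l::field"
  assumes "sep_closed TYPE('l)" "frobexp TYPE('l) q"
  shows "\<exists>y. y = y ^ q + c"
proof -
  have q: "q > 1"
    by (rule frobexp_gt1[OF assms(2)])
  define p where "p = Polynomial.monom 1 q - [:0, 1:] + [:c:]"
  have "pderiv p = - 1"
    using frobexp_of_nat[OF assms(2)]
    by (simp add: p_def pderiv_diff pderiv_add pderiv_monom pderiv_pCons one_pCons)
  then have "separable_poly p"
    by (auto simp: separable_poly_def intro!: coprimeI)
  moreover have "Polynomial.coeff p q = 1"
    using q by (auto simp: p_def coeff_pCons split: nat.splits)
  then have "Polynomial.degree p \<ge> q"
    by (intro le_degree) simp
  then have "Polynomial.degree p > 0"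
    using q by simp
  ultimately obtain y where "poly p y = 0"
    using assms(1) by (auto simp: sep_closed_def)
  then have "y = y ^ q + c"
    by (simp add: p_def poly_monom algebra_simps)
  then show ?thesis ..
qed

text \<open>The additive polynomial P has derivative -1. For p = P/y this reads p + y p' = -1, so p
  is separable. The nonzero coefficient makes its degree positive, and its constant term -1 keeps
  its roots away from 0.\<close>

lemma additive_poly_root:
  fixes a :: "nat \<Rightarrow> 'l::field"
  assumes "sep_closed TYPE('l)" "frobexp TYPE('l) q" "k < m" "a k \<noteq> 0"
  shows "\<exists>y. y \<noteq> 0 \<and> y = (\<Sum>l<m. a l * y ^ (q ^ Suc l))"
proof -
  have q: "q > 1"
    by (rule frobexp_gt1[OF assms(2)])
  have qpos: "q ^ Suc l > 1" for l
    using q by (rule one_less_power) simp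
  define p where "p = (\<Sum>l<m. Polynomial.monom (a l) (q ^ Suc l - 1)) - 1"
  define P where "P = (\<Sum>l<m. Polynomial.monom (a l) (q ^ Suc l)) - [:0, 1:]"
  have "[:0, 1:] * Polynomial.monom (a l) (q ^ Suc l - 1) = Polynomial.monom (a l) (q ^ Suc l)" for l
  proof -
    have "[:0, 1:] * Polynomial.monom (a l) (q ^ Suc l - 1) = Polynomial.monom (a l) (Suc (q ^ Suc l - 1))"
      by (simp only: monom_Suc) simp
    also have "Suc (q ^ Suc l - 1) = q ^ Suc l"
      using qpos[of l] by linarith
    finally show ?thesis .
  qed
  then have Pp: "P = [:0, 1:] * p"
    by (simp add: P_def p_def right_diff_distrib sum_distrib_left del: power_Suc mult_pCons_left)
  have "of_nat (q ^ Suc l) = (0::'l)" for l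
    using frobexp_of_nat[OF assms(2)] by simp
  moreover have "pderiv (sum f I) = (\<Sum>i\<in>I. pderiv (f i))" for f :: "nat \<Rightarrow> 'l poly" and I
    by (induction I rule: infinite_finite_induct) (simp_all add: pderiv_add)
  ultimately have "pderiv P = - 1"
    by (simp add: P_def pderiv_diff pderiv_monom pderiv_pCons one_pCons del: power_Suc of_nat_power)
  then have "p + [:0, 1:] * pderiv p = - 1"
    by (simp add: Pp pderiv_mult pderiv_pCons one_pCons [symmetric] add.commute del: mult_pCons_left)
  then have "separable_poly p"
    unfolding separable_poly_def
    by (metis coprimeI dvd_add dvd_minus_iff dvd_mult)
  moreover have "Polynomial.degree p > 0"
  proof -
    have "q ^ Suc l - 1 = q ^ Suc k - 1 \<longleftrightarrow> l = k" for l
    proof -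
      have "q ^ Suc l - 1 = q ^ Suc k - 1 \<longleftrightarrow> q ^ Suc l = q ^ Suc k"
        using qpos[of l] qpos[of k] by linarith
      then show ?thesis
        using q by (simp add: power_inject_exp del: power_Suc)
    qed
    then have "Polynomial.coeff p (q ^ Suc k - 1) = a k"
      using assms(3) qpos[of k] by (simp add: p_def coeff_sum coeff_eq_0 del: power_Suc)
    then have "Polynomial.degree p \<ge> q ^ Suc k - 1"
      using assms(4) by (intro le_degree) simp
    then show ?thesis
      using qpos[of k] by linarith
  qed
  ultimately obtain y where y: "poly p y = 0"
    using assms(1) by (auto simp: sep_closed_def)
  have "y \<noteq> 0"
  proof
    assume "y = 0"
    moreover have "\<not> q ^ Suc l \<le> Suc 0" for l
      using qpos[of l] by simp
    ultimately have "poly p y = - 1"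
      by (simp add: p_def poly_sum poly_monom power_0_left del: power_Suc)
    then show False
      using y by simp
  qed
  moreover have "poly P y = 0"
    by (simp add: Pp y)
  then have "y = (\<Sum>l<m. a l * y ^ (q ^ Suc l))"
    by (simp add: P_def poly_sum poly_monom del: power_Suc)
  ultimately show ?thesis
    by blast
qed

text \<open>The vectors are power series, so that the vector space theory of the library applies;
  only the first \<open>r\<close> coefficients matter.\<close>

interpretation fpsv: vector_space "\<lambda>(c::'l::field) f. fps_const c * f"
  by unfold_locales (simp_all add: algebra_simps flip: fps_const_add fps_const_mult)

text \<open>Coefficients are attached to indices, so repetitions in the family do no harm.\<close>

lemma fpsv_span_image:
  fixes f :: "'i \<Rightarrow> 'l::field fps"
  assumes "finite I" "x \<in> fpsv.span (f ` I)"
  shows "\<exists>a. x = (\<Sum>i\<in>I. fps_const (a i) * f i)"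
  using assms
proof (induction I arbitrary: x rule: finite_induct)
  case (insert i I)
  then obtain k where "x - fps_const k * f i \<in> fpsv.span (f ` I)"
    by (auto simp: fpsv.span_insert)
  then obtain a where "x - fps_const k * f i = (\<Sum>j\<in>I. fps_const (a j) * f j)"
    using insert.IH by blast
  then have "x = (\<Sum>j\<in>insert i I. fps_const ((a(i := k)) j) * f j)"
    using insert.hyps by (auto simp: algebra_simps cong: sum.cong intro!: sum.cong)
  then show ?case
    by blast
qed simp

text \<open>The functional is the coordinate at \<open>x\<close> in a basis that extends
  \<open>B\<close> together with \<open>x\<close>.\<close>

lemma fpsv_functional:
  fixes B :: "'l::field fps set"
  assumes "fpsv.independent B" "x \<notin> fpsv.span B"
  obtains f where "\<And>y z. f (y + z) = f y + f z" "\<And>c y. f (fps_const c * y) = c * f y"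
    "f x = (1::'l)" "\<And>b. b \<in> B \<Longrightarrow> f b = 0"
proof -
  define E where "E = fpsv.extend_basis (insert x B)"
  have ind: "fpsv.independent (insert x B)"
    using assms by (simp add: fpsv.independent_insert fpsv.span_base)
  have E: "insert x B \<subseteq> E" "fpsv.independent E" "fpsv.span E = UNIV"
    unfolding E_def using fpsv.extend_basis_superset[OF ind]
      fpsv.independent_extend_basis[OF ind] fpsv.span_extend_basis[OF ind] by auto
  have "x \<notin> B"
    using assms fpsv.span_base by blast
  then show thesis
    using E by (intro that[of "\<lambda>y. fpsv.representation E y x"])
      (auto simp: fpsv.representation_add fpsv.representation_scale fpsv.representation_basis)
qed

section \<open>Lang's theorem over a separably closed field\<close>

locale semilinear_matrix =
  fixes r q :: nat and T Ti :: "nat \<Rightarrow> nat \<Rightarrow> 'l::field"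
  assumes sep_closed: "sep_closed TYPE('l)" and frobexp: "frobexp TYPE('l) q"
    and left_inverse: "i < r \<Longrightarrow> j < r \<Longrightarrow> (\<Sum>k<r. Ti i k * T k j) = (if i = j then 1 else 0)"
begin

definition \<phi> :: "'l fps \<Rightarrow> 'l fps"
  where "\<phi> f = Abs_fps (\<lambda>i. if i < r then \<Sum>j<r. T i j * fps_nth f j ^ q else 0)"

definition Vr :: "'l fps set"
  where "Vr = {f. \<forall>i\<ge>r. fps_nth f i = 0}"

lemma q1: "q > 1"
  using frobexp frobexp_gt1 by blast

lemma \<phi>_nth: "fps_nth (\<phi> f) i = (if i < r then \<Sum>j<r. T i j * fps_nth f j ^ q else 0)"
  by (simp add: \<phi>_def)

lemma \<phi>_X: "\<phi> f \<in> Vr"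
  by (simp add: Vr_def \<phi>_nth)

lemma \<phi>_add: "\<phi> (f + g) = \<phi> f + \<phi> g"
  by (rule fps_ext) (simp add: \<phi>_nth frobexp_add[OF frobexp] algebra_simps sum.distrib)

lemma \<phi>_scale: "\<phi> (fps_const c * f) = fps_const (c ^ q) * \<phi> f"
  by (rule fps_ext) (simp add: \<phi>_nth power_mult_distrib sum_distrib_left mult_ac)

lemma \<phi>_0 [simp]: "\<phi> 0 = 0"
  using q1 by (intro fps_ext) (simp add: \<phi>_nth power_0_left)

lemma \<phi>_sum: "\<phi> (\<Sum>i\<in>I. f i) = (\<Sum>i\<in>I. \<phi> (f i))"
  by (induction I rule: infinite_finite_induct) (simp_all add: \<phi>_add)

lemma subspace_X: "fpsv.subspace Vr"
  by (auto simp: fpsv.subspace_def Vr_def)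

lemma X_decomp: "f \<in> Vr \<Longrightarrow> f = (\<Sum>i<r. fps_const (fps_nth f i) * fps_X ^ i)"
  by (rule fps_ext) (auto simp: Vr_def fps_sum_nth fps_X_power_nth if_distrib cong: if_cong)

lemma X_span: "Vr \<subseteq> fpsv.span ((\<lambda>i. fps_X ^ i) ` {..<r})"
proof
  fix f assume "f \<in> Vr"
  then have "f = (\<Sum>i<r. fps_const (fps_nth f i) * fps_X ^ i)"
    by (rule X_decomp)
  also have "\<dots> \<in> fpsv.span ((\<lambda>i. fps_X ^ i) ` {..<r})"
    by (intro fpsv.span_sum fpsv.span_scale fpsv.span_base) auto
  finally show "f \<in> fpsv.span ((\<lambda>i. fps_X ^ i) ` {..<r})" .
qed

lemma independent_card:
  assumes "fpsv.independent B" "B \<subseteq> Vr"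
  shows "finite B \<and> card B \<le> r"
proof -
  have "finite B \<and> card B \<le> card ((\<lambda>i. fps_X ^ i :: 'l fps) ` {..<r})"
    using assms X_span by (intro fpsv.independent_span_bound) auto
  moreover have "card ((\<lambda>i. fps_X ^ i :: 'l fps) ` {..<r}) \<le> r"
    using card_image_le[of "{..<r}"] by auto
  ultimately show ?thesis
    by linarith
qed

text \<open>If \<phi>(x) were in the span, cancelling \<open>T\<close> would express the entrywise
  q-th power of x as the combination, with coefficients c_b, of the entrywise q-th powers of the b.
  The c_b need not have q-th roots, so this cannot be pulled back to x directly. Instead, a
  functional that is 1 at x and 0 on \<open>B\<close>, with its own coefficients raised to the q-th
  power, separates the two sides.\<close>

lemma \<phi>_notin_span_fixed:
  assumes B: "fpsv.independent B" "finite B" "B \<subseteq> Vr" "\<And>b. b \<in> B \<Longrightarrow> \<phi> b = b"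
    and x: "x \<in> Vr" "x \<notin> fpsv.span B"
  shows "\<phi> x \<noteq> (\<Sum>b\<in>B. fps_const (c b) * b)"
proof
  assume eq: "\<phi> x = (\<Sum>b\<in>B. fps_const (c b) * b)"
  define d where "d j = fps_nth x j ^ q - (\<Sum>b\<in>B. c b * fps_nth b j ^ q)" for j
  have "(\<Sum>j<r. T i j * d j) = 0" if "i < r" for i
  proof -
    have "(\<Sum>j<r. T i j * fps_nth x j ^ q) = (\<Sum>b\<in>B. c b * fps_nth (\<phi> b) i)"
      using arg_cong[OF eq, of "\<lambda>f. fps_nth f i"] that B(4) by (simp add: \<phi>_nth fps_sum_nth)
    also have "\<dots> = (\<Sum>j<r. T i j * (\<Sum>b\<in>B. c b * fps_nth b j ^ q))"
      using that by (simp add: \<phi>_nth sum_distrib_left) (subst sum.swap, simp add: mult_ac)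
    finally show ?thesis
      by (simp add: d_def right_diff_distrib sum_subtractf)
  qed
  then have "(\<Sum>k<r. Ti i k * (\<Sum>j<r. T k j * d j)) = 0" for i
    by simp
  moreover have "(\<Sum>k<r. Ti i k * (\<Sum>j<r. T k j * d j)) = d i" if "i < r" for i
  proof -
    have "(\<Sum>k<r. Ti i k * (\<Sum>j<r. T k j * d j)) = (\<Sum>j<r. (\<Sum>k<r. Ti i k * T k j) * d j)"
      by (simp add: sum_distrib_left sum_distrib_right mult.assoc) (subst sum.swap, simp)
    also have "\<dots> = (\<Sum>j<r. (if i = j then 1 else 0) * d j)"
      using that by (intro sum.cong) (auto simp: left_inverse)
    also have "\<dots> = d i"
      using that by (simp add: if_distrib[of "\<lambda>x. x * _"] cong: if_cong)
    finally show ?thesis .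
  qed
  ultimately have d: "fps_nth x j ^ q = (\<Sum>b\<in>B. c b * fps_nth b j ^ q)" if "j < r" for j
    using that by (auto simp: d_def)
  obtain f where f: "\<And>y z. f (y + z) = f y + f z" "\<And>c y. f (fps_const c * y) = c * f y"
    "f x = (1::'l)" "\<And>b. b \<in> B \<Longrightarrow> f b = 0"
    using fpsv_functional[OF B(1) x(2)] by metis
  have f0: "f 0 = 0"
    using f(2)[of 0 0] by simp
  have fsum: "f (\<Sum>i\<in>J. g i) = (\<Sum>i\<in>J. f (g i))" for J :: "nat set" and g
    by (induction J rule: infinite_finite_induct) (auto simp: f f0)
  have fX: "f y ^ q = (\<Sum>i<r. fps_nth y i ^ q * f (fps_X ^ i) ^ q)" if "y \<in> Vr" for y
    by (subst X_decomp[OF that])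
      (simp add: fsum f(2) frobexp_sum[OF frobexp] power_mult_distrib)
  have "1 = f x ^ q"
    by (simp add: f)
  also have "\<dots> = (\<Sum>i<r. (\<Sum>b\<in>B. c b * fps_nth b i ^ q) * f (fps_X ^ i) ^ q)"
    by (simp add: fX[OF x(1)] d)
  also have "\<dots> = (\<Sum>b\<in>B. c b * (\<Sum>i<r. fps_nth b i ^ q * f (fps_X ^ i) ^ q))"
    by (simp add: sum_distrib_left sum_distrib_right mult.assoc) (subst sum.swap, simp)
  also have "\<dots> = (\<Sum>b\<in>B. c b * f b ^ q)"
    using B(3) by (intro sum.cong) (auto simp: fX)
  also have "\<dots> = 0"
    using f(4) q1 by (simp add: power_0_left)
  finally show False
    by simp
qed

text \<open>Modulo the span of the known fixed vectors, the iterates of \<open>w\<close> satisfy a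
  linear relation. A root of an additive polynomial yields a combination of them that is fixed
  modulo this span, and Artin-Schreier equations remove the remaining defect.\<close>

lemma fixed_vector_extend:
  assumes B: "fpsv.independent B" "B \<subseteq> Vr" "\<And>b. b \<in> B \<Longrightarrow> \<phi> b = b"
    and w: "w \<in> Vr" "w \<notin> fpsv.span B"
  obtains x where "x \<in> Vr" "\<phi> x = x" "x \<notin> fpsv.span B"
proof -
  have finB: "finite B"
    using independent_card B by blast
  define vs where "vs k = (\<phi> ^^ k) w" for k
  have vs_Suc: "vs (Suc k) = \<phi> (vs k)" for k
    by (simp add: vs_def)
  have vs_X: "vs k \<in> Vr" for k
    using w \<phi>_X by (cases k) (simp_all add: vs_def)
  define W where "W k = fpsv.span (B \<union> vs ` {..<k})" for k
  have ind: "fpsv.independent (B \<union> vs ` {..<k}) \<and> card (B \<union> vs ` {..<k}) = card B + k"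
    if "\<forall>i<k. vs i \<notin> W i" for k
    using that
  proof (induction k)
    case (Suc k)
    then have *: "vs k \<notin> W k" "fpsv.independent (B \<union> vs ` {..<k})" "card (B \<union> vs ` {..<k}) = card B + k"
      by auto
    have **: "B \<union> vs ` {..<Suc k} = insert (vs k) (B \<union> vs ` {..<k})"
      by (simp add: lessThan_Suc)
    have "vs k \<notin> B \<union> vs ` {..<k}"
      using *(1) fpsv.span_base[of "vs k" "B \<union> vs ` {..<k}"] unfolding W_def by argo
    then show ?case
      unfolding ** using * finB by (simp add: fpsv.independent_insert W_def)
  qed (simp add: B)
  have "\<exists>k. vs k \<in> W k"
  proof (rule ccontr)
    assume "\<nexists>k. vs k \<in> W k"
    then have *: "fpsv.independent (B \<union> vs ` {..<Suc r})" "card (B \<union> vs ` {..<Suc r}) = card B + Suc r"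
      using ind[of "Suc r"] by auto
    moreover have "B \<union> vs ` {..<Suc r} \<subseteq> Vr"
      using B vs_X by auto
    ultimately show False
      using independent_card[of "B \<union> vs ` {..<Suc r}"] by linarith
  qed
  \<comment> \<open>The least \<open>m\<close> for which \<phi>^m(w) depends on \<open>B\<close> and
    the earlier iterates; it exists because independent sets have at most \<open>r\<close>
    elements.\<close>
  define m where "m = (LEAST k. vs k \<in> W k)"
  have m: "vs m \<in> W m"
    unfolding m_def using \<open>\<exists>k. vs k \<in> W k\<close> by (rule LeastI_ex)
  have less_m: "vs k \<notin> W k" if "k < m" for k
    using not_less_Least[of k "\<lambda>k. vs k \<in> W k"] that by (auto simp: m_def)
  have "vs 0 \<notin> W 0"
    using w by (simp add: vs_def W_def)
  then have "m \<noteq> 0"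
    using m by metis
  then obtain n where n: "m = Suc n"
    by (cases m) auto
  obtain u u' where u: "u \<in> fpsv.span B" "u' \<in> fpsv.span (vs ` {..<m})" "vs m = u + u'"
    using m by (auto simp: W_def fpsv.span_Un)
  obtain c where c: "u = (\<Sum>b\<in>B. fps_const (c b) * b)"
    using fpsv_span_image[OF finB, of u "\<lambda>b. b"] u by auto
  obtain a where a: "u' = (\<Sum>i<m. fps_const (a i) * vs i)"
    using fpsv_span_image[of "{..<m}" u' vs] u by auto
  \<comment> \<open>Otherwise \<phi> would map the last iterate, which lies outside the span of
    \<open>B\<close>, into that span.\<close>
  have "\<exists>k<m. a k \<noteq> 0"
  proof (rule ccontr)
    assume "\<not> ?thesis"
    then have "\<phi> (vs n) = (\<Sum>b\<in>B. fps_const (c b) * b)"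
      using u(3) by (simp add: a c n vs_Suc)
    moreover have "vs n \<notin> fpsv.span B"
      using less_m[of n] fpsv.span_mono[of B "B \<union> vs ` {..<n}"] by (auto simp: n W_def)
    ultimately show False
      using \<phi>_notin_span_fixed[OF B(1) finB B(2,3) vs_X] by blast
  qed
  then obtain k where k: "k < m" "a k \<noteq> 0"
    by blast
  \<comment> \<open>For z = sum of x_i \<phi>^i(w), the requirement \<phi>(z) = z + y^q u with x_n =
    y gives x_0 = a_0 y^q and x_(i+1) = x_i^q + a_(i+1) y^q. Running the recursion up to x_n = y
    produces this equation for y.\<close>
  have "\<exists>y. y \<noteq> 0 \<and> y = (\<Sum>l<m. a (n - l) ^ (q ^ l) * y ^ (q ^ Suc l))"
    using k by (intro additive_poly_root[where k = "n - k"] sep_closed frobexp) (auto simp: n)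
  then obtain y where y: "y \<noteq> 0" "y = (\<Sum>l<m. a (n - l) ^ (q ^ l) * y ^ (q ^ Suc l))"
    by blast
  define x where "x i = (\<Sum>l\<le>i. a (i - l) ^ (q ^ l) * y ^ (q ^ Suc l))" for i
  have x0: "x 0 = a 0 * y ^ q"
    by (simp add: x_def)
  have xSuc: "x (Suc i) = x i ^ q + a (Suc i) * y ^ q" for i
    unfolding x_def sum.atMost_Suc_shift
    by (simp add: frobexp_sum[OF frobexp] power_mult_distrib mult.commute flip: power_mult)
  have xn: "x n = y"
    using y(2) by (simp add: x_def n lessThan_Suc_atMost)
  define z where "z = (\<Sum>i<m. fps_const (x i) * vs i)"
  have "\<phi> z = (\<Sum>i<m. fps_const (x i ^ q) * vs (Suc i))"
    by (simp add: z_def \<phi>_sum \<phi>_scale vs_Suc)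
  also have "\<dots> = (\<Sum>i<n. fps_const (x i ^ q) * vs (Suc i)) + fps_const (y ^ q) * vs m"
    by (simp add: n xn)
  also have "fps_const (y ^ q) * vs m = fps_const (y ^ q) * u + (\<Sum>i<m. fps_const (a i * y ^ q) * vs i)"
    by (simp add: u(3) a distrib_left sum_distrib_left fps_const_mult[symmetric] mult_ac del: fps_const_mult)
  also have "(\<Sum>i<m. fps_const (a i * y ^ q) * vs i) =
      fps_const (x 0) * vs 0 + (\<Sum>i<n. fps_const (a (Suc i) * y ^ q) * vs (Suc i))"
    by (simp add: n sum.lessThan_Suc_shift x0 del: sum.lessThan_Suc)
  also have "(\<Sum>i<n. fps_const (x i ^ q) * vs (Suc i)) + (fps_const (y ^ q) * u + (fps_const (x 0) * vs 0 +
        (\<Sum>i<n. fps_const (a (Suc i) * y ^ q) * vs (Suc i)))) =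
      fps_const (y ^ q) * u + (fps_const (x 0) * vs 0 + (\<Sum>i<n. fps_const (x (Suc i)) * vs (Suc i)))"
    by (simp add: xSuc sum.distrib distrib_right flip: fps_const_add)
  also have "\<dots> = fps_const (y ^ q) * u + z"
    by (simp add: z_def n sum.lessThan_Suc_shift del: sum.lessThan_Suc)
  finally have \<phi>z: "\<phi> z = fps_const (y ^ q) * u + z" .
  \<comment> \<open>Adding the sum of t_b b to z cancels y^q u as soon as t_b = t_b^q + y^q c_b for
    each b.\<close>
  have "\<forall>b. \<exists>t. t = t ^ q + y ^ q * c b"
    using artin_schreier_root[OF sep_closed frobexp] by blast
  then have "\<exists>t. \<forall>b. t b = t b ^ q + y ^ q * c b"
    by (rule choice)
  then obtain t where t': "\<forall>b. t b = t b ^ q + y ^ q * c b" ..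
  have t: "t b ^ q + y ^ q * c b = t b" for b
    by (rule sym) (rule spec[OF t'])
  define x' where "x' = z + (\<Sum>b\<in>B. fps_const (t b) * b)"
  have "\<phi> x' = z + (\<Sum>b\<in>B. fps_const (t b ^ q + y ^ q * c b) * b)"
  proof -
    have "\<phi> x' = fps_const (y ^ q) * u + z + (\<Sum>b\<in>B. fps_const (t b ^ q) * b)"
      unfolding x'_def \<phi>_add \<phi>_sum \<phi>_scale \<phi>z using B(3) by simp
    also have "fps_const (y ^ q) * u = (\<Sum>b\<in>B. fps_const (y ^ q * c b) * b)"
      unfolding c sum_distrib_left by (simp add: mult.assoc[symmetric])
    also have "\<dots> + z + (\<Sum>b\<in>B. fps_const (t b ^ q) * b) =
        z + ((\<Sum>b\<in>B. fps_const (t b ^ q) * b) + (\<Sum>b\<in>B. fps_const (y ^ q * c b) * b))"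
      by (simp only: ac_simps)
    also have "(\<Sum>b\<in>B. fps_const (t b ^ q) * b) + (\<Sum>b\<in>B. fps_const (y ^ q * c b) * b) =
        (\<Sum>b\<in>B. fps_const (t b ^ q + y ^ q * c b) * b)"
      unfolding sum.distrib[symmetric] fps_const_add[symmetric] distrib_right ..
    finally show ?thesis .
  qed
  also have "\<dots> = x'"
    by (simp add: x'_def t)
  finally have "\<phi> x' = x'" .
  moreover have "x' \<in> Vr"
    using \<phi>_X[of x'] \<open>\<phi> x' = x'\<close> by simp
  \<comment> \<open>The coefficient of \<phi>^n(w) in z is y, which is nonzero, and this iterate is
    independent of \<open>B\<close> and the earlier ones.\<close>
  moreover have "x' \<notin> fpsv.span B"
  proof
    assume "x' \<in> fpsv.span B"
    moreover have "(\<Sum>b\<in>B. fps_const (t b) * b) \<in> fpsv.span B"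
      by (intro fpsv.span_sum fpsv.span_scale fpsv.span_base)
    ultimately have "z \<in> fpsv.span B"
      using fpsv.span_diff[of x' B] by (force simp: x'_def)
    then have "z \<in> W n"
      using fpsv.span_mono[of B "B \<union> vs ` {..<n}"] by (auto simp: W_def)
    moreover have "(\<Sum>i<n. fps_const (x i) * vs i) \<in> W n"
      unfolding W_def by (intro fpsv.span_sum fpsv.span_scale fpsv.span_base) auto
    ultimately have "fps_const y * vs n \<in> W n"
      using fpsv.span_diff[of z "B \<union> vs ` {..<n}" "\<Sum>i<n. fps_const (x i) * vs i"]
      by (simp add: W_def z_def n xn)
    then have "fps_const (inverse y) * (fps_const y * vs n) \<in> W n"
      unfolding W_def by (rule fpsv.span_scale)
    then have "vs n \<in> W n"
      using y(1) by (simp add: mult.assoc[symmetric])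
    then show False
      using less_m[of n] by (simp add: n)
  qed
  ultimately show thesis
    using that by blast
qed

end

context semilinear_matrix
begin

text \<open>An independent set of fixed vectors of largest size spans, since otherwise it could be
  extended. It is listed as a family padded with zero vectors, so that it can be indexed up to
  \<open>r\<close>.\<close>

lemma fixed_basis:
  obtains \<beta> where "\<And>j. \<phi> (\<beta> j) = \<beta> j" "\<And>j. \<beta> j \<in> Vr" "Vr \<subseteq> fpsv.span (\<beta> ` {..<r})"
proof -
  define good where "good B \<longleftrightarrow> fpsv.independent B \<and> B \<subseteq> Vr \<and> (\<forall>b\<in>B. \<phi> b = b)" for B
  have "good {}"
    by (simp add: good_def fpsv.independent_empty)
  moreover have "\<forall>B. good B \<longrightarrow> card B \<le> r"
    using independent_card by (auto simp: good_def)
  ultimately obtain B where B: "good B" "\<forall>B'. good B' \<longrightarrow> card B' \<le> card B"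
    using ex_has_greatest_nat[of good "{}" card "Suc r"] by (auto simp: less_Suc_eq_le)
  have finB: "finite B" "card B \<le> r"
    using independent_card B by (auto simp: good_def)
  have span: "Vr \<subseteq> fpsv.span B"
  proof
    fix w assume w: "w \<in> Vr"
    show "w \<in> fpsv.span B"
    proof (rule ccontr)
      assume "w \<notin> fpsv.span B"
      then obtain x where x: "x \<in> Vr" "\<phi> x = x" "x \<notin> fpsv.span B"
        using fixed_vector_extend[of B w] B(1) w unfolding good_def by metis
      then have "good (insert x B)"
        using B(1) by (auto simp: good_def fpsv.independent_insert)
      moreover have "x \<notin> B"
        using x fpsv.span_base by blast
      ultimately show False
        using B(2) finB by force
    qed
  qed
  obtain f where f: "bij_betw f {..<card B} B"
    using ex_bij_betw_nat_finite[OF finB(1)] by (auto simp: atLeast0LessThan)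
  define \<beta> where "\<beta> j = (if j < card B then f j else 0)" for j
  have "f j \<in> B" if "j < card B" for j
    using f that by (auto dest: bij_betwE)
  then have "\<phi> (\<beta> j) = \<beta> j" "\<beta> j \<in> Vr" for j
    using B(1) \<phi>_scale[of 0 0] q1 fpsv.subspace_0[OF subspace_X] by (auto simp: \<beta>_def good_def power_0_left)
  moreover have "B \<subseteq> \<beta> ` {..<r}"
    using f finB(2) by (force simp: \<beta>_def bij_betw_def)
  then have "Vr \<subseteq> fpsv.span (\<beta> ` {..<r})"
    using span fpsv.span_mono by blast
  ultimately show thesis
    using that by blast
qed

text \<open>The columns of U are the fixed vectors, and V records the coordinates of the unit
  vectors in them.\<close>

lemma lang:
  obtains U V where
    "\<And>i j. i < r \<Longrightarrow> j < r \<Longrightarrow> (\<Sum>k<r. T i k * U k j ^ q) = U i j"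
    "\<And>i j. i < r \<Longrightarrow> j < r \<Longrightarrow> (\<Sum>k<r. U i k * V k j) = (if i = j then 1 else 0)"
proof -
  obtain \<beta> where \<beta>: "\<And>j. \<phi> (\<beta> j) = \<beta> j" "\<And>j. \<beta> j \<in> Vr" "Vr \<subseteq> fpsv.span (\<beta> ` {..<r})"
    using fixed_basis by metis
  have "\<forall>j<r. \<exists>a. fps_X ^ j = (\<Sum>k<r. fps_const (a k) * \<beta> k)"
  proof (intro allI impI)
    fix j assume "j < r"
    then have "fps_X ^ j \<in> Vr"
      by (auto simp: Vr_def fps_X_power_nth)
    then show "\<exists>a. fps_X ^ j = (\<Sum>k<r. fps_const (a k) * \<beta> k)"
      using \<beta>(3) by (intro fpsv_span_image) auto
  qed
  then obtain a where a: "\<And>j. j < r \<Longrightarrow> fps_X ^ j = (\<Sum>k<r. fps_const (a j k) * \<beta> k)"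
    by metis
  show thesis
  proof (rule that[of "\<lambda>i j. fps_nth (\<beta> j) i" "\<lambda>k j. a j k"])
    fix i j assume ij: "i < r" "j < r"
    show "(\<Sum>k<r. T i k * fps_nth (\<beta> j) k ^ q) = fps_nth (\<beta> j) i"
      using arg_cong[OF \<beta>(1)[of j], of "\<lambda>f. fps_nth f i"] ij by (simp add: \<phi>_nth)
    show "(\<Sum>k<r. fps_nth (\<beta> k) i * a j k) = (if i = j then 1 else 0)"
    proof -
      have "(\<Sum>k<r. fps_nth (\<beta> k) i * a j k) = fps_nth (\<Sum>k<r. fps_const (a j k) * \<beta> k) i"
        by (simp add: fps_sum_nth mult.commute)
      also have "\<dots> = fps_nth (fps_X ^ j) i"
        by (simp only: a[OF ij(2)])
      finally show ?thesis
        by (simp add: fps_X_power_nth)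
    qed
  qed
qed

text \<open>Substituting x = U y turns the system into y_k = y_k^q + (V b)_k, which is one
  Artin-Schreier equation for each k.\<close>

lemma lang_affine:
  "\<exists>x. \<forall>i<r. x i = (\<Sum>j<r. T i j * x j ^ q) + b i"
proof -
  obtain U V where TU: "\<And>i j. i < r \<Longrightarrow> j < r \<Longrightarrow> (\<Sum>k<r. T i k * U k j ^ q) = U i j"
    and UV: "\<And>i j. i < r \<Longrightarrow> j < r \<Longrightarrow> (\<Sum>k<r. U i k * V k j) = (if i = j then 1 else 0)"
    by (rule lang) blast
  have "\<forall>k. \<exists>t. t = t ^ q + (\<Sum>l<r. V k l * b l)"
    using artin_schreier_root[OF sep_closed frobexp] by blast
  then have "\<exists>y. \<forall>k. y k = y k ^ q + (\<Sum>l<r. V k l * b l)"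
    by (rule choice)
  then obtain y where y: "\<forall>k. y k = y k ^ q + (\<Sum>l<r. V k l * b l)" ..
  have "(\<Sum>k<r. U i k * y k) = (\<Sum>j<r. T i j * (\<Sum>k<r. U j k * y k) ^ q) + b i" if i: "i < r" for i
  proof -
    have "(\<Sum>k<r. U i k * y k) = (\<Sum>k<r. U i k * (y k ^ q + (\<Sum>l<r. V k l * b l)))"
      using y by (intro sum.cong refl arg_cong[where f = "(*) _"]) blast
    also have "\<dots> = (\<Sum>k<r. U i k * y k ^ q) + (\<Sum>k<r. \<Sum>l<r. U i k * V k l * b l)"
      by (simp add: distrib_left sum.distrib sum_distrib_left mult.assoc)
    also have "(\<Sum>k<r. \<Sum>l<r. U i k * V k l * b l) = (\<Sum>l<r. (\<Sum>k<r. U i k * V k l) * b l)"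
      by (subst sum.swap) (simp add: sum_distrib_right)
    also have "\<dots> = (\<Sum>l<r. if i = l then b l else 0)"
      using i by (intro sum.cong) (auto simp: UV)
    also have "\<dots> = b i"
      using i by simp
    also have "(\<Sum>k<r. U i k * y k ^ q) = (\<Sum>k<r. (\<Sum>j<r. T i j * U j k ^ q) * y k ^ q)"
      using i by (intro sum.cong) (auto simp: TU)
    also have "\<dots> = (\<Sum>j<r. \<Sum>k<r. T i j * (U j k * y k) ^ q)"
      unfolding sum_distrib_right power_mult_distrib mult.assoc by (rule sum.swap)
    also have "\<dots> = (\<Sum>j<r. T i j * (\<Sum>k<r. U j k * y k) ^ q)"
      by (simp add: frobexp_sum[OF frobexp] sum_distrib_left)
    finally show ?thesis .
  qed
  then show ?thesis
    by (intro exI[of _ "\<lambda>i. \<Sum>k<r. U i k * y k"]) blast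
qed

end

section \<open>Lang's theorem over power series\<close>

lemma sum_split_first: "(\<Sum>k=0..n. f k) = f 0 + (\<Sum>k=1..n. f k :: 'a::comm_monoid_add)" for n :: nat
  by (simp add: sum.atLeast_Suc_atMost)

text \<open>The n-th coefficient of U occurs in the equation only through the constant term of
  \<open>T\<close>; the rest is known from earlier coefficients. So each coefficient solves an
  affine system of the previous kind, and the inverse V is likewise computed recursively from an
  invertible U_0.\<close>

lemma lang_series:
  fixes T Ti :: "nat \<Rightarrow> nat \<Rightarrow> 'l::field fps"
  assumes sc: "sep_closed TYPE('l)" and fr: "frobexp TYPE('l) q"
    and inv: "\<And>i j. i < r \<Longrightarrow> j < r \<Longrightarrow> (\<Sum>k<r. Ti i k * T k j) = (if i = j then 1 else 0)"
  obtains U V where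
    "\<And>i j. i < r \<Longrightarrow> j < r \<Longrightarrow> (\<Sum>k<r. T i k * fps_frob q (U k j)) = U i j"
    "\<And>i j. i < r \<Longrightarrow> j < r \<Longrightarrow> (\<Sum>k<r. U i k * V k j) = (if i = j then 1 else 0)"
proof -
  interpret semilinear_matrix r q "\<lambda>i j. fps_nth (T i j) 0" "\<lambda>i j. fps_nth (Ti i j) 0"
  proof
    fix i j assume "i < r" "j < r"
    then show "(\<Sum>k<r. fps_nth (Ti i k) 0 * fps_nth (T k j) 0) = (if i = j then 1 else 0)"
      using arg_cong[OF inv, of i j "\<lambda>f. fps_nth f 0"] by (simp add: fps_sum_nth)
  qed (fact sc fr)+
  obtain U0 V0 where TU0: "\<And>i j. i < r \<Longrightarrow> j < r \<Longrightarrow> (\<Sum>k<r. fps_nth (T i k) 0 * U0 k j ^ q) = U0 i j"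
    and UV0: "\<And>i j. i < r \<Longrightarrow> j < r \<Longrightarrow> (\<Sum>k<r. U0 i k * V0 k j) = (if i = j then 1 else 0)"
    by (rule lang) blast
  \<comment> \<open>The clause for n = 0 forces the invertible solution \<open>U0\<close>; the
    homogeneous equation alone would also admit 0.\<close>
  define P where "P f n M \<longleftrightarrow> (n = 0 \<longrightarrow> M = U0) \<and> (\<forall>i<r. \<forall>j<r. M i j =
      (\<Sum>l<r. fps_nth (T i l) 0 * M l j ^ q) + (\<Sum>l<r. \<Sum>k=1..n. fps_nth (T i l) k * f (n - k) l j ^ q))"
    for f n and M :: "nat \<Rightarrow> nat \<Rightarrow> 'l"
  have "\<exists>u. \<forall>n. P u n (u n)"
  proof (rule dependent_wellorder_choice)
    fix M :: "nat \<Rightarrow> nat \<Rightarrow> 'l" and f g :: "nat \<Rightarrow> nat \<Rightarrow> nat \<Rightarrow> 'l" and n :: nat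
    assume "\<And>m. m < n \<Longrightarrow> f m = g m"
    then have "(\<Sum>l<r. \<Sum>k=1..n. fps_nth (T i l) k * f (n - k) l j ^ q) =
        (\<Sum>l<r. \<Sum>k=1..n. fps_nth (T i l) k * g (n - k) l j ^ q)" for i j
      by (intro sum.cong refl) auto
    then show "P f n M = P g n M"
      by (simp only: P_def)
  next
    fix n :: nat and f :: "nat \<Rightarrow> nat \<Rightarrow> nat \<Rightarrow> 'l"
    show "\<exists>M. P f n M"
    proof (cases "n = 0")
      case True
      then show ?thesis
        by (intro exI[of _ U0]) (auto simp: P_def TU0)
    next
      case False
      have "\<forall>j. \<exists>x. \<forall>i<r. x i = (\<Sum>l<r. fps_nth (T i l) 0 * x l ^ q) +
          (\<Sum>l<r. \<Sum>k=1..n. fps_nth (T i l) k * f (n - k) l j ^ q)"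
        by (intro allI lang_affine)
      then have "\<exists>x. \<forall>j. \<forall>i<r. x j i = (\<Sum>l<r. fps_nth (T i l) 0 * x j l ^ q) +
          (\<Sum>l<r. \<Sum>k=1..n. fps_nth (T i l) k * f (n - k) l j ^ q)"
        by (rule choice)
      then obtain x where "\<forall>j. \<forall>i<r. x j i = (\<Sum>l<r. fps_nth (T i l) 0 * x j l ^ q) +
          (\<Sum>l<r. \<Sum>k=1..n. fps_nth (T i l) k * f (n - k) l j ^ q)" ..
      then have "P f n (\<lambda>i j. x j i)"
        using False unfolding P_def by blast
      then show ?thesis
        by (rule exI[of "P f n"])
    qed
  qed
  then obtain u where u: "\<forall>n. P u n (u n)" ..
  define U where "U i j = Abs_fps (\<lambda>n. u n i j)" for i j
  have TU: "(\<Sum>l<r. T i l * fps_frob q (U l j)) = U i j" if "i < r" "j < r" for i j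
  proof (rule fps_ext)
    fix n
    have "fps_nth (\<Sum>l<r. T i l * fps_frob q (U l j)) n =
        (\<Sum>l<r. \<Sum>k=0..n. fps_nth (T i l) k * u (n - k) l j ^ q)"
      by (simp add: fps_sum_nth fps_mult_nth U_def)
    also have "\<dots> = u n i j"
    proof -
      have *: "u n i j = (\<Sum>l<r. fps_nth (T i l) 0 * u n l j ^ q) +
          (\<Sum>l<r. \<Sum>k=1..n. fps_nth (T i l) k * u (n - k) l j ^ q)"
        using spec[OF u, of n] that unfolding P_def by blast
      show ?thesis
        unfolding sum_split_first sum.distrib diff_zero using *[symmetric] .
    qed
    finally show "fps_nth (\<Sum>l<r. T i l * fps_frob q (U l j)) n = fps_nth (U i j) n"
      by (simp add: U_def)
  qed
  have u0: "u 0 = U0"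
    using spec[OF u, of 0] by (simp add: P_def)
  \<comment> \<open>Recursion for the inverse: the product of \<open>U0\<close> with the n-th
    coefficient has to cancel the contributions of the earlier ones.\<close>
  define P' where "P' f n M \<longleftrightarrow> (\<forall>i<r. \<forall>j<r. (\<Sum>l<r. U0 i l * M l j) +
      (\<Sum>l<r. \<Sum>k=1..n. u k i l * f (n - k) l j) = (if n = 0 \<and> i = j then 1 else 0))"
    for f n and M :: "nat \<Rightarrow> nat \<Rightarrow> 'l"
  have "\<exists>w. \<forall>n. P' w n (w n)"
  proof (rule dependent_wellorder_choice)
    fix M :: "nat \<Rightarrow> nat \<Rightarrow> 'l" and f g :: "nat \<Rightarrow> nat \<Rightarrow> nat \<Rightarrow> 'l" and n :: nat
    assume "\<And>m. m < n \<Longrightarrow> f m = g m"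
    then have "(\<Sum>l<r. \<Sum>k=1..n. u k i l * f (n - k) l j) = (\<Sum>l<r. \<Sum>k=1..n. u k i l * g (n - k) l j)" for i j
      by (intro sum.cong refl) auto
    then show "P' f n M = P' g n M"
      by (simp only: P'_def)
  next
    fix n :: nat and f :: "nat \<Rightarrow> nat \<Rightarrow> nat \<Rightarrow> 'l"
    define b where "b i j = (if n = 0 \<and> i = j then 1 else 0) - (\<Sum>l<r. \<Sum>k=1..n. u k i l * f (n - k) l j)" for i j
    have "(\<Sum>l<r. U0 i l * (\<Sum>m<r. V0 l m * b m j)) = b i j" if "i < r" for i j
    proof -
      have "(\<Sum>l<r. U0 i l * (\<Sum>m<r. V0 l m * b m j)) = (\<Sum>m<r. (\<Sum>l<r. U0 i l * V0 l m) * b m j)"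
        unfolding sum_distrib_left sum_distrib_right mult.assoc by (rule sum.swap)
      also have "\<dots> = (\<Sum>m<r. if i = m then b m j else 0)"
        using that by (intro sum.cong) (auto simp: UV0)
      finally show ?thesis
        using that by simp
    qed
    then have "P' f n (\<lambda>l j. \<Sum>m<r. V0 l m * b m j)"
      by (auto simp: P'_def b_def)
    then show "\<exists>M. P' f n M"
      by (rule exI[of "P' f n"])
  qed
  then obtain w where w: "\<forall>n. P' w n (w n)" ..
  define V where "V i j = Abs_fps (\<lambda>n. w n i j)" for i j
  have UV: "(\<Sum>l<r. U i l * V l j) = (if i = j then 1 else 0)" if "i < r" "j < r" for i j
  proof (rule fps_ext)
    fix n
    have "fps_nth (\<Sum>l<r. U i l * V l j) n = (\<Sum>l<r. \<Sum>k=0..n. u k i l * w (n - k) l j)"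
      by (simp add: fps_sum_nth fps_mult_nth U_def V_def)
    also have "\<dots> = (\<Sum>l<r. U0 i l * w n l j) + (\<Sum>l<r. \<Sum>k=1..n. u k i l * w (n - k) l j)"
      unfolding sum_split_first sum.distrib diff_zero u0 ..
    also have "\<dots> = (if n = 0 \<and> i = j then 1 else 0)"
      using spec[OF w, of n] that unfolding P'_def by blast
    finally show "fps_nth (\<Sum>l<r. U i l * V l j) n = fps_nth (if i = j then 1 else 0) n"
      by (simp add: fps_one_nth)
  qed
  show thesis
    using that TU UV by blast
qed


section \<open>The fixed field of the Galois group\<close>

text \<open>Partial embeddings over \<open>K\<close> are handled as their graphs, so that unions of chains and
  polynomials over the graph need no function application.\<close>

definition partial_embedding :: "'l::field set \<Rightarrow> ('l \<times> 'l) set \<Rightarrow> bool"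
  where "partial_embedding K S \<longleftrightarrow> (\<forall>x\<in>K. (x, x) \<in> S) \<and>
    (\<forall>a b c d. (a, b) \<in> S \<longrightarrow> (c, d) \<in> S \<longrightarrow> (a + c, b + d) \<in> S \<and> (a * c, b * d) \<in> S) \<and>
    (\<forall>b. (0, b) \<in> S \<longrightarrow> b = 0)"

text \<open>A nonzero constant term a of p gives x p_1(x) = -a and with it the inverse; a zero
  constant term means that a factor X can be removed. This makes the domain of a partial embedding a
  field, although only sums and products are built into the definition.\<close>

lemma inverse_algebraic:
  fixes S :: "'l::field set"
  assumes "subr S" "range (Polynomial.coeff p) \<subseteq> K" "K \<subseteq> S" "\<And>a. a \<in> K \<Longrightarrow> inverse a \<in> K"
    and "p \<noteq> 0" "poly p x = 0" "x \<in> S"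
  shows "inverse x \<in> S"
  using assms(2,5,6)
proof (induction p)
  case (pCons a p)
  have a: "a \<in> K"
    using subsetD[OF pCons.prems(1) rangeI[of _ 0]] by simp
  have p: "range (Polynomial.coeff p) \<subseteq> K"
  proof clarify
    fix i
    show "Polynomial.coeff p i \<in> K"
      using subsetD[OF pCons.prems(1) rangeI[of _ "Suc i"]] by simp
  qed
  have px: "poly p x \<in> S"
    using p assms(3) unfolding poly_altdef
    by (intro subr_sum[OF assms(1)] subrD(5)[OF assms(1)] subr_power[OF assms(1)] assms(7)) auto
  show ?case
  proof (cases "a = 0")
    case False
    have "x * poly p x = - a"
      using pCons.prems(3) by (simp add: add_eq_0_iff)
    then have "- inverse a * (x * poly p x) = 1"
      using False by simp
    then have "x * (- inverse a * poly p x) = 1"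
      by (simp only: ac_simps)
    then have "inverse x = - inverse a * poly p x"
      by (rule inverse_unique)
    moreover have "- inverse a \<in> S"
      using a assms(3,4) subrD(3)[OF assms(1)] by blast
    ultimately show ?thesis
      using subrD(5)[OF assms(1) _ px, of "- inverse a"] by simp
  next
    case True
    show ?thesis
    proof (cases "x = 0")
      case True
      then show ?thesis
        using subrD(1)[OF assms(1)] by simp
    next
      case False
      then have "poly p x = 0" "p \<noteq> 0"
        using pCons.prems True by auto
      then show ?thesis
        using pCons.IH p by blast
    qed
  qed
qed simp

lemma separable_poly_dvd:
  fixes p q :: "'l::field poly"
  assumes "separable_poly p" "q dvd p"
  shows "separable_poly q"
proof -
  obtain s where p: "p = q * s"
    using assms by (auto simp: dvd_def)
  show ?thesis
    unfolding separable_poly_def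
  proof (rule coprimeI)
    fix d assume "d dvd q" "d dvd pderiv q"
    then have "d dvd p" "d dvd pderiv p"
      by (auto simp: p pderiv_mult)
    then show "is_unit d"
      using assms(1) by (meson coprime_common_divisor separable_poly_def)
  qed
qed

locale embedding_setting =
  fixes K :: "'l::field set"
  assumes subr_K: "subr K" and inverse_K: "\<And>a. a \<in> K \<Longrightarrow> inverse a \<in> K"
    and sep_closure: "is_separable_closure_of TYPE('l) K"
begin

lemma separable_annihilator:
  obtains p where "range (Polynomial.coeff p) \<subseteq> K" "separable_poly p" "poly p x = 0" "p \<noteq> 0"
proof -
  obtain p where "range (Polynomial.coeff p) \<subseteq> K" "separable_poly p" "poly p x = 0"
    using sep_closure unfolding is_separable_closure_of_def by blast
  moreover have "p \<noteq> 0"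
    using \<open>separable_poly p\<close> by (auto simp: separable_poly_def)
  ultimately show thesis
    using that by blast
qed

lemma separable_root:
  "separable_poly p \<Longrightarrow> Polynomial.degree p > 0 \<Longrightarrow> \<exists>x::'l. poly p x = 0"
  using sep_closure by (auto simp: is_separable_closure_of_def)

section \<open>Extending an embedding by one element\<close>

context
  fixes S
  assumes S: "partial_embedding K S"
begin

lemma S_K: "x \<in> K \<Longrightarrow> (x, x) \<in> S"
  and S_add: "(a, b) \<in> S \<Longrightarrow> (c, d) \<in> S \<Longrightarrow> (a + c, b + d) \<in> S"
  and S_mult: "(a, b) \<in> S \<Longrightarrow> (c, d) \<in> S \<Longrightarrow> (a * c, b * d) \<in> S"
  and S_0: "(0, b) \<in> S \<Longrightarrow> b = 0"
  using S by (auto simp: partial_embedding_def)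

lemma S_uminus: "(a, b) \<in> S \<Longrightarrow> (- a, - b) \<in> S"
  using S_mult[OF S_K[of "-1"], of a b] subrD(2,3)[OF subr_K] by simp

lemma S_diff: "(a, b) \<in> S \<Longrightarrow> (c, d) \<in> S \<Longrightarrow> (a - c, b - d) \<in> S"
  using S_add[OF _ S_uminus, of a b c d] by simp

lemma S_unique: "(a, b) \<in> S \<Longrightarrow> (a, c) \<in> S \<Longrightarrow> b = c"
  using S_0[of "b - c"] S_diff[of a b a c] by simp

lemma S_zero: "(0, 0) \<in> S" and S_one: "(1, 1) \<in> S"
  using S_K subrD[OF subr_K] by auto

lemma S_sum: "(\<And>i. i \<in> I \<Longrightarrow> (f i, g i) \<in> S) \<Longrightarrow> (sum f I, sum g I) \<in> S"
  by (induction I rule: infinite_finite_induct) (auto intro: S_add S_zero)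

lemma subr_Domain: "subr (Domain S)"
proof (unfold subr_def, intro conjI ballI)
  show "0 \<in> Domain S" "1 \<in> Domain S"
    by (rule DomainI, rule S_zero, rule DomainI, rule S_one)
  fix x assume "x \<in> Domain S"
  then obtain x' where x: "(x, x') \<in> S" ..
  show "- x \<in> Domain S"
    by (rule DomainI, rule S_uminus, rule x)
  fix y assume "y \<in> Domain S"
  then obtain y' where y: "(y, y') \<in> S" ..
  show "x + y \<in> Domain S"
    by (rule DomainI, rule S_add, rule x, rule y)
  show "x * y \<in> Domain S"
    by (rule DomainI, rule S_mult, rule x, rule y)
qed

lemma inverse_Domain:
  assumes "a \<in> Domain S"
  shows "inverse a \<in> Domain S"
proof -
  obtain p where p: "range (Polynomial.coeff p) \<subseteq> K" "separable_poly p" "poly p a = 0" "p \<noteq> 0"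
    by (rule separable_annihilator)
  have "K \<subseteq> Domain S"
    by (rule subsetI) (rule DomainI[OF S_K])
  with subr_Domain p(1) show ?thesis
    using inverse_K p(4,3) assms by (rule inverse_algebraic)
qed

text \<open>The graph of the map that the embedding induces on polynomials over its domain.\<close>

definition poly_pairs :: "('l poly \<times> 'l poly) set"
  where "poly_pairs = {(p, p'). \<forall>i. (Polynomial.coeff p i, Polynomial.coeff p' i) \<in> S}"

lemma poly_pairs_add: "(p, p') \<in> poly_pairs \<Longrightarrow> (s, s') \<in> poly_pairs \<Longrightarrow> (p + s, p' + s') \<in> poly_pairs"
  by (simp add: poly_pairs_def S_add)

lemma poly_pairs_diff: "(p, p') \<in> poly_pairs \<Longrightarrow> (s, s') \<in> poly_pairs \<Longrightarrow> (p - s, p' - s') \<in> poly_pairs"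
  by (simp add: poly_pairs_def S_diff)

lemma poly_pairs_mult: "(p, p') \<in> poly_pairs \<Longrightarrow> (s, s') \<in> poly_pairs \<Longrightarrow> (p * s, p' * s') \<in> poly_pairs"
  by (simp add: poly_pairs_def coeff_mult S_sum S_mult)

lemma poly_pairs_monom: "(a, b) \<in> S \<Longrightarrow> (Polynomial.monom a n, Polynomial.monom b n) \<in> poly_pairs"
  by (simp add: poly_pairs_def S_zero)

lemma poly_pairs_0: "(0, p') \<in> poly_pairs \<Longrightarrow> p' = 0"
  by (rule poly_eqI) (auto simp: poly_pairs_def intro: S_0)

lemma poly_pairs_zero: "(0, 0) \<in> poly_pairs"
  by (simp add: poly_pairs_def S_zero)

lemma poly_pairs_K: "range (Polynomial.coeff p) \<subseteq> K \<Longrightarrow> (p, p) \<in> poly_pairs"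
  by (auto simp: poly_pairs_def intro: S_K)

lemma poly_pairs_degree: "(p, p') \<in> poly_pairs \<Longrightarrow> Polynomial.degree p' \<le> Polynomial.degree p"
proof (rule degree_le, intro allI impI)
  fix i assume "(p, p') \<in> poly_pairs" "Polynomial.degree p < i"
  then have "(0, Polynomial.coeff p' i) \<in> S"
    unfolding poly_pairs_def by (metis (mono_tags, lifting) case_prodD coeff_eq_0 mem_Collect_eq)
  then show "Polynomial.coeff p' i = 0"
    by (rule S_0)
qed

text \<open>Euclidean division by a monic polynomial, carried out on a polynomial and its image at
  once. Degrees are measured in the first component; the second is carried along.\<close>

lemma poly_pairs_div:
  assumes m: "(m, m') \<in> poly_pairs" "Polynomial.lead_coeff m = 1" and p: "(p, p') \<in> poly_pairs"
  shows "\<exists>s s' t t'. (s, s') \<in> poly_pairs \<and> (t, t') \<in> poly_pairs \<and> p = s * m + t \<and> p' = s' * m' + t' \<and>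
    (t = 0 \<or> Polynomial.degree t < Polynomial.degree m)"
  using p
proof (induction "Polynomial.degree p" arbitrary: p p' rule: less_induct)
  case less
  show ?case
  proof (cases "p = 0 \<or> Polynomial.degree p < Polynomial.degree m")
    case True
    then show ?thesis
      using less.prems poly_pairs_zero
      by (intro exI[of _ 0] exI[of _ p] exI[of _ p']) auto
  next
    case False
    define n where "n = Polynomial.degree p"
    define d where "d = n - Polynomial.degree m"
    define a where "a = Polynomial.coeff p n"
    define b where "b = Polynomial.coeff p' n"
    have dn: "n = d + Polynomial.degree m"
      using False by (simp add: d_def n_def)
    have ab: "(Polynomial.monom a d, Polynomial.monom b d) \<in> poly_pairs"
      using less.prems by (intro poly_pairs_monom) (auto simp: poly_pairs_def a_def b_def)
    define u where "u = p - Polynomial.monom a d * m"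
    define u' where "u' = p' - Polynomial.monom b d * m'"
    have u: "(u, u') \<in> poly_pairs"
      unfolding u_def u'_def by (intro poly_pairs_diff poly_pairs_mult less.prems ab m)
    have a0: "a \<noteq> 0"
      using False by (simp add: a_def n_def)
    have m0: "m \<noteq> 0"
      using m(2) by auto
    have deg_am: "Polynomial.degree (Polynomial.monom a d * m) = n"
      using a0 m0 by (simp add: degree_mult_eq degree_monom_eq dn monom_eq_0_iff)
    have "Polynomial.coeff (Polynomial.monom a d * m) n = a"
      using lead_coeff_mult[of "Polynomial.monom a d" m] deg_am m(2) a0
      by (simp add: degree_monom_eq)
    then have un: "Polynomial.coeff u n = 0"
      by (simp add: u_def a_def)
    have "Polynomial.degree u \<le> n"
      unfolding u_def using deg_am by (intro degree_diff_le) (auto simp: n_def)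
    then have "u = 0 \<or> Polynomial.degree u < n"
      using un by (metis leading_coeff_0_iff le_neq_implies_less)
    then obtain s s' t t' where st: "(s, s') \<in> poly_pairs" "(t, t') \<in> poly_pairs" "u = s * m + t"
      "u' = s' * m' + t'" "t = 0 \<or> Polynomial.degree t < Polynomial.degree m"
    proof
      assume "u = 0"
      then have "u' = 0"
        using u poly_pairs_0 by blast
      then show ?thesis
        using \<open>u = 0\<close> poly_pairs_zero that[of 0 0 0 0] by simp
    next
      assume "Polynomial.degree u < n"
      then show ?thesis
        using less.hyps[OF _ u] that unfolding n_def by blast
    qed
    have "p = (Polynomial.monom a d + s) * m + t" "p' = (Polynomial.monom b d + s') * m' + t'"
      using st(3,4) by (simp_all add: u_def u'_def algebra_simps)
    then show ?thesis
      using st(2,5) poly_pairs_add[OF ab st(1)] by blast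
  qed
qed

text \<open>The minimal polynomial of \<open>y\<close> over the domain of \<open>S\<close>, together
  with its image under the embedding.\<close>

definition minimal_pair :: "'l \<Rightarrow> 'l poly \<Rightarrow> 'l poly \<Rightarrow> bool"
  where "minimal_pair y m m' \<longleftrightarrow> (m, m') \<in> poly_pairs \<and> Polynomial.lead_coeff m = 1 \<and> poly m y = 0 \<and>
    (\<forall>(p, p')\<in>poly_pairs. poly p y = 0 \<and> p \<noteq> 0 \<longrightarrow> Polynomial.degree m \<le> Polynomial.degree p)"

text \<open>An annihilating pair of least degree becomes monic after multiplication by the inverse
  of the leading coefficient, which the domain contains.\<close>

lemma minimal_pair_exists: "\<exists>m m'. minimal_pair y m m'"
proof -
  define Z where "Z p \<longleftrightarrow> fst p \<noteq> 0 \<and> poly (fst p) y = 0 \<and> p \<in> poly_pairs" for p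
  obtain p0 where "range (Polynomial.coeff p0) \<subseteq> K" "separable_poly p0" "poly p0 y = 0" "p0 \<noteq> 0"
    by (rule separable_annihilator)
  then have "Z (p0, p0)"
    by (simp add: Z_def poly_pairs_K)
  then obtain p where p: "Z p" "\<And>s. Z s \<Longrightarrow> Polynomial.degree (fst p) \<le> Polynomial.degree (fst s)"
    using ex_has_least_nat[of Z "(p0, p0)" "\<lambda>p. Polynomial.degree (fst p)"] by metis
  define a where "a = Polynomial.lead_coeff (fst p)"
  have a0: "a \<noteq> 0"
    using p(1) by (simp add: a_def Z_def)
  have "a \<in> Domain S"
    using p(1) by (cases p) (auto simp: a_def Z_def poly_pairs_def Domain_iff)
  then obtain b where b: "(inverse a, b) \<in> S"
    using inverse_Domain by blast
  have "(Polynomial.monom (inverse a) 0 * fst p, Polynomial.monom b 0 * snd p) \<in> poly_pairs"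
    using p(1) b by (intro poly_pairs_mult poly_pairs_monom) (auto simp: Z_def)
  moreover have "Polynomial.monom (inverse a) 0 * fst p = Polynomial.smult (inverse a) (fst p)"
    by (simp add: monom_0)
  ultimately have "(Polynomial.smult (inverse a) (fst p), Polynomial.monom b 0 * snd p) \<in> poly_pairs"
    by simp
  moreover have "Polynomial.lead_coeff (Polynomial.smult (inverse a) (fst p)) = 1"
    using a0 unfolding lead_coeff_smult by (simp add: a_def)
  moreover have "poly (Polynomial.smult (inverse a) (fst p)) y = 0"
    using p(1) by (simp add: Z_def)
  moreover have "Polynomial.degree (Polynomial.smult (inverse a) (fst p)) \<le> Polynomial.degree s"
    if "(s, s') \<in> poly_pairs" "poly s y = 0 \<and> s \<noteq> 0" for s s'
    using p(2)[of "(s, s')"] that a0 by (simp add: Z_def)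
  ultimately have "minimal_pair y (Polynomial.smult (inverse a) (fst p)) (Polynomial.monom b 0 * snd p)"
    unfolding minimal_pair_def by blast
  then show ?thesis
    by blast
qed

text \<open>This makes the assignment of p'(y') to p(y) well defined when y' is a root of m': the
  remainder of p by m vanishes at y, hence is 0 by minimality, and so is its image.\<close>

lemma minimal_pair_div:
  assumes m: "minimal_pair y m m'" and p: "(p, p') \<in> poly_pairs" "poly p y = 0"
  shows "m' dvd p'"
proof -
  have mD: "(m, m') \<in> poly_pairs" "Polynomial.lead_coeff m = 1" "poly m y = 0"
    "\<And>s s'. (s, s') \<in> poly_pairs \<Longrightarrow> poly s y = 0 \<and> s \<noteq> 0 \<Longrightarrow> Polynomial.degree m \<le> Polynomial.degree s"
    using m unfolding minimal_pair_def by blast+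
  obtain s s' t t' where st: "(s, s') \<in> poly_pairs" "(t, t') \<in> poly_pairs" "p = s * m + t"
    "p' = s' * m' + t'" "t = 0 \<or> Polynomial.degree t < Polynomial.degree m"
    using poly_pairs_div[OF mD(1,2) p(1)] by (elim exE conjE)
  have "poly t y = 0"
    using p(2) mD(3) by (simp add: st(3))
  then have "t = 0"
    using mD(4)[OF st(2)] st(5) by linarith
  then have "t' = 0"
    using st(2) poly_pairs_0 by blast
  then show ?thesis
    using st(4) by simp
qed

text \<open>\<open>y\<close> is a root of a separable polynomial over \<open>K\<close>, which the
  embedding leaves unchanged, so m' divides it. Hence m' has a root to which \<open>y\<close> can be
  sent.\<close>

lemma minimal_pair_separable:
  assumes m: "minimal_pair y m m'"
  shows "separable_poly m'" "Polynomial.degree m' = Polynomial.degree m" "Polynomial.degree m > 0"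
proof -
  obtain p where p: "range (Polynomial.coeff p) \<subseteq> K" "separable_poly p" "poly p y = 0" "p \<noteq> 0"
    by (rule separable_annihilator)
  then have "m' dvd p"
    using minimal_pair_div[OF m poly_pairs_K] by blast
  then show "separable_poly m'"
    using p separable_poly_dvd by blast
  have "(Polynomial.lead_coeff m, Polynomial.coeff m' (Polynomial.degree m)) \<in> S"
    using m unfolding minimal_pair_def poly_pairs_def by blast
  then have "Polynomial.coeff m' (Polynomial.degree m) = 1"
    using m S_one S_unique by (auto simp: minimal_pair_def)
  then show "Polynomial.degree m' = Polynomial.degree m"
    using poly_pairs_degree[of m m'] m le_degree[of m' "Polynomial.degree m"]
    by (auto simp: minimal_pair_def)
  show "Polynomial.degree m > 0"
  proof (rule ccontr)
    assume "\<not> ?thesis"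
    then obtain c where c: "m = [:c:]"
      by (metis degree_eq_zeroE neq0_conv)
    then show False
      using m by (auto simp: minimal_pair_def)
  qed
qed

lemma extend_embedding:
  assumes m: "minimal_pair y m m'" and y': "poly m' y' = 0"
  obtains S' where "partial_embedding K S'" "S \<subseteq> S'" "(y, y') \<in> S'"
proof -
  \<comment> \<open>The values p(y) paired with p'(y'): the ring generated by \<open>y\<close> over
    the old domain, embedded by sending y to y'.\<close>
  define S' where "S' = (\<lambda>(p, p'). (poly p y, poly p' y')) ` poly_pairs"
  have S'I: "(p, p') \<in> poly_pairs \<Longrightarrow> (poly p y, poly p' y') \<in> S'" for p p'
    by (force simp: S'_def)
  have S'E: "\<exists>p p'. (p, p') \<in> poly_pairs \<and> a = poly p y \<and> b = poly p' y'" if "(a, b) \<in> S'" for a b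
    using that by (auto simp: S'_def)
  have sub: "S \<subseteq> S'"
  proof clarify
    fix a b assume "(a, b) \<in> S"
    then show "(a, b) \<in> S'"
      using S'I[OF poly_pairs_monom, of a b 0] by (simp add: poly_monom)
  qed
  have "(y, y') \<in> S'"
    using S'I[OF poly_pairs_monom, of 1 1 1] S_one by (simp add: poly_monom)
  moreover have "partial_embedding K S'"
    unfolding partial_embedding_def
  proof (intro conjI allI impI ballI)
    fix x assume "x \<in> K"
    then show "(x, x) \<in> S'"
      using sub S_K by blast
  next
    fix a b c d assume "(a, b) \<in> S'" "(c, d) \<in> S'"
    then obtain p p' s s' where "(p, p') \<in> poly_pairs" "a = poly p y" "b = poly p' y'"
      "(s, s') \<in> poly_pairs" "c = poly s y" "d = poly s' y'"
      using S'E by meson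
    then show "(a + c, b + d) \<in> S'" "(a * c, b * d) \<in> S'"
      using S'I[OF poly_pairs_add, of p p' s s'] S'I[OF poly_pairs_mult, of p p' s s'] by auto
  next
    fix b assume "(0, b) \<in> S'"
    then obtain p p' where p: "(p, p') \<in> poly_pairs" "poly p y = 0" "b = poly p' y'"
      using S'E by metis
    then have "m' dvd p'"
      using minimal_pair_div[OF m] by blast
    then show "b = 0"
      using y' p(3) by (auto simp: dvd_def)
  qed
  ultimately show thesis
    using that sub by blast
qed

end

text \<open>A maximal embedding, given by Zorn's lemma, is total, since it can be extended to any
  further element.\<close>

lemma partial_embedding_total:
  assumes "partial_embedding K S0"
  obtains S where "partial_embedding K S" "S0 \<subseteq> S" "Domain S = UNIV"
proof -
  define \<A> where "\<A> = {S. partial_embedding K S \<and> S0 \<subseteq> S}"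
  have "\<exists>M\<in>\<A>. \<forall>N\<in>\<A>. M \<subseteq> N \<longrightarrow> N = M"
  proof (rule subset_Zorn_nonempty)
    show "\<A> \<noteq> {}"
      using assms by (auto simp: \<A>_def)
  next
    fix \<C> assume \<C>: "\<C> \<noteq> {}" "subset.chain \<A> \<C>"
    then have pe: "partial_embedding K S" "S0 \<subseteq> S" if "S \<in> \<C>" for S
      using that by (auto simp: subset_chain_def \<A>_def)
    have two: "\<exists>S\<in>\<C>. x \<in> S \<and> y \<in> S" if "x \<in> \<Union>\<C>" "y \<in> \<Union>\<C>" for x y
      using that \<C>(2) unfolding subset_chain_def by blast
    have "partial_embedding K (\<Union>\<C>)"
      unfolding partial_embedding_def
    proof (intro conjI allI impI ballI)
      fix x assume "x \<in> K"
      then show "(x, x) \<in> \<Union>\<C>"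
        using \<C>(1) pe(1) S_K by blast
    next
      fix a b c d assume "(a, b) \<in> \<Union>\<C>" "(c, d) \<in> \<Union>\<C>"
      then obtain S where "S \<in> \<C>" "(a, b) \<in> S" "(c, d) \<in> S"
        using two by blast
      then show "(a + c, b + d) \<in> \<Union>\<C>" "(a * c, b * d) \<in> \<Union>\<C>"
        using S_add[OF pe(1)] S_mult[OF pe(1)] by blast+
    next
      fix b assume "(0, b) \<in> \<Union>\<C>"
      then show "b = 0"
        using S_0 pe(1) by blast
    qed
    moreover have "S0 \<subseteq> \<Union>\<C>"
      using \<C>(1) pe(2) by blast
    ultimately show "\<Union>\<C> \<in> \<A>"
      by (simp add: \<A>_def)
  qed
  then obtain S where SA: "S \<in> \<A>" and maxA: "\<forall>N\<in>\<A>. S \<subseteq> N \<longrightarrow> N = S" ..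
  then have S: "partial_embedding K S" "S0 \<subseteq> S"
    by (auto simp: \<A>_def)
  have max: "N = S" if "partial_embedding K N" "S \<subseteq> N" for N
    using maxA that S(2) by (auto simp: \<A>_def)
  have "y \<in> Domain S" for y
  proof -
    obtain m m' where m: "minimal_pair S y m m'"
      using minimal_pair_exists[OF S(1), of y] by (elim exE)
    obtain y' where "poly m' y' = 0"
      using separable_root[OF minimal_pair_separable(1)[OF S(1) m]] minimal_pair_separable(2,3)[OF S(1) m]
      by auto
    then obtain S' where S': "partial_embedding K S'" "S \<subseteq> S'" "(y, y') \<in> S'"
      by (rule extend_embedding[OF S(1) m])
    then show ?thesis
      using max[OF S'(1,2)] by (auto intro: DomainI)
  qed
  then have "UNIV = Domain S"
    by (rule UNIV_eq_I)
  then show thesis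
    using that[OF S] by simp
qed

end

section \<open>Automorphisms and the fixed field\<close>

context embedding_setting
begin

text \<open>Surjectivity is the issue: every element is a root of a nonzero polynomial over
  \<open>K\<close>, and the injective map permutes the finitely many roots of that
  polynomial.\<close>

lemma total_embedding_galois:
  assumes S: "partial_embedding K S" "Domain S = UNIV"
  obtains g where "g \<in> galois_group K" "\<And>x y. (x, y) \<in> S \<Longrightarrow> g x = y"
proof -
  define g where "g x = (SOME y. (x, y) \<in> S)" for x
  have gS: "(x, g x) \<in> S" for x
  proof -
    have "x \<in> Domain S"
      unfolding S(2) by (rule UNIV_I)
    then obtain y where "(x, y) \<in> S" ..
    then show ?thesis
      unfolding g_def by (rule someI)
  qed
  have g: "g x = y" if "(x, y) \<in> S" for x y
    using S_unique[OF S(1) gS that] .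
  have gK: "g x = x" if "x \<in> K" for x
    using S_K[OF S(1) that] by (rule g)
  have add: "g (x + y) = g x + g y" and mult: "g (x * y) = g x * g y" for x y
    using S_add[OF S(1) gS gS] S_mult[OF S(1) gS gS] by (auto intro: g)
  have g0: "g 0 = 0" and g1: "g 1 = 1"
    using gK subrD[OF subr_K] by auto
  have diff: "g (x - y) = g x - g y" for x y
    using S_diff[OF S(1) gS gS] by (auto intro: g)
  have "inj g"
  proof (rule injI)
    fix x y assume "g x = g y"
    then have *: "g (x - y) = 0"
      by (simp add: diff)
    show "x = y"
    proof (rule ccontr)
      assume "x \<noteq> y"
      then have "g ((x - y) * inverse (x - y)) = 1"
        by (simp add: g1)
      then show False
        unfolding mult * by simp
    qed
  qed
  have "surj g"
  proof -
    have "y \<in> range g" for y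
    proof -
      obtain p where p: "range (Polynomial.coeff p) \<subseteq> K" "separable_poly p" "poly p y = 0" "p \<noteq> 0"
        by (rule separable_annihilator)
      have gsum: "g (sum f I) = (\<Sum>i\<in>I. g (f i))" for f :: "nat \<Rightarrow> 'l" and I
        by (induction I rule: infinite_finite_induct) (simp_all add: g0 add)
      have gpow: "g (x ^ n) = g x ^ n" for x n
        by (induction n) (simp_all add: g1 mult)
      have "poly p (g x) = g (poly p x)" for x
      proof -
        have "g (Polynomial.coeff p i) = Polynomial.coeff p i" for i
          using p(1) gK by blast
        then show ?thesis
          by (simp add: poly_altdef gsum mult gpow)
      qed
      then have "g ` {x. poly p x = 0} \<subseteq> {x. poly p x = 0}"
        by (auto simp: g0)
      moreover have "finite {x. poly p x = 0}"
        by (rule poly_roots_finite[OF p(4)])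
      ultimately have "g ` {x. poly p x = 0} = {x. poly p x = 0}"
        using endo_inj_surj[of "{x. poly p x = 0}" g] \<open>inj g\<close> by (auto simp: inj_on_def)
      then show ?thesis
        using p(3) by blast
    qed
    then show ?thesis
      by blast
  qed
  then have "g \<in> galois_group K"
    using \<open>inj g\<close> gK
    by (auto simp: galois_group_def bij_def Ring.ring_hom_def ring_of_type_algebra_def add mult g1)
  then show thesis
    using g by (rule that)
qed

text \<open>An element outside \<open>K\<close> has a separable minimal polynomial of degree at
  least 2, hence a second root. Sending it there and extending gives an automorphism that moves
  it.\<close>

lemma galois_fixed_field:
  assumes "\<And>g. g \<in> galois_group K \<Longrightarrow> g x = x"
  shows "x \<in> K"
proof (rule ccontr)
  assume x: "x \<notin> K"
  \<comment> \<open>The identity of \<open>K\<close> as a partial embedding; both components of a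
    polynomial pair then agree.\<close>
  define S where "S = {(a, a) | a. a \<in> K}"
  have S: "partial_embedding K S"
    using subrD(1)[OF subr_K] subrD(4)[OF subr_K] subrD(5)[OF subr_K]
    unfolding partial_embedding_def S_def by fast
  obtain m m' where m: "minimal_pair S x m m'"
    using minimal_pair_exists[OF S, of x] by (elim exE)
  have pair: "(m, m') \<in> poly_pairs S" and mx: "poly m x = 0" and lc: "Polynomial.lead_coeff m = 1"
    using m by (auto simp: minimal_pair_def[OF S])
  have "(Polynomial.coeff m i, Polynomial.coeff m' i) \<in> S" for i
    using pair unfolding poly_pairs_def[OF S] by blast
  then have mm': "m' = m" and mK: "Polynomial.coeff m i \<in> K" for i
    by (auto simp: S_def intro!: poly_eqI)
  have sep: "separable_poly m"
    using minimal_pair_separable(1)[OF S m] mm' by simp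
  obtain m1 where m1: "m = [:- x, 1:] * m1"
    using mx by (auto simp: poly_eq_0_iff_dvd dvd_def)
  have "m1 \<noteq> 0"
    using m1 lc by auto
  have "Polynomial.degree m1 > 0"
  proof (rule ccontr)
    assume "\<not> ?thesis"
    then obtain c where c: "m1 = [:c:]"
      by (metis degree_eq_zeroE neq0_conv)
    then have "c = 1"
      using lc m1 \<open>m1 \<noteq> 0\<close> by auto
    then have "m = [:- x, 1:]"
      using m1 c by simp
    then have "- x \<in> K"
      using mK[of 0] by simp
    then show False
      using x subrD(3)[OF subr_K, of "- x"] by simp
  qed
  moreover have "separable_poly m1"
  proof (rule separable_poly_dvd[OF sep])
    show "m1 dvd m"
      by (subst m1) (rule dvd_triv_right)
  qed
  ultimately obtain x' where x': "poly m1 x' = 0"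
    using separable_root[of m1] by auto
  \<comment> \<open>A repeated root would be shared with the derivative, against
    separability.\<close>
  have "x' \<noteq> x"
  proof
    assume "x' = x"
    then have "poly (pderiv m) x = 0"
      using x' by (subst m1) (simp add: pderiv_diff pderiv_smult pderiv_pCons)
    then have "[:- x, 1:] dvd pderiv m" "[:- x, 1:] dvd m"
      using mx by (auto simp: poly_eq_0_iff_dvd)
    then have "is_unit [:- x, 1:]"
      using coprime_common_divisor[OF sep[unfolded separable_poly_def]] by simp
    then show False
      by (simp add: is_unit_poly_iff)
  qed
  have "poly m' x' = 0"
    unfolding mm' using x' by (subst m1) simp
  then obtain S' where S': "partial_embedding K S'" "S \<subseteq> S'" "(x, x') \<in> S'"
    by (rule extend_embedding[OF S m])
  obtain S'' where S'': "partial_embedding K S''" "S' \<subseteq> S''" "Domain S'' = UNIV"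
    by (rule partial_embedding_total[OF S'(1)])
  obtain g where g: "g \<in> galois_group K" "\<And>x y. (x, y) \<in> S'' \<Longrightarrow> g x = y"
    by (rule total_embedding_galois[OF S''(1,3)]) blast
  have "g x = x'"
    using S'(3) S''(2) by (intro g(2)) blast
  then show False
    using assms[OF g(1)] \<open>x' \<noteq> x\<close> by simp
qed

end


section \<open>Free modules in coordinates\<close>

text \<open>Entries are taken in the ambient field, and the coefficient ring is only a condition on
  them. A matrix thus stays literally the same under every change of rings.\<close>

definition vecs :: "'b::field set \<Rightarrow> nat \<Rightarrow> 'b vec set"
  where "vecs S n = {w \<in> carrier_vec n. \<forall>i<n. vec_index w i \<in> S}"

definition mats :: "'b::field set \<Rightarrow> nat \<Rightarrow> nat \<Rightarrow> 'b mat set"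
  where "mats S m n = {A \<in> carrier_mat m n. \<forall>i<m. \<forall>j<n. index_mat A (i, j) \<in> S}"

lemma vecsI: "w \<in> carrier_vec n \<Longrightarrow> (\<And>i. i < n \<Longrightarrow> vec_index w i \<in> S) \<Longrightarrow> w \<in> vecs S n"
  by (simp add: vecs_def)

lemma vecsD: "w \<in> vecs S n \<Longrightarrow> w \<in> carrier_vec n" "w \<in> vecs S n \<Longrightarrow> dim_vec w = n"
  "w \<in> vecs S n \<Longrightarrow> i < n \<Longrightarrow> vec_index w i \<in> S"
  by (auto simp: vecs_def)

lemma vecs_eqI: "u \<in> vecs S n \<Longrightarrow> w \<in> vecs S' n \<Longrightarrow> (\<And>i. i < n \<Longrightarrow> vec_index u i = vec_index w i) \<Longrightarrow> u = w"
  by (auto simp: vecs_def intro: eq_vecI)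

lemma matsI: "A \<in> carrier_mat m n \<Longrightarrow> (\<And>i j. i < m \<Longrightarrow> j < n \<Longrightarrow> index_mat A (i, j) \<in> S) \<Longrightarrow> A \<in> mats S m n"
  by (simp add: mats_def)

lemma matsD: "A \<in> mats S m n \<Longrightarrow> A \<in> carrier_mat m n" "A \<in> mats S m n \<Longrightarrow> dim_row A = m"
  "A \<in> mats S m n \<Longrightarrow> dim_col A = n"
  "A \<in> mats S m n \<Longrightarrow> i < m \<Longrightarrow> j < n \<Longrightarrow> index_mat A (i, j) \<in> S"
  by (auto simp: mats_def)

lemma vecs_mono: "S \<subseteq> S' \<Longrightarrow> vecs S n \<subseteq> vecs S' n"
  by (auto simp: vecs_def)

lemma mats_mono: "S \<subseteq> S' \<Longrightarrow> mats S m n \<subseteq> mats S' m n"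
  by (auto simp: mats_def)

lemma vecs_vec: "(\<And>i. i < n \<Longrightarrow> f i \<in> S) \<Longrightarrow> vec n f \<in> vecs S n"
  by (simp add: vecs_def)

lemma vecs_add:
  assumes "subr S" "u \<in> vecs S n" "w \<in> vecs S n"
  shows "u + w \<in> vecs S n"
  using vecsD[OF assms(2)] vecsD[OF assms(3)] subrD(4)[OF assms(1)] by (intro vecsI) auto

lemma vecs_smult:
  assumes "subr S" "s \<in> S" "w \<in> vecs S n"
  shows "s \<cdot>\<^sub>v w \<in> vecs S n"
  using vecsD[OF assms(3)] subrD(5)[OF assms(1,2)] by (intro vecsI) auto

lemma vecs_zero: "subr S \<Longrightarrow> 0\<^sub>v n \<in> vecs S n"
  by (intro vecsI) (auto intro: subrD)

lemma vecs_uminus: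
  assumes "subr S" "w \<in> vecs S n"
  shows "- w \<in> vecs S n"
  using vecsD[OF assms(2)] subrD(3)[OF assms(1)] by (intro vecsI) auto

lemma vecs_unit: "subr S \<Longrightarrow> unit_vec n j \<in> vecs S n"
  by (auto simp: vecs_def unit_vec_def intro: subrD)

lemma mult_mat_vec_nth:
  "A \<in> carrier_mat m n \<Longrightarrow> w \<in> carrier_vec n \<Longrightarrow> i < m \<Longrightarrow>
    vec_index (A *\<^sub>v w) i = (\<Sum>j<n. index_mat A (i, j) * vec_index w j)"
  by (auto simp: scalar_prod_def atLeast0LessThan intro!: sum.cong)

lemma mult_mat_nth:
  "A \<in> carrier_mat m n \<Longrightarrow> B \<in> carrier_mat n k \<Longrightarrow> i < m \<Longrightarrow> j < k \<Longrightarrow>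
    index_mat (A * B) (i, j) = (\<Sum>l<n. index_mat A (i, l) * index_mat B (l, j))"
  by (auto simp: scalar_prod_def atLeast0LessThan intro!: sum.cong)

lemma mats_mult_vec:
  assumes "subr S" "A \<in> mats S m n" "w \<in> vecs S n"
  shows "A *\<^sub>v w \<in> vecs S m"
proof (rule vecsI)
  show "A *\<^sub>v w \<in> carrier_vec m"
    using assms(2,3) by (auto simp: mats_def vecs_def)
  fix i assume "i < m"
  then show "vec_index (A *\<^sub>v w) i \<in> S"
    unfolding mult_mat_vec_nth[OF matsD(1)[OF assms(2)] vecsD(1)[OF assms(3)] \<open>i < m\<close>]
    using assms by (intro subr_sum subrD(5) matsD(4)[OF assms(2)] vecsD(3)[OF assms(3)]) auto
qed

lemma mats_mult:
  assumes "subr S" "A \<in> mats S m n" "B \<in> mats S n k"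
  shows "A * B \<in> mats S m k"
proof (rule matsI)
  show "A * B \<in> carrier_mat m k"
    using assms(2,3) by (auto simp: mats_def)
  fix i j assume ij: "i < m" "j < k"
  show "index_mat (A * B) (i, j) \<in> S"
    unfolding mult_mat_nth[OF matsD(1)[OF assms(2)] matsD(1)[OF assms(3)] ij]
    using assms ij by (intro subr_sum subrD(5) matsD(4)[OF assms(2)] matsD(4)[OF assms(3)]) auto
qed

lemma mats_one: "subr S \<Longrightarrow> 1\<^sub>m n \<in> mats S n n"
  by (auto simp: mats_def one_mat_def intro: subrD)

lemma mult_mat_unit_vec:
  fixes A :: "'a::comm_ring_1 mat"
  assumes "A \<in> carrier_mat m n" "j < n"
  shows "A *\<^sub>v unit_vec n j = col A j"
proof (rule eq_vecI)
  fix i assume "i < dim_vec (col A j)"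
  then have i: "i < m"
    using assms by simp
  have "vec_index (A *\<^sub>v unit_vec n j) i = (\<Sum>k<n. index_mat A (i, k) * vec_index (unit_vec n j) k)"
    using assms(1) i by (intro mult_mat_vec_nth) auto
  also have "\<dots> = (\<Sum>k<n. if k = j then index_mat A (i, k) else 0)"
    using assms by (intro sum.cong) (auto simp: unit_vec_def)
  finally show "vec_index (A *\<^sub>v unit_vec n j) i = vec_index (col A j) i"
    using assms i by simp
qed (use assms in auto)

text \<open>Vectors over \<open>S\<close> suffice because the unit vectors are among them. The
  matrices themselves may have entries outside \<open>S\<close>; this is used with \<open>S\<close>
  the ring of Frobenius-fixed series.\<close>

lemma mat_eq_by_vecs:
  assumes "subr S" "A \<in> carrier_mat m n" "B \<in> carrier_mat m n" "\<And>w. w \<in> vecs S n \<Longrightarrow> A *\<^sub>v w = B *\<^sub>v w"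
  shows "A = B"
proof (rule eq_matI)
  fix i j assume "i < dim_row B" "j < dim_col B"
  then have ij: "i < m" "j < n"
    using assms by auto
  have "col A j = col B j"
    using assms(4)[OF vecs_unit[OF assms(1)], of j] assms(2,3) ij by (simp add: mult_mat_unit_vec)
  then have "vec_index (col A j) i = vec_index (col B j) i"
    by simp
  then show "index_mat A (i, j) = index_mat B (i, j)"
    using assms(2,3) ij by simp
qed (use assms in auto)

section \<open>Modules with coordinates\<close>

lemma sub_ring_simps [simp]:
  "carrier (sub_ring S) = S" "monoid.mult (sub_ring S) = (\<lambda>x y. x * y)" "one (sub_ring S) = 1"
  "ring.zero (sub_ring S) = 0" "add (sub_ring S) = (\<lambda>x y. x + y)"
  by (simp_all add: ring_of_type_algebra_def)

lemma cring_sub_ring: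
  assumes "subr S"
  shows "cring (sub_ring S)"
proof (rule cringI)
  have "\<exists>y\<in>S. y + x = 0" if "x \<in> S" for x
    using subrD(3)[OF assms that] by (intro bexI[of _ "- x"]) auto
  then show "abelian_group (sub_ring S)"
    by (intro abelian_groupI) (auto simp: subrD[OF assms] algebra_simps)
  show "Group.comm_monoid (sub_ring S)"
    by (intro comm_monoidI) (auto simp: subrD[OF assms] algebra_simps)
qed (auto simp: algebra_simps)

text \<open>A linear isomorphism from S^n onto \<open>P\<close>. Because \<open>P\<close> is a mere
  record, its zero is pinned down too; for a subring \<open>S\<close> all module axioms for
  \<open>P\<close> are then transported from S^n.\<close>

definition coordz :: "'b::field set \<Rightarrow> nat \<Rightarrow> ('b, 'p) module \<Rightarrow> ('b vec \<Rightarrow> 'p) \<Rightarrow> bool"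
  where "coordz S n P \<kappa> \<longleftrightarrow> bij_betw \<kappa> (vecs S n) (carrier P) \<and>
    (\<forall>u\<in>vecs S n. \<forall>w\<in>vecs S n. \<kappa> (u + w) = \<kappa> u \<oplus>\<^bsub>P\<^esub> \<kappa> w) \<and>
    (\<forall>s\<in>S. \<forall>w\<in>vecs S n. \<kappa> (s \<cdot>\<^sub>v w) = s \<odot>\<^bsub>P\<^esub> \<kappa> w) \<and> \<zero>\<^bsub>P\<^esub> = \<kappa> (0\<^sub>v n)"

lemma coordzD:
  assumes "coordz S n P \<kappa>"
  shows "w \<in> vecs S n \<Longrightarrow> \<kappa> w \<in> carrier P"
    "u \<in> vecs S n \<Longrightarrow> w \<in> vecs S n \<Longrightarrow> \<kappa> u = \<kappa> w \<longleftrightarrow> u = w"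
    "u \<in> vecs S n \<Longrightarrow> w \<in> vecs S n \<Longrightarrow> \<kappa> u \<oplus>\<^bsub>P\<^esub> \<kappa> w = \<kappa> (u + w)"
    "s \<in> S \<Longrightarrow> w \<in> vecs S n \<Longrightarrow> s \<odot>\<^bsub>P\<^esub> \<kappa> w = \<kappa> (s \<cdot>\<^sub>v w)"
    "\<zero>\<^bsub>P\<^esub> = \<kappa> (0\<^sub>v n)"
    "x \<in> carrier P \<Longrightarrow> \<exists>w\<in>vecs S n. x = \<kappa> w"
  using assms unfolding coordz_def bij_betw_def by (auto simp: inj_on_eq_iff)

definition crd :: "'b::field set \<Rightarrow> nat \<Rightarrow> ('b vec \<Rightarrow> 'p) \<Rightarrow> 'p \<Rightarrow> 'b vec"
  where "crd S n \<kappa> = inv_into (vecs S n) \<kappa>"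

lemma crd:
  assumes "coordz S n P \<kappa>"
  shows "w \<in> vecs S n \<Longrightarrow> crd S n \<kappa> (\<kappa> w) = w"
    "x \<in> carrier P \<Longrightarrow> crd S n \<kappa> x \<in> vecs S n"
    "x \<in> carrier P \<Longrightarrow> \<kappa> (crd S n \<kappa> x) = x"
  using assms unfolding coordz_def bij_betw_def crd_def
  by (auto simp: inv_into_f_f f_inv_into_f inv_into_into)

lemma coordz_abelian_group:
  assumes c: "coordz S n P \<kappa>" and S: "subr S"
  shows "abelian_group P"
proof (rule abelian_groupI)
  note [simp] = coordzD(3)[OF c]
  fix x assume "x \<in> carrier P"
  then obtain u where u: "u \<in> vecs S n" "x = \<kappa> u"
    using coordzD(6)[OF c] by blast
  show "\<zero>\<^bsub>P\<^esub> \<oplus>\<^bsub>P\<^esub> x = x"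
    using u vecs_zero[OF S] vecsD(1)[OF u(1)] by (simp add: coordzD(5)[OF c])
  have "- u + u = 0\<^sub>v n"
    using vecsD(1)[OF u(1)] by auto
  then have "\<kappa> (- u) \<oplus>\<^bsub>P\<^esub> x = \<zero>\<^bsub>P\<^esub>"
    using u vecs_uminus[OF S u(1)] by (simp add: coordzD(5)[OF c])
  then show "\<exists>y\<in>carrier P. y \<oplus>\<^bsub>P\<^esub> x = \<zero>\<^bsub>P\<^esub>"
    using coordzD(1)[OF c vecs_uminus[OF S u(1)]] by blast
  fix y assume "y \<in> carrier P"
  then obtain w where w: "w \<in> vecs S n" "y = \<kappa> w"
    using coordzD(6)[OF c] by blast
  show "x \<oplus>\<^bsub>P\<^esub> y \<in> carrier P"
    using u w coordzD(1)[OF c vecs_add[OF S]] by simp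
  show "x \<oplus>\<^bsub>P\<^esub> y = y \<oplus>\<^bsub>P\<^esub> x"
    using u w comm_add_vec[OF vecsD(1)[OF u(1)] vecsD(1)[OF w(1)]] by simp
  fix z assume "z \<in> carrier P"
  then obtain t where t: "t \<in> vecs S n" "z = \<kappa> t"
    using coordzD(6)[OF c] by blast
  show "x \<oplus>\<^bsub>P\<^esub> y \<oplus>\<^bsub>P\<^esub> z = x \<oplus>\<^bsub>P\<^esub> (y \<oplus>\<^bsub>P\<^esub> z)"
    using u w t assoc_add_vec[OF vecsD(1)[OF u(1)] vecsD(1)[OF w(1)] vecsD(1)[OF t(1)]]
    by (simp add: vecs_add[OF S])
qed (use coordzD(1)[OF c vecs_zero[OF S]] in \<open>simp add: coordzD(5)[OF c]\<close>)

lemma coordz_finsum: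
  assumes c: "coordz S n P \<kappa>" and S: "subr S" and w: "\<And>a. a \<in> A \<Longrightarrow> w a \<in> vecs S n" and "finite A"
    and g: "\<And>a. a \<in> A \<Longrightarrow> g a = \<kappa> (w a)"
  shows "finsum P g A = \<kappa> (vec n (\<lambda>i. \<Sum>a\<in>A. vec_index (w a) i))"
  using \<open>finite A\<close> w g
proof (induction A rule: finite_induct)
  case empty
  interpret abelian_group P
    by (rule coordz_abelian_group[OF c S])
  have "vec n (\<lambda>i. 0 :: 'a) = 0\<^sub>v n"
    by (intro eq_vecI) auto
  then show ?case
    by (simp add: coordzD(5)[OF c])
next
  case (insert a A)
  interpret abelian_group P
    by (rule coordz_abelian_group[OF c S])
  have wa: "w a \<in> vecs S n" and wA: "\<And>b. b \<in> A \<Longrightarrow> w b \<in> vecs S n"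
    using insert.prems by auto
  have sum: "vec n (\<lambda>i. \<Sum>a\<in>A. vec_index (w a) i) \<in> vecs S n"
    using wA by (intro vecs_vec subr_sum[OF S] vecsD(3)) auto
  have "finsum P g (insert a A) = g a \<oplus>\<^bsub>P\<^esub> finsum P g A"
    using insert.prems insert.hyps coordzD(1)[OF c] by (intro finsum_insert) auto
  also have "\<dots> = \<kappa> (w a + vec n (\<lambda>i. \<Sum>a\<in>A. vec_index (w a) i))"
    using insert.IH insert.prems sum coordzD(3)[OF c wa sum] by simp
  also have "w a + vec n (\<lambda>i. \<Sum>a\<in>A. vec_index (w a) i) = vec n (\<lambda>i. \<Sum>a\<in>insert a A. vec_index (w a) i)"
    using insert.hyps vecsD(2)[OF wa] by (intro eq_vecI) auto
  finally show ?case .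
qed

lemma coordz_lincomb:
  assumes c: "coordz S n P \<kappa>" and S: "subr S" and "\<And>i. i < n \<Longrightarrow> a i \<in> S"
  shows "(\<Oplus>\<^bsub>P\<^esub>i\<in>{..<n}. a i \<odot>\<^bsub>P\<^esub> \<kappa> (unit_vec n i)) = \<kappa> (vec n a)"
proof -
  have "(\<Oplus>\<^bsub>P\<^esub>i\<in>{..<n}. a i \<odot>\<^bsub>P\<^esub> \<kappa> (unit_vec n i)) =
      \<kappa> (vec n (\<lambda>j. \<Sum>i<n. vec_index (a i \<cdot>\<^sub>v unit_vec n i) j))"
    using assms by (intro coordz_finsum[OF c S]) (auto simp: coordzD(4)[OF c] vecs_unit vecs_smult)
  also have "vec n (\<lambda>j. \<Sum>i<n. vec_index (a i \<cdot>\<^sub>v unit_vec n i) j) = vec n a"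
    by (intro eq_vecI) (auto simp: unit_vec_def if_distrib cong: if_cong)
  finally show ?thesis .
qed

lemma coordz_module:
  assumes c: "coordz S n P \<kappa>" and S: "subr S"
  shows "Module.module (sub_ring S) P"
proof (rule moduleI)
  note [simp] = coordzD(3)[OF c] coordzD(4)[OF c]
  {
    fix x assume "x \<in> carrier P"
    then obtain u where u: "u \<in> vecs S n" "x = \<kappa> u"
      using coordzD(6)[OF c] by blast
    then show "\<one>\<^bsub>sub_ring S\<^esub> \<odot>\<^bsub>P\<^esub> x = x"
      using subrD(2)[OF S] vecsD(1)[OF u(1)] by simp
  }
  fix a x assume a: "a \<in> carrier (sub_ring S)" and "x \<in> carrier P"
  then obtain u where u: "u \<in> vecs S n" "x = \<kappa> u"
    using coordzD(6)[OF c] by blast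
  have a: "a \<in> S"
    using a by simp
  note [simp] = u a vecs_smult[OF S] vecs_add[OF S] coordzD(1)[OF c]
  have uc: "u \<in> carrier_vec n"
    using u(1) by (rule vecsD)
  show "a \<odot>\<^bsub>P\<^esub> x \<in> carrier P"
    by simp
  {
    fix b assume "b \<in> carrier (sub_ring S)"
    then have b: "b \<in> S"
      by simp
    show "(a \<oplus>\<^bsub>sub_ring S\<^esub> b) \<odot>\<^bsub>P\<^esub> x = a \<odot>\<^bsub>P\<^esub> x \<oplus>\<^bsub>P\<^esub> b \<odot>\<^bsub>P\<^esub> x"
      using b subrD(4)[OF S a b] uc by (simp add: add_smult_distrib_vec)
    show "(a \<otimes>\<^bsub>sub_ring S\<^esub> b) \<odot>\<^bsub>P\<^esub> x = a \<odot>\<^bsub>P\<^esub> (b \<odot>\<^bsub>P\<^esub> x)"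
      using b subrD(5)[OF S a b] uc by (simp add: smult_smult_assoc)
  }
  fix y assume "y \<in> carrier P"
  then obtain w where w: "w \<in> vecs S n" "y = \<kappa> w"
    using coordzD(6)[OF c] by blast
  then show "a \<odot>\<^bsub>P\<^esub> (x \<oplus>\<^bsub>P\<^esub> y) = a \<odot>\<^bsub>P\<^esub> x \<oplus>\<^bsub>P\<^esub> a \<odot>\<^bsub>P\<^esub> y"
    using smult_add_distrib_vec[OF uc vecsD(1)[OF w(1)]] by simp
qed (rule cring_sub_ring[OF S], rule coordz_abelian_group[OF c S])

lemma coordz_basis:
  assumes c: "coordz S n P \<kappa>" and S: "subr S"
  shows "module_basis S P n (\<lambda>i. \<kappa> (unit_vec n i))"
  unfolding module_basis_def
proof (intro conjI allI impI ballI)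
  fix i assume "i < n"
  then show "\<kappa> (unit_vec n i) \<in> carrier P"
    by (intro coordzD(1)[OF c] vecs_unit S)
next
  fix x assume "x \<in> carrier P"
  then obtain w where w: "w \<in> vecs S n" "x = \<kappa> w"
    using coordzD(6)[OF c] by blast
  show "\<exists>!a. a \<in> {..<n} \<rightarrow>\<^sub>E S \<and> x = (\<Oplus>\<^bsub>P\<^esub>i\<in>{..<n}. a i \<odot>\<^bsub>P\<^esub> \<kappa> (unit_vec n i))"
  proof (rule ex1I)
    have "vec n (restrict (vec_index w) {..<n}) = w"
      using vecsD[OF w(1)] by (intro eq_vecI) auto
    then show "restrict (vec_index w) {..<n} \<in> {..<n} \<rightarrow>\<^sub>E S \<and>
        x = (\<Oplus>\<^bsub>P\<^esub>i\<in>{..<n}. restrict (vec_index w) {..<n} i \<odot>\<^bsub>P\<^esub> \<kappa> (unit_vec n i))"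
      using w coordz_lincomb[OF c S, of "restrict (vec_index w) {..<n}"] vecsD(3)[OF w(1)] by auto
  next
    fix a assume a: "a \<in> {..<n} \<rightarrow>\<^sub>E S \<and> x = (\<Oplus>\<^bsub>P\<^esub>i\<in>{..<n}. a i \<odot>\<^bsub>P\<^esub> \<kappa> (unit_vec n i))"
    then have aS: "a i \<in> S" if "i < n" for i
      using that by auto
    have "\<kappa> w = \<kappa> (vec n a)"
      using a w coordz_lincomb[OF c S aS] by auto
    then have "w = vec n a"
      using coordzD(2)[OF c w(1) vecs_vec[of n a S]] aS by auto
    then show "a = restrict (vec_index w) {..<n}"
      using a by (auto simp: PiE_def extensional_def restrict_def intro!: ext)
  qed
qed

lemma free_of_rank_coordz:
  "coordz S n P \<kappa> \<Longrightarrow> subr S \<Longrightarrow> free_of_rank S n P"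
  unfolding free_of_rank_def using coordz_module coordz_basis by blast

lemma coordz_of_free:
  assumes free: "free_of_rank B r M" and B: "subr B"
  obtains \<kappa> where "coordz B r M \<kappa>"
proof -
  obtain e where mod: "Module.module (sub_ring B) M" and e: "module_basis B M r e"
    using free by (auto simp: free_of_rank_def)
  interpret Module.module "sub_ring B" M
    by (rule mod)
  define \<kappa> where "\<kappa> w = (\<Oplus>\<^bsub>M\<^esub>i\<in>{..<r}. vec_index w i \<odot>\<^bsub>M\<^esub> e i)" for w
  have eM: "e i \<in> carrier M" if "i < r" for i
    using e that by (auto simp: module_basis_def)
  have tm: "(\<lambda>i. vec_index w i \<odot>\<^bsub>M\<^esub> e i) \<in> {..<r} \<rightarrow> carrier M" if "w \<in> vecs B r" for w
    using that eM vecsD(3)[OF that] smult_closed by (auto simp: Pi_def)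
  have closed: "\<kappa> w \<in> carrier M" if "w \<in> vecs B r" for w
    unfolding \<kappa>_def using tm[OF that] by (rule finsum_closed)
  have uniq: "\<exists>!a. a \<in> {..<r} \<rightarrow>\<^sub>E B \<and> x = (\<Oplus>\<^bsub>M\<^esub>i\<in>{..<r}. a i \<odot>\<^bsub>M\<^esub> e i)" if "x \<in> carrier M" for x
    using e that by (auto simp: module_basis_def)
  have \<kappa>_restrict: "\<kappa> w = (\<Oplus>\<^bsub>M\<^esub>i\<in>{..<r}. restrict (vec_index w) {..<r} i \<odot>\<^bsub>M\<^esub> e i)" if "w \<in> vecs B r" for w
    unfolding \<kappa>_def using tm[OF that] by (intro finsum_cong') auto
  have restrict_mem: "restrict (vec_index w) {..<r} \<in> {..<r} \<rightarrow>\<^sub>E B" if "w \<in> vecs B r" for w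
    using vecsD(3)[OF that] by auto
  have "inj_on \<kappa> (vecs B r)"
  proof (rule inj_onI)
    fix u w assume uw: "u \<in> vecs B r" "w \<in> vecs B r" "\<kappa> u = \<kappa> w"
    have "restrict (vec_index u) {..<r} = restrict (vec_index w) {..<r}"
      using uniq[OF closed[OF uw(1)]] restrict_mem[OF uw(1)] restrict_mem[OF uw(2)]
        \<kappa>_restrict[OF uw(1)] \<kappa>_restrict[OF uw(2)] uw(3) by (elim ex1E) metis
    then have "vec_index u i = vec_index w i" if "i < r" for i
      using that by (metis lessThan_iff restrict_apply')
    then show "u = w"
      using vecs_eqI[OF uw(1,2)] by blast
  qed
  moreover have "\<kappa> ` vecs B r = carrier M"
  proof (intro equalityI subsetI)
    fix x assume "x \<in> carrier M"
    then obtain a where a: "a \<in> {..<r} \<rightarrow>\<^sub>E B" "x = (\<Oplus>\<^bsub>M\<^esub>i\<in>{..<r}. a i \<odot>\<^bsub>M\<^esub> e i)"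
      using uniq by blast
    then have w: "vec r a \<in> vecs B r"
      by (intro vecs_vec) auto
    have "\<kappa> (vec r a) = x"
      unfolding \<kappa>_def a(2) using a(1) eM by (intro finsum_cong') (auto intro!: smult_closed)
    then show "x \<in> \<kappa> ` vecs B r"
      using w by blast
  qed (use closed in auto)
  moreover have "\<kappa> (u + w) = \<kappa> u \<oplus>\<^bsub>M\<^esub> \<kappa> w" if uw: "u \<in> vecs B r" "w \<in> vecs B r" for u w
  proof -
    have "\<kappa> u \<oplus>\<^bsub>M\<^esub> \<kappa> w = (\<Oplus>\<^bsub>M\<^esub>i\<in>{..<r}. vec_index u i \<odot>\<^bsub>M\<^esub> e i \<oplus>\<^bsub>M\<^esub> vec_index w i \<odot>\<^bsub>M\<^esub> e i)"
      unfolding \<kappa>_def using tm uw by (intro finsum_addf[symmetric]) auto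
    also have "\<dots> = \<kappa> (u + w)"
      unfolding \<kappa>_def
    proof (rule finsum_cong')
      fix i assume "i \<in> {..<r}"
      then show "vec_index u i \<odot>\<^bsub>M\<^esub> e i \<oplus>\<^bsub>M\<^esub> vec_index w i \<odot>\<^bsub>M\<^esub> e i = vec_index (u + w) i \<odot>\<^bsub>M\<^esub> e i"
        using smult_l_distr[of "vec_index u i" "vec_index w i" "e i"] eM vecsD[OF uw(1)] vecsD[OF uw(2)] by simp
    qed (use tm[OF vecs_add[OF B uw]] in auto)
    finally show ?thesis ..
  qed
  moreover have "\<kappa> (s \<cdot>\<^sub>v w) = s \<odot>\<^bsub>M\<^esub> \<kappa> w" if s: "s \<in> B" and w: "w \<in> vecs B r" for s w
  proof -
    have "s \<odot>\<^bsub>M\<^esub> \<kappa> w = (\<Oplus>\<^bsub>M\<^esub>i\<in>{..<r}. s \<odot>\<^bsub>M\<^esub> (vec_index w i \<odot>\<^bsub>M\<^esub> e i))"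
      unfolding \<kappa>_def using tm[OF w] s by (intro finsum_smult_ldistr) auto
    also have "\<dots> = \<kappa> (s \<cdot>\<^sub>v w)"
      unfolding \<kappa>_def
    proof (rule finsum_cong')
      fix i assume "i \<in> {..<r}"
      then show "s \<odot>\<^bsub>M\<^esub> (vec_index w i \<odot>\<^bsub>M\<^esub> e i) = vec_index (s \<cdot>\<^sub>v w) i \<odot>\<^bsub>M\<^esub> e i"
        using smult_assoc1[of s "vec_index w i" "e i"] s eM vecsD[OF w] by simp
    qed (use tm[OF vecs_smult[OF B s w]] in auto)
    finally show ?thesis ..
  qed
  moreover have "\<zero>\<^bsub>M\<^esub> = \<kappa> (0\<^sub>v r)"
  proof -
    have "\<kappa> (0\<^sub>v r) = (\<Oplus>\<^bsub>M\<^esub>i\<in>{..<r}. \<zero>\<^bsub>M\<^esub>)"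
      unfolding \<kappa>_def using eM smult_l_null by (intro finsum_cong') auto
    then show ?thesis
      by simp
  qed
  ultimately have "coordz B r M \<kappa>"
    by (simp add: coordz_def bij_betw_def)
  then show thesis
    by (rule that)
qed

text \<open>\<open>H\<close> is the matrix of \<open>f\<close> in the coordinates \<kappa> and
  \<kappa>'; values of \<open>f\<close> outside the carrier are left free.\<close>

definition act :: "'b::field set \<Rightarrow> nat \<Rightarrow> ('b vec \<Rightarrow> 'p) \<Rightarrow> ('b vec \<Rightarrow> 'q) \<Rightarrow> ('p \<Rightarrow> 'q) \<Rightarrow> 'b mat \<Rightarrow> bool"
  where "act S n \<kappa> \<kappa>' f H \<longleftrightarrow> (\<forall>w\<in>vecs S n. f (\<kappa> w) = \<kappa>' (H *\<^sub>v w))"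

lemma linear_maps_finsum:
  assumes f: "f \<in> linear_maps S P Q" and P: "abelian_group P" and Q: "abelian_group Q" and "finite A"
    and zero: "f \<zero>\<^bsub>P\<^esub> = \<zero>\<^bsub>Q\<^esub>" and g: "g \<in> A \<rightarrow> carrier P"
  shows "f (finsum P g A) = finsum Q (\<lambda>a. f (g a)) A"
  using \<open>finite A\<close> g
proof (induction A rule: finite_induct)
  case empty
  interpret P: abelian_group P by (rule P)
  interpret Q: abelian_group Q by (rule Q)
  show ?case
    by (simp add: zero)
next
  case (insert a A)
  interpret P: abelian_group P by (rule P)
  interpret Q: abelian_group Q by (rule Q)
  have fPQ: "f x \<in> carrier Q" if "x \<in> carrier P" for x
    using f that by (auto simp: linear_maps_def)
  have "f (finsum P g (insert a A)) = f (g a \<oplus>\<^bsub>P\<^esub> finsum P g A)"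
    using insert by (subst P.finsum_insert) auto
  also have "\<dots> = f (g a) \<oplus>\<^bsub>Q\<^esub> f (finsum P g A)"
    using f insert.prems by (auto simp: linear_maps_def intro!: P.finsum_closed)
  also have "\<dots> = finsum Q (\<lambda>a. f (g a)) (insert a A)"
    using insert fPQ by (subst Q.finsum_insert) auto
  finally show ?case .
qed

lemma linear_map_matrix:
  assumes c: "coordz S n P \<kappa>" "coordz S m Q \<kappa>'" and S: "subr S" and f: "f \<in> linear_maps S P Q"
  obtains H where "H \<in> mats S m n" "act S n \<kappa> \<kappa>' f H"
proof -
  have fPQ: "f x \<in> carrier Q" if "x \<in> carrier P" for x
    using f that by (auto simp: linear_maps_def)
  have fs: "f (s \<odot>\<^bsub>P\<^esub> x) = s \<odot>\<^bsub>Q\<^esub> f x" if "s \<in> S" "x \<in> carrier P" for s x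
    using f that by (auto simp: linear_maps_def)
  define h where "h j = crd S m \<kappa>' (f (\<kappa> (unit_vec n j)))" for j
  have \<kappa>u: "\<kappa> (unit_vec n j) \<in> carrier P" for j
    by (intro coordzD(1)[OF c(1)] vecs_unit S)
  have h: "h j \<in> vecs S m" "\<kappa>' (h j) = f (\<kappa> (unit_vec n j))" for j
    unfolding h_def using crd(2,3)[OF c(2) fPQ[OF \<kappa>u]] by auto
  define H where "H = mat m n (\<lambda>(i, j). vec_index (h j) i)"
  have H: "H \<in> mats S m n"
    using vecsD(3)[OF h(1)] by (intro matsI) (auto simp: H_def)
  \<comment> \<open>Linearity is stated without zero; zero is preserved because it is 0 times
    itself.\<close>
  have "f \<zero>\<^bsub>P\<^esub> = \<zero>\<^bsub>Q\<^esub>"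
  proof -
    interpret P: Module.module "sub_ring S" P by (rule coordz_module[OF c(1) S])
    interpret Q: Module.module "sub_ring S" Q by (rule coordz_module[OF c(2) S])
    have "f \<zero>\<^bsub>P\<^esub> = f (0 \<odot>\<^bsub>P\<^esub> \<zero>\<^bsub>P\<^esub>)"
      using P.smult_l_null[OF P.zero_closed] by simp
    also have "\<dots> = \<zero>\<^bsub>Q\<^esub>"
      using fs[OF subrD(1)[OF S] P.zero_closed] Q.smult_l_null[OF fPQ[OF P.zero_closed]] by simp
    finally show ?thesis .
  qed
  note fsum = linear_maps_finsum[OF f coordz_abelian_group[OF c(1) S] coordz_abelian_group[OF c(2) S] _ this]
  have "f (\<kappa> w) = \<kappa>' (H *\<^sub>v w)" if w: "w \<in> vecs S n" for w
  proof -
    have wS: "vec_index w i \<in> S" if "i < n" for i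
      using vecsD(3)[OF w that] .
    have "vec n (vec_index w) = w"
      using vecsD[OF w] by (intro eq_vecI) auto
    then have "f (\<kappa> w) = f (\<Oplus>\<^bsub>P\<^esub>i\<in>{..<n}. vec_index w i \<odot>\<^bsub>P\<^esub> \<kappa> (unit_vec n i))"
      using coordz_lincomb[OF c(1) S wS] by simp
    also have "\<dots> = (\<Oplus>\<^bsub>Q\<^esub>i\<in>{..<n}. f (vec_index w i \<odot>\<^bsub>P\<^esub> \<kappa> (unit_vec n i)))"
      using wS by (intro fsum) (auto simp: coordzD(4)[OF c(1) _ vecs_unit[OF S]]
          intro!: coordzD(1)[OF c(1)] vecs_smult[OF S] vecs_unit[OF S])
    also have "\<dots> = \<kappa>' (vec m (\<lambda>i. \<Sum>j<n. vec_index (vec_index w j \<cdot>\<^sub>v h j) i))"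
    proof (rule coordz_finsum[OF c(2) S])
      fix j assume "j \<in> {..<n}"
      then have wj: "vec_index w j \<in> S"
        using wS by simp
      then show "vec_index w j \<cdot>\<^sub>v h j \<in> vecs S m"
        by (intro vecs_smult S h)
      show "f (vec_index w j \<odot>\<^bsub>P\<^esub> \<kappa> (unit_vec n j)) = \<kappa>' (vec_index w j \<cdot>\<^sub>v h j)"
        using fs[OF wj \<kappa>u] coordzD(4)[OF c(2) wj h(1)] h(2) by simp
    qed simp
    also have "vec m (\<lambda>i. \<Sum>j<n. vec_index (vec_index w j \<cdot>\<^sub>v h j) i) = H *\<^sub>v w"
    proof (rule eq_vecI)
      fix i assume "i < dim_vec (H *\<^sub>v w)"
      then have i: "i < m"
        using matsD(2)[OF H] by simp
      then show "vec_index (vec m (\<lambda>i. \<Sum>j<n. vec_index (vec_index w j \<cdot>\<^sub>v h j) i)) i = vec_index (H *\<^sub>v w) i"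
        using vecsD(2)[OF h(1)] unfolding mult_mat_vec_nth[OF matsD(1)[OF H] vecsD(1)[OF w] i]
        by (simp add: H_def mult.commute)
    qed (use matsD(2)[OF H] in simp)
    finally show ?thesis .
  qed
  then show thesis
    using that[OF H] by (simp add: act_def)
qed

definition map_of_mat :: "'b::field set \<Rightarrow> nat \<Rightarrow> ('b, 'p) module \<Rightarrow> ('b vec \<Rightarrow> 'p) \<Rightarrow> ('b vec \<Rightarrow> 'q) \<Rightarrow> 'b mat \<Rightarrow> 'p \<Rightarrow> 'q"
  where "map_of_mat S n P \<kappa> \<kappa>' H = (\<lambda>x\<in>carrier P. \<kappa>' (H *\<^sub>v crd S n \<kappa> x))"

lemma map_of_mat:
  assumes c: "coordz S n P \<kappa>" "coordz S m Q \<kappa>'" and S: "subr S" and H: "H \<in> mats S m n"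
  shows "map_of_mat S n P \<kappa> \<kappa>' H \<in> linear_maps S P Q" "act S n \<kappa> \<kappa>' (map_of_mat S n P \<kappa> \<kappa>' H) H"
proof -
  let ?f = "map_of_mat S n P \<kappa> \<kappa>' H"
  have f: "?f (\<kappa> w) = \<kappa>' (H *\<^sub>v w)" if "w \<in> vecs S n" for w
    using that by (simp add: map_of_mat_def crd(1)[OF c(1)] coordzD(1)[OF c(1)])
  then show "act S n \<kappa> \<kappa>' ?f H"
    by (simp add: act_def)
  have Hc: "H \<in> carrier_mat m n"
    using H by (rule matsD)
  note [simp] = mats_mult_vec[OF S H] vecs_add[OF S] vecs_smult[OF S]
  show "?f \<in> linear_maps S P Q"
    unfolding linear_maps_def
  proof (intro CollectI conjI ballI)
    show "?f \<in> carrier P \<rightarrow>\<^sub>E carrier Q"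
      using crd(2)[OF c(1)] coordzD(1)[OF c(2)] by (auto simp: map_of_mat_def)
  next
    fix x y assume "x \<in> carrier P" "y \<in> carrier P"
    then obtain u w where uw: "u \<in> vecs S n" "x = \<kappa> u" "w \<in> vecs S n" "y = \<kappa> w"
      using coordzD(6)[OF c(1)] by meson
    then show "?f (x \<oplus>\<^bsub>P\<^esub> y) = ?f x \<oplus>\<^bsub>Q\<^esub> ?f y"
      using mult_add_distrib_mat_vec[OF Hc vecsD(1)[OF uw(1)] vecsD(1)[OF uw(3)]]
      by (simp add: f coordzD(3)[OF c(1)] coordzD(3)[OF c(2)])
  next
    fix s x assume "s \<in> S" "x \<in> carrier P"
    then obtain u where u: "s \<in> S" "u \<in> vecs S n" "x = \<kappa> u"
      using coordzD(6)[OF c(1)] by meson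
    then show "?f (s \<odot>\<^bsub>P\<^esub> x) = s \<odot>\<^bsub>Q\<^esub> ?f x"
      using mult_mat_vec[OF Hc vecsD(1)[OF u(2)], of s]
      by (simp add: f coordzD(4)[OF c(1)] coordzD(4)[OF c(2)])
  qed
qed

lemma extensional_act_eq:
  assumes c: "coordz S n P \<kappa>" and f: "f \<in> extensional (carrier P)" "act S n \<kappa> \<kappa>' f H"
    and g: "g \<in> extensional (carrier P)" "act S n \<kappa> \<kappa>' g H"
  shows "f = g"
proof (rule extensionalityI[OF f(1) g(1)])
  fix x assume "x \<in> carrier P"
  then obtain w where "w \<in> vecs S n" "x = \<kappa> w"
    using coordzD(6)[OF c] by blast
  then show "f x = g x"
    using f(2) g(2) by (simp add: act_def)
qed


section \<open>Base change in coordinates\<close>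

lemma finite_support_add: "finite {m. c m \<noteq> 0} \<Longrightarrow> finite {m. d m \<noteq> 0} \<Longrightarrow> finite {m. c m + d m \<noteq> (0::'b::field)}"
  by (rule finite_subset[of _ "{m. c m \<noteq> 0} \<union> {m. d m \<noteq> 0}"]) auto

locale base_change_setting =
  fixes \<phi> :: "'b::field \<Rightarrow> 'b" and B S :: "'b set" and M :: "('b, 'm) module"
    and r :: nat and \<kappa> :: "'b vec \<Rightarrow> 'm"
  assumes subr_B: "subr B" and subr_S: "subr S"
    and \<phi>_closed: "x \<in> B \<Longrightarrow> \<phi> x \<in> S"
    and \<phi>_add: "x \<in> B \<Longrightarrow> y \<in> B \<Longrightarrow> \<phi> (x + y) = \<phi> x + \<phi> y"
    and \<phi>_mult: "x \<in> B \<Longrightarrow> y \<in> B \<Longrightarrow> \<phi> (x * y) = \<phi> x * \<phi> y"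
    and \<phi>_1: "\<phi> 1 = 1"
    and M: "coordz B r M \<kappa>"
begin

abbreviation "co m \<equiv> crd B r \<kappa> m"

abbreviation "rel \<equiv> tensor_relations \<phi> B S M"

abbreviation "fs \<equiv> formal_sums S M"

lemma \<phi>_0: "\<phi> 0 = 0"
  using \<phi>_add[OF subrD(1)[OF subr_B] subrD(1)[OF subr_B]] by (metis add.right_neutral add_left_cancel)

lemma co_vecs: "m \<in> carrier M \<Longrightarrow> co m \<in> vecs B r"
  by (rule crd(2)[OF M])

lemma co_nth: "m \<in> carrier M \<Longrightarrow> i < r \<Longrightarrow> vec_index (co m) i \<in> B"
  using vecsD(3)[OF co_vecs] .

lemma co_add:
  assumes "m \<in> carrier M" "n \<in> carrier M"
  shows "co (m \<oplus>\<^bsub>M\<^esub> n) = co m + co n"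
  using crd(1)[OF M vecs_add[OF subr_B co_vecs[OF assms(1)] co_vecs[OF assms(2)]]]
    coordzD(3)[OF M co_vecs[OF assms(1)] co_vecs[OF assms(2)]] crd(3)[OF M] assms by simp

lemma co_smult:
  assumes "b \<in> B" "m \<in> carrier M"
  shows "co (b \<odot>\<^bsub>M\<^esub> m) = b \<cdot>\<^sub>v co m"
  using crd(1)[OF M vecs_smult[OF subr_B assms(1) co_vecs[OF assms(2)]]]
    coordzD(4)[OF M assms(1) co_vecs[OF assms(2)]] crd(3)[OF M] assms by simp

lemma M_closed: "m \<in> carrier M \<Longrightarrow> n \<in> carrier M \<Longrightarrow> m \<oplus>\<^bsub>M\<^esub> n \<in> carrier M"
  "b \<in> B \<Longrightarrow> m \<in> carrier M \<Longrightarrow> b \<odot>\<^bsub>M\<^esub> m \<in> carrier M"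
proof -
  show "m \<oplus>\<^bsub>M\<^esub> n \<in> carrier M" if "m \<in> carrier M" "n \<in> carrier M"
    using coordzD(1)[OF M vecs_add[OF subr_B co_vecs[OF that(1)] co_vecs[OF that(2)]]]
      coordzD(3)[OF M co_vecs[OF that(1)] co_vecs[OF that(2)]] crd(3)[OF M] that by simp
  show "b \<odot>\<^bsub>M\<^esub> m \<in> carrier M" if "b \<in> B" "m \<in> carrier M"
    using coordzD(1)[OF M vecs_smult[OF subr_B that(1) co_vecs[OF that(2)]]]
      coordzD(4)[OF M that(1) co_vecs[OF that(2)]] crd(3)[OF M] that by simp
qed

text \<open>Evaluates a formal sum of symbols m \<otimes> s as a vector over \<open>S\<close>,
  through the coordinates of the elements m.\<close>

definition kap :: "('m \<Rightarrow> 'b) \<Rightarrow> 'b vec"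
  where "kap c = vec r (\<lambda>i. \<Sum>m | c m \<noteq> 0. c m * \<phi> (vec_index (co m) i))"

text \<open>Intended as the tensor with coordinates \<open>w\<close>: the whole fibre of
  \<open>kap\<close>. That this fibre is a tensor class is the content of what follows;
  \<open>std\<close> provides a representative.\<close>

definition cls :: "'b vec \<Rightarrow> ('m \<Rightarrow> 'b) set"
  where "cls w = {c \<in> fs. kap c = w}"

definition std :: "'b vec \<Rightarrow> 'm \<Rightarrow> 'b"
  where "std w = (\<lambda>x. \<Sum>i<r. symb (\<kappa> (unit_vec r i)) (vec_index w i) x)"

lemma fsD: "c \<in> fs \<Longrightarrow> c m \<in> S" "c \<in> fs \<Longrightarrow> c m \<noteq> 0 \<Longrightarrow> m \<in> carrier M" "c \<in> fs \<Longrightarrow> finite {m. c m \<noteq> 0}"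
  by (auto simp: formal_sums_def)

lemma fs_outside: "c \<in> fs \<Longrightarrow> m \<notin> carrier M \<Longrightarrow> c m = 0"
  by (auto simp: formal_sums_def)

lemma fsI:
  "(\<And>m. c m \<in> S) \<Longrightarrow> (\<And>m. m \<notin> carrier M \<Longrightarrow> c m = 0) \<Longrightarrow> finite {m. c m \<noteq> 0} \<Longrightarrow> c \<in> fs"
  by (auto simp: formal_sums_def)

lemma fs_zero: "(\<lambda>_. 0) \<in> fs"
  using subrD(1)[OF subr_S] by (auto simp: formal_sums_def)

lemma fs_add:
  assumes "c \<in> fs" "d \<in> fs"
  shows "(\<lambda>x. c x + d x) \<in> fs"
proof (rule fsI)
  show "c m + d m \<in> S" for m
    by (intro subrD(4)[OF subr_S] fsD(1) assms)
  show "c m + d m = 0" if "m \<notin> carrier M" for m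
    using fs_outside[OF assms(1) that] fs_outside[OF assms(2) that] by simp
  show "finite {m. c m + d m \<noteq> 0}"
    by (intro finite_support_add fsD(3) assms)
qed

lemma fs_smult:
  assumes "s \<in> S" "c \<in> fs"
  shows "(\<lambda>x. s * c x) \<in> fs"
proof (rule fsI)
  show "s * c m \<in> S" for m
    by (intro subrD(5)[OF subr_S] fsD(1) assms)
  show "s * c m = 0" if "m \<notin> carrier M" for m
    using fs_outside[OF assms(2) that] by simp
  show "finite {m. s * c m \<noteq> 0}"
    by (rule finite_subset[OF _ fsD(3)[OF assms(2)]]) auto
qed

lemma fs_diff:
  assumes "c \<in> fs" "d \<in> fs"
  shows "(\<lambda>x. c x - d x) \<in> fs"
proof -
  have "(\<lambda>x. c x + - 1 * d x) \<in> fs"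
    by (intro fs_add fs_smult subrD(3)[OF subr_S] subrD(2)[OF subr_S] assms)
  then show ?thesis
    by simp
qed

lemma fs_symb: "m \<in> carrier M \<Longrightarrow> s \<in> S \<Longrightarrow> symb m s \<in> fs"
  using subrD(1)[OF subr_S] by (auto simp: formal_sums_def symb_def intro: finite_subset[of _ "{m}"])

lemma fs_sum: "(\<And>a. a \<in> A \<Longrightarrow> f a \<in> fs) \<Longrightarrow> (\<lambda>x. \<Sum>a\<in>A. f a x) \<in> fs"
  by (induction A rule: infinite_finite_induct) (auto simp: fs_zero fs_add)

lemma kap_nth:
  assumes "finite A" "{m. c m \<noteq> 0} \<subseteq> A" "i < r"
  shows "vec_index (kap c) i = (\<Sum>m\<in>A. c m * \<phi> (vec_index (co m) i))"
  unfolding kap_def using assms by (auto intro!: sum.mono_neutral_left)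

lemma kap_carrier: "kap c \<in> carrier_vec r"
  by (simp add: kap_def)

lemma kap_vecs: "c \<in> fs \<Longrightarrow> kap c \<in> vecs S r"
  unfolding kap_def
  by (intro vecs_vec subr_sum[OF subr_S] subrD(5)[OF subr_S] \<phi>_closed co_nth) (use fsD[of c] in blast)+

lemma kap_add:
  assumes "c \<in> fs" "d \<in> fs"
  shows "kap (\<lambda>x. c x + d x) = kap c + kap d"
proof (rule eq_vecI)
  fix i assume "i < dim_vec (kap c + kap d)"
  then have i: "i < r"
    by (simp add: kap_def)
  let ?A = "{m. c m \<noteq> 0} \<union> {m. d m \<noteq> 0}"
  have A: "finite ?A"
    using fsD(3) assms by auto
  have "vec_index (kap (\<lambda>x. c x + d x)) i = (\<Sum>m\<in>?A. (c m + d m) * \<phi> (vec_index (co m) i))"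
    by (rule kap_nth[OF A _ i]) auto
  also have "\<dots> = (\<Sum>m\<in>?A. c m * \<phi> (vec_index (co m) i)) + (\<Sum>m\<in>?A. d m * \<phi> (vec_index (co m) i))"
    by (simp only: distrib_right sum.distrib)
  also have "(\<Sum>m\<in>?A. c m * \<phi> (vec_index (co m) i)) = vec_index (kap c) i"
    by (rule kap_nth[OF A _ i, symmetric]) auto
  also have "(\<Sum>m\<in>?A. d m * \<phi> (vec_index (co m) i)) = vec_index (kap d) i"
    by (rule kap_nth[OF A _ i, symmetric]) auto
  finally have "vec_index (kap (\<lambda>x. c x + d x)) i = vec_index (kap c) i + vec_index (kap d) i" .
  then show "vec_index (kap (\<lambda>x. c x + d x)) i = vec_index (kap c + kap d) i"
    using i kap_carrier[of c] kap_carrier[of d] by simp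
qed (simp add: kap_def)

lemma kap_smult:
  assumes "c \<in> fs"
  shows "kap (\<lambda>x. s * c x) = s \<cdot>\<^sub>v kap c"
proof (rule eq_vecI)
  fix i assume "i < dim_vec (s \<cdot>\<^sub>v kap c)"
  then have i: "i < r"
    by (simp add: kap_def)
  show "vec_index (kap (\<lambda>x. s * c x)) i = vec_index (s \<cdot>\<^sub>v kap c) i"
    using i fsD(3)[OF assms] kap_carrier[of c]
    by (simp add: kap_nth[where A = "{m. c m \<noteq> 0}"] sum_distrib_left mult.assoc subset_iff)
qed (simp add: kap_def)

lemma kap_diff:
  assumes "c \<in> fs" "d \<in> fs"
  shows "kap (\<lambda>x. c x - d x) = kap c - kap d"
proof -
  have "(\<lambda>x. - 1 * d x) \<in> fs"
    by (intro fs_smult assms subrD(3)[OF subr_S] subrD(2)[OF subr_S])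
  from kap_add[OF assms(1) this] show ?thesis
    unfolding kap_smult[OF assms(2)] using kap_carrier[of c] kap_carrier[of d]
    by (auto intro!: eq_vecI)
qed

lemma kap_zero: "kap (\<lambda>_. 0) = 0\<^sub>v r"
  by (auto simp: kap_def)

lemma kap_symb:
  assumes "m \<in> carrier M"
  shows "kap (symb m s) = s \<cdot>\<^sub>v map_vec \<phi> (co m)"
proof (rule eq_vecI)
  fix i assume "i < dim_vec (s \<cdot>\<^sub>v map_vec \<phi> (co m))"
  then have i: "i < r"
    using vecsD(2)[OF co_vecs[OF assms]] by simp
  show "vec_index (kap (symb m s)) i = vec_index (s \<cdot>\<^sub>v map_vec \<phi> (co m)) i"
    using i vecsD(2)[OF co_vecs[OF assms]] by (simp add: kap_nth[where A = "{m}"] symb_def subset_iff)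
qed (use vecsD(2)[OF co_vecs[OF assms]] in \<open>simp add: kap_def\<close>)

lemma kap_sum:
  assumes "\<And>a. a \<in> A \<Longrightarrow> f a \<in> fs" "finite A" "i < r"
  shows "vec_index (kap (\<lambda>x. \<Sum>a\<in>A. f a x)) i = (\<Sum>a\<in>A. vec_index (kap (f a)) i)"
  using assms(2,1)
proof (induction A rule: finite_induct)
  case (insert a A)
  then show ?case
    using kap_add[of "f a" "\<lambda>x. \<Sum>a\<in>A. f a x"] fs_sum[of A f] kap_carrier[of "f a"] assms(3)
      kap_carrier[of "\<lambda>x. \<Sum>a\<in>A. f a x"] by simp
qed (use assms(3) in \<open>simp add: kap_zero\<close>)

lemma unit_M: "\<kappa> (unit_vec r i) \<in> carrier M"
  by (intro coordzD(1)[OF M] vecs_unit subr_B)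

lemma std_fs: "w \<in> vecs S r \<Longrightarrow> std w \<in> fs"
  unfolding std_def by (intro fs_sum fs_symb unit_M) (auto dest: vecsD(3))

lemma kap_std:
  assumes w: "w \<in> vecs S r"
  shows "kap (std w) = w"
proof (rule eq_vecI)
  fix i assume "i < dim_vec w"
  then have i: "i < r"
    using vecsD(2)[OF w] by simp
  have "vec_index (kap (std w)) i = (\<Sum>j<r. vec_index (kap (symb (\<kappa> (unit_vec r j)) (vec_index w j))) i)"
    unfolding std_def using i vecsD(3)[OF w] by (intro kap_sum fs_symb unit_M) auto
  also have "\<dots> = (\<Sum>j<r. if i = j then vec_index w j else 0)"
    using i by (intro sum.cong) (auto simp: kap_symb[OF unit_M] crd(1)[OF M vecs_unit[OF subr_B]] \<phi>_1 \<phi>_0)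
  finally show "vec_index (kap (std w)) i = vec_index w i"
    using i by simp
qed (use vecsD(2)[OF w] in \<open>simp add: kap_def\<close>)

text \<open>One half of the computation of the tensor product: relations are killed by
  \<open>kap\<close>.\<close>

lemma rel_fs: "d \<in> rel \<Longrightarrow> d \<in> fs \<and> kap d = 0\<^sub>v r"
proof (induction rule: tensor_relations.induct)
  case zero
  then show ?case
    by (simp add: fs_zero kap_zero)
next
  case (add c d)
  then show ?case
    by (simp add: fs_add kap_add)
next
  case (additive m n s)
  have "kap (\<lambda>x. symb (m \<oplus>\<^bsub>M\<^esub> n) s x - symb m s x - symb n s x) =
      s \<cdot>\<^sub>v map_vec \<phi> (co m + co n) - s \<cdot>\<^sub>v map_vec \<phi> (co m) - s \<cdot>\<^sub>v map_vec \<phi> (co n)"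
    using additive by (simp add: kap_diff fs_diff fs_symb M_closed kap_symb co_add)
  also have "\<dots> = 0\<^sub>v r"
    using vecsD(2)[OF co_vecs] co_nth additive
    by (intro eq_vecI) (auto simp: \<phi>_add algebra_simps)
  finally show ?case
    using additive by (simp add: fs_diff fs_symb M_closed)
next
  case (balanced m b s)
  have "kap (\<lambda>x. symb (b \<odot>\<^bsub>M\<^esub> m) s x - symb m (s * \<phi> b) x) =
      s \<cdot>\<^sub>v map_vec \<phi> (b \<cdot>\<^sub>v co m) - (s * \<phi> b) \<cdot>\<^sub>v map_vec \<phi> (co m)"
    using balanced by (simp add: kap_diff fs_symb M_closed kap_symb co_smult subrD(5)[OF subr_S] \<phi>_closed)
  also have "\<dots> = 0\<^sub>v r"
    using vecsD(2)[OF co_vecs] co_nth balanced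
    by (intro eq_vecI) (auto simp: \<phi>_mult)
  finally show ?case
    using balanced by (simp add: fs_diff fs_symb M_closed subrD(5)[OF subr_S] \<phi>_closed)
qed

lemma symb_uminus: "symb m (- s) = (\<lambda>x. - symb m s x)"
  by (auto simp: symb_def)

text \<open>The relations are generated by sums only; negatives are present because every generator
  changes sign with s.\<close>

lemma rel_uminus: "d \<in> rel \<Longrightarrow> (\<lambda>x. - d x) \<in> rel"
proof (induction rule: tensor_relations.induct)
  case zero
  then show ?case
    using tensor_relations.zero by simp
next
  case (add c d)
  then show ?case
    using tensor_relations.add[of "\<lambda>x. - c x" \<phi> B S M "\<lambda>x. - d x"] by simp
next
  case (additive m n s)
  then show ?case
    using tensor_relations.additive[of m M n "- s" S \<phi> B] subrD(3)[OF subr_S]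
    by (simp add: symb_uminus algebra_simps)
next
  case (balanced m b s)
  then show ?case
    using tensor_relations.balanced[of m M b B "- s" S \<phi>] subrD(3)[OF subr_S]
    by (simp add: symb_uminus algebra_simps)
qed

lemma rel_diff: "c \<in> rel \<Longrightarrow> d \<in> rel \<Longrightarrow> (\<lambda>x. c x - d x) \<in> rel"
  using tensor_relations.add[of c \<phi> B S M "\<lambda>x. - d x"] rel_uminus[of d] by simp

lemma rel_sum: "(\<And>a. a \<in> A \<Longrightarrow> f a \<in> rel) \<Longrightarrow> (\<lambda>x. \<Sum>a\<in>A. f a x) \<in> rel"
  by (induction A rule: infinite_finite_induct) (auto intro: tensor_relations.zero tensor_relations.add)

lemma symb_lincomb_rel:
  fixes k :: nat
  assumes s: "s \<in> S" and b: "\<And>i. i < k \<Longrightarrow> b i \<in> B" and e: "\<And>i. i < k \<Longrightarrow> e i \<in> carrier M"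
  shows "(\<lambda>x. symb (\<Oplus>\<^bsub>M\<^esub>i\<in>{..<k}. b i \<odot>\<^bsub>M\<^esub> e i) s x - (\<Sum>i<k. symb (e i) (s * \<phi> (b i)) x)) \<in> rel"
  using b e
proof (induction k)
  case 0
  interpret abelian_group M
    by (rule coordz_abelian_group[OF M subr_B])
  \<comment> \<open>With both elements zero, the additivity relation is the negative of 0 \<otimes>
    s.\<close>
  have "(\<lambda>x. symb (\<zero>\<^bsub>M\<^esub> \<oplus>\<^bsub>M\<^esub> \<zero>\<^bsub>M\<^esub>) s x - symb \<zero>\<^bsub>M\<^esub> s x - symb \<zero>\<^bsub>M\<^esub> s x) \<in> rel"
    using s by (intro tensor_relations.additive) auto
  from rel_uminus[OF this] show ?case
    by simp
next
  case (Suc k)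
  interpret abelian_group M
    by (rule coordz_abelian_group[OF M subr_B])
  define m where "m = (\<Oplus>\<^bsub>M\<^esub>i\<in>{..<k}. b i \<odot>\<^bsub>M\<^esub> e i)"
  have be: "b i \<odot>\<^bsub>M\<^esub> e i \<in> carrier M" if "i < Suc k" for i
    using Suc.prems that by (intro M_closed) auto
  have m: "m \<in> carrier M"
    unfolding m_def using be by (intro finsum_closed) auto
  have eq: "(\<Oplus>\<^bsub>M\<^esub>i\<in>{..<Suc k}. b i \<odot>\<^bsub>M\<^esub> e i) = b k \<odot>\<^bsub>M\<^esub> e k \<oplus>\<^bsub>M\<^esub> m"
    unfolding m_def lessThan_Suc using be by (intro finsum_insert) auto
  have 1: "(\<lambda>x. symb (b k \<odot>\<^bsub>M\<^esub> e k \<oplus>\<^bsub>M\<^esub> m) s x - symb (b k \<odot>\<^bsub>M\<^esub> e k) s x - symb m s x) \<in> rel"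
    using be m s by (intro tensor_relations.additive) auto
  have 2: "(\<lambda>x. symb (b k \<odot>\<^bsub>M\<^esub> e k) s x - symb (e k) (s * \<phi> (b k)) x) \<in> rel"
    using Suc.prems s by (intro tensor_relations.balanced) auto
  have 3: "(\<lambda>x. symb m s x - (\<Sum>i<k. symb (e i) (s * \<phi> (b i)) x)) \<in> rel"
    unfolding m_def by (rule Suc.IH) (use Suc.prems in auto)
  have "(\<lambda>x. symb (b k \<odot>\<^bsub>M\<^esub> e k \<oplus>\<^bsub>M\<^esub> m) s x - symb (b k \<odot>\<^bsub>M\<^esub> e k) s x - symb m s x +
      (symb (b k \<odot>\<^bsub>M\<^esub> e k) s x - symb (e k) (s * \<phi> (b k)) x) +
      (symb m s x - (\<Sum>i<k. symb (e i) (s * \<phi> (b i)) x))) \<in> rel"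
    by (rule tensor_relations.add[OF tensor_relations.add[OF 1 2] 3])
  then show ?case
    unfolding eq sum.lessThan_Suc by (simp add: algebra_simps)
qed

lemma symb_std_rel:
  assumes "m \<in> carrier M" "s \<in> S"
  shows "(\<lambda>x. symb m s x - std (s \<cdot>\<^sub>v map_vec \<phi> (co m)) x) \<in> rel"
proof -
  have "(\<Oplus>\<^bsub>M\<^esub>i\<in>{..<r}. vec_index (co m) i \<odot>\<^bsub>M\<^esub> \<kappa> (unit_vec r i)) = \<kappa> (vec r (vec_index (co m)))"
    using co_nth[OF assms(1)] by (intro coordz_lincomb[OF M subr_B])
  also have "vec r (vec_index (co m)) = co m"
    using vecsD(2)[OF co_vecs[OF assms(1)]] by (intro eq_vecI) auto
  also have "\<kappa> (co m) = m"
    by (rule crd(3)[OF M assms(1)])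
  finally have *: "(\<Oplus>\<^bsub>M\<^esub>i\<in>{..<r}. vec_index (co m) i \<odot>\<^bsub>M\<^esub> \<kappa> (unit_vec r i)) = m" .
  have "std (s \<cdot>\<^sub>v map_vec \<phi> (co m)) x = (\<Sum>i<r. symb (\<kappa> (unit_vec r i)) (s * \<phi> (vec_index (co m) i)) x)" for x
    unfolding std_def using vecsD(2)[OF co_vecs[OF assms(1)]] by (intro sum.cong) auto
  then show ?thesis
    using symb_lincomb_rel[of s r "vec_index (co m)" "\<lambda>i. \<kappa> (unit_vec r i)"] assms co_nth[OF assms(1)] unit_M
    by (simp add: *)
qed

lemma std_sum:
  fixes A :: "'a set"
  assumes "\<And>a. a \<in> A \<Longrightarrow> w a \<in> carrier_vec r" "finite A"
  shows "std (vec r (\<lambda>i. \<Sum>a\<in>A. vec_index (w a) i)) x = (\<Sum>a\<in>A. std (w a) x)"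
proof -
  have symb_sum: "symb m (\<Sum>a\<in>A. f a) x = (\<Sum>a\<in>A. symb m (f a) x)" for m and f :: "'a \<Rightarrow> 'b"
    using assms(2) by (auto simp: symb_def)
  have "std (vec r (\<lambda>i. \<Sum>a\<in>A. vec_index (w a) i)) x = (\<Sum>i<r. symb (\<kappa> (unit_vec r i)) (\<Sum>a\<in>A. vec_index (w a) i) x)"
    unfolding std_def by (intro sum.cong) auto
  also have "\<dots> = (\<Sum>i<r. \<Sum>a\<in>A. symb (\<kappa> (unit_vec r i)) (vec_index (w a) i) x)"
    by (simp only: symb_sum)
  also have "\<dots> = (\<Sum>a\<in>A. std (w a) x)"
    unfolding std_def by (rule sum.swap)
  finally show ?thesis .
qed

text \<open>The other half: modulo relations a formal sum equals the standard one with the same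
  coordinates. So formal sums with equal value under \<open>kap\<close> are congruent.\<close>

lemma fs_std_rel:
  assumes c: "c \<in> fs"
  shows "(\<lambda>x. c x - std (kap c) x) \<in> rel"
proof -
  let ?A = "{m. c m \<noteq> 0}"
  have fin: "finite ?A"
    using c by (rule fsD)
  have csum: "c x = (\<Sum>m\<in>?A. symb m (c m) x)" for x
    using fin by (auto simp: symb_def)
  have "kap c = vec r (\<lambda>i. \<Sum>m\<in>?A. vec_index (c m \<cdot>\<^sub>v map_vec \<phi> (co m)) i)"
    unfolding kap_def using vecsD(2)[OF co_vecs[OF fsD(2)[OF c]]] by (intro eq_vecI) auto
  then have ssum: "std (kap c) x = (\<Sum>m\<in>?A. std (c m \<cdot>\<^sub>v map_vec \<phi> (co m)) x)" for x
    using std_sum[OF _ fin, of "\<lambda>m. c m \<cdot>\<^sub>v map_vec \<phi> (co m)"] vecsD(1)[OF co_vecs[OF fsD(2)[OF c]]] by simp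
  have "(\<lambda>x. c x - std (kap c) x) = (\<lambda>x. \<Sum>m\<in>?A. symb m (c m) x - std (c m \<cdot>\<^sub>v map_vec \<phi> (co m)) x)"
    unfolding sum_subtractf by (rule ext) (rule arg_cong2[OF csum ssum])
  moreover have "(\<lambda>x. \<Sum>m\<in>?A. symb m (c m) x - std (c m \<cdot>\<^sub>v map_vec \<phi> (co m)) x) \<in> rel"
    using symb_std_rel[OF fsD(2)[OF c] fsD(1)[OF c]] by (intro rel_sum) auto
  ultimately show ?thesis
    by (simp only:)
qed

lemma tensor_class_eq:
  assumes c: "c \<in> fs"
  shows "tensor_class \<phi> B S M c = cls (kap c)"
proof (intro equalityI subsetI)
  fix d assume "d \<in> tensor_class \<phi> B S M c"
  then have d: "d \<in> fs" "(\<lambda>x. d x - c x) \<in> rel"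
    by (auto simp: tensor_class_def)
  then have "kap d - kap c = 0\<^sub>v r"
    using rel_fs kap_diff[OF d(1) c] by simp
  then have "kap d = kap c"
  proof (intro eq_vecI)
    fix i assume "i < dim_vec (kap c)"
    then have i: "i < r"
      by (simp add: kap_def)
    have "vec_index (kap d - kap c) i = vec_index (0\<^sub>v r) i"
      using \<open>kap d - kap c = 0\<^sub>v r\<close> by simp
    then show "vec_index (kap d) i = vec_index (kap c) i"
      using i kap_carrier[of d] kap_carrier[of c] by simp
  qed (simp add: kap_def)
  then show "d \<in> cls (kap c)"
    using d by (simp add: cls_def)
next
  fix d assume "d \<in> cls (kap c)"
  then have d: "d \<in> fs" "kap d = kap c"
    by (auto simp: cls_def)
  have "(\<lambda>x. (d x - std (kap d) x) - (c x - std (kap c) x)) \<in> rel"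
    by (intro rel_diff fs_std_rel c d)
  then show "d \<in> tensor_class \<phi> B S M c"
    using d by (simp add: tensor_class_def)
qed

lemma std_cls: "w \<in> vecs S r \<Longrightarrow> std w \<in> cls w"
  by (simp add: cls_def std_fs kap_std)

lemma coordz_base_change: "coordz S r (base_change \<phi> B S M) cls"
  unfolding coordz_def
proof (intro conjI ballI)
  show "bij_betw cls (vecs S r) (carrier (base_change \<phi> B S M))"
  proof (rule bij_betwI')
    fix u w assume "u \<in> vecs S r" "w \<in> vecs S r"
    then show "(cls u = cls w) = (u = w)"
      using std_cls[of u] by (auto simp: cls_def)
  next
    fix u assume "u \<in> vecs S r"
    then have "cls u = tensor_class \<phi> B S M (std u)"
      by (simp add: tensor_class_eq std_fs kap_std)
    then show "cls u \<in> carrier (base_change \<phi> B S M)"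
      using std_fs[OF \<open>u \<in> vecs S r\<close>] by (simp add: base_change_def)
  next
    fix U assume "U \<in> carrier (base_change \<phi> B S M)"
    then obtain c where "c \<in> fs" "U = tensor_class \<phi> B S M c"
      by (auto simp: base_change_def)
    then show "\<exists>u\<in>vecs S r. U = cls u"
      using kap_vecs tensor_class_eq by blast
  qed
next
  fix u w assume u: "u \<in> vecs S r" and w: "w \<in> vecs S r"
  show "cls (u + w) = cls u \<oplus>\<^bsub>base_change \<phi> B S M\<^esub> cls w"
  proof (intro equalityI subsetI)
    fix d assume "d \<in> cls (u + w)"
    then have d: "d \<in> fs" "kap d = u + w"
      by (auto simp: cls_def)
    \<comment> \<open>The sum of two classes is a set of sums, so an element over u + w has to be
      split: into \<open>std u\<close> and a rest, which lies over w.\<close>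
    have "kap (\<lambda>x. d x - std u x) = u + w - u"
      using d u by (simp add: kap_diff std_fs kap_std)
    also have "\<dots> = w"
      using vecsD(1)[OF u] vecsD(1)[OF w] by (intro eq_vecI) auto
    finally have "(\<lambda>x. d x - std u x) \<in> cls w"
      using d u by (simp add: cls_def fs_diff std_fs)
    moreover have "d = (\<lambda>x. std u x + (d x - std u x))"
      by simp
    ultimately have "\<exists>c c'. d = (\<lambda>m. c m + c' m) \<and> c \<in> cls u \<and> c' \<in> cls w"
      using std_cls[OF u] by (intro exI[of _ "std u"] exI[of _ "\<lambda>x. d x - std u x"]) simp
    then show "d \<in> cls u \<oplus>\<^bsub>base_change \<phi> B S M\<^esub> cls w"
      by (simp add: base_change_def)
  next
    fix d assume "d \<in> cls u \<oplus>\<^bsub>base_change \<phi> B S M\<^esub> cls w"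
    then show "d \<in> cls (u + w)"
      by (auto simp: base_change_def cls_def fs_add kap_add)
  qed
next
  fix s w assume s: "s \<in> S" and w: "w \<in> vecs S r"
  have "tensor_class \<phi> B S M (\<lambda>m. s * c m) = cls (s \<cdot>\<^sub>v w)" if "c \<in> cls w" for c
    using that s by (simp add: cls_def[of w] tensor_class_eq fs_smult kap_smult)
  then show "cls (s \<cdot>\<^sub>v w) = s \<odot>\<^bsub>base_change \<phi> B S M\<^esub> cls w"
    using std_cls[OF w] by (auto simp: base_change_def)
next
  show "\<zero>\<^bsub>base_change \<phi> B S M\<^esub> = cls (0\<^sub>v r)"
    by (simp add: base_change_def tensor_class_eq fs_zero kap_zero)
qed

lemma pure_tensor_eq:
  "m \<in> carrier M \<Longrightarrow> s \<in> S \<Longrightarrow> pure_tensor \<phi> B S M m s = cls (s \<cdot>\<^sub>v map_vec \<phi> (co m))"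
  by (simp add: pure_tensor_def tensor_class_eq fs_symb kap_symb)

text \<open>\<open>tensor_lift\<close> picks a representative, but its value depends on the
  coordinates only, provided \<psi> turns the balancing factor \<phi>(b) into \<chi>(b) and
  \<open>g\<close> is linear with respect to \<chi>. The canonical maps are instances: \<psi> is the
  identity for extensions of linear maps, the Frobenius for \<open>frob_pull\<close>, and an
  automorphism applied to coefficients for the Galois action.\<close>

lemma tensor_lift_cls:
  fixes P :: "('b, 'n) module"
  assumes w: "w \<in> vecs S r" and P: "coordz S' r' P \<kappa>'" and S': "subr S'"
    and \<psi>: "\<And>x. x \<in> S \<Longrightarrow> \<psi> x \<in> S'" "\<And>x y. x \<in> S \<Longrightarrow> y \<in> S \<Longrightarrow> \<psi> (x + y) = \<psi> x + \<psi> y"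
    and \<chi>: "\<And>b. b \<in> B \<Longrightarrow> \<chi> b \<in> S'" "\<And>s b. s \<in> S \<Longrightarrow> b \<in> B \<Longrightarrow> \<psi> (s * \<phi> b) = \<psi> s * \<chi> b"
    and G: "G \<in> mats S' r' r"
    and g: "\<And>m. m \<in> carrier M \<Longrightarrow> g m = \<kappa>' (G *\<^sub>v map_vec \<chi> (co m))"
  shows "tensor_lift P \<psi> g (cls w) = \<kappa>' (G *\<^sub>v map_vec \<psi> w)"
proof -
  define c where "c = (SOME c. c \<in> cls w)"
  have "c \<in> cls w"
    unfolding c_def by (rule someI[of "\<lambda>c. c \<in> cls w", OF std_cls[OF w]])
  then have c: "c \<in> fs" "kap c = w"
    by (auto simp: cls_def)
  let ?A = "{m. c m \<noteq> 0}"
  have A: "finite ?A" "\<And>m. m \<in> ?A \<Longrightarrow> m \<in> carrier M"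
    using fsD[OF c(1)] by auto
  have \<psi>0: "\<psi> 0 = 0"
    using \<psi>(2)[OF subrD(1)[OF subr_S] subrD(1)[OF subr_S]] by (metis add.right_neutral add_left_cancel)
  have \<psi>_sum: "\<psi> (\<Sum>a\<in>I. f a) = (\<Sum>a\<in>I. \<psi> (f a))" if "\<And>a. a \<in> I \<Longrightarrow> f a \<in> S" for I and f :: "'m \<Rightarrow> 'b"
    using that
    by (induction I rule: infinite_finite_induct) (auto simp: \<psi>0 \<psi>(2) subr_sum[OF subr_S])
  have \<chi>co: "map_vec \<chi> (co m) \<in> vecs S' r" if "m \<in> carrier M" for m
    using vecsD[OF co_vecs[OF that]] \<chi>(1) by (intro vecsI) auto
  have Gco: "G *\<^sub>v map_vec \<chi> (co m) \<in> vecs S' r'" if "m \<in> carrier M" for m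
    by (intro mats_mult_vec[OF S' G] \<chi>co that)
  have "tensor_lift P \<psi> g (cls w) = (\<Oplus>\<^bsub>P\<^esub>m\<in>?A. \<psi> (c m) \<odot>\<^bsub>P\<^esub> g m)"
    by (simp add: tensor_lift_def Let_def c_def)
  also have "\<dots> = \<kappa>' (vec r' (\<lambda>i. \<Sum>m\<in>?A. vec_index (\<psi> (c m) \<cdot>\<^sub>v (G *\<^sub>v map_vec \<chi> (co m))) i))"
  proof (rule coordz_finsum[OF P S' _ A(1)])
    fix m assume "m \<in> ?A"
    then have m: "m \<in> carrier M"
      by (rule A)
    have cm: "\<psi> (c m) \<in> S'"
      by (intro \<psi>(1) fsD(1)[OF c(1)])
    show "\<psi> (c m) \<cdot>\<^sub>v (G *\<^sub>v map_vec \<chi> (co m)) \<in> vecs S' r'"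
      by (intro vecs_smult S' cm Gco m)
    show "\<psi> (c m) \<odot>\<^bsub>P\<^esub> g m = \<kappa>' (\<psi> (c m) \<cdot>\<^sub>v (G *\<^sub>v map_vec \<chi> (co m)))"
      unfolding g[OF m] by (rule coordzD(4)[OF P cm Gco[OF m]])
  qed
  also have "vec r' (\<lambda>i. \<Sum>m\<in>?A. vec_index (\<psi> (c m) \<cdot>\<^sub>v (G *\<^sub>v map_vec \<chi> (co m))) i) = G *\<^sub>v map_vec \<psi> w"
  proof (rule eq_vecI)
    fix i assume "i < dim_vec (G *\<^sub>v map_vec \<psi> w)"
    then have i: "i < r'"
      using matsD(2)[OF G] by simp
    have "vec_index (vec r' (\<lambda>i. \<Sum>m\<in>?A. vec_index (\<psi> (c m) \<cdot>\<^sub>v (G *\<^sub>v map_vec \<chi> (co m))) i)) i =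
        (\<Sum>m\<in>?A. \<psi> (c m) * (\<Sum>j<r. index_mat G (i, j) * \<chi> (vec_index (co m) j)))"
      using i
    proof (simp, intro sum.cong refl)
      fix m assume "m \<in> ?A"
      then have m: "m \<in> carrier M"
        by (rule A)
      have "vec_index (G *\<^sub>v map_vec \<chi> (co m)) i = (\<Sum>j<r. index_mat G (i, j) * \<chi> (vec_index (co m) j))"
        unfolding mult_mat_vec_nth[OF matsD(1)[OF G] vecsD(1)[OF \<chi>co[OF m]] i]
        using vecsD(2)[OF co_vecs[OF m]] by (intro sum.cong) auto
      then show "vec_index (\<psi> (c m) \<cdot>\<^sub>v (G *\<^sub>v map_vec \<chi> (co m))) i =
          \<psi> (c m) * (\<Sum>j<r. index_mat G (i, j) * \<chi> (vec_index (co m) j))"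
        using i matsD(2)[OF G] by simp
    qed
    also have "\<dots> = (\<Sum>j<r. index_mat G (i, j) * (\<Sum>m\<in>?A. \<psi> (c m) * \<chi> (vec_index (co m) j)))"
      unfolding sum_distrib_left by (subst sum.swap) (simp add: mult.left_commute)
    also have "\<dots> = (\<Sum>j<r. index_mat G (i, j) * \<psi> (vec_index w j))"
    proof (intro sum.cong refl arg_cong[where f = "(*) _"])
      fix j assume "j \<in> {..<r}"
      then have j: "j < r"
        by simp
      have *: "c m * \<phi> (vec_index (co m) j) \<in> S" if "m \<in> ?A" for m
        using that by (intro subrD(5)[OF subr_S] fsD(1)[OF c(1)] \<phi>_closed co_nth A(2) j)
      have "\<psi> (vec_index w j) = \<psi> (\<Sum>m\<in>?A. c m * \<phi> (vec_index (co m) j))"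
        using kap_nth[OF A(1) _ j, of c] c(2) by simp
      also have "\<dots> = (\<Sum>m\<in>?A. \<psi> (c m * \<phi> (vec_index (co m) j)))"
        by (rule \<psi>_sum[OF *])
      also have "\<dots> = (\<Sum>m\<in>?A. \<psi> (c m) * \<chi> (vec_index (co m) j))"
        using j by (intro sum.cong refl \<chi>(2) fsD(1)[OF c(1)] co_nth A(2))
      finally show "(\<Sum>m\<in>?A. \<psi> (c m) * \<chi> (vec_index (co m) j)) = \<psi> (vec_index w j)" ..
    qed
    also have "\<dots> = vec_index (G *\<^sub>v map_vec \<psi> w) i"
      using vecsD(1,2)[OF w] by (subst mult_mat_vec_nth[OF matsD(1)[OF G] _ i]) auto
    finally show "vec_index (vec r' (\<lambda>i. \<Sum>m\<in>?A. vec_index (\<psi> (c m) \<cdot>\<^sub>v (G *\<^sub>v map_vec \<chi> (co m))) i)) i =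
        vec_index (G *\<^sub>v map_vec \<psi> w) i" .
  qed (use matsD(2)[OF G] in simp)
  finally show ?thesis .
qed

end

definition rhom :: "('a::comm_ring_1 \<Rightarrow> 'a) \<Rightarrow> bool"
  where "rhom h \<longleftrightarrow> h 0 = 0 \<and> h 1 = 1 \<and> (\<forall>x y. h (x + y) = h x + h y) \<and> (\<forall>x y. h (x * y) = h x * h y)"

lemma rhomD:
  assumes "rhom h"
  shows "h 0 = 0" "h 1 = 1" "h (x + y) = h x + h y" "h (x * y) = h x * h y"
  using assms by (auto simp: rhom_def)

lemma rhom_sum: "rhom h \<Longrightarrow> h (sum f I) = (\<Sum>i\<in>I. h (f i))"
  by (induction I rule: infinite_finite_induct) (simp_all add: rhomD)

lemma rhom_power: "rhom h \<Longrightarrow> h (x ^ n) = h x ^ n"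
  by (induction n) (simp_all add: rhomD)

lemma rhom_uminus: "rhom h \<Longrightarrow> h (- x) = - h x"
  using rhomD(3)[of h "- x" x] rhomD(1)[of h] by (simp add: eq_neg_iff_add_eq_0)

lemma rhom_mult_mat:
  fixes h :: "'a::comm_ring_1 \<Rightarrow> 'a"
  assumes "rhom h" "A \<in> carrier_mat m n" "B \<in> carrier_mat n k"
  shows "map_mat h (A * B) = map_mat h A * map_mat h B"
proof (rule eq_matI)
  fix i j assume "i < dim_row (map_mat h A * map_mat h B)" "j < dim_col (map_mat h A * map_mat h B)"
  then have ij: "i < m" "j < k"
    using assms by auto
  have "index_mat (map_mat h (A * B)) (i, j) = h (index_mat (A * B) (i, j))"
    using assms ij by simp
  also have "\<dots> = (\<Sum>l<n. h (index_mat A (i, l)) * h (index_mat B (l, j)))"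
    unfolding mult_mat_nth[OF assms(2,3) ij] by (simp add: rhom_sum[OF assms(1)] rhomD(4)[OF assms(1)])
  also have "\<dots> = (\<Sum>l<n. index_mat (map_mat h A) (i, l) * index_mat (map_mat h B) (l, j))"
    using assms ij by (intro sum.cong) auto
  also have "\<dots> = index_mat (map_mat h A * map_mat h B) (i, j)"
    using assms by (intro mult_mat_nth[OF _ _ ij, symmetric]) auto
  finally show "index_mat (map_mat h (A * B)) (i, j) = index_mat (map_mat h A * map_mat h B) (i, j)" .
qed (use assms in auto)

lemma rhom_mult_vec:
  fixes h :: "'a::comm_ring_1 \<Rightarrow> 'a"
  assumes "rhom h" "A \<in> carrier_mat m n" "w \<in> carrier_vec n"
  shows "map_vec h (A *\<^sub>v w) = map_mat h A *\<^sub>v map_vec h w"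
proof (rule eq_vecI)
  fix i assume "i < dim_vec (map_mat h A *\<^sub>v map_vec h w)"
  then have i: "i < m"
    using assms by auto
  have "vec_index (map_vec h (A *\<^sub>v w)) i = h (vec_index (A *\<^sub>v w) i)"
    using assms i by simp
  also have "\<dots> = (\<Sum>l<n. h (index_mat A (i, l)) * h (vec_index w l))"
    unfolding mult_mat_vec_nth[OF assms(2,3) i] by (simp add: rhom_sum[OF assms(1)] rhomD(4)[OF assms(1)])
  also have "\<dots> = (\<Sum>l<n. index_mat (map_mat h A) (i, l) * vec_index (map_vec h w) l)"
    using assms i by (intro sum.cong) auto
  also have "\<dots> = vec_index (map_mat h A *\<^sub>v map_vec h w) i"
    using assms by (intro mult_mat_vec_nth[OF _ _ i, symmetric]) auto
  finally show "vec_index (map_vec h (A *\<^sub>v w)) i = vec_index (map_mat h A *\<^sub>v map_vec h w) i" .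
qed (use assms in auto)

lemma rhom_one_mat: "rhom h \<Longrightarrow> map_mat h (1\<^sub>m n) = 1\<^sub>m n"
  by (rule eq_matI) (auto simp: rhomD)

section \<open>Coefficientwise maps, power series and localizations\<close>

lemma map_coeffs_nth [simp]: "h 0 = 0 \<Longrightarrow> fls_nth (map_coeffs h f) i = h (fls_nth f i)"
  unfolding map_coeffs_def
  by (rule nth_Abs_fls_lower_bound[of "fls_subdegree f"]) auto

lemma map_coeffs_shift: "h 0 = 0 \<Longrightarrow> map_coeffs h (fls_shift n f) = fls_shift n (map_coeffs h f)"
  by (rule fls_eqI) simp

lemma map_coeffs_fps: "h 0 = 0 \<Longrightarrow> map_coeffs h (fps_to_fls f) = fps_to_fls (Abs_fps (\<lambda>i. h (fps_nth f i)))"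
  by (rule fls_eqI) (auto simp: fps_to_fls_nth)

text \<open>Multiplicativity is checked for power series, whose products have coefficients given by
  finite sums over fixed ranges, and carried over by shifting.\<close>

lemma rhom_map_coeffs:
  fixes h :: "'l::field \<Rightarrow> 'l"
  assumes "rhom h"
  shows "rhom (map_coeffs h)"
  unfolding rhom_def
proof (intro conjI allI)
  have h0: "h 0 = 0"
    using assms by (rule rhomD)
  show "map_coeffs h 0 = 0" "map_coeffs h 1 = 1"
    by (rule fls_eqI, simp add: h0 rhomD[OF assms])+
  fix f g :: "'l fls"
  show "map_coeffs h (f + g) = map_coeffs h f + map_coeffs h g"
    by (rule fls_eqI) (simp add: h0 rhomD[OF assms])
  have fps: "map_coeffs h (fps_to_fls a * fps_to_fls b) = map_coeffs h (fps_to_fls a) * map_coeffs h (fps_to_fls b)" for a b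
    by (simp add: map_coeffs_fps[of h, OF h0] flip: fls_times_fps_to_fls)
      (rule fps_ext, simp add: fps_mult_nth rhom_sum[OF assms] rhomD(4)[OF assms])
  obtain a where a: "f = fls_shift (- fls_subdegree f) (fps_to_fls a)"
    by (rule fls_as_fps[of f "- fls_subdegree f"]) auto
  obtain b where b: "g = fls_shift (- fls_subdegree g) (fps_to_fls b)"
    by (rule fls_as_fps[of g "- fls_subdegree g"]) auto
  have "map_coeffs h (fls_shift i (fps_to_fls a) * fls_shift j (fps_to_fls b)) =
      map_coeffs h (fls_shift i (fps_to_fls a)) * map_coeffs h (fls_shift j (fps_to_fls b))" for i j
    by (simp add: fls_times_both_shifted_simp map_coeffs_shift[of h, OF h0] fps)
  then show "map_coeffs h (f * g) = map_coeffs h f * map_coeffs h g"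
    using a b by metis
qed

lemma rhom_frobexp: "frobexp TYPE('l::field) q \<Longrightarrow> rhom (\<lambda>x::'l. x ^ q)"
  unfolding rhom_def using frobexp_gt1[where 'a = 'l, of q] frobexp_add[where 'a = 'l, of q]
  by (simp add: power_mult_distrib)

lemma rhom_frob: "frobexp TYPE('l::field) q \<Longrightarrow> rhom (frob q :: 'l fls \<Rightarrow> _)"
  unfolding frob_def by (intro rhom_map_coeffs rhom_frobexp)

lemma frob_fps: "q > 0 \<Longrightarrow> frob q (fps_to_fls f) = fps_to_fls (fps_frob q f)"
  by (simp add: frob_def map_coeffs_fps fps_frob_def)

lemma power_series_over_eq: "power_series_over S = fps_to_fls ` fps_over S"
  by (simp add: power_series_over_def fps_over_def)

lemma subr_power_series_over:
  assumes "subr S"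
  shows "subr (power_series_over S)"
  unfolding power_series_over_eq subr_def
proof (intro conjI ballI)
  note F = subrD[OF subr_fps_over[OF assms]]
  show "0 \<in> fps_to_fls ` fps_over S" "1 \<in> fps_to_fls ` fps_over S"
    using F(1,2) by (metis fps_zero_to_fls image_eqI, metis fps_one_to_fls image_eqI)
  fix x assume "x \<in> fps_to_fls ` fps_over S"
  then obtain a where a: "a \<in> fps_over S" "x = fps_to_fls a"
    by blast
  show "- x \<in> fps_to_fls ` fps_over S"
    using F(3)[OF a(1)] a(2) by (metis fps_to_fls_uminus image_eqI)
  fix y assume "y \<in> fps_to_fls ` fps_over S"
  then obtain b where b: "b \<in> fps_over S" "y = fps_to_fls b"
    by blast
  show "x + y \<in> fps_to_fls ` fps_over S" "x * y \<in> fps_to_fls ` fps_over S"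
    using F(4)[OF a(1) b(1)] F(5)[OF a(1) b(1)] a(2) b(2)
    by (metis fps_to_fls_plus image_eqI, metis fls_times_fps_to_fls image_eqI)
qed

lemma power_series_over_mono: "S \<subseteq> S' \<Longrightarrow> power_series_over S \<subseteq> power_series_over S'"
  by (auto simp: power_series_over_def)

lemma power_series_over_iff:
  assumes "0 \<in> S"
  shows "f \<in> power_series_over S \<longleftrightarrow> (\<forall>i. fls_nth f i \<in> S) \<and> (\<forall>i<0. fls_nth f i = 0)"
proof
  assume "f \<in> power_series_over S"
  then show "(\<forall>i. fls_nth f i \<in> S) \<and> (\<forall>i<0. fls_nth f i = 0)"
    using assms by (auto simp: power_series_over_eq fps_to_fls_nth intro: fps_overD)
next
  assume *: "(\<forall>i. fls_nth f i \<in> S) \<and> (\<forall>i<0. fls_nth f i = 0)"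
  have "f = fps_to_fls (Abs_fps (\<lambda>n. fls_nth f (int n)))"
    using * by (intro fls_eqI) (auto simp: fps_to_fls_nth)
  moreover have "Abs_fps (\<lambda>n. fls_nth f (int n)) \<in> fps_over S"
    using * by (intro fps_overI) auto
  ultimately show "f \<in> power_series_over S"
    unfolding power_series_over_eq by blast
qed

lemma localizeI: "x * s ^ n \<in> B \<Longrightarrow> x \<in> localize B s"
  by (auto simp: localize_def)

lemma localize_superset: "B \<subseteq> localize B s"
proof
  fix x assume "x \<in> B"
  then show "x \<in> localize B s"
    using localizeI[of x s 0 B] by simp
qed

lemma localize_mono: "B \<subseteq> B' \<Longrightarrow> localize B s \<subseteq> localize B' s"
  by (auto simp: localize_def)

lemma subr_localize:
  fixes B :: "'b::field set"
  assumes "subr B" "s \<in> B"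
  shows "subr (localize B s)"
  unfolding subr_def
proof (intro conjI ballI)
  show "0 \<in> localize B s" "1 \<in> localize B s"
    using localize_superset[of B s] subrD[OF assms(1)] by auto
  fix x assume "x \<in> localize B s"
  then obtain n where n: "x * s ^ n \<in> B"
    by (auto simp: localize_def)
  show "- x \<in> localize B s"
    using subrD(3)[OF assms(1) n] by (intro localizeI[of _ _ n]) simp
  fix y assume "y \<in> localize B s"
  then obtain m where m: "y * s ^ m \<in> B"
    by (auto simp: localize_def)
  have p: "s ^ k \<in> B" for k
    by (rule subr_power[OF assms])
  have "x * s ^ n * s ^ m + y * s ^ m * s ^ n \<in> B"
    by (intro subrD(4)[OF assms(1)] subrD(5)[OF assms(1)] n m p)
  then show "x + y \<in> localize B s"
    by (intro localizeI[of _ _ "n + m"]) (simp add: algebra_simps power_add)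
  have "x * s ^ n * (y * s ^ m) \<in> B"
    by (intro subrD(5)[OF assms(1)] n m)
  then show "x * y \<in> localize B s"
    by (intro localizeI[of _ _ "n + m"]) (simp add: algebra_simps power_add)
qed

lemma localize_common_exponent:
  fixes B :: "'b::field set"
  assumes "subr B" "s \<in> B" "finite A" "\<And>a. a \<in> A \<Longrightarrow> f a \<in> localize B s"
  obtains n where "\<And>a. a \<in> A \<Longrightarrow> f a * s ^ n \<in> B"
proof -
  have "\<exists>n. \<forall>a\<in>A. f a * s ^ n \<in> B"
    using assms(3,4)
  proof (induction A rule: finite_induct)
    case (insert a A)
    then obtain n where n: "\<forall>a\<in>A. f a * s ^ n \<in> B"
      by auto
    obtain m where m: "f a * s ^ m \<in> B"
      using insert.prems by (auto simp: localize_def)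
    have "f b * s ^ (n + m) \<in> B" if "b \<in> insert a A" for b
    proof (cases "b = a")
      case True
      then show ?thesis
        using subrD(5)[OF assms(1) m subr_power[OF assms(1,2), of n]] by (simp add: power_add mult_ac)
    next
      case False
      then have "f b * s ^ n \<in> B"
        using n that by blast
      then show ?thesis
        using subrD(5)[OF assms(1) _ subr_power[OF assms(1,2), of m]] by (simp add: power_add mult.assoc[symmetric])
    qed
    then show ?case
      by blast
  qed auto
  then show thesis
    using that by blast
qed

lemma z_minus_fps: "z_minus \<zeta> = fps_to_fls (lin \<zeta>)"
  by (simp add: z_minus_def)

lemma z_minus_over:
  assumes "subr S" "\<zeta> \<in> S"
  shows "z_minus \<zeta> \<in> power_series_over S"
  unfolding z_minus_fps power_series_over_eq
  by (intro imageI subrD(6)[OF subr_fps_over] fps_X_over fps_const_over assms)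

lemma z_minus_inverse:
  fixes \<zeta> :: "'l::field"
  assumes "subr S" "inverse \<zeta> \<in> S" "\<zeta> \<noteq> 0"
  shows "inverse (z_minus \<zeta>) \<in> power_series_over S"
proof -
  \<comment> \<open>The geometric series of 1/(z - \<zeta>).\<close>
  define g where "g = Abs_fps (\<lambda>i. - (inverse \<zeta> ^ Suc i))"
  have "lin \<zeta> * g = 1"
  proof (rule fps_ext)
    fix i
    show "fps_nth (lin \<zeta> * g) i = fps_nth 1 i"
      using assms(3) by (cases i) (simp_all add: lin_mult_nth_Suc g_def fps_one_nth)
  qed
  then have "z_minus \<zeta> * fps_to_fls g = 1"
    unfolding z_minus_fps fls_times_fps_to_fls[symmetric] by simp
  then have "inverse (z_minus \<zeta>) = fps_to_fls g"
    by (rule inverse_unique)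
  moreover have "g \<in> fps_over S"
    unfolding g_def using subr_power[OF assms(1,2)] subrD(3)[OF assms(1)] by (intro fps_overI) (simp del: power_Suc)
  ultimately show ?thesis
    unfolding power_series_over_eq by blast
qed

lemma shtuka_ring_subset:
  fixes \<zeta> :: "'l::field"
  assumes "subr S" "R \<subseteq> S" "inverse \<zeta> \<in> S" "\<zeta> \<noteq> 0"
  shows "shtuka_ring R \<zeta> \<subseteq> power_series_over S"
proof
  fix x assume "x \<in> shtuka_ring R \<zeta>"
  then obtain n where n: "x * z_minus \<zeta> ^ n \<in> power_series_over R"
    by (auto simp: shtuka_ring_def localize_def)
  have "z_minus \<zeta> \<noteq> 0"
    using assms(4) by (auto simp: z_minus_def dest!: arg_cong[where f = "\<lambda>f. fls_nth f 0"])
  then have "x = x * z_minus \<zeta> ^ n * inverse (z_minus \<zeta>) ^ n"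
    by (simp add: field_simps)
  also have "\<dots> \<in> power_series_over S"
  proof (rule subrD(5)[OF subr_power_series_over[OF assms(1)]])
    show "x * z_minus \<zeta> ^ n \<in> power_series_over S"
      using n power_series_over_mono[OF assms(2)] by blast
    show "inverse (z_minus \<zeta>) ^ n \<in> power_series_over S"
      by (intro subr_power[OF subr_power_series_over] z_minus_inverse assms)
  qed
  finally show "x \<in> power_series_over S" .
qed

lemma map_vec_ident: "map_vec (\<lambda>x. x) w = w"
  by (intro eq_vecI) auto

section \<open>The canonical maps in coordinates\<close>

locale lift_setting =
  fixes R :: "'l::field set" and q :: nat
  assumes subr_R': "subr R" and frobexp': "frobexp TYPE('l) q"
begin

abbreviation "B \<equiv> power_series_over R"

lemma subr_B': "subr B"
  by (rule subr_power_series_over[OF subr_R'])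

lemmas rhom_q = rhom_frob[OF frobexp']

lemma frob_B: "b \<in> B \<Longrightarrow> frob q b \<in> B"
  using frobexp_gt1[OF frobexp'] fps_frob_over[OF subr_R'] by (auto simp: power_series_over_eq frob_fps)

text \<open>Coordinates on M \<otimes> S for the basis e_i \<otimes> 1; \<open>fcl\<close> does the
  same for the Frobenius pullback with the pulled back basis.\<close>

definition cl :: "'l fls set \<Rightarrow> ('l fls, 'm) module \<Rightarrow> nat \<Rightarrow> ('l fls vec \<Rightarrow> 'm) \<Rightarrow> 'l fls vec \<Rightarrow> ('m \<Rightarrow> 'l fls) set"
  where "cl S M r \<kappa> = base_change_setting.cls (\<lambda>x. x) B S M r \<kappa>"

definition fcl :: "'l fls set \<Rightarrow> ('l fls, 'm) module \<Rightarrow> nat \<Rightarrow> ('l fls vec \<Rightarrow> 'm) \<Rightarrow> 'l fls vec \<Rightarrow> ('m \<Rightarrow> 'l fls) set"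
  where "fcl S M r \<kappa> = base_change_setting.cls (frob q) B S M r \<kappa>"

lemma bcs:
  assumes "subr S" "B \<subseteq> S" "coordz B r M \<kappa>"
  shows "base_change_setting (\<lambda>x. x) B S M r \<kappa>" "base_change_setting (frob q) B S M r \<kappa>"
  using assms subr_B' frob_B rhomD[OF rhom_q] by (unfold_locales) auto

context
  fixes M :: "('l fls, 'm) module" and r \<kappa>
  assumes M: "coordz B r M \<kappa>"
begin

lemma coB: "m \<in> carrier M \<Longrightarrow> crd B r \<kappa> m \<in> vecs B r"
  by (rule crd(2)[OF M])

context
  fixes S
  assumes S: "subr S" "B \<subseteq> S"
begin

lemma coordz_ext: "coordz S r (ext R S M) (cl S M r \<kappa>)"
  unfolding cl_def by (rule base_change_setting.coordz_base_change[OF bcs(1)[OF S M]])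

lemma coordz_frob_ext: "coordz S r (frob_ext q R S M) (fcl S M r \<kappa>)"
  unfolding fcl_def by (rule base_change_setting.coordz_base_change[OF bcs(2)[OF S M]])

lemma pure_ext_eq: "m \<in> carrier M \<Longrightarrow> pure_ext R S M m = cl S M r \<kappa> (crd B r \<kappa> m)"
  unfolding cl_def using base_change_setting.pure_tensor_eq[OF bcs(1)[OF S M], of m 1] subrD(2)[OF S(1)]
  by (simp add: map_vec_ident)

lemma pure_frob_ext_eq: "m \<in> carrier M \<Longrightarrow> pure_frob_ext q R S M m = fcl S M r \<kappa> (map_vec (frob q) (crd B r \<kappa> m))"
  unfolding fcl_def using base_change_setting.pure_tensor_eq[OF bcs(2)[OF S M], of m 1] subrD(2)[OF S(1)]
  by simp

lemma frob_pull_eq: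
  assumes w: "w \<in> vecs S r" and "\<And>s. s \<in> S \<Longrightarrow> frob q s \<in> S"
  shows "frob_pull q R S M (cl S M r \<kappa> w) = fcl S M r \<kappa> (map_vec (frob q) w)"
proof -
  have "frob_pull q R S M (cl S M r \<kappa> w) = fcl S M r \<kappa> (1\<^sub>m r *\<^sub>v map_vec (frob q) w)"
    unfolding frob_pull_def cl_def
  proof (rule base_change_setting.tensor_lift_cls[OF bcs(1)[OF S M] w coordz_frob_ext S(1), where \<chi> = "frob q"])
    fix m assume m: "m \<in> carrier M"
    show "pure_frob_ext q R S M m = fcl S M r \<kappa> (1\<^sub>m r *\<^sub>v map_vec (frob q) (crd B r \<kappa> m))"
      using pure_frob_ext_eq[OF m] vecsD(1)[OF coB[OF m]] by simp
  qed (use assms S rhomD[OF rhom_q] in \<open>auto simp: mats_one\<close>)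
  then show ?thesis
    using vecsD(1)[OF w] by simp
qed

text \<open>Elements of M have coordinates with coefficients in \<open>R\<close>, which
  \<open>g\<close> fixes; so \<open>g\<close> acts on coordinates alone.\<close>

lemma galois_eq:
  assumes w: "w \<in> vecs S r" and g: "rhom g" "\<And>x. x \<in> R \<Longrightarrow> g x = x" "\<And>s. s \<in> S \<Longrightarrow> map_coeffs g s \<in> S"
  shows "tensor_lift (ext R S M) (map_coeffs g) (pure_ext R S M) (cl S M r \<kappa> w) =
    cl S M r \<kappa> (map_vec (map_coeffs g) w)"
proof -
  have B: "map_coeffs g b = b" if "b \<in> B" for b
    using that g(2) subrD(1)[OF subr_R'] power_series_over_iff[of R b]
    by (intro fls_eqI) (simp add: rhomD(1)[OF g(1)])
  note rg = rhomD[OF rhom_map_coeffs[OF g(1)]]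
  have "tensor_lift (ext R S M) (map_coeffs g) (pure_ext R S M) (cl S M r \<kappa> w) =
      cl S M r \<kappa> (1\<^sub>m r *\<^sub>v map_vec (map_coeffs g) w)"
    unfolding cl_def[of S M r \<kappa>, THEN fun_cong, of w]
  proof (rule base_change_setting.tensor_lift_cls[OF bcs(1)[OF S M] w coordz_ext S(1), where \<chi> = "map_coeffs g"])
    fix m assume m: "m \<in> carrier M"
    have "map_vec (map_coeffs g) (crd B r \<kappa> m) = crd B r \<kappa> m"
      using B vecsD[OF coB[OF m]] by (intro eq_vecI) auto
    then show "pure_ext R S M m = cl S M r \<kappa> (1\<^sub>m r *\<^sub>v map_vec (map_coeffs g) (crd B r \<kappa> m))"
      using pure_ext_eq[OF m] vecsD(1)[OF coB[OF m]] by simp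
  qed (use g S rg in \<open>auto simp: mats_one\<close>)
  then show ?thesis
    using vecsD(1)[OF w] by simp
qed

lemma enlarge_eq:
  assumes S': "subr S'" "B \<subseteq> S'" "S' \<subseteq> S" and w: "w \<in> vecs S' r"
  shows "enlarge R S M (cl S' M r \<kappa> w) = cl S M r \<kappa> w"
proof -
  have "enlarge R S M (cl S' M r \<kappa> w) = cl S M r \<kappa> (1\<^sub>m r *\<^sub>v map_vec (\<lambda>x. x) w)"
    unfolding enlarge_def cl_def[of S' M r \<kappa>]
  proof (rule base_change_setting.tensor_lift_cls[OF bcs(1)[OF S'(1,2) M] w coordz_ext S(1), where \<chi> = "\<lambda>x. x"])
    fix m assume m: "m \<in> carrier M"
    show "pure_ext R S M m = cl S M r \<kappa> (1\<^sub>m r *\<^sub>v map_vec (\<lambda>x. x) (crd B r \<kappa> m))"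
      using pure_ext_eq[OF m] vecsD(1)[OF coB[OF m]] by (simp add: map_vec_ident)
  qed (use S S' in \<open>auto simp: mats_one\<close>)
  then show ?thesis
    using vecsD(1)[OF w] by (simp add: map_vec_ident)
qed

lemma frob_enlarge_eq:
  assumes S': "subr S'" "B \<subseteq> S'" "S' \<subseteq> S" and w: "w \<in> vecs S' r"
  shows "frob_enlarge q R S M (fcl S' M r \<kappa> w) = fcl S M r \<kappa> w"
proof -
  have "frob_enlarge q R S M (fcl S' M r \<kappa> w) = fcl S M r \<kappa> (1\<^sub>m r *\<^sub>v map_vec (\<lambda>x. x) w)"
    unfolding frob_enlarge_def fcl_def[of S' M r \<kappa>]
  proof (rule base_change_setting.tensor_lift_cls[OF bcs(2)[OF S'(1,2) M] w coordz_frob_ext S(1), where \<chi> = "frob q"])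
    fix m assume m: "m \<in> carrier M"
    show "pure_frob_ext q R S M m = fcl S M r \<kappa> (1\<^sub>m r *\<^sub>v map_vec (frob q) (crd B r \<kappa> m))"
      using pure_frob_ext_eq[OF m] vecsD(1)[OF coB[OF m]] by simp
  qed (use S S' frob_B in \<open>auto simp: mats_one\<close>)
  then show ?thesis
    using vecsD(1)[OF w] by (simp add: map_vec_ident)
qed

lemma tau_ext_eq:
  assumes W: "subr (shtuka_ring R \<zeta>)" "B \<subseteq> shtuka_ring R \<zeta>" "shtuka_ring R \<zeta> \<subseteq> S"
    and \<tau>: "act (shtuka_ring R \<zeta>) r (fcl (shtuka_ring R \<zeta>) M r \<kappa>) (cl (shtuka_ring R \<zeta>) M r \<kappa>) \<tau> T"
    and T: "T \<in> mats (shtuka_ring R \<zeta>) r r" and w: "w \<in> vecs S r"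
  shows "tau_ext R q \<zeta> S (M, \<tau>) (fcl S M r \<kappa> w) = cl S M r \<kappa> (T *\<^sub>v w)"
proof -
  interpret bw: base_change_setting "\<lambda>x. x" B "shtuka_ring R \<zeta>" M r \<kappa>
    by (rule bcs(1)[OF W(1,2) M])
  have "tau_ext R q \<zeta> S (M, \<tau>) (fcl S M r \<kappa> w) = cl S M r \<kappa> (T *\<^sub>v map_vec (\<lambda>x. x) w)"
    unfolding tau_ext_def fcl_def[of S M r \<kappa>] prod.case
  proof (rule base_change_setting.tensor_lift_cls[OF bcs(2)[OF S M] w coordz_ext S(1), where \<chi> = "frob q"])
    fix m assume m: "m \<in> carrier M"
    have fm: "map_vec (frob q) (crd B r \<kappa> m) \<in> vecs (shtuka_ring R \<zeta>) r"
      using vecsD[OF coB[OF m]] frob_B W(2) by (intro vecsI) auto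
    have "pure_frob_ext q R (shtuka_ring R \<zeta>) M m = fcl (shtuka_ring R \<zeta>) M r \<kappa> (map_vec (frob q) (crd B r \<kappa> m))"
      unfolding fcl_def using base_change_setting.pure_tensor_eq[OF bcs(2)[OF W(1,2) M] m, of 1] subrD(2)[OF W(1)]
      by simp
    then have "\<tau> (pure_frob_ext q R (shtuka_ring R \<zeta>) M m) =
        cl (shtuka_ring R \<zeta>) M r \<kappa> (T *\<^sub>v map_vec (frob q) (crd B r \<kappa> m))"
      using \<tau> fm by (simp add: act_def)
    then show "enlarge R S M (\<tau> (pure_frob_ext q R (shtuka_ring R \<zeta>) M m)) =
        cl S M r \<kappa> (T *\<^sub>v map_vec (frob q) (crd B r \<kappa> m))"
      using enlarge_eq[OF W mats_mult_vec[OF W(1) T fm]] by simp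
  qed (use S W subsetD[OF mats_mono[OF W(3)] T] frob_B in auto)
  then show ?thesis
    by (simp add: map_vec_ident)
qed

end

context
  fixes N :: "('l fls, 'n) module" and s \<kappa>' S
  assumes N: "coordz B s N \<kappa>'" and S: "subr S" "B \<subseteq> S"
begin

lemma coordz_ext': "coordz S s (ext R S N) (cl S N s \<kappa>')"
  unfolding cl_def by (rule base_change_setting.coordz_base_change[OF bcs(1)[OF S N]])

lemma coordz_frob_ext': "coordz S s (frob_ext q R S N) (fcl S N s \<kappa>')"
  unfolding fcl_def by (rule base_change_setting.coordz_base_change[OF bcs(2)[OF S N]])

lemma act_carrier:
  assumes H: "H \<in> mats B s r" "act B r \<kappa> \<kappa>' f H" and m: "m \<in> carrier M"
  shows "f m \<in> carrier N" "crd B s \<kappa>' (f m) = H *\<^sub>v crd B r \<kappa> m"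
proof -
  have "f m = \<kappa>' (H *\<^sub>v crd B r \<kappa> m)"
    using H(2) coB[OF m] crd(3)[OF M m] unfolding act_def by metis
  moreover have "H *\<^sub>v crd B r \<kappa> m \<in> vecs B s"
    by (rule mats_mult_vec[OF subr_B' H(1) coB[OF m]])
  ultimately show "f m \<in> carrier N" "crd B s \<kappa>' (f m) = H *\<^sub>v crd B r \<kappa> m"
    using coordzD(1)[OF N] crd(1)[OF N] by auto
qed

lemma map_ext_eq:
  assumes H: "H \<in> mats B s r" "act B r \<kappa> \<kappa>' f H" and w: "w \<in> vecs S r"
  shows "map_ext R S N f (cl S M r \<kappa> w) = cl S N s \<kappa>' (H *\<^sub>v w)"
proof -
  have "map_ext R S N f (cl S M r \<kappa> w) = cl S N s \<kappa>' (H *\<^sub>v map_vec (\<lambda>x. x) w)"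
    unfolding map_ext_def cl_def[of S M r \<kappa>]
  proof (rule base_change_setting.tensor_lift_cls[OF bcs(1)[OF S M] w coordz_ext' S(1), where \<chi> = "\<lambda>x. x"])
    fix m assume m: "m \<in> carrier M"
    have "pure_ext R S N (f m) = cl S N s \<kappa>' (crd B s \<kappa>' (f m))"
      unfolding cl_def
      using base_change_setting.pure_tensor_eq[OF bcs(1)[OF S N] act_carrier(1)[OF H m], of 1] subrD(2)[OF S(1)]
      by (simp add: map_vec_ident)
    then show "pure_ext R S N (f m) = cl S N s \<kappa>' (H *\<^sub>v map_vec (\<lambda>x. x) (crd B r \<kappa> m))"
      by (simp add: act_carrier(2)[OF H m] map_vec_ident)
  qed (use S H mats_mono[OF S(2)] in auto)
  then show ?thesis
    by (simp add: map_vec_ident)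
qed

text \<open>The pullback of an element has its twisted coordinates, hence the pullback of
  \<open>f\<close> has the twisted matrix.\<close>

lemma map_frob_ext_eq:
  assumes H: "H \<in> mats B s r" "act B r \<kappa> \<kappa>' f H" and w: "w \<in> vecs S r"
  shows "map_frob_ext q R S N f (fcl S M r \<kappa> w) = fcl S N s \<kappa>' (map_mat (frob q) H *\<^sub>v w)"
proof -
  have fH: "map_mat (frob q) H \<in> mats S s r"
    using matsD[OF H(1)] frob_B S(2) by (intro matsI) auto
  have "map_frob_ext q R S N f (fcl S M r \<kappa> w) = fcl S N s \<kappa>' (map_mat (frob q) H *\<^sub>v map_vec (\<lambda>x. x) w)"
    unfolding map_frob_ext_def fcl_def[of S M r \<kappa>]
  proof (rule base_change_setting.tensor_lift_cls[OF bcs(2)[OF S M] w coordz_frob_ext' S(1) _ _ _ _ fH, where \<chi> = "frob q"])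
    fix m assume m: "m \<in> carrier M"
    have "pure_frob_ext q R S N (f m) = fcl S N s \<kappa>' (map_vec (frob q) (crd B s \<kappa>' (f m)))"
      unfolding fcl_def
      using base_change_setting.pure_tensor_eq[OF bcs(2)[OF S N] act_carrier(1)[OF H m], of 1] subrD(2)[OF S(1)]
      by simp
    then show "pure_frob_ext q R S N (f m) = fcl S N s \<kappa>' (map_mat (frob q) H *\<^sub>v map_vec (frob q) (crd B r \<kappa> m))"
      by (simp add: act_carrier(2)[OF H m] rhom_mult_vec[OF rhom_q matsD(1)[OF H(1)] vecsD(1)[OF coB[OF m]]])
  qed (use S frob_B in auto)
  then show ?thesis
    by (simp add: map_vec_ident)
qed

context
  fixes E f H
  assumes E: "subr E" "B \<subseteq> E" "E \<subseteq> S" and H: "H \<in> mats E s r" "act E r (cl E M r \<kappa>) (cl E N s \<kappa>') f H"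
begin

lemma act_pure:
  assumes m: "m \<in> carrier M"
  shows "f (pure_ext R E M m) = cl E N s \<kappa>' (H *\<^sub>v crd B r \<kappa> m)" "H *\<^sub>v crd B r \<kappa> m \<in> vecs E s"
proof -
  have c: "crd B r \<kappa> m \<in> vecs E r"
    using coB[OF m] vecs_mono[OF E(2)] by blast
  show "f (pure_ext R E M m) = cl E N s \<kappa>' (H *\<^sub>v crd B r \<kappa> m)"
    using H(2) c unfolding act_def pure_ext_eq[OF E(1,2) m] by blast
  show "H *\<^sub>v crd B r \<kappa> m \<in> vecs E s"
    by (rule mats_mult_vec[OF E(1) H(1) c])
qed

lemma qmap_ext_eq:
  assumes "E = inv_z_ring R" and w: "w \<in> vecs S r"
  shows "qmap_ext R S M N f (cl S M r \<kappa> w) = cl S N s \<kappa>' (H *\<^sub>v w)"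
proof -
  have "qmap_ext R S M N f (cl S M r \<kappa> w) = cl S N s \<kappa>' (H *\<^sub>v map_vec (\<lambda>x. x) w)"
    unfolding qmap_ext_def cl_def[of S M r \<kappa>] assms(1)[symmetric]
  proof (rule base_change_setting.tensor_lift_cls[OF bcs(1)[OF S M] w coordz_ext' S(1), where \<chi> = "\<lambda>x. x"])
    fix m assume m: "m \<in> carrier M"
    have "enlarge R S N (cl E N s \<kappa>' (H *\<^sub>v crd B r \<kappa> m)) = cl S N s \<kappa>' (H *\<^sub>v crd B r \<kappa> m)"
      by (rule lift_setting.enlarge_eq[OF lift_setting_axioms N S E act_pure(2)[OF m]])
    then show "enlarge R S N (f (pure_ext R E M m)) = cl S N s \<kappa>' (H *\<^sub>v map_vec (\<lambda>x. x) (crd B r \<kappa> m))"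
      unfolding act_pure(1)[OF m] by (simp add: map_vec_ident)
  qed (use S H mats_mono[OF E(3)] in auto)
  then show ?thesis
    by (simp add: map_vec_ident)
qed

text \<open>The image of an element of M lies only in N \<otimes> E, so it is pulled back there and
  enlarged afterwards; for this the Frobenius has to preserve \<open>E\<close>.\<close>

lemma qmap_frob_ext_eq:
  assumes "E = inv_z_ring R" and w: "w \<in> vecs S r" and fE: "\<And>x. x \<in> E \<Longrightarrow> frob q x \<in> E"
  shows "qmap_frob_ext q R S M N f (fcl S M r \<kappa> w) = fcl S N s \<kappa>' (map_mat (frob q) H *\<^sub>v w)"
proof -
  have fH: "map_mat (frob q) H \<in> mats S s r"
    using matsD[OF H(1)] fE E(3) by (intro matsI) auto
  have "qmap_frob_ext q R S M N f (fcl S M r \<kappa> w) = fcl S N s \<kappa>' (map_mat (frob q) H *\<^sub>v map_vec (\<lambda>x. x) w)"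
    unfolding qmap_frob_ext_def fcl_def[of S M r \<kappa>] assms(1)[symmetric]
  proof (rule base_change_setting.tensor_lift_cls[OF bcs(2)[OF S M] w coordz_frob_ext' S(1) _ _ _ _ fH, where \<chi> = "frob q"])
    fix m assume m: "m \<in> carrier M"
    have "frob_pull q R E N (cl E N s \<kappa>' (H *\<^sub>v crd B r \<kappa> m)) = fcl E N s \<kappa>' (map_vec (frob q) (H *\<^sub>v crd B r \<kappa> m))"
      by (rule lift_setting.frob_pull_eq[OF lift_setting_axioms N E(1,2) act_pure(2)[OF m] fE])
    moreover have "map_vec (frob q) (H *\<^sub>v crd B r \<kappa> m) \<in> vecs E s"
      using vecsD[OF act_pure(2)[OF m]] fE by (intro vecsI) auto
    then have "frob_enlarge q R S N (fcl E N s \<kappa>' (map_vec (frob q) (H *\<^sub>v crd B r \<kappa> m))) =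
        fcl S N s \<kappa>' (map_vec (frob q) (H *\<^sub>v crd B r \<kappa> m))"
      by (rule lift_setting.frob_enlarge_eq[OF lift_setting_axioms N S E])
    ultimately show "frob_enlarge q R S N (frob_pull q R E N (f (pure_ext R E M m))) =
        fcl S N s \<kappa>' (map_mat (frob q) H *\<^sub>v map_vec (frob q) (crd B r \<kappa> m))"
      unfolding act_pure(1)[OF m] by (simp add: rhom_mult_vec[OF rhom_q matsD(1)[OF H(1)] vecsD(1)[OF coB[OF m]]])
  qed (use S frob_B in auto)
  then show ?thesis
    by (simp add: map_vec_ident)
qed

end

end

end

end


section \<open>Constants and parameters of the setting\<close>

text \<open>The translates of \<open>G\<close> by multiples i x, 0 \<le> i < p, are disjoint: a
  nonzero difference of two such i is invertible modulo p, so a common element would put x into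
  \<open>G\<close>.\<close>

lemma additive_subgroup_extend:
  fixes G :: "'a::field set"
  assumes G: "finite G" "0 \<in> G" "\<And>x y. x \<in> G \<Longrightarrow> y \<in> G \<Longrightarrow> x - y \<in> G" and x: "x \<notin> G"
    and p: "normalization_semidom_class.prime p" "p = CHAR('a)"
  defines "G' \<equiv> (\<lambda>(g, i). g + of_nat i * x) ` (G \<times> {..<p})"
  shows "card G' = p * card G" "\<And>x y. x \<in> G' \<Longrightarrow> y \<in> G' \<Longrightarrow> x - y \<in> G'"
proof -
  have uminus: "- y \<in> G" if "y \<in> G" for y
    using G(3)[OF G(2) that] by simp
  have add: "y + z \<in> G" if "y \<in> G" "z \<in> G" for y z
    using G(3)[OF that(1) uminus[OF that(2)]] by simp
  have mult: "of_nat n * y \<in> G" if "y \<in> G" for n y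
    by (induction n) (auto simp: G(2) algebra_simps intro: add that)
  have nomult: "of_nat d * x \<notin> G" if d: "0 < d" "d < p" for d
  proof
    assume *: "of_nat d * x \<in> G"
    have "coprime d p"
      using d p(1) by (metis coprime_commute nat_dvd_not_less prime_imp_coprime)
    then obtain e where "[d * e = Suc 0] (mod p)"
      using cong_solve_coprime_nat[of d p] by blast
    then have "of_nat (d * e) = (of_nat (Suc 0) :: 'a)"
      unfolding p(2) by (simp only: of_nat_eq_iff_cong_CHAR)
    moreover have "of_nat e * (of_nat d * x) = of_nat (d * e) * x"
      by (simp add: mult_ac)
    ultimately have "of_nat e * (of_nat d * x) = x"
      by (simp only: of_nat_Suc of_nat_0 add_0_right mult_1_left)
    then show False
      using mult[OF *, of e] x by (simp only:)
  qed
  have le: "i = j" if "g + of_nat i * x = h + of_nat j * x" "g \<in> G" "h \<in> G" "i < p" "i \<le> j" "j < p" for g h i j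
  proof (rule ccontr)
    assume "i \<noteq> j"
    have "of_nat (j - i) * x = g - h"
      using that(1,5) by (simp add: of_nat_diff algebra_simps)
    then have "of_nat (j - i) * x \<in> G"
      using G(3)[OF that(2,3)] by (simp only:)
    moreover have "0 < j - i" "j - i < p"
      using that \<open>i \<noteq> j\<close> by linarith+
    ultimately show False
      using nomult by blast
  qed
  have "inj_on (\<lambda>(g, i). g + of_nat i * x) (G \<times> {..<p})"
  proof (rule inj_onI)
    fix y z
    assume yz: "y \<in> G \<times> {..<p}" "z \<in> G \<times> {..<p}"
      "(case y of (g, i) \<Rightarrow> g + of_nat i * x) = (case z of (g, i) \<Rightarrow> g + of_nat i * x)"
    obtain g i h j where gh: "y = (g, i)" "z = (h, j)"
      by (cases y, cases z)
    then have *: "g \<in> G" "h \<in> G" "i < p" "j < p" "g + of_nat i * x = h + of_nat j * x"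
      using yz by auto
    then have "i = j"
      using le[of g i h j] le[of h j g i] by (cases "i \<le> j") auto
    then show "y = z"
      using *(5) gh by simp
  qed
  then show "card G' = p * card G"
    unfolding G'_def by (simp add: card_image card_cartesian_product)
  fix y z assume "y \<in> G'" "z \<in> G'"
  then obtain g i h j where *: "g \<in> G" "h \<in> G" "i < p" "j < p" "y = g + of_nat i * x" "z = h + of_nat j * x"
    unfolding G'_def by auto
  \<comment> \<open>The difference i - j modulo p, written so that no natural subtraction is
    truncated.\<close>
  define k where "k = (i + (p - j)) mod p"
  have "of_nat k = (of_nat (i + (p - j)) :: 'a)"
    unfolding of_nat_eq_iff_cong_CHAR k_def p(2)[symmetric] by (simp add: cong_def)
  also have "\<dots> = of_nat i - of_nat j"
    using *(4) p(2) by (simp add: of_nat_diff)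
  finally have k: "of_nat k = (of_nat i - of_nat j :: 'a)" .
  have "y - z = (g - h) + of_nat k * x"
    unfolding k *(5,6) by (simp add: left_diff_distrib)
  moreover have "k < p"
    using p(1) by (simp add: k_def prime_gt_0_nat)
  ultimately show "y - z \<in> G'"
    unfolding G'_def using G(3)[OF *(1,2)] by (intro image_eqI[of _ _ "(g - h, k)"]) auto
qed

text \<open>Finiteness makes the characteristic p positive. A subgroup of \<open>F\<close> of
  largest p-power order is all of \<open>F\<close>, since adjoining an element would multiply its
  order by p; and the exponent is positive because 0 and 1 differ.\<close>

lemma finite_subring_frobexp:
  fixes F :: "'a::field set"
  assumes F: "subr F" "finite F"
  shows "frobexp TYPE('a) (card F)"
proof -
  have of_nat_F: "of_nat n \<in> F" for n
    by (induction n) (auto intro: subrD[OF F(1)])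
  define p where "p = CHAR('a)"
  have "p > 0"
  proof (rule ccontr)
    assume "\<not> p > 0"
    then have "inj (of_nat :: nat \<Rightarrow> 'a)"
      by (intro injI) (simp add: of_nat_eq_iff_cong_CHAR p_def)
    then have "infinite (range (of_nat :: nat \<Rightarrow> 'a))"
      using range_inj_infinite by blast
    moreover have "range of_nat \<subseteq> F"
      using of_nat_F by blast
    ultimately show False
      using F(2) finite_subset by blast
  qed
  then have p: "normalization_semidom_class.prime p"
    unfolding p_def by (rule prime_CHAR_semidom)
  define good where "good G \<longleftrightarrow> G \<subseteq> F \<and> 0 \<in> G \<and> (\<forall>x\<in>G. \<forall>y\<in>G. x - y \<in> G) \<and> (\<exists>e. card G = p ^ e)" for G
  have "good {0}"
    by (auto simp: good_def intro!: exI[of _ 0] subrD[OF F(1)])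
  moreover have "\<forall>G. good G \<longrightarrow> card G < Suc (card F)"
    using F(2) by (auto simp: good_def less_Suc_eq_le intro: card_mono)
  ultimately obtain G where G: "good G" "\<forall>G'. good G' \<longrightarrow> card G' \<le> card G"
    using ex_has_greatest_nat[of good "{0}" card "Suc (card F)"] by auto
  have finG: "finite G"
    using G(1) F(2) finite_subset by (auto simp: good_def)
  have "G = F"
  proof (rule ccontr)
    assume "G \<noteq> F"
    then obtain x where x: "x \<in> F" "x \<notin> G"
      using G(1) by (auto simp: good_def)
    define G' where "G' = (\<lambda>(g, i). g + of_nat i * x) ` (G \<times> {..<p})"
    have "card G' = p * card G" "\<And>x y. x \<in> G' \<Longrightarrow> y \<in> G' \<Longrightarrow> x - y \<in> G'"
      unfolding G'_def using additive_subgroup_extend[OF finG _ _ x(2) p p_def] G(1)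
      by (auto simp: good_def)
    moreover have "G' \<subseteq> F"
      using G(1) x(1) of_nat_F unfolding G'_def good_def
      by (auto intro!: subrD(4)[OF F(1)] subrD(5)[OF F(1)])
    moreover have "0 \<in> G'"
      unfolding G'_def using G(1) \<open>p > 0\<close> by (intro image_eqI[of _ _ "(0, 0)"]) (auto simp: good_def)
    ultimately have "good G'"
      using G(1) unfolding good_def by (auto intro: exI[of _ "Suc _"])
    then have "p * card G \<le> card G"
      using G(2) \<open>card G' = p * card G\<close> by metis
    moreover have "card G > 0"
      using G(1) finG by (auto simp: good_def card_gt_0_iff)
    ultimately show False
      using prime_gt_1_nat[OF p] by simp
  qed
  then obtain e where e: "card F = p ^ e"
    using G(1) by (auto simp: good_def)
  have "card {0, 1 :: 'a} \<le> card F"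
    using F by (intro card_mono) (auto intro: subrD)
  then have "e > 0"
    using e by (cases e) auto
  then show ?thesis
    using e p by (auto simp: frobexp_def p_def)
qed

text \<open>Multiplication by a nonzero element permutes the nonzero elements, and comparing their
  products gives x^(q-1) = 1. Conversely, x^q - x has no more than q roots.\<close>

lemma finite_subring_roots:
  fixes F :: "'a::field set"
  assumes F: "subr F" "finite F"
  shows "F = {x. x ^ card F = x}"
proof -
  define q where "q = card F"
  have q: "q > 1"
    unfolding q_def by (rule frobexp_gt1[OF finite_subring_frobexp[OF F]])
  have sub: "F \<subseteq> {x. x ^ q = x}"
  proof
    fix x assume x: "x \<in> F"
    show "x \<in> {x. x ^ q = x}"
    proof (cases "x = 0")
      case True
      then show ?thesis
        using q by simp
    next
      case False
      have "(*) x ` (F - {0}) \<subseteq> F - {0}"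
        using x False subrD(5)[OF F(1)] by auto
      moreover have inj: "inj_on ((*) x) (F - {0})"
        using False by (auto simp: inj_on_def)
      ultimately have "(*) x ` (F - {0}) = F - {0}"
        using F(2) by (intro endo_inj_surj) auto
      then have "\<Prod>(F - {0}) = (\<Prod>y\<in>F - {0}. x * y)"
        using prod.reindex[OF inj, of "\<lambda>y. y"] by simp
      also have "\<dots> = x ^ (q - 1) * \<Prod>(F - {0})"
        using F subrD(1)[OF F(1)] by (simp add: prod.distrib q_def)
      finally have "x ^ (q - 1) = 1"
        using F(2) by simp
      then have "x ^ Suc (q - 1) = x"
        by simp
      then show ?thesis
        using q by simp
    qed
  qed
  define P where "P = Polynomial.monom (1 :: 'a) q - Polynomial.monom 1 1"
  have "Polynomial.degree P \<le> q"
    unfolding P_def using q by (intro degree_diff_le) (auto simp: degree_monom_eq)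
  moreover have "Polynomial.coeff P q = 1"
    using q by (simp add: P_def)
  then have "P \<noteq> 0"
    by auto
  ultimately have "finite {x. poly P x = 0}" "card {x. poly P x = 0} \<le> q"
    using poly_roots_finite[of P] card_poly_roots_bound[of P] by auto
  moreover have "{x. poly P x = 0} = {x. x ^ q = x}"
    by (auto simp: P_def poly_monom)
  ultimately have "F = {x. x ^ q = x}"
    using sub by (intro card_seteq) (auto simp: q_def)
  then show ?thesis
    by (simp add: q_def)
qed

lemma subr_subring:
  assumes "subring V (ring_of_type_algebra :: 'a::field ring)"
  shows "subr V"
proof -
  interpret R: ring "ring_of_type_algebra :: 'a ring"
    by (rule ring_from_type_algebra)
  note * = subringE[OF assms]
  have "- x \<in> V" if "x \<in> V" for x
  proof -
    have "\<ominus>\<^bsub>ring_of_type_algebra\<^esub> x + x = 0"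
      using R.l_neg[of x] by (simp add: ring_of_type_algebra_def)
    then have "\<ominus>\<^bsub>ring_of_type_algebra\<^esub> x = - x"
      by (simp add: eq_neg_iff_add_eq_0)
    then show ?thesis
      using *(5)[OF that] by simp
  qed
  moreover have "0 \<in> V" "1 \<in> V"
    using *(2,3) by (simp_all add: ring_of_type_algebra_def)
  moreover have "x * y \<in> V" "x + y \<in> V" if "x \<in> V" "y \<in> V" for x y
    using *(6,7)[OF that] by (simp_all add: ring_of_type_algebra_def)
  ultimately show ?thesis
    unfolding subr_def by blast
qed

lemma inverse_subfield:
  assumes "subfield V (ring_of_type_algebra :: 'a::field ring)" "x \<in> V"
  shows "inverse x \<in> V"
proof (cases "x = 0")
  case False
  interpret R: field "ring_of_type_algebra :: 'a ring"
    by (rule field_from_type_algebra)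
  have x: "x \<in> V - {\<zero>\<^bsub>ring_of_type_algebra\<^esub>}"
    using False assms(2) by (simp add: ring_of_type_algebra_def)
  have "x * inv\<^bsub>ring_of_type_algebra\<^esub> x = 1"
    using R.subfield_m_inv(2)[OF assms(1) x] by (simp add: ring_of_type_algebra_def)
  then have "inv\<^bsub>ring_of_type_algebra\<^esub> x = inverse x"
    by (rule inverse_unique[symmetric])
  then show ?thesis
    using R.subfield_m_inv(1)[OF assms(1) x] by simp
qed (use assms in simp)

section \<open>The field of constants and the parameter \<zeta>\<close>

context shtuka_setting
begin

lemma subr_K': "subr K"
  using subfieldE(1)[OF K_field] by (rule subr_subring)

lemma valued_field_K: "valued_field K v"
  by unfold_locales (auto simp: subr_K' K_value intro: inverse_subfield[OF K_field])

lemma subr_A: "subr A"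
  unfolding coord_ring_def subr_def closed_points_def
  by (auto intro: subrD[OF subr_subring])

lemma \<gamma>:
  "a \<in> A \<Longrightarrow> \<gamma> a \<in> R" "a \<in> A \<Longrightarrow> b \<in> A \<Longrightarrow> \<gamma> (a * b) = \<gamma> a * \<gamma> b"
  "a \<in> A \<Longrightarrow> b \<in> A \<Longrightarrow> \<gamma> (a + b) = \<gamma> a + \<gamma> b" "\<gamma> 1 = 1"
  using \<gamma>_hom by (auto simp: Ring.ring_hom_def sub_ring_simps simp del: Int_iff)

lemma \<gamma>_eq_0: "a \<in> A \<Longrightarrow> \<gamma> a = 0 \<longleftrightarrow> a = 0"
proof -
  assume a: "a \<in> A"
  have "\<gamma> 0 = 0"
    using \<gamma>(3)[OF subrD(1)[OF subr_A] subrD(1)[OF subr_A]] by (metis add.right_neutral add_left_cancel)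
  then show ?thesis
    using \<gamma>_inj a subrD(1)[OF subr_A] by (metis inj_on_contraD)
qed

lemma v_\<gamma>: "b \<in> A \<Longrightarrow> b \<notin> \<epsilon> \<Longrightarrow> \<gamma> b \<noteq> 0 \<and> v (\<gamma> b) = 1"
proof -
  interpret valued_field K v
    by (rule valued_field_K)
  assume b: "b \<in> A" "b \<notin> \<epsilon>"
  then have "\<not> v (\<gamma> b) < 1" "v (\<gamma> b) \<le> 1"
    using \<gamma>(1)[OF b(1)] by (auto simp: kernel_point_def valuation_ideal_def valuation_ring_def)
  then show ?thesis
    by auto
qed

lemma extend_quotient:
  assumes "a \<in> A" "b \<in> A" "b \<notin> \<epsilon>"
  shows "extend_to_local_ring A \<epsilon> \<gamma> (a / b) = \<gamma> a / \<gamma> b"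
  unfolding extend_to_local_ring_def
proof (rule the_equality)
  show "\<exists>a'\<in>A. \<exists>b'\<in>A - \<epsilon>. a / b = a' / b' \<and> \<gamma> a / \<gamma> b = \<gamma> a' / \<gamma> b'"
    using assms by blast
  fix y assume "\<exists>a'\<in>A. \<exists>b'\<in>A - \<epsilon>. a / b = a' / b' \<and> y = \<gamma> a' / \<gamma> b'"
  then obtain a' b' where *: "a' \<in> A" "b' \<in> A" "b' \<notin> \<epsilon>" "a / b = a' / b'" "y = \<gamma> a' / \<gamma> b'"
    by blast
  have nz: "\<gamma> b \<noteq> 0" "\<gamma> b' \<noteq> 0"
    using v_\<gamma> assms * by auto
  then have "b \<noteq> 0" "b' \<noteq> 0"
    using \<gamma>_eq_0 assms * by auto
  then have "a * b' = a' * b"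
    using *(4) by (simp add: frac_eq_eq)
  then have "\<gamma> a * \<gamma> b' = \<gamma> a' * \<gamma> b"
    using \<gamma>(2) assms * by metis
  then show "y = \<gamma> a / \<gamma> b"
    using nz *(5) by (simp add: frac_eq_eq)
qed

text \<open>Write z = a/b with a in \<epsilon> and b in A outside \<epsilon>. Then |\<gamma>(a)| < 1
  and |\<gamma>(b)| = 1, and \<gamma>(a) is nonzero by injectivity.\<close>

lemma \<zeta>_facts: "\<zeta> \<in> K" "\<zeta> \<noteq> 0" "v \<zeta> < 1"
proof -
  interpret valued_field K v
    by (rule valued_field_K)
  have one: "1 \<in> A" "1 \<notin> \<epsilon>"
    using subrD(2)[OF subr_A] \<gamma>(4) by (auto simp: kernel_point_def valuation_ideal_def)
  have "1 \<in> local_ring_at A \<epsilon>"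
    unfolding local_ring_at_def using one by (intro CollectI exI[of _ 1]) auto
  \<comment> \<open>The multiple of z by 1 shows that z itself is a fraction with numerator in
    \<epsilon>.\<close>
  then have "z \<in> {z * x | x. x \<in> local_ring_at A \<epsilon>}"
    by (intro CollectI exI[of _ 1]) simp
  then have "z \<in> {a / b | a b. a \<in> \<epsilon> \<and> b \<in> A \<and> b \<notin> \<epsilon>}"
    using uniformizer unfolding uniformizer_at_def by blast
  then obtain a b where ab: "z = a / b" "a \<in> \<epsilon>" "b \<in> A" "b \<notin> \<epsilon>"
    by blast
  have a: "a \<in> A" "\<gamma> a \<in> K" "v (\<gamma> a) < 1"
    using ab(2) by (auto simp: kernel_point_def valuation_ideal_def)
  have "z \<noteq> 0"
    using uniformizer by (simp add: uniformizer_at_def)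
  then have "\<gamma> a \<noteq> 0"
    using \<gamma>_eq_0[OF a(1)] ab(1) by auto
  have b: "\<gamma> b \<in> K" "\<gamma> b \<noteq> 0" "v (\<gamma> b) = 1"
    using \<gamma>(1)[OF ab(3)] v_\<gamma>[OF ab(3,4)] by (auto simp: valuation_ring_def)
  have "\<zeta> = \<gamma> a / \<gamma> b"
    using extend_quotient[OF a(1) ab(3,4)] unfolding \<zeta>_def ab(1)[symmetric] .
  then have \<zeta>: "\<zeta> = \<gamma> a * inverse (\<gamma> b)"
    by (simp add: divide_inverse)
  show "\<zeta> \<in> K"
    unfolding \<zeta> using a b inverse_K by simp
  show "\<zeta> \<noteq> 0"
    unfolding \<zeta> using \<open>\<gamma> a \<noteq> 0\<close> b by simp
  show "v \<zeta> < 1"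
    unfolding \<zeta> using a b inverse_K by (simp add: v_mult v_inverse)
qed

text \<open>A homomorphism from the field A/\<epsilon> that preserves 1 is injective, so the image
  has as many elements as the residue field.\<close>

lemma F_eps_facts: "subr F_eps" "finite F_eps" "card F_eps = qhat" "F_eps \<subseteq> K"
proof -
  interpret V: valued_field K v
    by (rule valued_field_K)
  let ?Q = "sub_ring A Quot \<epsilon>"
  interpret Q: field ?Q
    using maximalideal.quotient_is_field[OF \<epsilon>_maximal cring_sub_ring[OF subr_A]] .
  interpret R: cring "sub_ring R"
    by (rule cring_sub_ring[OF V.subr_R])
  interpret h: ring_hom_ring ?Q "sub_ring R" \<iota>
    by (intro ring_hom_ringI2 Q.ring_axioms R.ring_axioms \<iota>_hom)
  have "inj_on \<iota> (carrier ?Q)"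
  proof (rule h.non_trivial_field_hom_imp_inj[OF Q.field_axioms])
    have "\<iota> \<one>\<^bsub>?Q\<^esub> = 1"
      using h.hom_one by (simp only: sub_ring_simps)
    then have "1 \<in> \<iota> ` carrier ?Q"
      using Q.one_closed by (metis image_eqI)
    then have "\<iota> ` carrier ?Q \<noteq> {0}"
      using zero_neq_one[where 'a = 'l] by (metis singletonD)
    then show "\<iota> ` carrier ?Q \<noteq> {\<zero>\<^bsub>sub_ring R\<^esub>}"
      by (simp only: sub_ring_simps not_False_eq_True)
  qed
  then show "card F_eps = qhat"
    by (simp add: F_eps_def qhat_def card_image)
  show "finite F_eps"
    unfolding F_eps_def using \<epsilon>_finite by simp
  have in_F: "\<iota> x \<in> F_eps" if "x \<in> carrier ?Q" for x
    using that by (auto simp: F_eps_def)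
  show "F_eps \<subseteq> K"
    unfolding F_eps_def using h.hom_closed by (auto simp: sub_ring_simps valuation_ring_def)
  show "subr F_eps"
    unfolding subr_def
  proof (intro conjI ballI)
    show "0 \<in> F_eps" "1 \<in> F_eps"
      using in_F[OF Q.zero_closed] in_F[OF Q.one_closed] h.hom_zero h.hom_one by (auto simp: sub_ring_simps)
    fix x assume "x \<in> F_eps"
    then obtain a where a: "a \<in> carrier ?Q" "x = \<iota> a"
      by (auto simp: F_eps_def)
    have "\<iota> (\<ominus>\<^bsub>?Q\<^esub> a) + \<iota> a = 0"
      using h.hom_add[OF Q.a_inv_closed[OF a(1)] a(1)] Q.l_neg[OF a(1)] h.hom_zero
      by (simp add: sub_ring_simps)
    then have "\<iota> (\<ominus>\<^bsub>?Q\<^esub> a) = - x"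
      using a(2) by (simp add: eq_neg_iff_add_eq_0)
    then show "- x \<in> F_eps"
      using in_F[OF Q.a_inv_closed[OF a(1)]] by simp
    fix y assume "y \<in> F_eps"
    then obtain b where b: "b \<in> carrier ?Q" "y = \<iota> b"
      by (auto simp: F_eps_def)
    show "x + y \<in> F_eps"
      using in_F[OF Q.a_closed[OF a(1) b(1)]] h.hom_add[OF a(1) b(1)] a b by (simp add: sub_ring_simps)
    show "x * y \<in> F_eps"
      using in_F[OF Q.m_closed[OF a(1) b(1)]] h.hom_mult[OF a(1) b(1)] a b by (simp add: sub_ring_simps)
  qed
qed

lemma frobexp_qhat: "frobexp TYPE('l) qhat"
  using finite_subring_frobexp[OF F_eps_facts(1,2)] by (simp add: F_eps_facts(3))

text \<open>Tate modules see the constants only as elements fixed by the Frobenius; this identifies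
  them with F_\<epsilon>.\<close>

lemma F_eps_eq: "F_eps = {x. x ^ qhat = x}"
  using finite_subring_roots[OF F_eps_facts(1,2)] by (simp add: F_eps_facts(3))

end


section \<open>Continuity of the Galois action\<close>

lemma fps_to_fls_sum: "fps_to_fls (\<Sum>i\<in>I. f i) = (\<Sum>i\<in>I. fps_to_fls (f i))"
  by (induction I rule: infinite_finite_induct) simp_all

lemma mats_power_series:
  assumes "A \<in> mats (power_series_over S) m n" "0 \<in> S"
  obtains a where "A = mat m n (\<lambda>(i, j). fps_to_fls (a i j))" "\<And>i j. a i j \<in> fps_over S"
proof -
  have *: "\<exists>f\<in>fps_over S. i < m \<and> j < n \<longrightarrow> index_mat A (i, j) = fps_to_fls f" for i j
  proof (cases "i < m \<and> j < n")
    case True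
    then show ?thesis
      using matsD(4)[OF assms(1), of i j] by (auto simp: power_series_over_eq)
  next
    case False
    have "0 \<in> fps_over S"
      using assms(2) by (intro fps_overI) simp
    then show ?thesis
      using False by blast
  qed
  define a where "a i j = (SOME f. f \<in> fps_over S \<and> (i < m \<and> j < n \<longrightarrow> index_mat A (i, j) = fps_to_fls f))" for i j
  have a: "a i j \<in> fps_over S \<and> (i < m \<and> j < n \<longrightarrow> index_mat A (i, j) = fps_to_fls (a i j))" for i j
    unfolding a_def by (rule someI_ex) (use *[of i j] in blast)
  have "A = mat m n (\<lambda>(i, j). fps_to_fls (a i j))"
    using matsD[OF assms(1)] a by (intro eq_matI) auto
  then show thesis
    using that a by blast
qed

lemma lang_mat:
  fixes T Ti :: "'l::field fls mat"
  assumes sc: "sep_closed TYPE('l)" and fr: "frobexp TYPE('l) q"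
    and T: "T \<in> mats (power_series_over UNIV) r r" "Ti \<in> mats (power_series_over UNIV) r r" "Ti * T = 1\<^sub>m r"
  obtains U V where "U \<in> mats (power_series_over UNIV) r r" "V \<in> mats (power_series_over UNIV) r r"
    "T * map_mat (frob q) U = U" "U * V = 1\<^sub>m r" "V * U = 1\<^sub>m r"
proof -
  have q0: "q > 0"
    using frobexp_gt1[OF fr] by simp
  obtain t where t: "T = mat r r (\<lambda>(i, j). fps_to_fls (t i j))"
    by (rule mats_power_series[OF T(1)]) auto
  obtain ti where ti: "Ti = mat r r (\<lambda>(i, j). fps_to_fls (ti i j))"
    by (rule mats_power_series[OF T(2)]) auto
  have nth: "index_mat (mat r r (\<lambda>(i, j). fps_to_fls (a i j)) * mat r r (\<lambda>(i, j). fps_to_fls (b i j))) (i, j) =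
      fps_to_fls (\<Sum>k<r. a i k * b k j)" if "i < r" "j < r" for a b :: "nat \<Rightarrow> nat \<Rightarrow> 'l fps" and i j
  proof -
    have "index_mat (mat r r (\<lambda>(i, j). fps_to_fls (a i j)) * mat r r (\<lambda>(i, j). fps_to_fls (b i j))) (i, j) =
        (\<Sum>k<r. index_mat (mat r r (\<lambda>(i, j). fps_to_fls (a i j))) (i, k) * index_mat (mat r r (\<lambda>(i, j). fps_to_fls (b i j))) (k, j))"
      using that by (intro mult_mat_nth) auto
    also have "\<dots> = (\<Sum>k<r. fps_to_fls (a i k * b k j))"
      using that by (intro sum.cong) (auto simp: fls_times_fps_to_fls)
    finally show ?thesis
      by (simp add: fps_to_fls_sum)
  qed
  have "(\<Sum>k<r. ti i k * t k j) = (if i = j then 1 else 0)" if "i < r" "j < r" for i j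
  proof -
    have "fps_to_fls (\<Sum>k<r. ti i k * t k j) = index_mat (1\<^sub>m r) (i, j)"
      using nth[OF that, of ti t] T(3) unfolding t ti by simp
    also have "\<dots> = fps_to_fls (if i = j then 1 else 0)"
      using that by simp
    finally show ?thesis
      by (simp only: fps_to_fls_eq_iff)
  qed
  then obtain u v where tu: "\<And>i j. i < r \<Longrightarrow> j < r \<Longrightarrow> (\<Sum>k<r. t i k * fps_frob q (u k j)) = u i j"
    and uv: "\<And>i j. i < r \<Longrightarrow> j < r \<Longrightarrow> (\<Sum>k<r. u i k * v k j) = (if i = j then 1 else 0)"
    by (rule lang_series[OF sc fr]) blast+
  define U where "U = mat r r (\<lambda>(i, j). fps_to_fls (u i j))"
  define V where "V = mat r r (\<lambda>(i, j). fps_to_fls (v i j))"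
  have UV: "U \<in> carrier_mat r r" "V \<in> carrier_mat r r"
    by (auto simp: U_def V_def)
  have mem: "fps_to_fls f \<in> power_series_over UNIV" for f :: "'l fps"
    by (auto simp: power_series_over_def)
  have "map_mat (frob q) U = mat r r (\<lambda>(i, j). fps_to_fls (fps_frob q (u i j)))"
    by (intro eq_matI) (auto simp: U_def frob_fps[OF q0])
  then have "T * map_mat (frob q) U = U"
    unfolding t by (intro eq_matI) (auto simp: U_def nth tu simp del: index_mult_mat(1))
  moreover have "U * V = 1\<^sub>m r"
    unfolding U_def V_def by (intro eq_matI) (auto simp: nth uv simp del: index_mult_mat(1))
  moreover from this have "V * U = 1\<^sub>m r"
    by (rule mat_mult_left_right_inverse[OF UV])
  moreover have "U \<in> mats (power_series_over UNIV) r r" "V \<in> mats (power_series_over UNIV) r r"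
    unfolding U_def V_def by (intro matsI; simp add: mem)+
  ultimately show thesis
    using that by blast
qed

section \<open>Krull topology and z-adic continuity\<close>

lemma topspace_krull: "topspace (krull_topology K) = galois_group K"
  by (simp add: krull_topology_def)

lemma openin_krull:
  assumes "finite A" "g0 \<in> galois_group K"
  shows "openin (krull_topology K) {g \<in> galois_group K. \<forall>x\<in>A. g x = g0 x}"
proof -
  have "openin (product_topology (\<lambda>_. discrete_topology UNIV) UNIV) (\<Pi>\<^sub>E x\<in>UNIV. if x \<in> A then {g0 x} else UNIV)"
    using assms(1) by (intro product_topology_basis) (auto intro: finite_subset)
  then have "openin (krull_topology K)
      (galois_group K \<inter> (\<Pi>\<^sub>E x\<in>UNIV. if x \<in> A then {g0 x} else UNIV))"
    unfolding krull_topology_def by (auto simp: openin_subtopology_Int2)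
  moreover have "galois_group K \<inter> (\<Pi>\<^sub>E x\<in>UNIV. if x \<in> A then {g0 x} else UNIV) =
      {g \<in> galois_group K. \<forall>x\<in>A. g x = g0 x}"
    by (force simp: PiE_def Pi_def split: if_splits)
  ultimately show ?thesis
    by simp
qed

lemma dist_fls_le:
  fixes f g :: "'a::group_add fls"
  assumes "\<And>i. i < int n \<Longrightarrow> fls_nth f i = fls_nth g i"
  shows "dist f g \<le> inverse (2 ^ n)"
proof (cases "f = g")
  case False
  then have "int n \<le> fls_subdegree (f - g)"
    using assms by (intro fls_subdegree_geI) auto
  then have "n \<le> nat (fls_subdegree (f - g))" "fls_subdegree (f - g) \<ge> 0"
    by linarith+
  then show ?thesis
    using False by (simp add: dist_fls_def le_imp_inverse_le power_increasing)
qed simp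

text \<open>Agreement with a given automorphism on a finite set is an open condition. So continuity
  follows when each z-adic truncation depends on finitely many values of the automorphism.\<close>

lemma continuous_krull:
  fixes a :: "('l::field \<Rightarrow> 'l) \<Rightarrow> 'l fls"
  assumes D: "\<And>g. g \<in> galois_group K \<Longrightarrow> a g \<in> D"
    and fin: "\<And>n. \<exists>A. finite A \<and> (\<forall>g\<in>galois_group K. \<forall>g0\<in>galois_group K. (\<forall>x\<in>A. g x = g0 x) \<longrightarrow>
        (\<forall>i<int n. fls_nth (a g) i = fls_nth (a g0) i))"
  shows "continuous_map (krull_topology K) (top_of_set D) a"
  unfolding continuous_map_def topspace_krull
proof (intro conjI allI impI)
  show "a \<in> galois_group K \<rightarrow> topspace (top_of_set D)"
    using D by simp
  fix O' assume "openin (top_of_set D) O'"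
  then obtain T where T: "open T" "O' = D \<inter> T"
    by (auto simp: openin_open)
  show "openin (krull_topology K) {g \<in> galois_group K. a g \<in> O'}"
  proof (subst openin_subopen, intro ballI)
    fix g0 assume "g0 \<in> {g \<in> galois_group K. a g \<in> O'}"
    then have g0: "g0 \<in> galois_group K" "a g0 \<in> T"
      using T by auto
    then obtain e where e: "e > 0" "\<And>y. dist y (a g0) < e \<Longrightarrow> y \<in> T"
      using T(1) unfolding open_dist by blast
    obtain n where n: "inverse (2 ^ n) < e"
      using real_arch_pow_inv[OF e(1), of "1 / 2"] by (auto simp: power_one_over inverse_eq_divide)
    obtain A where A: "finite A" "\<And>g. g \<in> galois_group K \<Longrightarrow> (\<forall>x\<in>A. g x = g0 x) \<Longrightarrow>
        (\<forall>i<int n. fls_nth (a g) i = fls_nth (a g0) i)"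
      using fin[of n] g0(1) by blast
    have "{g \<in> galois_group K. \<forall>x\<in>A. g x = g0 x} \<subseteq> {g \<in> galois_group K. a g \<in> O'}"
    proof clarify
      fix g assume g: "g \<in> galois_group K" "\<forall>x\<in>A. g x = g0 x"
      then have "dist (a g) (a g0) \<le> inverse (2 ^ n)"
        using A(2)[OF g] by (intro dist_fls_le) auto
      then have "a g \<in> T"
        using n e(2) by fastforce
      then show "a g \<in> O'"
        using T(2) D[OF g(1)] by blast
    qed
    then show "\<exists>T. openin (krull_topology K) T \<and> g0 \<in> T \<and> T \<subseteq> {g \<in> galois_group K. a g \<in> O'}"
      using openin_krull[OF A(1) g0(1)] g0(1) by (intro exI conjI) auto
  qed
qed

lemma galois_rhom: "g \<in> galois_group K \<Longrightarrow> rhom g"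
  "g \<in> galois_group K \<Longrightarrow> x \<in> K \<Longrightarrow> g x = x"
proof -
  assume g: "g \<in> galois_group K"
  then have h: "g (x + y) = g x + g y" "g (x * y) = g x * g y" "g 1 = 1" for x y
    by (auto simp: galois_group_def Ring.ring_hom_def ring_of_type_algebra_def)
  then have "g 0 + g 0 = g 0 + 0"
    by (metis add.right_neutral)
  then have "g 0 = 0"
    by (simp only: add_left_cancel)
  then show "rhom g"
    using h by (simp add: rhom_def)
  show "x \<in> K \<Longrightarrow> g x = x"
    using g by (simp add: galois_group_def)
qed

lemma galois_comp: "g \<in> galois_group K \<Longrightarrow> h \<in> galois_group K \<Longrightarrow> g \<circ> h \<in> galois_group K"
  by (auto simp: galois_group_def Ring.ring_hom_def ring_of_type_algebra_def intro: bij_comp)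

lemma galois_id: "id \<in> galois_group K"
  by (auto simp: galois_group_def Ring.ring_hom_def ring_of_type_algebra_def)

text \<open>For power series, the coefficients of V g(U) below z^n involve g only through its values
  at the coefficients of \<open>U\<close> of index at most n.\<close>

lemma continuous_coefficient:
  fixes V U :: "'l::field fls mat"
  assumes V: "V \<in> mats (power_series_over UNIV) r r" and U: "U \<in> mats (power_series_over UNIV) r r"
    and D: "\<And>g. g \<in> galois_group K \<Longrightarrow> index_mat (V * map_mat (map_coeffs g) U) (i, j) \<in> D"
    and ij: "i < r" "j < r"
  shows "continuous_map (krull_topology K) (top_of_set D) (\<lambda>g. index_mat (V * map_mat (map_coeffs g) U) (i, j))"
proof (rule continuous_krull[OF D], assumption)
  fix n
  obtain u where u: "U = mat r r (\<lambda>(i, j). fps_to_fls (u i j))"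
    by (rule mats_power_series[OF U]) auto
  obtain w where w: "V = mat r r (\<lambda>(i, j). fps_to_fls (w i j))"
    by (rule mats_power_series[OF V]) auto
  have entry: "index_mat (V * map_mat (map_coeffs g) U) (i, j) =
      fps_to_fls (\<Sum>k<r. w i k * Abs_fps (\<lambda>m. g (fps_nth (u k j) m)))" if g: "g \<in> galois_group K" for g
  proof -
    have "index_mat (V * map_mat (map_coeffs g) U) (i, j) =
        (\<Sum>k<r. index_mat V (i, k) * index_mat (map_mat (map_coeffs g) U) (k, j))"
      using V U ij by (intro mult_mat_nth) (auto simp: mats_def)
    also have "\<dots> = (\<Sum>k<r. fps_to_fls (w i k * Abs_fps (\<lambda>m. g (fps_nth (u k j) m))))"
      using ij rhomD(1)[OF galois_rhom(1)[OF g]]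
      by (intro sum.cong) (auto simp: u w map_coeffs_fps fls_times_fps_to_fls)
    finally show ?thesis
      by (simp add: fps_to_fls_sum)
  qed
  let ?A = "(\<lambda>(k, m). fps_nth (u k j) m) ` ({..<r} \<times> {..n})"
  have "fls_nth (index_mat (V * map_mat (map_coeffs g) U) (i, j)) l =
      fls_nth (index_mat (V * map_mat (map_coeffs g0) U) (i, j)) l"
    if g: "g \<in> galois_group K" "g0 \<in> galois_group K" "\<forall>x\<in>?A. g x = g0 x" and l: "l < int n" for g g0 l
  proof -
    have gg: "g (fps_nth (u k j) m) = g0 (fps_nth (u k j) m)" if "k < r" "m \<le> n" for k m
      using g(3) that by force
    have "fps_nth (\<Sum>k<r. w i k * Abs_fps (\<lambda>m. g (fps_nth (u k j) m))) (nat l) =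
        fps_nth (\<Sum>k<r. w i k * Abs_fps (\<lambda>m. g0 (fps_nth (u k j) m))) (nat l)"
      unfolding fps_sum_nth fps_mult_nth fps_nth_Abs_fps
      using l by (intro sum.cong refl arg_cong[where f = "(*) _"] gg) auto
    then show ?thesis
      unfolding entry[OF g(1)] entry[OF g(2)] by (simp add: fps_to_fls_nth)
  qed
  then show "\<exists>A. finite A \<and> (\<forall>g\<in>galois_group K. \<forall>g0\<in>galois_group K. (\<forall>x\<in>A. g x = g0 x) \<longrightarrow>
        (\<forall>l<int n. fls_nth (index_mat (V * map_mat (map_coeffs g) U) (i, j)) l =
          fls_nth (index_mat (V * map_mat (map_coeffs g0) U) (i, j)) l))"
    by (intro exI[of _ ?A] conjI) (auto simp only: finite_imageI finite_SigmaI finite_lessThan finite_atMost)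
qed


section \<open>Coordinates of local shtukas\<close>

lemma choice2:
  assumes "\<forall>a b. \<exists>f. P a b f"
  shows "\<exists>A. \<forall>a b. P a b (A a b)"
proof -
  have "\<forall>a. \<exists>g. \<forall>b. P a b (g b)"
  proof
    fix a
    show "\<exists>g. \<forall>b. P a b (g b)"
      using spec[OF assms, of a] by (rule choice)
  qed
  then show ?thesis
    by (rule choice)
qed

text \<open>What remains of the setting once the curve has provided the number q and the element
  \<zeta>.\<close>

locale tate_setting = valued_field K v
  for K :: "'l::field set" and v +
  fixes q :: nat and \<zeta> :: 'l
  assumes embedding: "embedding_setting K"
    and discrete: "discretely_valued K v"
    and frobexp_q: "frobexp TYPE('l) q"
    and \<zeta>_K: "\<zeta> \<in> K" and \<zeta>_nonzero: "\<zeta> \<noteq> 0" and v_\<zeta>: "v \<zeta> < 1"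
begin

sublocale lift: lift_setting valR q
  by unfold_locales (rule subr_R, rule frobexp_q)

abbreviation "B \<equiv> power_series_over valR"

abbreviation "W \<equiv> shtuka_ring valR \<zeta>"

abbreviation (input) "PU \<equiv> power_series_over (UNIV :: 'l set)"

lemma subr_B: "subr B"
  by (rule lift.subr_B')

lemma \<zeta>_R: "\<zeta> \<in> valR"
  using \<zeta>_K v_\<zeta> by (simp add: valuation_ring_def)

lemma subr_W: "subr W"
  unfolding shtuka_ring_def by (intro subr_localize subr_B z_minus_over subr_R \<zeta>_R)

lemma B_W: "B \<subseteq> W"
  unfolding shtuka_ring_def by (rule localize_superset)

lemma W_PK: "W \<subseteq> power_series_over K"
  using \<zeta>_K \<zeta>_nonzero R_K by (intro shtuka_ring_subset subr_K inverse_K) auto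

lemma W_PU: "W \<subseteq> PU"
  using W_PK power_series_over_mono[of K UNIV] by blast

lemma subr_PU: "subr PU"
  by (rule subr_power_series_over) (simp add: subr_def)

lemma sep_closed_l: "sep_closed TYPE('l)"
  using embedding_setting.separable_root[OF embedding] by (auto simp: sep_closed_def)

definition coords_of :: "('l, 'm) shtuka \<Rightarrow> nat \<times> ('l fls vec \<Rightarrow> 'm) \<times> 'l fls mat \<Rightarrow> bool"
  where "coords_of = (\<lambda>(M, \<tau>) (r, \<kappa>, T). coordz B r M \<kappa> \<and> T \<in> mats W r r \<and> (\<exists>Ti\<in>mats W r r. T * Ti = 1\<^sub>m r \<and> Ti * T = 1\<^sub>m r) \<and>
    act W r (lift.fcl W M r \<kappa>) (lift.cl W M r \<kappa>) \<tau> T)"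

text \<open>Preimages of the basis vectors under \<tau> form a right inverse of its matrix, which is
  two-sided because the matrix is square.\<close>

lemma coords_of_exists:
  assumes "local_shtuka valR q \<zeta> r (M, \<tau>)"
  shows "\<exists>d. coords_of (M, \<tau>) d"
proof -
  have free: "free_of_rank B r M" and lin: "\<tau> \<in> linear_maps W (frob_ext q valR W M) (ext valR W M)"
    and bij: "bij_betw \<tau> (carrier (frob_ext q valR W M)) (carrier (ext valR W M))"
    using assms by (auto simp: local_shtuka_def)
  obtain \<kappa> where \<kappa>: "coordz B r M \<kappa>"
    by (rule coordz_of_free[OF free subr_B])
  note cf = lift.coordz_frob_ext[OF \<kappa> subr_W B_W] and ce = lift.coordz_ext[OF \<kappa> subr_W B_W]
  obtain T where T: "T \<in> mats W r r" "act W r (lift.fcl W M r \<kappa>) (lift.cl W M r \<kappa>) \<tau> T"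
    by (rule linear_map_matrix[OF cf ce subr_W lin])
  have "\<exists>w\<in>vecs W r. T *\<^sub>v w = unit_vec r j" for j
  proof -
    have "lift.cl W M r \<kappa> (unit_vec r j) \<in> \<tau> ` carrier (frob_ext q valR W M)"
      using bij coordzD(1)[OF ce vecs_unit[OF subr_W]] by (auto simp: bij_betw_def)
    then obtain x where "x \<in> carrier (frob_ext q valR W M)" "lift.cl W M r \<kappa> (unit_vec r j) = \<tau> x"
      by blast
    then obtain w where w: "w \<in> vecs W r" "lift.cl W M r \<kappa> (unit_vec r j) = \<tau> (lift.fcl W M r \<kappa> w)"
      using coordzD(6)[OF cf] by blast
    then have "lift.cl W M r \<kappa> (unit_vec r j) = lift.cl W M r \<kappa> (T *\<^sub>v w)"
      using T(2) by (simp add: act_def)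
    then show ?thesis
      using coordzD(2)[OF ce vecs_unit[OF subr_W] mats_mult_vec[OF subr_W T(1) w(1)]] w(1) by auto
  qed
  then obtain f where f: "\<And>j. f j \<in> vecs W r" "\<And>j. T *\<^sub>v f j = unit_vec r j"
    by metis
  define Ti where "Ti = mat r r (\<lambda>(i, j). vec_index (f j) i)"
  have Ti: "Ti \<in> mats W r r"
    using vecsD(3)[OF f(1)] by (intro matsI) (auto simp: Ti_def)
  have "T * Ti = 1\<^sub>m r"
  proof (rule eq_matI)
    fix i j assume "i < dim_row (1\<^sub>m r :: 'l fls mat)" "j < dim_col (1\<^sub>m r :: 'l fls mat)"
    then have ij: "i < r" "j < r"
      by auto
    have "index_mat (T * Ti) (i, j) = (\<Sum>l<r. index_mat T (i, l) * index_mat Ti (l, j))"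
      by (rule mult_mat_nth[OF matsD(1)[OF T(1)] matsD(1)[OF Ti] ij])
    also have "\<dots> = (\<Sum>l<r. index_mat T (i, l) * vec_index (f j) l)"
      using ij by (intro sum.cong) (auto simp: Ti_def)
    also have "\<dots> = vec_index (T *\<^sub>v f j) i"
      by (rule mult_mat_vec_nth[OF matsD(1)[OF T(1)] vecsD(1)[OF f(1)] ij(1), symmetric])
    finally show "index_mat (T * Ti) (i, j) = index_mat (1\<^sub>m r) (i, j)"
      using ij by (simp add: f(2) unit_vec_def)
  qed (use matsD[OF T(1)] matsD[OF Ti] in auto)
  moreover from this have "Ti * T = 1\<^sub>m r"
    by (rule mat_mult_left_right_inverse[OF matsD(1)[OF T(1)] matsD(1)[OF Ti]])
  ultimately have "coords_of (M, \<tau>) (r, \<kappa>, T)"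
    using \<kappa> T Ti by (auto simp: coords_of_def)
  then show ?thesis
    by blast
qed

text \<open>Coordinates are chosen once for each object, so that matrices of morphisms can be
  compared and multiplied.\<close>

definition coords :: "('l, 'm) shtuka \<Rightarrow> nat \<times> ('l fls vec \<Rightarrow> 'm) \<times> 'l fls mat"
  where "coords U = (SOME d. coords_of U d)"

definition "rk U = fst (coords U)"

definition "\<kappa> U = fst (snd (coords U))"

definition "TT U = snd (snd (coords U))"

definition obj :: "('l, 'm) shtuka set"
  where "obj = {U. \<exists>r. local_shtuka valR q \<zeta> r U}"

lemma obj:
  assumes "U \<in> obj"
  shows "coordz B (rk U) (fst U) (\<kappa> U)" "TT U \<in> mats W (rk U) (rk U)"
    "\<exists>Ti\<in>mats W (rk U) (rk U). TT U * Ti = 1\<^sub>m (rk U) \<and> Ti * TT U = 1\<^sub>m (rk U)"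
    "act W (rk U) (lift.fcl W (fst U) (rk U) (\<kappa> U)) (lift.cl W (fst U) (rk U) (\<kappa> U)) (snd U) (TT U)"
proof -
  have "coords_of U (coords U)"
    unfolding coords_def by (rule someI_ex, cases U) (use assms coords_of_exists in \<open>auto simp: obj_def\<close>)
  then show "coordz B (rk U) (fst U) (\<kappa> U)" "TT U \<in> mats W (rk U) (rk U)"
    "\<exists>Ti\<in>mats W (rk U) (rk U). TT U * Ti = 1\<^sub>m (rk U) \<and> Ti * TT U = 1\<^sub>m (rk U)"
    "act W (rk U) (lift.fcl W (fst U) (rk U) (\<kappa> U)) (lift.cl W (fst U) (rk U) (\<kappa> U)) (snd U) (TT U)"
    unfolding coords_of_def rk_def \<kappa>_def TT_def by (cases U; cases "coords U"; auto)+
qed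

lemma lang_obj:
  assumes U: "U \<in> obj"
  shows "\<exists>P Q. P \<in> mats PU (rk U) (rk U) \<and> Q \<in> mats PU (rk U) (rk U) \<and>
    TT U * map_mat (frob q) P = P \<and> P * Q = 1\<^sub>m (rk U) \<and> Q * P = 1\<^sub>m (rk U)"
proof -
  obtain Ti where Ti: "Ti \<in> mats W (rk U) (rk U)" "Ti * TT U = 1\<^sub>m (rk U)"
    using obj(3)[OF U] by blast
  have "TT U \<in> mats PU (rk U) (rk U)" "Ti \<in> mats PU (rk U) (rk U)"
    using obj(2)[OF U] Ti(1) mats_mono[OF W_PU] by auto
  then obtain P Q where "P \<in> mats PU (rk U) (rk U)" "Q \<in> mats PU (rk U) (rk U)"
    "TT U * map_mat (frob q) P = P" "P * Q = 1\<^sub>m (rk U)" "Q * P = 1\<^sub>m (rk U)"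
    by (rule lang_mat[OF sep_closed_l frobexp_q _ _ Ti(2)])
  then show ?thesis
    by blast
qed

text \<open>A fundamental matrix of the equation T \<sigma>(w) = w; \<open>VV U\<close> is its
  inverse.\<close>

definition "UU U = (SOME P. \<exists>Q. P \<in> mats PU (rk U) (rk U) \<and> Q \<in> mats PU (rk U) (rk U) \<and>
    TT U * map_mat (frob q) P = P \<and> P * Q = 1\<^sub>m (rk U) \<and> Q * P = 1\<^sub>m (rk U))"

definition "VV U = (SOME Q. UU U \<in> mats PU (rk U) (rk U) \<and> Q \<in> mats PU (rk U) (rk U) \<and>
    TT U * map_mat (frob q) (UU U) = UU U \<and> UU U * Q = 1\<^sub>m (rk U) \<and> Q * UU U = 1\<^sub>m (rk U))"

lemma UV:
  assumes "U \<in> obj"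
  shows "UU U \<in> mats PU (rk U) (rk U)" "VV U \<in> mats PU (rk U) (rk U)"
    "TT U * map_mat (frob q) (UU U) = UU U" "UU U * VV U = 1\<^sub>m (rk U)" "VV U * UU U = 1\<^sub>m (rk U)"
proof -
  have "\<exists>Q. UU U \<in> mats PU (rk U) (rk U) \<and> Q \<in> mats PU (rk U) (rk U) \<and>
    TT U * map_mat (frob q) (UU U) = UU U \<and> UU U * Q = 1\<^sub>m (rk U) \<and> Q * UU U = 1\<^sub>m (rk U)"
    unfolding UU_def by (rule someI_ex[OF lang_obj[OF assms]])
  then have "UU U \<in> mats PU (rk U) (rk U) \<and> VV U \<in> mats PU (rk U) (rk U) \<and>
    TT U * map_mat (frob q) (UU U) = UU U \<and> UU U * VV U = 1\<^sub>m (rk U) \<and> VV U * UU U = 1\<^sub>m (rk U)"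
    unfolding VV_def by (rule someI_ex)
  then show "UU U \<in> mats PU (rk U) (rk U)" "VV U \<in> mats PU (rk U) (rk U)"
    "TT U * map_mat (frob q) (UU U) = UU U" "UU U * VV U = 1\<^sub>m (rk U)" "VV U * UU U = 1\<^sub>m (rk U)"
    by auto
qed

text \<open>Solved for \<sigma>(H) and for H, the equation becomes a \<open>frob_system\<close>
  indexed by pairs. The coefficient relating the entries (i,j) and (k,l) is the product of the (i,k)
  entry of Ti' and the (l,j) entry of T, respectively of T' and Ti, times a power of z -
  \<zeta>.\<close>

lemma integral_mat:
  assumes T: "T \<in> mats W n n" and Ti: "Ti \<in> mats W n n" "T * Ti = 1\<^sub>m n"
    and T': "T' \<in> mats W m m" and Ti': "Ti' \<in> mats W m m" "Ti' * T' = 1\<^sub>m m"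
    and H: "H \<in> mats (power_series_over K) m n" and eq: "T' * map_mat (frob q) H = H * T"
  shows "H \<in> mats B m n"
proof -
  have q0: "q > 0"
    using frobexp_gt1[OF frobexp_q] by simp
  obtain h where h: "H = mat m n (\<lambda>(i, j). fps_to_fls (h i j))" "\<And>i j. h i j \<in> fps_over K"
    using mats_power_series[OF H] subrD(1)[OF subr_K] by metis
  note c = matsD(1)[OF T] matsD(1)[OF Ti(1)] matsD(1)[OF T'] matsD(1)[OF Ti'(1)] matsD(1)[OF H]
  have fH: "map_mat (frob q) H \<in> carrier_mat m n"
    using c by simp
  have fH': "map_mat (frob q) H = Ti' * (H * T)"
    using Ti'(2) c fH by (simp add: assoc_mult_mat[symmetric, OF c(4) c(3) fH] flip: eq)
  have "H * (T * Ti) = H"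
    unfolding Ti(2) using c by simp
  then have H': "H = T' * (map_mat (frob q) H * Ti)"
    using assoc_mult_mat[OF c(3) fH c(2)] assoc_mult_mat[OF c(5) c(1) c(2)] eq by simp
  define s where "s = fps_to_fls (lin \<zeta>)"
  have sB: "s \<in> B"
    unfolding s_def z_minus_fps[symmetric] by (rule z_minus_over[OF subr_R \<zeta>_R])
  have W: "W = localize B s"
    by (simp add: shtuka_ring_def s_def z_minus_fps)
  have ex: "\<exists>N. \<forall>i<a. \<forall>j<b. index_mat X0 (i, j) * s ^ N \<in> B" if "X0 \<in> mats W a b" for X0 a b
  proof -
    have "\<And>p. p \<in> {..<a} \<times> {..<b} \<Longrightarrow> index_mat X0 p \<in> localize B s"
      using matsD(4)[OF that] W by auto
    then obtain N where "\<And>p. p \<in> {..<a} \<times> {..<b} \<Longrightarrow> index_mat X0 p * s ^ N \<in> B"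
      using localize_common_exponent[OF subr_B sB, of "{..<a} \<times> {..<b}" "index_mat X0"] by auto
    then show ?thesis
      by blast
  qed
  obtain N1 where N1: "\<forall>i<n. \<forall>j<n. index_mat T (i, j) * s ^ N1 \<in> B"
    using ex[OF T] by blast
  obtain N2 where N2: "\<forall>i<n. \<forall>j<n. index_mat Ti (i, j) * s ^ N2 \<in> B"
    using ex[OF Ti(1)] by blast
  obtain N3 where N3: "\<forall>i<m. \<forall>j<m. index_mat T' (i, j) * s ^ N3 \<in> B"
    using ex[OF T'] by blast
  obtain N4 where N4: "\<forall>i<m. \<forall>j<m. index_mat Ti' (i, j) * s ^ N4 \<in> B"
    using ex[OF Ti'(1)] by blast
  have sp: "s ^ k \<in> B" for k
    by (rule subr_power[OF subr_B sB])
  \<comment> \<open>Large enough to clear the denominators of the products of two entries that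
    occur.\<close>
  define N where "N = N1 + N2 + N3 + N4"
  have prodB: "s ^ N * (x * y) \<in> B" if "x * s ^ a \<in> B" "y * s ^ b \<in> B" "a + b \<le> N" for x y a b
  proof -
    have "s ^ (N - (a + b)) * ((x * s ^ a) * (y * s ^ b)) \<in> B"
      by (intro subrD(5)[OF subr_B] sp that)
    moreover have "s ^ N = s ^ (N - (a + b)) * (s ^ a * s ^ b)"
      using that(3) by (simp flip: power_add)
    ultimately show ?thesis
      by (simp add: mult_ac)
  qed
  have fromB: "\<exists>f\<in>fps_over valR. x = fps_to_fls f" if "x \<in> B" for x
    using that by (auto simp: power_series_over_eq)
  define I where "I = {..<m} \<times> {..<n}"
  have "\<exists>A. \<forall>a\<in>I. \<forall>b\<in>I. A a b \<in> fps_over valR \<and>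
      fps_to_fls (A a b) = s ^ N * (index_mat Ti' (fst a, fst b) * index_mat T (snd b, snd a))"
  proof -
    have "\<forall>a b. \<exists>f. a \<in> I \<longrightarrow> b \<in> I \<longrightarrow> f \<in> fps_over valR \<and>
        fps_to_fls f = s ^ N * (index_mat Ti' (fst a, fst b) * index_mat T (snd b, snd a))"
    proof (intro allI)
      fix a b
      show "\<exists>f. a \<in> I \<longrightarrow> b \<in> I \<longrightarrow> f \<in> fps_over valR \<and>
          fps_to_fls f = s ^ N * (index_mat Ti' (fst a, fst b) * index_mat T (snd b, snd a))"
      proof (cases "a \<in> I \<and> b \<in> I")
        case True
        then have "s ^ N * (index_mat Ti' (fst a, fst b) * index_mat T (snd b, snd a)) \<in> B"
          using N1 N4 by (intro prodB[of _ N4 _ N1]) (auto simp: I_def N_def)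
        then show ?thesis
          using fromB by metis
      qed auto
    qed
    then have "\<exists>A. \<forall>a b. a \<in> I \<longrightarrow> b \<in> I \<longrightarrow> A a b \<in> fps_over valR \<and>
        fps_to_fls (A a b) = s ^ N * (index_mat Ti' (fst a, fst b) * index_mat T (snd b, snd a))"
      by (rule choice2)
    then show ?thesis
      by blast
  qed
  then obtain A where A: "\<And>a b. a \<in> I \<Longrightarrow> b \<in> I \<Longrightarrow> A a b \<in> fps_over valR"
    "\<And>a b. a \<in> I \<Longrightarrow> b \<in> I \<Longrightarrow> fps_to_fls (A a b) = s ^ N * (index_mat Ti' (fst a, fst b) * index_mat T (snd b, snd a))"
    by blast
  have "\<exists>A. \<forall>a\<in>I. \<forall>b\<in>I. A a b \<in> fps_over valR \<and>
      fps_to_fls (A a b) = s ^ N * (index_mat T' (fst a, fst b) * index_mat Ti (snd b, snd a))"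
  proof -
    have "\<forall>a b. \<exists>f. a \<in> I \<longrightarrow> b \<in> I \<longrightarrow> f \<in> fps_over valR \<and>
        fps_to_fls f = s ^ N * (index_mat T' (fst a, fst b) * index_mat Ti (snd b, snd a))"
    proof (intro allI)
      fix a b
      show "\<exists>f. a \<in> I \<longrightarrow> b \<in> I \<longrightarrow> f \<in> fps_over valR \<and>
          fps_to_fls f = s ^ N * (index_mat T' (fst a, fst b) * index_mat Ti (snd b, snd a))"
      proof (cases "a \<in> I \<and> b \<in> I")
        case True
        then have "s ^ N * (index_mat T' (fst a, fst b) * index_mat Ti (snd b, snd a)) \<in> B"
          using N2 N3 by (intro prodB[of _ N3 _ N2]) (auto simp: I_def N_def)
        then show ?thesis
          using fromB by metis
      qed auto
    qed
    then have "\<exists>A. \<forall>a b. a \<in> I \<longrightarrow> b \<in> I \<longrightarrow> A a b \<in> fps_over valR \<and>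
        fps_to_fls (A a b) = s ^ N * (index_mat T' (fst a, fst b) * index_mat Ti (snd b, snd a))"
      by (rule choice2)
    then show ?thesis
      by blast
  qed
  then obtain A' where A': "\<And>a b. a \<in> I \<Longrightarrow> b \<in> I \<Longrightarrow> A' a b \<in> fps_over valR"
    "\<And>a b. a \<in> I \<Longrightarrow> b \<in> I \<Longrightarrow> fps_to_fls (A' a b) = s ^ N * (index_mat T' (fst a, fst b) * index_mat Ti (snd b, snd a))"
    by blast
  have triple: "index_mat (X1 * (X2 * X3)) (i, j) =
      (\<Sum>b\<in>I. index_mat X1 (i, fst b) * index_mat X3 (snd b, j) * index_mat X2 b)"
    if "X1 \<in> carrier_mat m m" "X2 \<in> carrier_mat m n" "X3 \<in> carrier_mat n n" "i < m" "j < n"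
    for X1 X2 X3 :: "'l fls mat" and i j
  proof -
    have "index_mat (X1 * (X2 * X3)) (i, j) = (\<Sum>k<m. index_mat X1 (i, k) * index_mat (X2 * X3) (k, j))"
      using that by (intro mult_mat_nth) auto
    also have "\<dots> = (\<Sum>k<m. \<Sum>l<n. index_mat X1 (i, k) * index_mat X3 (l, j) * index_mat X2 (k, l))"
      using that by (intro sum.cong refl) (simp add: mult_mat_nth sum_distrib_left mult_ac del: index_mult_mat(1))
    also have "\<dots> = (\<Sum>b\<in>I. index_mat X1 (i, fst b) * index_mat X3 (snd b, j) * index_mat X2 b)"
      unfolding I_def sum.cartesian_product by (intro sum.cong) auto
    finally show ?thesis .
  qed
  have hI: "index_mat H b = fps_to_fls (h (fst b) (snd b))"
    "index_mat (map_mat (frob q) H) b = fps_to_fls (fps_frob q (h (fst b) (snd b)))" if "b \<in> I" for b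
    using that by (auto simp: h(1) I_def frob_fps[OF q0])
  interpret frob_system K v q N \<zeta> I "\<lambda>a. h (fst a) (snd a)" A A'
  proof unfold_locales
    fix a assume a: "a \<in> I"
    then have ij: "fst a < m" "snd a < n"
      by (auto simp: I_def)
    have "fps_to_fls (lin \<zeta> ^ N * fps_frob q (h (fst a) (snd a))) = s ^ N * index_mat (map_mat (frob q) H) (fst a, snd a)"
      using hI(2)[OF a] by (simp add: s_def fls_times_fps_to_fls fps_to_fls_power)
    also have "\<dots> = s ^ N * (\<Sum>b\<in>I. index_mat Ti' (fst a, fst b) * index_mat T (snd b, snd a) * index_mat H b)"
      unfolding fH' triple[OF c(4) c(5) c(1) ij] ..
    also have "\<dots> = (\<Sum>b\<in>I. fps_to_fls (A a b) * fps_to_fls (h (fst b) (snd b)))"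
      unfolding sum_distrib_left using A(2)[OF a] hI(1) by (intro sum.cong refl) (simp add: mult_ac)
    also have "\<dots> = fps_to_fls (\<Sum>b\<in>I. A a b * h (fst b) (snd b))"
      by (simp add: fps_to_fls_sum fls_times_fps_to_fls)
    finally show "lin \<zeta> ^ N * fps_frob q (h (fst a) (snd a)) = (\<Sum>b\<in>I. A a b * h (fst b) (snd b))"
      by (simp only: fps_to_fls_eq_iff)
    have "fps_to_fls (lin \<zeta> ^ N * h (fst a) (snd a)) = s ^ N * index_mat H (fst a, snd a)"
      using hI(1)[OF a] by (simp add: s_def fls_times_fps_to_fls fps_to_fls_power)
    also have "index_mat H (fst a, snd a) = (\<Sum>b\<in>I. index_mat T' (fst a, fst b) * index_mat Ti (snd b, snd a) * index_mat (map_mat (frob q) H) b)"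
      using arg_cong[OF H', of "\<lambda>M. index_mat M (fst a, snd a)"] triple[OF c(3) fH c(2) ij] by (rule trans)
    also have "s ^ N * \<dots> = (\<Sum>b\<in>I. fps_to_fls (A' a b) * fps_to_fls (fps_frob q (h (fst b) (snd b))))"
      unfolding sum_distrib_left using A'(2)[OF a] hI(2) by (intro sum.cong refl) (simp add: mult_ac)
    also have "\<dots> = fps_to_fls (\<Sum>b\<in>I. A' a b * fps_frob q (h (fst b) (snd b)))"
      by (simp add: fps_to_fls_sum fls_times_fps_to_fls)
    finally show "lin \<zeta> ^ N * h (fst a) (snd a) = (\<Sum>b\<in>I. A' a b * fps_frob q (h (fst b) (snd b)))"
      by (simp only: fps_to_fls_eq_iff)
  qed (use frobexp_q \<zeta>_K \<zeta>_nonzero v_\<zeta> h(2) A(1) A'(1) in \<open>auto simp: I_def\<close>)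
  have "h i j \<in> fps_over valR" if "i < m" "j < n" for i j
    using integral[OF discrete, of "(i, j)"] that by (auto simp: I_def)
  then show ?thesis
    unfolding power_series_over_eq by (intro matsI) (auto simp: h(1))
qed

lemma coeffs_K:
  assumes "\<And>g. g \<in> galois_group K \<Longrightarrow> map_coeffs g f = f"
  shows "fls_nth f i \<in> K"
proof (rule embedding_setting.galois_fixed_field[OF embedding])
  fix g assume g: "g \<in> galois_group K"
  have "g (fls_nth f i) = fls_nth (map_coeffs g f) i"
    by (rule map_coeffs_nth[symmetric]) (rule rhomD(1)[OF galois_rhom(1)[OF g]])
  also have "\<dots> = fls_nth f i"
    by (simp only: assms[OF g])
  finally show "g (fls_nth f i) = fls_nth f i" .
qed

end


section \<open>Full faithfulness\<close>

lemma act_unique: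
  assumes c: "coordz S n P \<kappa>" "coordz S m Q \<kappa>'" and S: "subr S" and H: "H \<in> mats S m n" "H' \<in> mats S m n"
    and a: "act S n \<kappa> \<kappa>' f H" "act S n \<kappa> \<kappa>' f H'"
  shows "H = H'"
proof (rule mat_eq_by_vecs[OF S matsD(1)[OF H(1)] matsD(1)[OF H(2)]])
  fix w assume w: "w \<in> vecs S n"
  have "\<kappa>' (H *\<^sub>v w) = \<kappa>' (H' *\<^sub>v w)"
    using a w by (simp add: act_def)
  then show "H *\<^sub>v w = H' *\<^sub>v w"
    using coordzD(2)[OF c(2) mats_mult_vec[OF S H(1) w] mats_mult_vec[OF S H(2) w]] by simp
qed

text \<open>One argument for both functors. \<open>E\<close> is R[[z]] or R[[z]][1/z], over which
  the source modules \<open>X0\<close> have the coordinates \<open>kx\<close>; \<open>S\<close>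
  consists of power series or of Laurent series over the separable closure. Morphisms are presented
  as solutions of the matrix equation, and \<open>integral_E\<close> says that solutions with
  coefficients in \<open>K\<close> are defined over \<open>E\<close>.\<close>

locale tate_functor = tate_setting K v q \<zeta>
  for K :: "'l::field set" and v q \<zeta> +
  fixes S E :: "'l fls set" and C :: "(('l, 'm) shtuka, 'x \<Rightarrow> 'x) category"
    and X0 :: "('l, 'm) shtuka \<Rightarrow> ('l fls, 'x) module" and kx :: "('l, 'm) shtuka \<Rightarrow> 'l fls vec \<Rightarrow> 'x"
    and F1 :: "('l, 'm) shtuka \<Rightarrow> ('l, 'm) shtuka \<Rightarrow> ('x \<Rightarrow> 'x) \<Rightarrow> ('m \<Rightarrow> 'l fls) set \<Rightarrow> ('m \<Rightarrow> 'l fls) set"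
  assumes S: "subr S" "PU \<subseteq> S"
    and S_closed: "\<And>s. s \<in> S \<Longrightarrow> frob q s \<in> S" "\<And>g s. g \<in> galois_group K \<Longrightarrow> s \<in> S \<Longrightarrow> map_coeffs g s \<in> S"
    and E: "subr E" "E \<subseteq> S"
    and Ob: "Ob C = obj"
    and kx: "\<And>U. U \<in> obj \<Longrightarrow> coordz E (rk U) (X0 U) (kx U)"
    and Hom: "\<And>U U'. U \<in> obj \<Longrightarrow> U' \<in> obj \<Longrightarrow> Hom C U U' = {f \<in> linear_maps E (X0 U) (X0 U').
      \<forall>H\<in>mats E (rk U') (rk U). act E (rk U) (kx U) (kx U') f H \<longrightarrow> TT U' * map_mat (frob q) H = H * TT U}"
    and Idt: "\<And>U. U \<in> obj \<Longrightarrow> Idt C U = (\<lambda>x\<in>carrier (X0 U). x)"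
    and Comp: "\<And>U g f. U \<in> obj \<Longrightarrow> Comp C U g f = compose (carrier (X0 U)) g f"
    and F1: "\<And>U U' f H w. U \<in> obj \<Longrightarrow> U' \<in> obj \<Longrightarrow> H \<in> mats E (rk U') (rk U) \<Longrightarrow>
      act E (rk U) (kx U) (kx U') f H \<Longrightarrow> w \<in> vecs S (rk U) \<Longrightarrow>
      lift.cl S (fst U) (rk U) (\<kappa> U) w \<in> carrier (fst (tate_object valR q \<zeta> S U)) \<Longrightarrow>
      F1 U U' f (lift.cl S (fst U) (rk U) (\<kappa> U) w) = lift.cl S (fst U') (rk U') (\<kappa> U') (H *\<^sub>v w)"
    and F1_ext: "\<And>U U' f. F1 U U' f \<in> extensional (carrier (fst (tate_object valR q \<zeta> S U)))"
    and integral_E: "\<And>(U :: ('l, 'm) shtuka) (U' :: ('l, 'm) shtuka) H. U \<in> obj \<Longrightarrow> U' \<in> obj \<Longrightarrow> H \<in> mats S (rk U') (rk U) \<Longrightarrow>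
      (\<And>i j k. i < rk U' \<Longrightarrow> j < rk U \<Longrightarrow> fls_nth (index_mat H (i, j)) k \<in> K) \<Longrightarrow>
      TT U' * map_mat (frob q) H = H * TT U \<Longrightarrow> H \<in> mats E (rk U') (rk U)"
    and E_K: "\<And>x i. x \<in> E \<Longrightarrow> fls_nth x i \<in> K"
    and F_K: "{x. x ^ q = x} \<subseteq> K"
begin

text \<open>The scalars of the representations. With the fixed coefficients known to be
  F_\<epsilon>, they are A_\<epsilon> for power series and Q_\<epsilon> for Laurent series.\<close>

definition D :: "'l fls set"
  where "D = {x \<in> S. frob q x = x}"

abbreviation "Y U \<equiv> tate_object valR q \<zeta> S U"

abbreviation "ky U \<equiv> lift.cl S (fst U) (rk U) (\<kappa> U)"

abbreviation "fr \<equiv> map_vec (frob q)"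

abbreviation "frm \<equiv> map_mat (frob q)"

lemmas rq = rhom_frob[OF frobexp_q]

lemma B_S: "B \<subseteq> S"
  using B_W W_PU S(2) by blast

lemma W_S: "W \<subseteq> S"
  using W_PU S(2) by blast

lemma D_S: "D \<subseteq> S"
  by (auto simp: D_def)

lemma subr_D: "subr D"
  unfolding subr_def D_def using subrD[OF S(1)] rhomD[OF rq] rhom_uminus[OF rq] by auto

lemma fr_vecs: "w \<in> vecs S n \<Longrightarrow> fr w \<in> vecs S n"
  using S_closed(1) by (auto simp: vecs_def)

lemma vecs_D_iff: "d \<in> vecs D n \<longleftrightarrow> d \<in> vecs S n \<and> fr d = d"
proof
  assume "d \<in> vecs D n"
  then show "d \<in> vecs S n \<and> fr d = d"
    by (auto simp: vecs_def D_def intro!: eq_vecI)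
next
  assume d: "d \<in> vecs S n \<and> fr d = d"
  have "frob q (vec_index d i) = vec_index d i" if "i < n" for i
  proof -
    have "dim_vec d = n"
      using d by (auto dest: vecsD(2))
    then have "vec_index (fr d) i = frob q (vec_index d i)"
      using that by (intro index_map_vec(1)) simp
    then have "frob q (vec_index d i) = vec_index (fr d) i"
      by (rule sym)
    also have "\<dots> = vec_index d i"
      using d by (simp only:)
    finally show ?thesis .
  qed
  then show "d \<in> vecs D n"
    using d by (auto simp: vecs_def D_def)
qed

lemma galois_frob:
  assumes g: "g \<in> galois_group K"
  shows "map_coeffs g (frob q x) = frob q (map_coeffs g x)"
proof -
  have "g 0 = 0" "(0::'l) ^ q = 0"
    using rhomD(1)[OF galois_rhom(1)[OF g]] frobexp_gt1[OF frobexp_q] by (auto simp: power_0_left)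
  then show ?thesis
    using rhom_power[OF galois_rhom(1)[OF g]] unfolding frob_def by (intro fls_eqI) simp
qed

lemma galois_K: "g \<in> galois_group K \<Longrightarrow> (\<And>i. fls_nth x i \<in> K) \<Longrightarrow> map_coeffs g x = x"
  using galois_rhom(2)[of g K] rhomD(1)[OF galois_rhom(1)[of g K]] by (intro fls_eqI) simp

text \<open>Coefficients of Frobenius-fixed series are roots of x^q = x, and these lie in
  \<open>K\<close>.\<close>

lemma galois_D: "g \<in> galois_group K \<Longrightarrow> x \<in> D \<Longrightarrow> map_coeffs g x = x"
proof (rule galois_K)
  fix i assume "x \<in> D"
  then have "fls_nth (frob q x) i = fls_nth x i"
    by (simp add: D_def)
  then show "fls_nth x i \<in> K"
    using F_K frobexp_gt1[OF frobexp_q] by (auto simp: frob_def power_0_left)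
qed

section \<open>The Tate module as a Galois representation\<close>

context
  fixes U :: "('l, 'm) shtuka"
  assumes U: "U \<in> obj"
begin

lemma coordz_ky: "coordz S (rk U) (ext valR S (fst U)) (ky U)"
  by (rule lift.coordz_ext[OF obj(1)[OF U] S(1) B_S])

lemma T_S: "TT U \<in> mats S (rk U) (rk U)"
  using obj(2)[OF U] mats_mono[OF W_S] by blast

lemma P_S: "UU U \<in> mats S (rk U) (rk U)" and Q_S: "VV U \<in> mats S (rk U) (rk U)"
  using UV(1,2)[OF U] mats_mono[OF S(2)] by auto

lemmas P_c = matsD(1)[OF P_S] and Q_c = matsD(1)[OF Q_S] and T_c = matsD(1)[OF T_S]

lemma PQ_vec: "w \<in> carrier_vec (rk U) \<Longrightarrow> UU U *\<^sub>v (VV U *\<^sub>v w) = w"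
  "w \<in> carrier_vec (rk U) \<Longrightarrow> VV U *\<^sub>v (UU U *\<^sub>v w) = w"
  using UV(4,5)[OF U] P_c Q_c by (simp_all add: assoc_mult_mat_vec[symmetric])

lemma tate_carrier: "carrier (fst (Y U)) = ky U ` {w \<in> vecs S (rk U). TT U *\<^sub>v fr w = w}"
proof -
  have act: "tau_ext valR q \<zeta> S U (frob_pull q valR S (fst U) (ky U w)) = ky U (TT U *\<^sub>v fr w)"
    if w: "w \<in> vecs S (rk U)" for w
  proof -
    have "frob_pull q valR S (fst U) (ky U w) = lift.fcl S (fst U) (rk U) (\<kappa> U) (fr w)"
      by (rule lift.frob_pull_eq[OF obj(1)[OF U] S(1) B_S w S_closed(1)])
    moreover have "tau_ext valR q \<zeta> S (fst U, snd U) (lift.fcl S (fst U) (rk U) (\<kappa> U) (fr w)) = ky U (TT U *\<^sub>v fr w)"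
      by (rule lift.tau_ext_eq[OF obj(1)[OF U] S(1) B_S subr_W B_W W_S obj(4)[OF U] obj(2)[OF U] fr_vecs[OF w]])
    ultimately show ?thesis
      by simp
  qed
  have "carrier (fst (Y U)) = {x \<in> carrier (ext valR S (fst U)). tau_ext valR q \<zeta> S U (frob_pull q valR S (fst U) x) = x}"
    by (cases U) (simp add: tate_object_def)
  also have "\<dots> = ky U ` {w \<in> vecs S (rk U). TT U *\<^sub>v fr w = w}"
  proof (intro equalityI subsetI)
    fix x assume "x \<in> {x \<in> carrier (ext valR S (fst U)). tau_ext valR q \<zeta> S U (frob_pull q valR S (fst U) x) = x}"
    then have x: "x \<in> carrier (ext valR S (fst U))" "tau_ext valR q \<zeta> S U (frob_pull q valR S (fst U) x) = x"
      by auto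
    obtain w where w: "w \<in> vecs S (rk U)" "x = ky U w"
      using coordzD(6)[OF coordz_ky x(1)] by blast
    then have "ky U (TT U *\<^sub>v fr w) = ky U w"
      using act[OF w(1)] x(2) by simp
    then have "TT U *\<^sub>v fr w = w"
      using coordzD(2)[OF coordz_ky mats_mult_vec[OF S(1) T_S fr_vecs[OF w(1)]] w(1)] by simp
    then show "x \<in> ky U ` {w \<in> vecs S (rk U). TT U *\<^sub>v fr w = w}"
      using w by blast
  next
    fix x assume "x \<in> ky U ` {w \<in> vecs S (rk U). TT U *\<^sub>v fr w = w}"
    then obtain w where w: "w \<in> vecs S (rk U)" "TT U *\<^sub>v fr w = w" "x = ky U w"
      by blast
    then show "x \<in> {x \<in> carrier (ext valR S (fst U)). tau_ext valR q \<zeta> S U (frob_pull q valR S (fst U) x) = x}"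
      using act[OF w(1)] coordzD(1)[OF coordz_ky w(1)] by simp
  qed
  finally show ?thesis .
qed

lemma tate_vec:
  assumes d: "d \<in> vecs D (rk U)"
  shows "UU U *\<^sub>v d \<in> vecs S (rk U)" "TT U *\<^sub>v fr (UU U *\<^sub>v d) = UU U *\<^sub>v d"
proof -
  have dS: "d \<in> vecs S (rk U)" "fr d = d"
    using d vecs_D_iff by auto
  show "UU U *\<^sub>v d \<in> vecs S (rk U)"
    by (rule mats_mult_vec[OF S(1) P_S dS(1)])
  have "TT U *\<^sub>v fr (UU U *\<^sub>v d) = TT U *\<^sub>v (frm (UU U) *\<^sub>v d)"
    by (simp add: rhom_mult_vec[OF rq P_c vecsD(1)[OF dS(1)]] dS(2))
  also have "\<dots> = UU U *\<^sub>v d"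
    using assoc_mult_mat_vec[OF T_c _ vecsD(1)[OF dS(1)], of "frm (UU U)"] UV(3)[OF U] P_c by simp
  finally show "TT U *\<^sub>v fr (UU U *\<^sub>v d) = UU U *\<^sub>v d" .
qed

text \<open>For P = \<open>UU U\<close> the equation T \<sigma>(P) = P gives P \<sigma>(P^-1 w) = T
  \<sigma>(w) = w, so P^-1 w is fixed by the Frobenius.\<close>

lemma tate_vec_inv:
  assumes w: "w \<in> vecs S (rk U)" "TT U *\<^sub>v fr w = w"
  shows "VV U *\<^sub>v w \<in> vecs D (rk U)"
proof -
  have d: "VV U *\<^sub>v w \<in> vecs S (rk U)"
    by (rule mats_mult_vec[OF S(1) Q_S w(1)])
  have "UU U *\<^sub>v fr (VV U *\<^sub>v w) = TT U *\<^sub>v (frm (UU U) *\<^sub>v fr (VV U *\<^sub>v w))"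
    using assoc_mult_mat_vec[OF T_c _ vecsD(1)[OF fr_vecs[OF d]], of "frm (UU U)"] UV(3)[OF U] P_c by simp
  also have "\<dots> = TT U *\<^sub>v fr (UU U *\<^sub>v (VV U *\<^sub>v w))"
    by (simp add: rhom_mult_vec[OF rq P_c vecsD(1)[OF d]])
  also have "\<dots> = w"
    using PQ_vec(1)[OF vecsD(1)[OF w(1)]] w(2) by simp
  finally have "VV U *\<^sub>v w = VV U *\<^sub>v (UU U *\<^sub>v fr (VV U *\<^sub>v w))"
    by simp
  also have "\<dots> = fr (VV U *\<^sub>v w)"
    by (rule PQ_vec(2)[OF vecsD(1)[OF fr_vecs[OF d]]])
  finally show ?thesis
    using d vecs_D_iff by simp
qed

text \<open>Coordinates of the Tate module over \<open>D\<close>, with the columns of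
  \<open>UU U\<close> as basis.\<close>

definition "kd d = ky U (UU U *\<^sub>v d)"

lemma fst_Y: "fst (Y U) = (ext valR S (fst U))\<lparr>carrier := carrier (fst (Y U))\<rparr>"
  by (cases U) (simp add: tate_object_def)

lemma Y_ops: "add (fst (Y U)) = add (ext valR S (fst U))" "module.smult (fst (Y U)) = module.smult (ext valR S (fst U))"
  "ring.zero (fst (Y U)) = ring.zero (ext valR S (fst U))"
  by (subst fst_Y, simp)+

lemma coordz_kd: "coordz D (rk U) (fst (Y U)) kd"
  unfolding coordz_def
proof (intro conjI ballI)
  have inj: "inj_on kd (vecs D (rk U))"
  proof (rule inj_onI)
    fix d d' assume d: "d \<in> vecs D (rk U)" "d' \<in> vecs D (rk U)" "kd d = kd d'"
    then have "UU U *\<^sub>v d = UU U *\<^sub>v d'"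
      using coordzD(2)[OF coordz_ky tate_vec(1)[OF d(1)] tate_vec(1)[OF d(2)]] by (simp add: kd_def)
    then have "VV U *\<^sub>v (UU U *\<^sub>v d) = VV U *\<^sub>v (UU U *\<^sub>v d')"
      by simp
    then show "d = d'"
      using PQ_vec(2)[OF vecsD(1)[OF d(1)]] PQ_vec(2)[OF vecsD(1)[OF d(2)]] by simp
  qed
  have "kd ` vecs D (rk U) = carrier (fst (Y U))"
    unfolding tate_carrier
  proof (intro equalityI subsetI)
    fix x assume "x \<in> kd ` vecs D (rk U)"
    then show "x \<in> ky U ` {w \<in> vecs S (rk U). TT U *\<^sub>v fr w = w}"
      using tate_vec by (auto simp: kd_def)
  next
    fix x assume "x \<in> ky U ` {w \<in> vecs S (rk U). TT U *\<^sub>v fr w = w}"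
    then obtain w where w: "w \<in> vecs S (rk U)" "TT U *\<^sub>v fr w = w" "x = ky U w"
      by blast
    then have "x = kd (VV U *\<^sub>v w)"
      by (simp add: kd_def PQ_vec(1)[OF vecsD(1)[OF w(1)]])
    then show "x \<in> kd ` vecs D (rk U)"
      using tate_vec_inv[OF w(1,2)] by blast
  qed
  then show "bij_betw kd (vecs D (rk U)) (carrier (fst (Y U)))"
    using inj by (simp add: bij_betw_def)
next
  fix d d' assume d: "d \<in> vecs D (rk U)" "d' \<in> vecs D (rk U)"
  then show "kd (d + d') = kd d \<oplus>\<^bsub>fst (Y U)\<^esub> kd d'"
    unfolding Y_ops kd_def coordzD(3)[OF coordz_ky tate_vec(1)[OF d(1)] tate_vec(1)[OF d(2)]]
    using mult_add_distrib_mat_vec[OF P_c vecsD(1)[OF d(1)] vecsD(1)[OF d(2)]] by simp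
next
  fix s d assume s: "s \<in> D" and d: "d \<in> vecs D (rk U)"
  have "s \<in> S"
    using s D_S by blast
  then show "kd (s \<cdot>\<^sub>v d) = s \<odot>\<^bsub>fst (Y U)\<^esub> kd d"
    unfolding Y_ops kd_def coordzD(4)[OF coordz_ky \<open>s \<in> S\<close> tate_vec(1)[OF d]]
    using mult_mat_vec[OF P_c vecsD(1)[OF d], of s] by simp
next
  have "UU U *\<^sub>v 0\<^sub>v (rk U) = 0\<^sub>v (rk U)"
    using P_c by (intro eq_vecI) auto
  then show "\<zero>\<^bsub>fst (Y U)\<^esub> = kd (0\<^sub>v (rk U))"
    unfolding Y_ops kd_def coordzD(5)[OF coordz_ky] by simp
qed

lemma galois_act:
  assumes "g \<in> galois_group K" "w \<in> vecs S (rk U)"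
  shows "snd (Y U) g (ky U w) = ky U (map_vec (map_coeffs g) w)"
proof -
  have "tensor_lift (ext valR S (fst U)) (map_coeffs g) (pure_ext valR S (fst U)) (ky U w) = ky U (map_vec (map_coeffs g) w)"
    using galois_rhom(2)[OF assms(1)] R_K
    by (intro lift.galois_eq[OF obj(1)[OF U] S(1) B_S assms(2) galois_rhom(1)[OF assms(1)] _ S_closed(2)[OF assms(1)]]) auto
  then show ?thesis
    by (cases U) (simp add: tate_object_def)
qed

definition "gm g = map_mat (map_coeffs g) (UU U)"

lemma gm: "g \<in> galois_group K \<Longrightarrow> gm g \<in> mats PU (rk U) (rk U)"
  using UV(1)[OF U] rhomD(1)[OF galois_rhom(1)[of g K]]
  by (auto simp: mats_def gm_def power_series_over_iff)

text \<open>\<open>g\<close> fixes the matrix of \<tau>, whose entries have coefficients in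
  \<open>K\<close>, and commutes with the Frobenius. So it maps the fundamental matrix to another
  solution.\<close>

lemma gm_fixed:
  assumes g: "g \<in> galois_group K"
  shows "TT U * frm (gm g) = gm g"
proof -
  have "map_mat (map_coeffs g) (TT U) = TT U"
  proof (rule eq_matI)
    fix i j assume "i < dim_row (TT U)" "j < dim_col (TT U)"
    then have ij: "i < rk U" "j < rk U"
      using T_c by auto
    have "index_mat (TT U) (i, j) \<in> power_series_over K"
      using matsD(4)[OF obj(2)[OF U] ij] W_PK by blast
    then have "map_coeffs g (index_mat (TT U) (i, j)) = index_mat (TT U) (i, j)"
      using power_series_over_iff[OF subrD(1)[OF subr_K]] by (intro galois_K[OF g]) auto
    then show "index_mat (map_mat (map_coeffs g) (TT U)) (i, j) = index_mat (TT U) (i, j)"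
      using ij T_c by simp
  qed auto
  moreover have "map_mat (map_coeffs g) (frm (UU U)) = frm (gm g)"
    unfolding gm_def by (rule eq_matI) (auto simp: galois_frob[OF g])
  moreover have "map_mat (map_coeffs g) (TT U * frm (UU U)) = map_mat (map_coeffs g) (TT U) * map_mat (map_coeffs g) (frm (UU U))"
    using P_c by (intro rhom_mult_mat[OF rhom_map_coeffs[OF galois_rhom(1)[OF g]] T_c]) auto
  ultimately show ?thesis
    unfolding UV(3)[OF U] by (simp add: gm_def)
qed

text \<open>Two matrix solutions differ by a factor that is fixed by the Frobenius. This factor is
  the matrix of \<open>g\<close> on the Tate module.\<close>

lemma ag: 
  assumes g: "g \<in> galois_group K"
  shows "VV U * gm g \<in> mats D (rk U) (rk U)"
proof -
  have gS: "gm g \<in> mats S (rk U) (rk U)"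
    using gm[OF g] mats_mono[OF S(2)] by blast
  have gc: "gm g \<in> carrier_mat (rk U) (rk U)"
    by (rule matsD(1)[OF gS])
  have aS: "VV U * gm g \<in> mats S (rk U) (rk U)"
    by (rule mats_mult[OF S(1) Q_S gS])
  have ac: "frm (VV U * gm g) \<in> carrier_mat (rk U) (rk U)"
    using Q_c gc by simp
  have PQg: "UU U * (VV U * gm g) = gm g"
    using assoc_mult_mat[OF P_c Q_c gc] UV(4)[OF U] gc by simp
  have "UU U * frm (VV U * gm g) = TT U * (frm (UU U) * frm (VV U * gm g))"
    using assoc_mult_mat[OF T_c _ ac, of "frm (UU U)"] UV(3)[OF U] P_c by simp
  also have "frm (UU U) * frm (VV U * gm g) = frm (gm g)"
    using rhom_mult_mat[OF rq P_c matsD(1)[OF aS]] PQg by simp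
  finally have "UU U * frm (VV U * gm g) = gm g"
    using gm_fixed[OF g] by simp
  then have "VV U * (UU U * frm (VV U * gm g)) = VV U * gm g"
    by simp
  then have fixed: "frm (VV U * gm g) = VV U * gm g"
    using assoc_mult_mat[OF Q_c P_c ac] UV(5)[OF U] left_mult_one_mat[OF ac] by metis
  show ?thesis
  proof (rule matsI[OF matsD(1)[OF aS]])
    fix i j assume ij: "i < rk U" "j < rk U"
    have "frob q (index_mat (VV U * gm g) (i, j)) = index_mat (frm (VV U * gm g)) (i, j)"
      using ij matsD[OF aS] by simp
    then show "index_mat (VV U * gm g) (i, j) \<in> D"
      unfolding fixed using matsD(4)[OF aS ij] by (simp add: D_def)
  qed
qed

lemma act_galois:
  assumes g: "g \<in> galois_group K"
  shows "act D (rk U) kd kd (snd (Y U) g) (VV U * gm g)"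
  unfolding act_def
proof
  fix d assume d: "d \<in> vecs D (rk U)"
  have gc: "gm g \<in> carrier_mat (rk U) (rk U)"
    by (rule matsD(1)[OF gm[OF g]])
  have dc: "d \<in> carrier_vec (rk U)"
    by (rule vecsD(1)[OF d])
  have "map_vec (map_coeffs g) d = d"
    using vecsD(3)[OF d] galois_D[OF g] vecsD(2)[OF d] by (intro eq_vecI) auto
  then have "snd (Y U) g (kd d) = ky U (gm g *\<^sub>v d)"
    unfolding kd_def galois_act[OF g tate_vec(1)[OF d]]
      rhom_mult_vec[OF rhom_map_coeffs[OF galois_rhom(1)[OF g]] P_c dc] gm_def by simp
  also have "gm g *\<^sub>v d = UU U *\<^sub>v (VV U *\<^sub>v (gm g *\<^sub>v d))"
    using gc dc by (intro PQ_vec(1)[symmetric]) simp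
  also have "VV U *\<^sub>v (gm g *\<^sub>v d) = (VV U * gm g) *\<^sub>v d"
    by (rule assoc_mult_mat_vec[OF Q_c gc dc, symmetric])
  finally show "snd (Y U) g (kd d) = kd ((VV U * gm g) *\<^sub>v d)"
    by (simp add: kd_def)
qed

lemma galois_Y:
  assumes "g \<in> galois_group K" "x \<in> carrier (fst (Y U))"
  shows "snd (Y U) g x \<in> carrier (fst (Y U))"
proof -
  obtain d where d: "d \<in> vecs D (rk U)" "x = kd d"
    using coordzD(6)[OF coordz_kd assms(2)] by blast
  have "snd (Y U) g x = kd ((VV U * gm g) *\<^sub>v d)"
    using act_galois[OF assms(1)] d by (simp add: act_def)
  then show ?thesis
    using coordzD(1)[OF coordz_kd mats_mult_vec[OF subr_D ag[OF assms(1)] d(1)]] by simp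
qed

lemma galois_representation_Y: "galois_representation K D (rk U) (Y U)"
proof -
  have "free_of_rank D (rk U) (fst (Y U))"
    by (rule free_of_rank_coordz[OF coordz_kd subr_D])
  moreover have "restrict (snd (Y U) g) (carrier (fst (Y U))) \<in> linear_maps D (fst (Y U)) (fst (Y U))"
    if g: "g \<in> galois_group K" for g
  proof -
    note m = map_of_mat[OF coordz_kd coordz_kd subr_D ag[OF g]]
    have "restrict (snd (Y U) g) (carrier (fst (Y U))) = map_of_mat D (rk U) (fst (Y U)) kd kd (VV U * gm g)"
    proof (rule extensional_act_eq[OF coordz_kd _ _ _ m(2)])
      show "act D (rk U) kd kd (restrict (snd (Y U) g) (carrier (fst (Y U)))) (VV U * gm g)"
        using act_galois[OF g] coordzD(1)[OF coordz_kd] by (auto simp: act_def)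
    qed (auto simp: map_of_mat_def)
    then show ?thesis
      using m(1) by simp
  qed
  moreover have "snd (Y U) id x = x" if "x \<in> carrier (fst (Y U))" for x
  proof -
    obtain d where d: "d \<in> vecs D (rk U)" "x = kd d"
      using coordzD(6)[OF coordz_kd \<open>x \<in> carrier (fst (Y U))\<close>] by blast
    have "map_vec (map_coeffs id) (UU U *\<^sub>v d) = UU U *\<^sub>v d"
      by (intro eq_vecI) (auto intro!: fls_eqI)
    then show ?thesis
      unfolding d(2) kd_def galois_act[OF galois_id tate_vec(1)[OF d(1)]] by simp
  qed
  moreover have "snd (Y U) (g \<circ> h) x = snd (Y U) g (snd (Y U) h x)"
    if g: "g \<in> galois_group K" and h: "h \<in> galois_group K" and x: "x \<in> carrier (fst (Y U))" for g h x
  proof -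
    obtain d where d: "d \<in> vecs D (rk U)" "x = kd d"
      using coordzD(6)[OF coordz_kd x] by blast
    let ?w = "UU U *\<^sub>v d"
    have w: "?w \<in> vecs S (rk U)"
      by (rule tate_vec(1)[OF d(1)])
    have hw: "map_vec (map_coeffs h) ?w \<in> vecs S (rk U)"
      using vecsD[OF w] S_closed(2)[OF h] by (intro vecsI) auto
    have "map_vec (map_coeffs (g \<circ> h)) ?w = map_vec (map_coeffs g) (map_vec (map_coeffs h) ?w)"
      using rhomD(1)[OF galois_rhom(1)[OF g]] rhomD(1)[OF galois_rhom(1)[OF h]]
      by (intro eq_vecI) (auto intro!: fls_eqI)
    then show ?thesis
      unfolding d(2) kd_def galois_act[OF galois_comp[OF g h] w] galois_act[OF h w] galois_act[OF g hw] by simp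
  qed
  moreover have "\<exists>e a. module_basis D (fst (Y U)) (rk U) e \<and>
       (\<forall>i<rk U. \<forall>j<rk U. continuous_map (krull_topology K) (top_of_set D) (a i j)) \<and>
       (\<forall>g\<in>galois_group K. \<forall>j<rk U. snd (Y U) g (e j) = (\<Oplus>\<^bsub>fst (Y U)\<^esub>i\<in>{..<rk U}. a i j g \<odot>\<^bsub>fst (Y U)\<^esub> e i))"
  proof (intro exI[of _ "\<lambda>i. kd (unit_vec (rk U) i)"]
      exI[of _ "\<lambda>i j g. index_mat (VV U * map_mat (map_coeffs g) (UU U)) (i, j)"] conjI allI impI ballI)
    show "module_basis D (fst (Y U)) (rk U) (\<lambda>i. kd (unit_vec (rk U) i))"
      by (rule coordz_basis[OF coordz_kd subr_D])
    fix i j assume ij: "i < rk U" "j < rk U"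
    show "continuous_map (krull_topology K) (top_of_set D) (\<lambda>g. index_mat (VV U * map_mat (map_coeffs g) (UU U)) (i, j))"
      using matsD(4)[OF ag ij] ij
      by (intro continuous_coefficient[OF UV(2)[OF U] UV(1)[OF U]]) (auto simp: gm_def)
  next
    fix g j assume g: "g \<in> galois_group K" and j: "j < rk U"
    have "snd (Y U) g (kd (unit_vec (rk U) j)) = kd ((VV U * gm g) *\<^sub>v unit_vec (rk U) j)"
      using act_galois[OF g] vecs_unit[OF subr_D] by (simp add: act_def)
    also have "(VV U * gm g) *\<^sub>v unit_vec (rk U) j = col (VV U * gm g) j"
      by (rule mult_mat_unit_vec[OF matsD(1)[OF ag[OF g]] j])
    also have "\<dots> = vec (rk U) (\<lambda>i. index_mat (VV U * gm g) (i, j))"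
      using matsD[OF ag[OF g]] j by (intro eq_vecI) auto
    also have "kd \<dots> = (\<Oplus>\<^bsub>fst (Y U)\<^esub>i\<in>{..<rk U}. index_mat (VV U * gm g) (i, j) \<odot>\<^bsub>fst (Y U)\<^esub> kd (unit_vec (rk U) i))"
      using matsD(4)[OF ag[OF g] _ j] by (intro coordz_lincomb[OF coordz_kd subr_D, symmetric])
    finally show "snd (Y U) g (kd (unit_vec (rk U) j)) = (\<Oplus>\<^bsub>fst (Y U)\<^esub>i\<in>{..<rk U}.
        index_mat (VV U * map_mat (map_coeffs g) (UU U)) (i, j) \<odot>\<^bsub>fst (Y U)\<^esub> kd (unit_vec (rk U) i))"
      by (simp only: gm_def)
  qed
  ultimately show ?thesis
    unfolding galois_representation_def by (cases "Y U") auto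
qed

end

section \<open>Morphisms of Tate modules\<close>

context
  fixes U U' :: "('l, 'm) shtuka"
  assumes U: "U \<in> obj" and U': "U' \<in> obj"
begin

lemma hom_matrix:
  assumes "f \<in> Hom C U U'"
  obtains H where "H \<in> mats E (rk U') (rk U)" "act E (rk U) (kx U) (kx U') f H" "TT U' * frm H = H * TT U"
proof -
  have f: "f \<in> linear_maps E (X0 U) (X0 U')"
    using assms Hom[OF U U'] by auto
  obtain H where H: "H \<in> mats E (rk U') (rk U)" "act E (rk U) (kx U) (kx U') f H"
    by (rule linear_map_matrix[OF kx[OF U] kx[OF U'] E(1) f])
  then show thesis
    using assms Hom[OF U U'] that by auto
qed

lemma matrix_hom:
  assumes f: "f \<in> linear_maps E (X0 U) (X0 U')" and H: "H \<in> mats E (rk U') (rk U)" "act E (rk U) (kx U) (kx U') f H"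
    and eq: "TT U' * frm H = H * TT U"
  shows "f \<in> Hom C U U'"
  unfolding Hom[OF U U'] using f eq act_unique[OF kx[OF U] kx[OF U'] E(1) _ H(1) _ H(2)] by blast

lemma tate_image:
  assumes H: "H \<in> mats S (rk U') (rk U)" "TT U' * frm H = H * TT U" and w: "w \<in> vecs S (rk U)" "TT U *\<^sub>v fr w = w"
  shows "H *\<^sub>v w \<in> vecs S (rk U')" "TT U' *\<^sub>v fr (H *\<^sub>v w) = H *\<^sub>v w"
proof -
  note c = T_c[OF U] T_c[OF U'] matsD(1)[OF H(1)] vecsD(1)[OF w(1)] vecsD(1)[OF fr_vecs[OF w(1)]]
  show "H *\<^sub>v w \<in> vecs S (rk U')"
    by (rule mats_mult_vec[OF S(1) H(1) w(1)])
  have fH: "frm H \<in> carrier_mat (rk U') (rk U)"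
    using c by simp
  have "TT U' *\<^sub>v fr (H *\<^sub>v w) = (TT U' * frm H) *\<^sub>v fr w"
    unfolding rhom_mult_vec[OF rq c(3,4)] by (rule assoc_mult_mat_vec[OF c(2) fH c(5), symmetric])
  also have "\<dots> = H *\<^sub>v (TT U *\<^sub>v fr w)"
    unfolding H(2) by (rule assoc_mult_mat_vec[OF c(3) c(1) c(5)])
  finally show "TT U' *\<^sub>v fr (H *\<^sub>v w) = H *\<^sub>v w"
    by (simp only: w(2))
qed

lemma Y_vec:
  assumes "x \<in> carrier (fst (Y U))"
  obtains w where "w \<in> vecs S (rk U)" "TT U *\<^sub>v fr w = w" "x = ky U w"
  using assms unfolding tate_carrier[OF U] by blast

lemma F1_act:
  assumes H: "H \<in> mats E (rk U') (rk U)" "act E (rk U) (kx U) (kx U') f H" and w: "w \<in> vecs S (rk U)" "TT U *\<^sub>v fr w = w"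
  shows "F1 U U' f (ky U w) = ky U' (H *\<^sub>v w)"
  using w by (intro F1[OF U U' H w(1)]) (auto simp: tate_carrier[OF U])

lemma F1_rep:
  assumes f: "f \<in> Hom C U U'"
  shows "F1 U U' f \<in> rep_morphisms K D (Y U) (Y U')"
proof -
  obtain H where H: "H \<in> mats E (rk U') (rk U)" "act E (rk U) (kx U) (kx U') f H" "TT U' * frm H = H * TT U"
    by (rule hom_matrix[OF f])
  have HS: "H \<in> mats S (rk U') (rk U)"
    using H(1) mats_mono[OF E(2)] by blast
  have Hc: "H \<in> carrier_mat (rk U') (rk U)"
    by (rule matsD(1)[OF HS])
  note F = F1_act[OF H(1,2)]
  note img = tate_image[OF HS H(3)]
  have lin: "F1 U U' f \<in> linear_maps D (fst (Y U)) (fst (Y U'))"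
    unfolding linear_maps_def
  proof (intro CollectI conjI ballI)
    have "F1 U U' f x \<in> carrier (fst (Y U'))" if "x \<in> carrier (fst (Y U))" for x
    proof -
      obtain w where w: "w \<in> vecs S (rk U)" "TT U *\<^sub>v fr w = w" "x = ky U w"
        by (rule Y_vec[OF \<open>x \<in> carrier (fst (Y U))\<close>])
      then show ?thesis
        using F[OF w(1,2)] img[OF w(1,2)] unfolding tate_carrier[OF U'] by auto
    qed
    then show "F1 U U' f \<in> carrier (fst (Y U)) \<rightarrow>\<^sub>E carrier (fst (Y U'))"
      using F1_ext by (auto simp: PiE_def)
  next
    fix x y assume x: "x \<in> carrier (fst (Y U))" and y: "y \<in> carrier (fst (Y U))"
    obtain w where w: "w \<in> vecs S (rk U)" "TT U *\<^sub>v fr w = w" "x = ky U w"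
      by (rule Y_vec[OF x])
    obtain w' where w': "w' \<in> vecs S (rk U)" "TT U *\<^sub>v fr w' = w'" "y = ky U w'"
      by (rule Y_vec[OF y])
    have c: "w \<in> carrier_vec (rk U)" "w' \<in> carrier_vec (rk U)" "fr w \<in> carrier_vec (rk U)" "fr w' \<in> carrier_vec (rk U)"
      using vecsD(1)[OF w(1)] vecsD(1)[OF w'(1)] by auto
    have "fr (w + w') = fr w + fr w'"
      using c rhomD(3)[OF rq] by (intro eq_vecI) auto
    then have s: "w + w' \<in> vecs S (rk U)" "TT U *\<^sub>v fr (w + w') = w + w'"
      using vecs_add[OF S(1) w(1) w'(1)] mult_add_distrib_mat_vec[OF T_c[OF U] c(3,4)] w(2) w'(2) by auto
    show "F1 U U' f (x \<oplus>\<^bsub>fst (Y U)\<^esub> y) = F1 U U' f x \<oplus>\<^bsub>fst (Y U')\<^esub> F1 U U' f y"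
      unfolding w(3) w'(3) Y_ops[OF U] Y_ops[OF U'] coordzD(3)[OF coordz_ky[OF U] w(1) w'(1)] F[OF s] F[OF w(1,2)] F[OF w'(1,2)]
        coordzD(3)[OF coordz_ky[OF U'] img(1)[OF w(1,2)] img(1)[OF w'(1,2)]]
      by (simp only: mult_add_distrib_mat_vec[OF Hc c(1,2)])
  next
    fix s x assume s: "s \<in> D" and x: "x \<in> carrier (fst (Y U))"
    obtain w where w: "w \<in> vecs S (rk U)" "TT U *\<^sub>v fr w = w" "x = ky U w"
      by (rule Y_vec[OF x])
    have sS: "s \<in> S" "frob q s = s"
      using s by (auto simp: D_def)
    have c: "w \<in> carrier_vec (rk U)" "fr w \<in> carrier_vec (rk U)"
      using vecsD(1)[OF w(1)] by auto
    have "fr (s \<cdot>\<^sub>v w) = s \<cdot>\<^sub>v fr w"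
      using rhomD(4)[OF rq] sS(2) by (intro eq_vecI) auto
    then have sw: "s \<cdot>\<^sub>v w \<in> vecs S (rk U)" "TT U *\<^sub>v fr (s \<cdot>\<^sub>v w) = s \<cdot>\<^sub>v w"
      using vecs_smult[OF S(1) sS(1) w(1)] mult_mat_vec[OF T_c[OF U] c(2), of s] w(2) by auto
    show "F1 U U' f (s \<odot>\<^bsub>fst (Y U)\<^esub> x) = s \<odot>\<^bsub>fst (Y U')\<^esub> F1 U U' f x"
      unfolding w(3) Y_ops[OF U] Y_ops[OF U'] coordzD(4)[OF coordz_ky[OF U] sS(1) w(1)] F[OF sw] F[OF w(1,2)]
        coordzD(4)[OF coordz_ky[OF U'] sS(1) img(1)[OF w(1,2)]]
      by (simp only: mult_mat_vec[OF Hc c(1)])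
  qed
  moreover have "F1 U U' f (snd (Y U) g x) = snd (Y U') g (F1 U U' f x)"
    if g: "g \<in> galois_group K" and x: "x \<in> carrier (fst (Y U))" for g x
  proof -
    obtain w where w: "w \<in> vecs S (rk U)" "TT U *\<^sub>v fr w = w" "x = ky U w"
      by (rule Y_vec[OF x])
    have gw: "map_vec (map_coeffs g) w \<in> vecs S (rk U)"
      using vecsD[OF w(1)] S_closed(2)[OF g] by (intro vecsI) auto
    have "ky U (map_vec (map_coeffs g) w) \<in> carrier (fst (Y U))"
      using galois_Y[OF U g x] galois_act[OF U g w(1)] w(3) by simp
    then have gF: "F1 U U' f (ky U (map_vec (map_coeffs g) w)) = ky U' (H *\<^sub>v map_vec (map_coeffs g) w)"
      by (rule F1[OF U U' H(1,2) gw])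
    \<comment> \<open>\<open>H\<close> has coefficients in \<open>K\<close>; hence the induced map
      commutes with the Galois action.\<close>
    have "map_mat (map_coeffs g) H = H"
    proof (rule eq_matI)
      fix i j assume "i < dim_row H" "j < dim_col H"
      then have ij: "i < (rk U')" "j < (rk U)"
        using Hc by auto
      have "H \<in> mats E (rk U') (rk U)"
        by (rule H(1))
      then show "index_mat (map_mat (map_coeffs g) H) (i, j) = index_mat H (i, j)"
        using ij Hc galois_K[OF g] E_K matsD(4)[OF H(1) ij] by simp
    qed auto
    then have "map_vec (map_coeffs g) (H *\<^sub>v w) = H *\<^sub>v map_vec (map_coeffs g) w"
      using rhom_mult_vec[OF rhom_map_coeffs[OF galois_rhom(1)[OF g]] Hc vecsD(1)[OF w(1)]] by simp
    then show ?thesis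
      unfolding w(3) galois_act[OF U g w(1)] gF F[OF w(1,2)] galois_act[OF U' g img(1)[OF w(1,2)]] by simp
  qed
  ultimately show ?thesis
    unfolding rep_morphisms_def by (simp add: case_prod_beta)
qed

lemma F1_bij: "bij_betw (F1 U U') (Hom C U U') (rep_morphisms K D (Y U) (Y U'))"
proof (rule bij_betw_imageI)
  show "inj_on (F1 U U') (Hom C U U')"
  proof (rule inj_onI)
    fix f f' assume f: "f \<in> Hom C U U'" "f' \<in> Hom C U U'" "F1 U U' f = F1 U U' f'"
    obtain H where H: "H \<in> mats E (rk U') (rk U)" "act E (rk U) (kx U) (kx U') f H" "TT U' * frm H = H * TT U"
      by (rule hom_matrix[OF f(1)])
    obtain H' where H': "H' \<in> mats E (rk U') (rk U)" "act E (rk U) (kx U) (kx U') f' H'" "TT U' * frm H' = H' * TT U"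
      by (rule hom_matrix[OF f(2)])
    have HS: "H \<in> mats S (rk U') (rk U)" "H' \<in> mats S (rk U') (rk U)"
      using H(1) H'(1) mats_mono[OF E(2)] by auto
    note c = matsD(1)[OF HS(1)] matsD(1)[OF HS(2)] P_c[OF U] Q_c[OF U]
    \<comment> \<open>The two maps agree on the Tate module, which contains the columns of the
      invertible matrix \<open>UU U\<close>.\<close>
    have "H * UU U = H' * UU U"
    proof (rule mat_eq_by_vecs[OF subr_D])
      show "H * UU U \<in> carrier_mat (rk U') (rk U)" "H' * UU U \<in> carrier_mat (rk U') (rk U)"
        using c by auto
      fix d assume d: "d \<in> vecs D (rk U)"
      note t = tate_vec[OF U d]
      have "ky U' (H *\<^sub>v (UU U *\<^sub>v d)) = ky U' (H' *\<^sub>v (UU U *\<^sub>v d))"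
        using F1_act[OF H(1,2) t] F1_act[OF H'(1,2) t] f(3) by simp
      then have "H *\<^sub>v (UU U *\<^sub>v d) = H' *\<^sub>v (UU U *\<^sub>v d)"
        using coordzD(2)[OF coordz_ky[OF U'] tate_image(1)[OF HS(1) H(3) t] tate_image(1)[OF HS(2) H'(3) t]] by simp
      then show "(H * UU U) *\<^sub>v d = (H' * UU U) *\<^sub>v d"
        using c vecsD(1)[OF d] by (simp add: assoc_mult_mat_vec)
    qed
    then have "H * UU U * VV U = H' * UU U * VV U"
      by simp
    then have "H = H'"
      using UV(4)[OF U] c by (simp add: assoc_mult_mat[OF c(1) c(3) c(4)] assoc_mult_mat[OF c(2) c(3) c(4)])
    moreover have "f \<in> extensional (carrier (X0 U))" "f' \<in> extensional (carrier (X0 U))"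
      using f(1,2) unfolding Hom[OF U U'] linear_maps_def by (auto simp: PiE_iff)
    ultimately show "f = f'"
      using H(2) H'(2) by (intro extensional_act_eq[OF kx[OF U]]) auto
  qed
next
  show "F1 U U' ` Hom C U U' = rep_morphisms K D (Y U) (Y U')"
  proof (intro equalityI subsetI)
    fix G assume "G \<in> F1 U U' ` Hom C U U'"
    then show "G \<in> rep_morphisms K D (Y U) (Y U')"
      using F1_rep by blast
  next
    fix G assume "G \<in> rep_morphisms K D (Y U) (Y U')"
    then have G: "G \<in> linear_maps D (fst (Y U)) (fst (Y U'))"
      "\<And>g x. g \<in> galois_group K \<Longrightarrow> x \<in> carrier (fst (Y U)) \<Longrightarrow> G (snd (Y U) g x) = snd (Y U') g (G x)"
      unfolding rep_morphisms_def by (auto simp: case_prod_beta)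
    obtain c where c: "c \<in> mats D (rk U') (rk U)" "act D (rk U) (kd U) (kd U') G c"
      by (rule linear_map_matrix[OF coordz_kd[OF U] coordz_kd[OF U'] subr_D G(1)])
    have cS: "c \<in> mats S (rk U') (rk U)"
      using c(1) mats_mono[OF D_S] by blast
    note cc = matsD(1)[OF cS] P_c[OF U] Q_c[OF U] P_c[OF U'] Q_c[OF U'] T_c[OF U] T_c[OF U']
    have fc: "frm c = c"
      using matsD[OF c(1)] by (intro eq_matI) (auto simp: D_def)
    define H where "H = UU U' * c * VV U"
    have Pc: "UU U' * c \<in> carrier_mat (rk U') (rk U)"
      using cc by simp
    have Hc: "H \<in> carrier_mat (rk U') (rk U)"
      using cc by (simp add: H_def)
    have HS: "H \<in> mats S (rk U') (rk U)"
      unfolding H_def by (rule mats_mult[OF S(1) mats_mult[OF S(1) P_S[OF U'] cS] Q_S[OF U]])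
    have HP: "H * UU U = UU U' * c"
      unfolding H_def using assoc_mult_mat[OF Pc cc(3) cc(2)] UV(5)[OF U] right_mult_one_mat[OF Pc] by simp
    \<comment> \<open>Both sides equal P' c, where P' = \<open>UU U'\<close>: the matrix c is fixed
      by the Frobenius, and the fundamental matrices absorb T and T'. The invertible factor
      \<sigma>(P), with P = \<open>UU U\<close>, is cancelled afterwards.\<close>
    have "TT U' * frm H * frm (UU U) = H * TT U * frm (UU U)"
    proof -
      have fH: "frm H \<in> carrier_mat (rk U') (rk U)" and fP: "frm (UU U) \<in> carrier_mat (rk U) (rk U)" and fP': "frm (UU U') \<in> carrier_mat (rk U') (rk U')"
        using Hc cc by auto
      have "TT U' * frm H * frm (UU U) = TT U' * (frm H * frm (UU U))"
        by (rule assoc_mult_mat[OF cc(7) fH fP])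
      also have "frm H * frm (UU U) = frm (UU U') * c"
        unfolding rhom_mult_mat[OF rq Hc cc(2), symmetric] HP rhom_mult_mat[OF rq cc(4) cc(1)] fc ..
      also have "TT U' * (frm (UU U') * c) = UU U' * c"
        using assoc_mult_mat[OF cc(7) fP' cc(1)] UV(3)[OF U'] by simp
      also have "\<dots> = H * (TT U * frm (UU U))"
        unfolding UV(3)[OF U] HP ..
      also have "\<dots> = H * TT U * frm (UU U)"
        by (rule assoc_mult_mat[OF Hc cc(6) fP, symmetric])
      finally show ?thesis .
    qed
    then have "TT U' * frm H * frm (UU U) * frm (VV U) = H * TT U * frm (UU U) * frm (VV U)"
      by simp
    moreover have cancel: "M1 * frm (UU U) * frm (VV U) = M1" if "M1 \<in> carrier_mat (rk U') (rk U)" for M1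
    proof -
      have "frm (UU U) * frm (VV U) = 1\<^sub>m (rk U)"
        unfolding rhom_mult_mat[OF rq cc(2) cc(3), symmetric] UV(4)[OF U] by (rule rhom_one_mat[OF rq])
      then show ?thesis
        using assoc_mult_mat[OF that, of "frm (UU U)" "rk U" "frm (VV U)" "rk U"] cc that by simp
    qed
    moreover have "TT U' * frm H \<in> carrier_mat (rk U') (rk U)" "H * TT U \<in> carrier_mat (rk U') (rk U)"
      using cc Hc by auto
    ultimately have eq: "TT U' * frm H = H * TT U"
      by (simp only: cancel)
    have act: "G (ky U w) = ky U' (H *\<^sub>v w)" if w: "w \<in> vecs S (rk U)" "TT U *\<^sub>v fr w = w" for w
    proof -
      have d: "VV U *\<^sub>v w \<in> vecs D (rk U)"
        by (rule tate_vec_inv[OF U w])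
      have "ky U w = kd U (VV U *\<^sub>v w)"
        unfolding kd_def[OF U] PQ_vec(1)[OF U vecsD(1)[OF w(1)]] ..
      then have "G (ky U w) = kd U' (c *\<^sub>v (VV U *\<^sub>v w))"
        using c(2) d by (simp add: act_def)
      also have "\<dots> = ky U' (H *\<^sub>v w)"
        unfolding kd_def[OF U'] H_def assoc_mult_mat_vec[OF Pc cc(3) vecsD(1)[OF w(1)]]
          assoc_mult_mat_vec[OF cc(4) cc(1) vecsD(1)[OF d]] ..
      finally show ?thesis .
    qed
    \<comment> \<open>Because \<open>G\<close> commutes with g, the matrices H and g(H) agree on all
      g(P) d with d over \<open>D\<close>, where P = \<open>UU U\<close>. These vectors determine a
      matrix, since g(P) is invertible.\<close>
    have gH: "map_mat (map_coeffs g) H = H" if g: "g \<in> galois_group K" for g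
    proof -
      note rg = rhom_map_coeffs[OF galois_rhom(1)[OF g]]
      let ?g = "map_mat (map_coeffs g)"
      have gc: "?g H \<in> carrier_mat (rk U') (rk U)" "?g (UU U) \<in> carrier_mat (rk U) (rk U)" "?g (VV U) \<in> carrier_mat (rk U) (rk U)"
        using Hc cc by auto
      have "H * ?g (UU U) = ?g H * ?g (UU U)"
      proof (rule mat_eq_by_vecs[OF subr_D])
        show "H * ?g (UU U) \<in> carrier_mat (rk U') (rk U)" "?g H * ?g (UU U) \<in> carrier_mat (rk U') (rk U)"
          using Hc gc by auto
        fix d assume d: "d \<in> vecs D (rk U)"
        note dc = vecsD(1)[OF d]
        note t = tate_vec[OF U d]
        have gd: "map_vec (map_coeffs g) d = d"
          using vecsD(3)[OF d] galois_D[OF g] vecsD(2)[OF d] by (intro eq_vecI) auto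
        have gw: "map_vec (map_coeffs g) (UU U *\<^sub>v d) = ?g (UU U) *\<^sub>v d"
          unfolding rhom_mult_vec[OF rg cc(2) dc] gd ..
        have x: "ky U (UU U *\<^sub>v d) \<in> carrier (fst (Y U))"
          unfolding tate_carrier[OF U] using t by blast
        have gx: "ky U (?g (UU U) *\<^sub>v d) \<in> carrier (fst (Y U))"
          using galois_Y[OF U g x] unfolding galois_act[OF U g t(1)] gw .
        obtain w where w: "w \<in> vecs S (rk U)" "TT U *\<^sub>v fr w = w" "ky U (?g (UU U) *\<^sub>v d) = ky U w"
          by (rule Y_vec[OF gx])
        have gUS: "?g (UU U) *\<^sub>v d \<in> vecs S (rk U)"
          unfolding gw[symmetric] using vecsD[OF t(1)] S_closed(2)[OF g] by (intro vecsI) auto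
        have wd: "w = ?g (UU U) *\<^sub>v d"
          using coordzD(2)[OF coordz_ky[OF U] gUS w(1)] w(3) by simp
        have "ky U' (H *\<^sub>v w) = G (snd (Y U) g (ky U (UU U *\<^sub>v d)))"
          unfolding galois_act[OF U g t(1)] gw w(3) by (rule act[OF w(1,2), symmetric])
        also have "\<dots> = snd (Y U') g (ky U' (H *\<^sub>v (UU U *\<^sub>v d)))"
          unfolding G(2)[OF g x] act[OF t] ..
        also have "\<dots> = ky U' (map_vec (map_coeffs g) (H *\<^sub>v (UU U *\<^sub>v d)))"
          by (rule galois_act[OF U' g tate_image(1)[OF HS eq t]])
        also have "map_vec (map_coeffs g) (H *\<^sub>v (UU U *\<^sub>v d)) = ?g H *\<^sub>v w"
          unfolding rhom_mult_vec[OF rg Hc vecsD(1)[OF t(1)]] gw wd ..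
        finally have k: "ky U' (H *\<^sub>v w) = ky U' (?g H *\<^sub>v w)" .
        have gHS: "?g H \<in> mats S (rk U') (rk U)"
          using matsD[OF HS] S_closed(2)[OF g] by (intro matsI) auto
        have "H *\<^sub>v w = ?g H *\<^sub>v w"
          using k coordzD(2)[OF coordz_ky[OF U'] mats_mult_vec[OF S(1) HS w(1)] mats_mult_vec[OF S(1) gHS w(1)]] by simp
        then show "(H * ?g (UU U)) *\<^sub>v d = (?g H * ?g (UU U)) *\<^sub>v d"
          unfolding wd assoc_mult_mat_vec[OF Hc gc(2) dc] assoc_mult_mat_vec[OF gc(1) gc(2) dc] .
      qed
      then have "H * ?g (UU U) * ?g (VV U) = ?g H * ?g (UU U) * ?g (VV U)"
        by simp
      moreover have "?g (UU U) * ?g (VV U) = 1\<^sub>m (rk U)"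
        unfolding rhom_mult_mat[OF rg cc(2) cc(3), symmetric] UV(4)[OF U] by (rule rhom_one_mat[OF rg])
      ultimately show ?thesis
        using assoc_mult_mat[OF Hc gc(2,3)] assoc_mult_mat[OF gc] Hc gc(1) by simp
    qed
    \<comment> \<open>Galois-invariance puts all coefficients into \<open>K\<close>, which is what
      the integrality assumption asks for.\<close>
    have "fls_nth (index_mat H (i, j)) k \<in> K" if ij: "i < (rk U')" "j < (rk U)" for i j k
    proof (rule coeffs_K)
      fix g assume g: "g \<in> galois_group K"
      show "map_coeffs g (index_mat H (i, j)) = index_mat H (i, j)"
        using arg_cong[OF gH[OF g], of "\<lambda>M. index_mat M (i, j)"] ij Hc by simp
    qed
    then have HE: "H \<in> mats E (rk U') (rk U)"
      by (rule integral_E[OF U U' HS]) (auto intro: eq)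
    let ?f = "map_of_mat E (rk U) (X0 U) (kx U) (kx U') H"
    note f = map_of_mat[OF kx[OF U] kx[OF U'] E(1) HE]
    have "?f \<in> Hom C U U'"
      by (rule matrix_hom[OF f(1) HE f(2) eq])
    moreover have "F1 U U' ?f = G"
    proof (rule extensionalityI)
      show "F1 U U' ?f \<in> extensional (carrier (fst (Y U)))"
        by (rule F1_ext)
      show "G \<in> extensional (carrier (fst (Y U)))"
        using G(1) by (auto simp: linear_maps_def PiE_iff)
      fix x assume "x \<in> carrier (fst (Y U))"
      then obtain w where w: "w \<in> vecs S (rk U)" "TT U *\<^sub>v fr w = w" "x = ky U w"
        by (rule Y_vec)
      show "F1 U U' ?f x = G x"
        unfolding w(3) F1_act[OF HE f(2) w(1,2)] act[OF w(1,2)] ..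
    qed
    ultimately show "G \<in> F1 U U' ` Hom C U U'"
      by blast
  qed
qed

end

lemma one_act:
  assumes U: "U \<in> obj"
  shows "(\<lambda>x\<in>carrier (X0 U). x) \<in> linear_maps E (X0 U) (X0 U)" "1\<^sub>m (rk U) \<in> mats E (rk U) (rk U)"
    "act E (rk U) (kx U) (kx U) (\<lambda>x\<in>carrier (X0 U). x) (1\<^sub>m (rk U))"
proof -
  show one: "1\<^sub>m (rk U) \<in> mats E (rk U) (rk U)"
    by (rule mats_one[OF E(1)])
  show act: "act E (rk U) (kx U) (kx U) (\<lambda>x\<in>carrier (X0 U). x) (1\<^sub>m (rk U))"
    unfolding act_def using coordzD(1)[OF kx[OF U]] vecsD(1) by fastforce
  have "(\<lambda>x\<in>carrier (X0 U). x) = map_of_mat E (rk U) (X0 U) (kx U) (kx U) (1\<^sub>m (rk U))"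
    using map_of_mat(2)[OF kx[OF U] kx[OF U] E(1) one] act
    by (intro extensional_act_eq[OF kx[OF U]]) (auto simp: map_of_mat_def)
  then show "(\<lambda>x\<in>carrier (X0 U). x) \<in> linear_maps E (X0 U) (X0 U)"
    using map_of_mat(1)[OF kx[OF U] kx[OF U] E(1) one] by simp
qed

lemma fully_faithful: "fully_faithful_functor C (rep_category K D) Y F1"
  unfolding fully_faithful_functor_def is_functor_def Ob
proof (intro conjI ballI)
  fix U :: "('l, 'm) shtuka" assume U: "U \<in> obj"
  show "Y U \<in> Ob (rep_category K D)"
    using galois_representation_Y[OF U] by (auto simp: rep_category_def)
  note one = one_act[OF U]
  show "F1 U U (Idt C U) = Idt (rep_category K D) (Y U)"
  proof (rule extensionalityI)
    show "F1 U U (Idt C U) \<in> extensional (carrier (fst (Y U)))"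
      by (rule F1_ext)
    show "Idt (rep_category K D) (Y U) \<in> extensional (carrier (fst (Y U)))"
      by (simp add: rep_category_def)
    fix x assume x: "x \<in> carrier (fst (Y U))"
    then obtain w where w: "w \<in> vecs S (rk U)" "TT U *\<^sub>v fr w = w" "x = ky U w"
      by (rule Y_vec[OF U U])
    have "F1 U U (Idt C U) x = ky U (1\<^sub>m (rk U) *\<^sub>v w)"
      unfolding w(3) Idt[OF U] by (rule F1_act[OF U U one(2,3) w(1,2)])
    then show "F1 U U (Idt C U) x = Idt (rep_category K D) (Y U) x"
      using x w vecsD(1)[OF w(1)] by (simp add: rep_category_def)
  qed
  fix U' :: "('l, 'm) shtuka" assume U': "U' \<in> obj"
  show "bij_betw (F1 U U') (Hom C U U') (Hom (rep_category K D) (Y U) (Y U'))"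
    using F1_bij[OF U U'] by (simp add: rep_category_def)
  fix f assume f: "f \<in> Hom C U U'"
  show "F1 U U' f \<in> Hom (rep_category K D) (Y U) (Y U')"
    using F1_rep[OF U U' f] by (simp add: rep_category_def)
next
  fix U U' U'' :: "('l, 'm) shtuka" and f g
  assume U: "U \<in> obj" and U': "U' \<in> obj" and U'': "U'' \<in> obj" and f: "f \<in> Hom C U U'" and g: "g \<in> Hom C U' U''"
  obtain H where H: "H \<in> mats E (rk U') (rk U)" "act E (rk U) (kx U) (kx U') f H" "TT U' * frm H = H * TT U"
    by (rule hom_matrix[OF U U' f])
  obtain H' where H': "H' \<in> mats E (rk U'') (rk U')" "act E (rk U') (kx U') (kx U'') g H'" "TT U'' * frm H' = H' * TT U'"
    by (rule hom_matrix[OF U' U'' g])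
  have HS: "H \<in> mats S (rk U') (rk U)"
    using H(1) mats_mono[OF E(2)] by blast
  note c = matsD(1)[OF H(1)] matsD(1)[OF H'(1)]
  have HH: "H' * H \<in> mats E (rk U'') (rk U)"
    by (rule mats_mult[OF E(1) H'(1) H(1)])
  have act: "act E (rk U) (kx U) (kx U'') (compose (carrier (X0 U)) g f) (H' * H)"
    unfolding act_def
  proof
    fix w assume w: "w \<in> vecs E (rk U)"
    have "compose (carrier (X0 U)) g f (kx U w) = g (f (kx U w))"
      by (rule compose_eq[OF coordzD(1)[OF kx[OF U] w]])
    also have "\<dots> = kx U'' (H' *\<^sub>v (H *\<^sub>v w))"
      using H(2) H'(2) w mats_mult_vec[OF E(1) H(1) w] by (simp add: act_def)
    finally show "compose (carrier (X0 U)) g f (kx U w) = kx U'' ((H' * H) *\<^sub>v w)"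
      unfolding assoc_mult_mat_vec[OF c(2) c(1) vecsD(1)[OF w]] .
  qed
  show "F1 U U'' (Comp C U g f) = Comp (rep_category K D) (Y U) (F1 U' U'' g) (F1 U U' f)"
    unfolding Comp[OF U]
  proof (rule extensionalityI)
    show "F1 U U'' (compose (carrier (X0 U)) g f) \<in> extensional (carrier (fst (Y U)))"
      by (rule F1_ext)
    show "Comp (rep_category K D) (Y U) (F1 U' U'' g) (F1 U U' f) \<in> extensional (carrier (fst (Y U)))"
      by (simp add: rep_category_def)
    fix x assume x: "x \<in> carrier (fst (Y U))"
    then obtain w where w: "w \<in> vecs S (rk U)" "TT U *\<^sub>v fr w = w" "x = ky U w"
      by (rule Y_vec[OF U U])
    note img = tate_image[OF U U' HS H(3) w(1,2)]
    have "F1 U U'' (compose (carrier (X0 U)) g f) x = ky U'' ((H' * H) *\<^sub>v w)"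
      unfolding w(3) by (rule F1_act[OF U U'' HH act w(1,2)])
    also have "\<dots> = ky U'' (H' *\<^sub>v (H *\<^sub>v w))"
      unfolding assoc_mult_mat_vec[OF c(2) c(1) vecsD(1)[OF w(1)]] ..
    also have "\<dots> = F1 U' U'' g (F1 U U' f x)"
      unfolding w(3) F1_act[OF U U' H(1,2) w(1,2)] by (rule F1_act[OF U' U'' H'(1,2) img, symmetric])
    finally show "F1 U U'' (compose (carrier (X0 U)) g f) x = Comp (rep_category K D) (Y U) (F1 U' U'' g) (F1 U U' f) x"
      using x by (simp add: rep_category_def compose_eq)
  qed
qed

end

section \<open>Verification for the two functors\<close>

lemma compat_iff:
  assumes S: "subr S" and c: "coordz S n M \<phi>" "coordz S m N \<psi>"
    and T: "T' \<in> mats S m m" "G \<in> mats S m n" "H \<in> mats S m n" "T \<in> mats S n n"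
    and a: "\<And>w. w \<in> vecs S n \<Longrightarrow> a (\<phi> w) = \<psi> (T' *\<^sub>v (G *\<^sub>v w))"
    and b: "\<And>w. w \<in> vecs S n \<Longrightarrow> b (\<phi> w) = \<psi> (H *\<^sub>v (T *\<^sub>v w))"
  shows "(\<forall>x\<in>carrier M. a x = b x) \<longleftrightarrow> T' * G = H * T"
proof -
  have assoc: "T' *\<^sub>v (G *\<^sub>v w) = (T' * G) *\<^sub>v w" "H *\<^sub>v (T *\<^sub>v w) = (H * T) *\<^sub>v w" if "w \<in> vecs S n" for w
    using assoc_mult_mat_vec[OF matsD(1)[OF T(1)] matsD(1)[OF T(2)] vecsD(1)[OF that]]
      assoc_mult_mat_vec[OF matsD(1)[OF T(3)] matsD(1)[OF T(4)] vecsD(1)[OF that]] by auto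
  note p = mats_mult[OF S T(1,2)] mats_mult[OF S T(3,4)]
  have "(\<forall>x\<in>carrier M. a x = b x) \<longleftrightarrow> (\<forall>w\<in>vecs S n. a (\<phi> w) = b (\<phi> w))"
    using coordzD(1)[OF c(1)] coordzD(6)[OF c(1)] by blast
  also have "\<dots> \<longleftrightarrow> (\<forall>w\<in>vecs S n. (T' * G) *\<^sub>v w = (H * T) *\<^sub>v w)"
    by (intro ball_cong refl) (simp add: a b assoc coordzD(2)[OF c(2) mats_mult_vec[OF S p(1)] mats_mult_vec[OF S p(2)]])
  also have "\<dots> \<longleftrightarrow> T' * G = H * T"
    using mat_eq_by_vecs[OF S matsD(1)[OF p(1)] matsD(1)[OF p(2)]] by auto
  finally show ?thesis .
qed

text \<open>Turns a compatibility condition on a linear map into one on its unique matrix, in the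
  form used by \<open>tate_functor\<close>.\<close>

lemma hom_set_eq:
  assumes c: "coordz E n M \<phi>" "coordz E m N \<psi>" and E: "subr E"
    and iff: "\<And>f H. H \<in> mats E m n \<Longrightarrow> act E n \<phi> \<psi> f H \<Longrightarrow> P f \<longleftrightarrow> Q H"
  shows "{f \<in> linear_maps E M N. P f} = {f \<in> linear_maps E M N. \<forall>H\<in>mats E m n. act E n \<phi> \<psi> f H \<longrightarrow> Q H}"
proof (intro Collect_cong conj_cong refl)
  fix f assume "f \<in> linear_maps E M N"
  then obtain H where H: "H \<in> mats E m n" "act E n \<phi> \<psi> f H"
    by (rule linear_map_matrix[OF c E])
  then show "P f \<longleftrightarrow> (\<forall>H\<in>mats E m n. act E n \<phi> \<psi> f H \<longrightarrow> Q H)"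
    using iff act_unique[OF c E] by metis
qed

lemma mats_map: "H \<in> mats S m n \<Longrightarrow> (\<And>x. x \<in> S \<Longrightarrow> h x \<in> S) \<Longrightarrow> map_mat h H \<in> mats S m n"
  by (auto simp: mats_def)

context tate_setting
begin

abbreviation (input) "F \<equiv> {x :: 'l. x ^ q = x}"

lemma q_pos: "q > 0"
  using frobexp_gt1[OF frobexp_q] by simp

lemma frob_nth: "fls_nth (frob q x) i = fls_nth x i ^ q" for x :: "'l fls"
  using q_pos by (simp add: frob_def power_0_left)

lemma frob_X: "frob q fls_X = (fls_X :: 'l fls)"
  using q_pos by (intro fls_eqI) (simp add: frob_nth power_0_left)

lemma F_zero: "0 \<in> F"
  using q_pos by (simp add: power_0_left)

text \<open>The condition is coefficientwise x^q = x, so the Frobenius-fixed scalars are the power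
  series over the finite field.\<close>

lemma frob_fixed_PU: "{x \<in> PU. frob q x = x} = power_series_over F"
  using F_zero by (auto simp: power_series_over_iff[OF F_zero] power_series_over_iff[of UNIV] fls_eq_iff frob_nth)

lemma frob_fixed_LU: "{x \<in> laurent_series_over UNIV. frob q x = x} = laurent_series_over F"
  by (auto simp: laurent_series_over_def fls_eq_iff frob_nth)

lemma W_lift:
  assumes "U \<in> obj" "subr S" "W \<subseteq> S" "w \<in> vecs S (rk U)"
  shows "tau_ext valR q \<zeta> S U (lift.fcl S (fst U) (rk U) (\<kappa> U) w) = lift.cl S (fst U) (rk U) (\<kappa> U) (TT U *\<^sub>v w)"
proof -
  have B: "B \<subseteq> S"
    using B_W assms(3) by blast
  show ?thesis
    using lift.tau_ext_eq[OF obj(1)[OF assms(1)] assms(2) B subr_W B_W assms(3) obj(4)[OF assms(1)] obj(2)[OF assms(1)] assms(4)]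
    by simp
qed

lemma morphisms_eq:
  assumes U: "U \<in> obj" "U' \<in> obj"
  shows "shtuka_morphisms valR q \<zeta> U U' = {f \<in> linear_maps B (fst U) (fst U').
    \<forall>H\<in>mats B (rk U') (rk U). act B (rk U) (\<kappa> U) (\<kappa> U') f H \<longrightarrow> TT U' * map_mat (frob q) H = H * TT U}"
proof -
  have "shtuka_morphisms valR q \<zeta> U U' = {f \<in> linear_maps B (fst U) (fst U').
      \<forall>x\<in>carrier (frob_ext q valR W (fst U)).
        snd U' (map_frob_ext q valR W (fst U') f x) = map_ext valR W (fst U') f (snd U x)}"
    by (simp add: shtuka_morphisms_def case_prod_beta)
  also have "\<dots> = {f \<in> linear_maps B (fst U) (fst U').
    \<forall>H\<in>mats B (rk U') (rk U). act B (rk U) (\<kappa> U) (\<kappa> U') f H \<longrightarrow> TT U' * map_mat (frob q) H = H * TT U}"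
  proof (rule hom_set_eq[OF obj(1)[OF U(1)] obj(1)[OF U(2)] subr_B])
    fix f H assume H: "H \<in> mats B (rk U') (rk U)" "act B (rk U) (\<kappa> U) (\<kappa> U') f H"
    have G: "map_mat (frob q) H \<in> mats W (rk U') (rk U)"
      using mats_map[OF H(1)] lift.frob_B mats_mono[OF B_W] by blast
    have HW: "H \<in> mats W (rk U') (rk U)"
      using H(1) mats_mono[OF B_W] by blast
    show "(\<forall>x\<in>carrier (frob_ext q valR W (fst U)).
        snd U' (map_frob_ext q valR W (fst U') f x) = map_ext valR W (fst U') f (snd U x)) \<longleftrightarrow>
        TT U' * map_mat (frob q) H = H * TT U"
    proof (rule compat_iff[OF subr_W lift.coordz_frob_ext[OF obj(1)[OF U(1)] subr_W B_W]
          lift.coordz_ext[OF obj(1)[OF U(2)] subr_W B_W] obj(2)[OF U(2)] G HW obj(2)[OF U(1)]])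
      fix w assume w: "w \<in> vecs W (rk U)"
      show "snd U' (map_frob_ext q valR W (fst U') f (lift.fcl W (fst U) (rk U) (\<kappa> U) w)) =
          lift.cl W (fst U') (rk U') (\<kappa> U') (TT U' *\<^sub>v (map_mat (frob q) H *\<^sub>v w))"
        using obj(4)[OF U(2)] mats_mult_vec[OF subr_W G w]
        by (simp add: lift.map_frob_ext_eq[OF obj(1)[OF U(1)] obj(1)[OF U(2)] subr_W B_W H w] act_def)
      show "map_ext valR W (fst U') f (snd U (lift.fcl W (fst U) (rk U) (\<kappa> U) w)) =
          lift.cl W (fst U') (rk U') (\<kappa> U') (H *\<^sub>v (TT U *\<^sub>v w))"
        using obj(4)[OF U(1)] w
        by (simp add: lift.map_ext_eq[OF obj(1)[OF U(1)] obj(1)[OF U(2)] subr_W B_W H mats_mult_vec[OF subr_W obj(2)[OF U(1)] w]] act_def)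
    qed
  qed
  finally show ?thesis .
qed

lemma integral_obj:
  assumes U: "U \<in> obj" "U' \<in> obj" and H: "H \<in> mats PU (rk U') (rk U)"
    and K: "\<And>i j k. i < rk U' \<Longrightarrow> j < rk U \<Longrightarrow> fls_nth (index_mat H (i, j)) k \<in> K"
    and eq: "TT U' * map_mat (frob q) H = H * TT U"
  shows "H \<in> mats B (rk U') (rk U)"
proof -
  obtain Ti where Ti: "Ti \<in> mats W (rk U) (rk U)" "TT U * Ti = 1\<^sub>m (rk U)"
    using obj(3)[OF U(1)] by blast
  obtain Ti' where Ti': "Ti' \<in> mats W (rk U') (rk U')" "Ti' * TT U' = 1\<^sub>m (rk U')"
    using obj(3)[OF U(2)] by blast
  have "H \<in> mats (power_series_over K) (rk U') (rk U)"
  proof (rule matsI[OF matsD(1)[OF H]])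
    fix i j assume ij: "i < rk U'" "j < rk U"
    show "index_mat H (i, j) \<in> power_series_over K"
      using matsD(4)[OF H ij] K[OF ij] subrD(1)[OF subr_K] by (simp add: power_series_over_iff)
  qed
  then show ?thesis
    by (rule integral_mat[OF obj(2)[OF U(1)] Ti obj(2)[OF U(2)] Ti' _ eq])
qed

lemma tate_functor_T:
  assumes F_K: "F \<subseteq> K"
  shows "tate_functor K v q \<zeta> PU B (shtuka_category valR q \<zeta> :: (('l, 'm) shtuka, _) category) fst \<kappa> (T_map valR q \<zeta>)"
proof unfold_locales
  show "subr PU"
    by (rule subr_PU)
  show "PU \<subseteq> PU" ..
  show "frob q s \<in> PU" if "s \<in> PU" for s
    using that q_pos by (auto simp: power_series_over_iff frob_nth power_0_left)
  show "map_coeffs g s \<in> PU" if "g \<in> galois_group K" "s \<in> PU" for g s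
    using that rhomD(1)[OF galois_rhom(1)[OF that(1)]] by (auto simp: power_series_over_iff)
  show "subr B" "B \<subseteq> PU"
    using subr_B B_W W_PU by auto
  show "Ob (shtuka_category valR q \<zeta> :: (('l, 'm) shtuka, _) category) = obj"
    by (simp add: shtuka_category_def obj_def)
  show "coordz B (rk U) (fst U) (\<kappa> U)" if "U \<in> obj" for U :: "('l, 'm) shtuka"
    by (rule obj(1)[OF that])
  show "Hom (shtuka_category valR q \<zeta>) U U' = {f \<in> linear_maps B (fst U) (fst U').
    \<forall>H\<in>mats B (rk U') (rk U). act B (rk U) (\<kappa> U) (\<kappa> U') f H \<longrightarrow> TT U' * map_mat (frob q) H = H * TT U}"
    if "U \<in> obj" "U' \<in> obj" for U U' :: "('l, 'm) shtuka"
    using morphisms_eq[OF that] by (simp add: shtuka_category_def)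
  show "T_map valR q \<zeta> U U' f (lift.cl PU (fst U) (rk U) (\<kappa> U) w) = lift.cl PU (fst U') (rk U') (\<kappa> U') (H *\<^sub>v w)"
    if "U \<in> obj" "U' \<in> obj" "H \<in> mats B (rk U') (rk U)" "act B (rk U) (\<kappa> U) (\<kappa> U') f H" "w \<in> vecs PU (rk U)"
      "lift.cl PU (fst U) (rk U) (\<kappa> U) w \<in> carrier (fst (tate_object valR q \<zeta> PU U))"
    for U U' :: "('l, 'm) shtuka" and f H w
  proof -
    have "B \<subseteq> PU"
      using B_W W_PU by blast
    then show ?thesis
      using lift.map_ext_eq[OF obj(1)[OF that(1)] obj(1)[OF that(2)] subr_PU _ that(3,4,5)] that(6) by (simp add: T_map_def)
  qed
  show "H \<in> mats B (rk U') (rk U)"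
    if "U \<in> obj" "U' \<in> obj" "H \<in> mats PU (rk U') (rk U)"
      "\<And>i j k. i < rk U' \<Longrightarrow> j < rk U \<Longrightarrow> fls_nth (index_mat H (i, j)) k \<in> K"
      "TT U' * map_mat (frob q) H = H * TT U"
    for U U' :: "('l, 'm) shtuka" and H
    by (rule integral_obj[OF that])
  show "fls_nth x i \<in> K" if "x \<in> B" for x i
    using that R_K subrD(1)[OF subr_R] by (auto simp: power_series_over_iff)
qed (auto simp: shtuka_category_def T_map_def F_K)

section \<open>Quasi-morphisms and the rational functor\<close>

abbreviation "E \<equiv> inv_z_ring valR"

abbreviation "S2 \<equiv> localize E (z_minus \<zeta>)"

lemma X_B: "fls_X \<in> B"
  using subrD(1,2)[OF subr_R] by (auto simp: power_series_over_iff)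

lemma subr_E: "subr E"
  unfolding inv_z_ring_def by (rule subr_localize[OF subr_B X_B])

lemma B_E: "B \<subseteq> E"
  unfolding inv_z_ring_def by (rule localize_superset)

lemma frob_E: "x \<in> E \<Longrightarrow> frob q x \<in> E"
proof -
  assume "x \<in> E"
  then obtain n where n: "x * fls_X ^ n \<in> B"
    by (auto simp: inv_z_ring_def localize_def)
  have "frob q (x * fls_X ^ n) = frob q x * fls_X ^ n"
    by (simp add: rhomD(4)[OF lift.rhom_q] rhom_power[OF lift.rhom_q] frob_X)
  then have "frob q x * fls_X ^ n \<in> B"
    using lift.frob_B[OF n] by simp
  then show ?thesis
    unfolding inv_z_ring_def by (rule localizeI)
qed

lemma subr_S2: "subr S2"
  using z_minus_over[OF subr_R \<zeta>_R] B_E by (intro subr_localize subr_E) auto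

lemma S2_supersets: "E \<subseteq> S2" "B \<subseteq> S2" "W \<subseteq> S2"
  using localize_superset[of E "z_minus \<zeta>"] B_E localize_mono[OF B_E] unfolding shtuka_ring_def by auto

abbreviation "\<kappa>q U \<equiv> lift.cl E (fst U) (rk U) (\<kappa> U)"

lemma coordz_\<kappa>q: "U \<in> obj \<Longrightarrow> coordz E (rk U) (ext valR E (fst U)) (\<kappa>q U)"
  by (rule lift.coordz_ext[OF obj(1) subr_E B_E])

text \<open>Compatibility is tested over the common overring \<open>S2\<close>, which admits both
  the denominators z of the map and z - \<zeta> of \<tau>.\<close>

lemma quasi_morphisms_eq:
  assumes U: "U \<in> obj" "U' \<in> obj"
  shows "shtuka_quasi_morphisms valR q \<zeta> U U' = {f \<in> linear_maps E (ext valR E (fst U)) (ext valR E (fst U')).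
    \<forall>H\<in>mats E (rk U') (rk U). act E (rk U) (\<kappa>q U) (\<kappa>q U') f H \<longrightarrow> TT U' * map_mat (frob q) H = H * TT U}"
proof -
  have "shtuka_quasi_morphisms valR q \<zeta> U U' = {f \<in> linear_maps E (ext valR E (fst U)) (ext valR E (fst U')).
      \<forall>x\<in>carrier (frob_ext q valR S2 (fst U)).
        tau_ext valR q \<zeta> S2 U' (qmap_frob_ext q valR S2 (fst U) (fst U') f x) =
        qmap_ext valR S2 (fst U) (fst U') f (tau_ext valR q \<zeta> S2 U x)}"
    by (simp add: shtuka_quasi_morphisms_def case_prod_beta Let_def)
  also have "\<dots> = {f \<in> linear_maps E (ext valR E (fst U)) (ext valR E (fst U')).
    \<forall>H\<in>mats E (rk U') (rk U). act E (rk U) (\<kappa>q U) (\<kappa>q U') f H \<longrightarrow> TT U' * map_mat (frob q) H = H * TT U}"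
  proof (rule hom_set_eq[OF coordz_\<kappa>q[OF U(1)] coordz_\<kappa>q[OF U(2)] subr_E])
    fix f H assume H: "H \<in> mats E (rk U') (rk U)" "act E (rk U) (\<kappa>q U) (\<kappa>q U') f H"
    have G: "map_mat (frob q) H \<in> mats S2 (rk U') (rk U)"
      using mats_map[OF H(1)] frob_E mats_mono[OF S2_supersets(1)] by blast
    have HS: "H \<in> mats S2 (rk U') (rk U)"
      using H(1) mats_mono[OF S2_supersets(1)] by blast
    have T: "TT U \<in> mats S2 (rk U) (rk U)" "TT U' \<in> mats S2 (rk U') (rk U')"
      using obj(2)[OF U(1)] obj(2)[OF U(2)] mats_mono[OF S2_supersets(3)] by auto
    show "(\<forall>x\<in>carrier (frob_ext q valR S2 (fst U)).
        tau_ext valR q \<zeta> S2 U' (qmap_frob_ext q valR S2 (fst U) (fst U') f x) =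
        qmap_ext valR S2 (fst U) (fst U') f (tau_ext valR q \<zeta> S2 U x)) \<longleftrightarrow>
        TT U' * map_mat (frob q) H = H * TT U"
    proof (rule compat_iff[OF subr_S2 lift.coordz_frob_ext[OF obj(1)[OF U(1)] subr_S2 S2_supersets(2)]
          lift.coordz_ext[OF obj(1)[OF U(2)] subr_S2 S2_supersets(2)] T(2) G HS T(1)])
      fix w assume w: "w \<in> vecs S2 (rk U)"
      show "tau_ext valR q \<zeta> S2 U' (qmap_frob_ext q valR S2 (fst U) (fst U') f (lift.fcl S2 (fst U) (rk U) (\<kappa> U) w)) =
          lift.cl S2 (fst U') (rk U') (\<kappa> U') (TT U' *\<^sub>v (map_mat (frob q) H *\<^sub>v w))"
        using W_lift[OF U(2) subr_S2 S2_supersets(3) mats_mult_vec[OF subr_S2 G w]]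
          lift.qmap_frob_ext_eq[OF obj(1)[OF U(1)] obj(1)[OF U(2)] subr_S2 S2_supersets(2) subr_E B_E S2_supersets(1) H refl w frob_E]
        by simp
      show "qmap_ext valR S2 (fst U) (fst U') f (tau_ext valR q \<zeta> S2 U (lift.fcl S2 (fst U) (rk U) (\<kappa> U) w)) =
          lift.cl S2 (fst U') (rk U') (\<kappa> U') (H *\<^sub>v (TT U *\<^sub>v w))"
        using W_lift[OF U(1) subr_S2 S2_supersets(3) w]
          lift.qmap_ext_eq[OF obj(1)[OF U(1)] obj(1)[OF U(2)] subr_S2 S2_supersets(2) subr_E B_E S2_supersets(1) H refl mats_mult_vec[OF subr_S2 T(1) w]]
        by simp
    qed
  qed
  finally show ?thesis .
qed

lemma mult_X_power_nth: "fls_nth (x * fls_X ^ n) i = fls_nth x (i - int n)" for x :: "'l fls"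
  by (simp add: fls_X_power_times_conv_shift)

text \<open>A power of z turns \<open>H\<close> into a matrix of power series and preserves the
  equation, because z is fixed by the Frobenius. So the integral case applies.\<close>

lemma quasi_integral_obj:
  assumes U: "U \<in> obj" "U' \<in> obj" and H: "H \<in> carrier_mat (rk U') (rk U)"
    and K: "\<And>i j k. i < rk U' \<Longrightarrow> j < rk U \<Longrightarrow> fls_nth (index_mat H (i, j)) k \<in> K"
    and eq: "TT U' * map_mat (frob q) H = H * TT U"
  shows "H \<in> mats E (rk U') (rk U)"
proof -
  have X_PU: "(fls_X :: 'l fls) \<in> PU"
    using X_B B_W W_PU by blast
  have "x \<in> localize PU fls_X" for x :: "'l fls"
    by (rule localizeI[of _ _ "nat (- fls_subdegree x)"]) (auto simp: power_series_over_iff mult_X_power_nth)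
  then obtain N where N: "\<And>ij. ij \<in> {..<rk U'} \<times> {..<rk U} \<Longrightarrow> index_mat H ij * fls_X ^ N \<in> PU"
    using localize_common_exponent[OF subr_PU X_PU, of "{..<rk U'} \<times> {..<rk U}" "index_mat H"] by auto
  let ?x = "fls_X ^ N :: 'l fls"
  let ?H = "?x \<cdot>\<^sub>m H"
  have T: "TT U \<in> carrier_mat (rk U) (rk U)" "TT U' \<in> carrier_mat (rk U') (rk U')"
    by (rule matsD(1)[OF obj(2)[OF U(1)]], rule matsD(1)[OF obj(2)[OF U(2)]])
  have "frob q ?x = ?x"
    by (simp add: rhom_power[OF lift.rhom_q] frob_X)
  then have "map_mat (frob q) ?H = ?x \<cdot>\<^sub>m map_mat (frob q) H"
    by (intro eq_matI) (auto simp: rhomD(4)[OF lift.rhom_q])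
  then have "TT U' * map_mat (frob q) ?H = ?x \<cdot>\<^sub>m (TT U' * map_mat (frob q) H)"
    using T H by (simp add: mult_smult_distrib[of _ "rk U'" "rk U'" _ "rk U"])
  also have "\<dots> = ?H * TT U"
    unfolding eq using T H by (simp add: mult_smult_assoc_mat[of _ "rk U'" "rk U" _ "rk U"])
  finally have eq': "TT U' * map_mat (frob q) ?H = ?H * TT U" .
  have "?H \<in> mats B (rk U') (rk U)"
  proof (rule integral_obj[OF U _ _ eq'])
    show "?H \<in> mats PU (rk U') (rk U)"
      using H N by (intro matsI) (auto simp: mult.commute)
    show "fls_nth (index_mat ?H (i, j)) k \<in> K" if "i < rk U'" "j < rk U" for i j k
      using K[OF that] H that by (simp add: mult.commute[of ?x] mult_X_power_nth)
  qed
  then have "index_mat H (i, j) * ?x \<in> B" if "i < rk U'" "j < rk U" for i j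
    using matsD(4)[of ?H B "rk U'" "rk U" i j] that H by (simp add: mult.commute)
  then show ?thesis
    using H by (intro matsI) (auto simp: inv_z_ring_def intro: localizeI)
qed

lemma tate_functor_V:
  assumes F_K: "F \<subseteq> K"
  shows "tate_functor K v q \<zeta> (laurent_series_over UNIV) E (shtuka_quasi_category valR q \<zeta> :: (('l, 'm) shtuka, _) category)
    (\<lambda>U. ext valR E (fst U)) \<kappa>q (V_map valR q \<zeta>)"
proof -
  have LU: "laurent_series_over UNIV = (UNIV :: 'l fls set)"
    by (auto simp: laurent_series_over_def)
  have subr_UNIV: "subr (UNIV :: 'l fls set)"
    by (simp add: subr_def)
  show ?thesis
  proof unfold_locales
    show "Hom (shtuka_quasi_category valR q \<zeta>) U U' = {f \<in> linear_maps E (ext valR E (fst U)) (ext valR E (fst U')).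
      \<forall>H\<in>mats E (rk U') (rk U). act E (rk U) (\<kappa>q U) (\<kappa>q U') f H \<longrightarrow> TT U' * map_mat (frob q) H = H * TT U}"
      if "U \<in> obj" "U' \<in> obj" for U U' :: "('l, 'm) shtuka"
      using quasi_morphisms_eq[OF that] by (simp add: shtuka_quasi_category_def)
    show "V_map valR q \<zeta> U U' f (lift.cl (laurent_series_over UNIV) (fst U) (rk U) (\<kappa> U) w) =
        lift.cl (laurent_series_over UNIV) (fst U') (rk U') (\<kappa> U') (H *\<^sub>v w)"
      if "U \<in> obj" "U' \<in> obj" "H \<in> mats E (rk U') (rk U)" "act E (rk U) (\<kappa>q U) (\<kappa>q U') f H"
        "w \<in> vecs (laurent_series_over UNIV) (rk U)"
        "lift.cl (laurent_series_over UNIV) (fst U) (rk U) (\<kappa> U) w \<in> carrier (fst (tate_object valR q \<zeta> (laurent_series_over UNIV) U))"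
      for U U' :: "('l, 'm) shtuka" and f H w
      using lift.qmap_ext_eq[OF obj(1)[OF that(1)] obj(1)[OF that(2)] subr_UNIV _ subr_E B_E _ that(3,4) refl] that(5,6)
      by (simp add: V_map_def LU)
    show "H \<in> mats E (rk U') (rk U)"
      if "U \<in> obj" "U' \<in> obj" "H \<in> mats (laurent_series_over UNIV) (rk U') (rk U)"
        "\<And>i j k. i < rk U' \<Longrightarrow> j < rk U \<Longrightarrow> fls_nth (index_mat H (i, j)) k \<in> K"
        "TT U' * map_mat (frob q) H = H * TT U"
      for U U' :: "('l, 'm) shtuka" and H
      by (rule quasi_integral_obj[OF that(1,2) matsD(1)[OF that(3)] that(4,5)])
    show "fls_nth x i \<in> K" if x: "x \<in> E" for x i
    proof -
      obtain n where "x * fls_X ^ n \<in> B"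
        using x by (auto simp: inv_z_ring_def localize_def)
      then have "fls_nth (x * fls_X ^ n) (i + int n) \<in> valR"
        using subrD(1)[OF subr_R] by (simp add: power_series_over_iff)
      then show ?thesis
        using R_K by (auto simp: mult_X_power_nth)
    qed
  qed (auto simp: shtuka_quasi_category_def V_map_def LU subr_UNIV subr_E obj_def coordz_\<kappa>q[unfolded obj_def] F_K[THEN subsetD])
qed

end

theorem theorem4p20:
  fixes Fq :: "'q::field set" and infty :: "'q set"
    and K :: "'l::field set" and v :: "'l \<Rightarrow> real"
    and \<gamma> :: "'q \<Rightarrow> 'l" and \<iota> :: "'q set \<Rightarrow> 'l" and z :: 'q
    and R :: "'l set" and qhat :: nat and \<zeta> :: 'l and F\<^sub>\<epsilon> :: "'l set"
  assumes setting: "shtuka_setting Fq infty K v \<gamma> \<iota> z"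
    and discrete: "discretely_valued K v"
  defines "R \<equiv> valuation_ring K v"
    and "qhat \<equiv> shtuka_setting.qhat Fq infty K v \<gamma>"
    and "\<zeta> \<equiv> shtuka_setting.\<zeta> Fq infty K v \<gamma> z"
    and "F\<^sub>\<epsilon> \<equiv> shtuka_setting.F_eps Fq infty K v \<gamma> \<iota>"
  shows
    "fully_faithful_functor
       (shtuka_category R qhat \<zeta> :: (('l, 'm) shtuka, _) category)
       (rep_category K (power_series_over F\<^sub>\<epsilon>))
       (T_object R qhat \<zeta>) (T_map R qhat \<zeta>)
     \<and>
     fully_faithful_functor
       (shtuka_quasi_category R qhat \<zeta> :: (('l, 'm) shtuka, _) category)
       (rep_category K (laurent_series_over F\<^sub>\<epsilon>))
       (V_object R qhat \<zeta>) (V_map R qhat \<zeta>)"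
proof -
  note parameters = qhat_def \<zeta>_def F\<^sub>\<epsilon>_def
  interpret S: shtuka_setting Fq infty K v \<gamma> \<iota> z
    by (rule setting)
  have "embedding_setting K"
    by unfold_locales (auto simp: S.subr_K' S.sep_closure intro: inverse_subfield[OF S.K_field])
  then interpret tate_setting K v qhat \<zeta>
    using discrete S.frobexp_qhat S.\<zeta>_facts unfolding parameters
    by (intro tate_setting.intro tate_setting_axioms.intro S.valued_field_K)
  \<comment> \<open>F_\<epsilon> enters as the set of roots of x^q = x, the form in which the
    Frobenius-fixed series are described.\<close>
  have F: "F\<^sub>\<epsilon> = {x. x ^ qhat = x}"
    using S.F_eps_eq unfolding parameters .
  then have F_K: "{x. x ^ qhat = x} \<subseteq> K"
    using S.F_eps_facts(4) unfolding parameters by simp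
  have "fully_faithful_functor (shtuka_category R qhat \<zeta> :: (('l, 'm) shtuka, _) category)
      (rep_category K (power_series_over F\<^sub>\<epsilon>)) (T_object R qhat \<zeta>) (T_map R qhat \<zeta>)"
    using tate_functor.fully_faithful[OF tate_functor_T[OF F_K]]
    unfolding tate_functor.D_def[OF tate_functor_T[OF F_K]] frob_fixed_PU F R_def .
  moreover have "fully_faithful_functor (shtuka_quasi_category R qhat \<zeta> :: (('l, 'm) shtuka, _) category)
      (rep_category K (laurent_series_over F\<^sub>\<epsilon>)) (V_object R qhat \<zeta>) (V_map R qhat \<zeta>)"
    using tate_functor.fully_faithful[OF tate_functor_V[OF F_K]]
    unfolding tate_functor.D_def[OF tate_functor_V[OF F_K]] frob_fixed_LU F R_def .
  ultimately show ?thesis ..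
qed

end
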